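(* There exists an algebra isomorphism $F:\mathcal B\to\mathcal A$, uniquely determined by the property that $\iota_{\mathcal A}\circ F=\iota_{\mathcal B}$. Furthermore, $F(\mathcal B_m)=\mathcal A_m$ for each $m=0,1,2,\dots$.
   Context: **Symmetric groups.** $\mathbb N=\{1,2,\dots\}$, $\mathbb N_n=\{1,\dots,n\}$. $S(n)$ is the group of permutations of $\mathbb N_n$, realized by permutation matrices ($g_{ij}=1$ if $g(j)=i$, and $g_{ij}=0$ otherwise); $S(n)\subset S(n+1)$ in the natural way, and $S(\infty)=\bigcup_n S(n)$. For $0\le m\le n$, $S_m(n)\subseteq S(n)$ is the pointwise stabilizer of $1,\dots,m$. For $g\in S(\infty)$, $\deg g$ is the number of points of $\mathbb N$ not fixed by $g$; for an element of $\mathbb C[S(\infty)]$, $\deg(\sum\alpha(g)g)=\max\{\deg g:\alpha(g)\neq0\}$. **Representations $T^\lambda$.** $\mathbb Y$ is the set of all Young diagrams (partitions), including the empty one $\varnothing$; $|\lambda|$ is the number of boxes; $\pi^\lambda$ is the irreducible unitary representation of $S(|\lambda|)$ indexed by $\lambda$ in the standard way, with space $H(\pi^\lambda)$. $T^\varnothing$ is the trivial one-dimensional representation of $S(\infty)$. For $|\lambda|=\ell\ge1$, let $\Omega(\ell,\infty)$ be the set of $\{0,1\}$-matrices of format $\mathbb N_\ell\times\mathbb N$ with exactly one $1$ in each row and at most one $1$ in each column. $H(T^\lambda)$ is the Hilbert space of functions $\phi:\Omega(\ell,\infty)\to H(\pi^\lambda)$ with $\sum_\omega\|\phi(\omega)\|^2<\infty$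 and $\phi(s\omega)=\pi^\lambda(s)\phi(\omega)$ for $s\in S(\ell)$, and $(T^\lambda(g)\phi)(\omega)=\phi(\omega g)$ for $g\in S(\infty)$. (The $T^\lambda$, $\lambda\in\mathbb Y$, are exactly the irreducible tame representations of $S(\infty)$.) **The algebra $\mathcal B$.** For $0\le m\le n$, $\mathcal B_m(n)$ is the centralizer of $S_m(n)$ in $\mathbb C[S(n)]$. A sequence $\alpha=(\alpha_1,\alpha_2,\dots)$ in $\mathbb C[S(\infty)]$ with $\alpha_n\in\mathbb C[S(n)]$ for all large $n$ is called convergent if: (1) for every $\lambda\in\mathbb Y$ the operators $T^\lambda(\alpha_n)$ have a limit $\overline T^\lambda(\alpha)$ in the strong operator topology; (2) there is $m$ such that $\alpha_n\in\mathcal B_m(n)$ for all large $n$; (3) $\sup_n\deg\alpha_n<\infty$. Convergent sequences $\alpha,\beta$ are equivalent if $\overline T^\lambda(\alpha)=\overline T^\lambda(\beta)$ for all $\lambda$. $\mathcal B$ is the associative algebra of equivalence classes of convergent sequences with component-wise operations. $\mathcal B_m\subseteq\mathcal B$ is the subalgebra of classes represented by convergent sequences $(\alpha_n)$ with $\alpha_n\in\mathcal B_m(n)$ for all large $n$. **The algebra $\mathcal A$ (centralizer construction).** $\Gamma(n)$ is the semigroup of $n\times n$ $\{0,1\}$-matrices with at most one $1$ in each row and each column, under matrix multiplication ($\Gamma(0)$ is the one-element semigroup). For $\gamma\in\Gamma(n)$, $\deg\gamma$ is the number of zeros on the diagonal; for elements of $\mathcal A(n):=\mathbb C[\Gamma(n)]$,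 the degree is the maximum of degrees of semigroup elements occurring with nonzero coefficient. $\theta_{n,n-1}:\mathcal A(n)\to\mathcal A(n-1)$ is the linear extension of the map deleting the last row and column. For $0\le m\le n$, $\Gamma_m(n)\subseteq\Gamma(n)$ is the subsemigroup of matrices whose first $m$ diagonal entries equal $1$, and $\mathcal A_m(n)$ is the centralizer of $\Gamma_m(n)$ in $\mathcal A(n)$; $\theta_{n,n-1}$ restricts to unital algebra morphisms $\mathcal A_m(n)\to\mathcal A_m(n-1)$, $0\le m\le n-1$. $\mathcal A_m$ is the algebra of sequences $a=(a_n)_{n\ge m}$ with $a_n\in\mathcal A_m(n)$, $a_{n-1}=\theta_{n,n-1}(a_n)$ for $n>m$, and $\sup_n\deg a_n<\infty$, with component-wise operations. Forgetting the first term embeds $\mathcal A_m\subset\mathcal A_{m+1}$, and $\mathcal A:=\bigcup_m\mathcal A_m$. **Action of $\mathcal A$.** Let $|\lambda|=\ell$ and $n\ge\ell$. $H_n(T^\lambda)\subset H(T^\lambda)$ is the subspace of vectors invariant under all permutations in $S(\infty)$ fixing $1,\dots,n$; for $\ell\ge 1$ it consists of the functions $\phi$ supported on those $\omega$ whose columns with indices $>n$ are zero. The set of such $\omega$ is identified with the set $\Omega(\ell,n)$ of $\ell\times n$ $\{0,1\}$-matrices with exactly one $1$ per row and at most one $1$ per column. The semigroup $\Gamma(n)$ is represented on $H_n(T^\lambda)$ by $(\mathcal T^\lambda_n(\gamma)\phi)(\omega)=\phi(\omega\gamma)$ if $\omega\gamma\in\Omega(\ell,n)$, and $=0$ otherwise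 ($\omega\in\Omega(\ell,n)$); for $\lambda=\varnothing$, $\mathcal T^\varnothing_n(\gamma)=1$ for all $\gamma$. Extend $\mathcal T^\lambda_n$ linearly to $\mathcal A(n)$. Let $H_\infty(T^\lambda)=\bigcup_nH_n(T^\lambda)$ (dense in $H(T^\lambda)$). For $a=(a_n)_{n\ge m}\in\mathcal A_m$, $\widetilde{\mathcal T}^\lambda(a)$ is the operator on $H_\infty(T^\lambda)$ whose restriction to $H_n(T^\lambda)$ equals $\mathcal T^\lambda_n(a_n)$ for all $n\ge\max(m,\ell)$; this is well defined, gives a representation of $\mathcal A$, and each $\widetilde{\mathcal T}^\lambda(a)$ is bounded and so is extended to $H(T^\lambda)$. **The maps $\iota$.** Let $\mathcal E=\prod_{\lambda\in\mathbb Y}\operatorname{End}(H(T^\lambda))$ (bounded operators), an algebra with component-wise operations. $\iota_{\mathcal A}:\mathcal A\to\mathcal E$ is $a\mapsto\prod_\lambda\widetilde{\mathcal T}^\lambda(a)$, and $\iota_{\mathcal B}:\mathcal B\to\mathcal E$ is $\alpha\mapsto\prod_\lambda\overline T^\lambda(\alpha)$. *)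

theory Defs
  imports
    "HOL-Analysis.Infinite_Sum"
    "HOL-Library.Poly_Mapping"
    "HOL-Combinatorics.Permutations"
    "HOL-Algebra.QuotRing"
    "HOL-Algebra.Module"
begin

section \<open>Semigroup algebras\<close>

text \<open>
  An element of a complex semigroup algebra is a finitely supported function, that is, an element
  of the type \<open>'g \<Rightarrow>\<^sub>0 complex\<close>. The semigroup operation is an explicit argument of the
  convolution product, and a subalgebra spanned by \<open>G\<close> is a condition on supports.
\<close>

definition alg_over :: "'g set \<Rightarrow> ('g \<Rightarrow>\<^sub>0 complex) set" where
  "alg_over G = {x. Poly_Mapping.keys x \<subseteq> G}"

definition scale :: "complex \<Rightarrow> ('g \<Rightarrow>\<^sub>0 complex) \<Rightarrow> ('g \<Rightarrow>\<^sub>0 complex)" where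
  "scale c x = Poly_Mapping.map ((*) c) x"

definition convolve ::
  "('g \<Rightarrow> 'g \<Rightarrow> 'g) \<Rightarrow> ('g \<Rightarrow>\<^sub>0 complex) \<Rightarrow> ('g \<Rightarrow>\<^sub>0 complex) \<Rightarrow> ('g \<Rightarrow>\<^sub>0 complex)" where
  "convolve f x y = (\<Sum>g\<in>Poly_Mapping.keys x. \<Sum>h\<in>Poly_Mapping.keys y.
     Poly_Mapping.single (f g h) (Poly_Mapping.lookup x g * Poly_Mapping.lookup y h))"

definition linear_ext ::
  "('g \<Rightarrow> 'h) \<Rightarrow> ('g \<Rightarrow>\<^sub>0 complex) \<Rightarrow> ('h \<Rightarrow>\<^sub>0 complex)" where
  "linear_ext f x = (\<Sum>g\<in>Poly_Mapping.keys x.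
     Poly_Mapping.single (f g) (Poly_Mapping.lookup x g))"

definition alg_centralizer ::
  "('g \<Rightarrow> 'g \<Rightarrow> 'g) \<Rightarrow> 'g set \<Rightarrow> 'g set \<Rightarrow> ('g \<Rightarrow>\<^sub>0 complex) set" where
  "alg_centralizer f H G = {x \<in> alg_over G. \<forall>h\<in>H.
     convolve f (Poly_Mapping.single h 1) x = convolve f x (Poly_Mapping.single h 1)}"

text \<open>Maximum of \<open>d\<close> over the support; the zero element gets the value 0.\<close>

definition max_deg :: "('g \<Rightarrow> nat) \<Rightarrow> ('g \<Rightarrow>\<^sub>0 complex) \<Rightarrow> nat" where
  "max_deg d x = Max (insert 0 (d ` Poly_Mapping.keys x))"


section \<open>Symmetric groups\<close>

text \<open>
  The point set is \<open>{1, 2, \<dots>}\<close>. Permutations of \<open>{1..n}\<close> are functions on \<open>nat\<close> that are the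
  identity outside \<open>{1..n}\<close> (in particular at 0), so the inclusions of the groups are literal.
\<close>

definition Sym :: "nat \<Rightarrow> (nat \<Rightarrow> nat) set" where
  "Sym n = {g. g permutes {1..n}}"

definition Sym_inf :: "(nat \<Rightarrow> nat) set" where
  "Sym_inf = (\<Union>n. Sym n)"

definition Sym_stab :: "nat \<Rightarrow> nat \<Rightarrow> (nat \<Rightarrow> nat) set" where
  "Sym_stab m n = {g \<in> Sym n. \<forall>i\<in>{1..m}. g i = i}"

definition perm_deg :: "(nat \<Rightarrow> nat) \<Rightarrow> nat" where
  "perm_deg g = card {i. g i \<noteq> i}"

type_synonym grp_alg = "(nat \<Rightarrow> nat) \<Rightarrow>\<^sub>0 complex"

abbreviation grp_mult :: "grp_alg \<Rightarrow> grp_alg \<Rightarrow> grp_alg" where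
  "grp_mult \<equiv> convolve (\<circ>)"

definition cB :: "nat \<Rightarrow> nat \<Rightarrow> grp_alg set" where
  "cB m n = alg_centralizer (\<circ>) (Sym_stab m n) (Sym n)"


section \<open>Matrices with entries 0 and 1\<close>

text \<open>
  A matrix is a function of a row and a column index, both running from 1; a matrix of smaller
  format is padded by zeros. Padding turns the deletion of rows and columns into truncation and
  the set of matrices whose columns beyond \<open>n\<close> vanish into the matrices with \<open>n\<close> columns.
  In every product formed below the rows of the left factor have finite support.
\<close>

type_synonym matr = "nat \<Rightarrow> nat \<Rightarrow> nat"

definition mmult :: "matr \<Rightarrow> matr \<Rightarrow> matr" where
  "mmult A B = (\<lambda>i j. \<Sum>k | A i k \<noteq> 0. A i k * B k j)"

definition perm_matr :: "(nat \<Rightarrow> nat) \<Rightarrow> matr" where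
  "perm_matr g = (\<lambda>i j. if g j = i then 1 else 0)"

definition id_matr :: "nat \<Rightarrow> matr" where
  "id_matr n = (\<lambda>i j. if i = j \<and> i \<in> {1..n} then 1 else 0)"

definition truncate :: "nat \<Rightarrow> matr \<Rightarrow> matr" where
  "truncate n A = (\<lambda>i j. if i \<in> {1..n} \<and> j \<in> {1..n} then A i j else 0)"

definition Omega_inf :: "nat \<Rightarrow> matr set" where
  "Omega_inf l = {\<omega>. (\<forall>i j. \<omega> i j \<in> {0, 1}) \<and>
     (\<forall>i j. \<omega> i j \<noteq> 0 \<longrightarrow> i \<in> {1..l} \<and> 1 \<le> j) \<and>
     (\<forall>i\<in>{1..l}. \<exists>!j. \<omega> i j = 1) \<and>
     (\<forall>j i i'. \<omega> i j = 1 \<and> \<omega> i' j = 1 \<longrightarrow> i = i')}"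

definition Omega_fin :: "nat \<Rightarrow> nat \<Rightarrow> matr set" where
  "Omega_fin l n = {\<omega> \<in> Omega_inf l. \<forall>i j. n < j \<longrightarrow> \<omega> i j = 0}"

definition Gam :: "nat \<Rightarrow> matr set" where
  "Gam n = {\<gamma>. (\<forall>i j. \<gamma> i j \<in> {0, 1}) \<and>
     (\<forall>i j. \<gamma> i j \<noteq> 0 \<longrightarrow> i \<in> {1..n} \<and> j \<in> {1..n}) \<and>
     (\<forall>i j j'. \<gamma> i j = 1 \<and> \<gamma> i j' = 1 \<longrightarrow> j = j') \<and>
     (\<forall>j i i'. \<gamma> i j = 1 \<and> \<gamma> i' j = 1 \<longrightarrow> i = i')}"

definition Gam_sub :: "nat \<Rightarrow> nat \<Rightarrow> matr set" where
  "Gam_sub m n = {\<gamma> \<in> Gam n. \<forall>i\<in>{1..m}. \<gamma> i i = 1}"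

definition Gam_deg :: "nat \<Rightarrow> matr \<Rightarrow> nat" where
  "Gam_deg n \<gamma> = card {i \<in> {1..n}. \<gamma> i i = 0}"

type_synonym sg_alg = "matr \<Rightarrow>\<^sub>0 complex"

definition cA :: "nat \<Rightarrow> nat \<Rightarrow> sg_alg set" where
  "cA m n = alg_centralizer mmult (Gam_sub m n) (Gam n)"

text \<open>\<open>theta n\<close> is the map from level \<open>n\<close> to level \<open>n - 1\<close>.\<close>

definition theta :: "nat \<Rightarrow> sg_alg \<Rightarrow> sg_alg" where
  "theta n = linear_ext (truncate (n - 1))"


section \<open>The irreducible representations of the finite symmetric groups\<close>

text \<open>A Young diagram is the weakly decreasing list of its (positive) row lengths.\<close>

definition Young :: "nat list set" where
  "Young = {\<mu>. sorted_wrt (\<ge>) \<mu> \<and> 0 \<notin> set \<mu>}"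

abbreviation ysize :: "nat list \<Rightarrow> nat" where
  "ysize \<mu> \<equiv> sum_list \<mu>"

text \<open>
  The standard tableau of shape \<open>\<mu>\<close> whose boxes are numbered row by row: the row (counted from 0)
  and the column (counted from 1) of the box containing \<open>k \<in> {1..ysize \<mu>}\<close>.
\<close>

definition tab_row :: "nat list \<Rightarrow> nat \<Rightarrow> nat" where
  "tab_row \<mu> k = (LEAST i. k \<le> sum_list (take (Suc i) \<mu>))"

definition tab_col :: "nat list \<Rightarrow> nat \<Rightarrow> nat" where
  "tab_col \<mu> k = k - sum_list (take (tab_row \<mu> k) \<mu>)"

definition row_group :: "nat list \<Rightarrow> (nat \<Rightarrow> nat) set" where
  "row_group \<mu> = {p \<in> Sym (ysize \<mu>). \<forall>k\<in>{1..ysize \<mu>}. tab_row \<mu> (p k) = tab_row \<mu> k}"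

definition col_group :: "nat list \<Rightarrow> (nat \<Rightarrow> nat) set" where
  "col_group \<mu> = {q \<in> Sym (ysize \<mu>). \<forall>k\<in>{1..ysize \<mu>}. tab_col \<mu> (q k) = tab_col \<mu> k}"

definition young_symmetrizer :: "nat list \<Rightarrow> grp_alg" where
  "young_symmetrizer \<mu> = (\<Sum>p\<in>row_group \<mu>. \<Sum>q\<in>col_group \<mu>.
     Poly_Mapping.single (p \<circ> q) (of_int (sign q)))"

text \<open>
  The irreducible representation indexed by \<open>\<mu>\<close> is realized, as usual, on the left ideal generated
  by the Young symmetrizer, with the group acting by left multiplication; a single row gives the
  trivial representation. The inner product of functions on the group is invariant, and on an
  irreducible representation an invariant inner product is unique up to a factor.
\<close>

definition H_pi :: "nat list \<Rightarrow> grp_alg set" where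
  "H_pi \<mu> = {grp_mult x (young_symmetrizer \<mu>) | x. x \<in> alg_over (Sym (ysize \<mu>))}"

definition pi_rep :: "(nat \<Rightarrow> nat) \<Rightarrow> grp_alg \<Rightarrow> grp_alg" where
  "pi_rep s v = grp_mult (Poly_Mapping.single s 1) v"

definition norm_sq :: "grp_alg \<Rightarrow> real" where
  "norm_sq v = (\<Sum>g\<in>Poly_Mapping.keys v. (cmod (Poly_Mapping.lookup v g))\<^sup>2)"


section \<open>The tame representations of the infinite symmetric group\<close>

text \<open>
  A function on \<open>Omega_inf l\<close> is extended by zero. For the empty diagram \<open>Omega_inf 0\<close> consists of
  the zero matrix alone and \<open>H_pi []\<close> is a line, so that the definitions of this section give the
  trivial one-dimensional representation also in that case.
\<close>

type_synonym hvec = "matr \<Rightarrow> grp_alg"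

definition H_T :: "nat list \<Rightarrow> hvec set" where
  "H_T \<mu> = {\<phi>.
     (\<forall>\<omega>. \<omega> \<notin> Omega_inf (ysize \<mu>) \<longrightarrow> \<phi> \<omega> = 0) \<and>
     (\<forall>\<omega>\<in>Omega_inf (ysize \<mu>). \<phi> \<omega> \<in> H_pi \<mu>) \<and>
     (\<lambda>\<omega>. norm_sq (\<phi> \<omega>)) summable_on Omega_inf (ysize \<mu>) \<and>
     (\<forall>s\<in>Sym (ysize \<mu>). \<forall>\<omega>\<in>Omega_inf (ysize \<mu>).
        \<phi> (mmult (perm_matr s) \<omega>) = pi_rep s (\<phi> \<omega>))}"

definition norm_T :: "nat list \<Rightarrow> hvec \<Rightarrow> real" where
  "norm_T \<mu> \<phi> = sqrt (\<Sum>\<^sub>\<infinity>\<omega>\<in>Omega_inf (ysize \<mu>). norm_sq (\<phi> \<omega>))"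

text \<open>Bounded linear operators on \<open>H_T \<mu>\<close>, as functions that are \<open>undefined\<close> elsewhere.\<close>

definition End_T :: "nat list \<Rightarrow> (hvec \<Rightarrow> hvec) set" where
  "End_T \<mu> = {L \<in> H_T \<mu> \<rightarrow>\<^sub>E H_T \<mu>.
     (\<forall>\<phi>\<in>H_T \<mu>. \<forall>\<psi>\<in>H_T \<mu>. L (\<lambda>\<omega>. \<phi> \<omega> + \<psi> \<omega>) = (\<lambda>\<omega>. L \<phi> \<omega> + L \<psi> \<omega>)) \<and>
     (\<forall>c. \<forall>\<phi>\<in>H_T \<mu>. L (\<lambda>\<omega>. scale c (\<phi> \<omega>)) = (\<lambda>\<omega>. scale c (L \<phi> \<omega>))) \<and>
     (\<exists>C. \<forall>\<phi>\<in>H_T \<mu>. norm_T \<mu> (L \<phi>) \<le> C * norm_T \<mu> \<phi>)}"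

definition T_grp :: "nat list \<Rightarrow> (nat \<Rightarrow> nat) \<Rightarrow> hvec \<Rightarrow> hvec" where
  "T_grp \<mu> g \<phi> = (\<lambda>\<omega>. if \<omega> \<in> Omega_inf (ysize \<mu>) then \<phi> (mmult \<omega> (perm_matr g)) else 0)"

definition T_alg :: "nat list \<Rightarrow> grp_alg \<Rightarrow> hvec \<Rightarrow> hvec" where
  "T_alg \<mu> x = (\<lambda>\<phi>\<in>H_T \<mu>. \<lambda>\<omega>.
     \<Sum>g\<in>Poly_Mapping.keys x. scale (Poly_Mapping.lookup x g) (T_grp \<mu> g \<phi> \<omega>))"

definition sot_limit :: "nat list \<Rightarrow> (nat \<Rightarrow> hvec \<Rightarrow> hvec) \<Rightarrow> (hvec \<Rightarrow> hvec) \<Rightarrow> bool" where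
  "sot_limit \<mu> X L \<longleftrightarrow> L \<in> End_T \<mu> \<and>
     (\<forall>\<phi>\<in>H_T \<mu>. (\<lambda>n. norm_T \<mu> (\<lambda>\<omega>. X n \<phi> \<omega> - L \<phi> \<omega>)) \<longlonglongrightarrow> 0)"


section \<open>The algebra of convergent sequences\<close>

text \<open>
  Sequences are indexed from 1; the entry at index 0 is arbitrary. It is irrelevant to the
  equivalence of sequences.
\<close>

definition conv_seq :: "(nat \<Rightarrow> grp_alg) set" where
  "conv_seq = {\<alpha>. (\<forall>n. \<alpha> n \<in> alg_over Sym_inf) \<and>
     (\<forall>\<^sub>F n in sequentially. \<alpha> n \<in> alg_over (Sym n)) \<and>
     (\<forall>\<mu>\<in>Young. \<exists>L. sot_limit \<mu> (\<lambda>n. T_alg \<mu> (\<alpha> n)) L) \<and>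
     (\<exists>m. \<forall>\<^sub>F n in sequentially. \<alpha> n \<in> cB m n) \<and>
     bdd_above (range (\<lambda>n. max_deg perm_deg (\<alpha> n)))}"

definition T_lim :: "nat list \<Rightarrow> (nat \<Rightarrow> grp_alg) \<Rightarrow> hvec \<Rightarrow> hvec" where
  "T_lim \<mu> \<alpha> = (THE L. sot_limit \<mu> (\<lambda>n. T_alg \<mu> (\<alpha> n)) L)"

definition conv_equiv :: "((nat \<Rightarrow> grp_alg) \<times> (nat \<Rightarrow> grp_alg)) set" where
  "conv_equiv = {(\<alpha>, \<beta>). \<alpha> \<in> conv_seq \<and> \<beta> \<in> conv_seq \<and> (\<forall>\<mu>\<in>Young. T_lim \<mu> \<alpha> = T_lim \<mu> \<beta>)}"

definition alg_B :: "(complex, (nat \<Rightarrow> grp_alg) set) module" where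
  "alg_B =
    \<lparr> carrier = conv_seq // conv_equiv,
      monoid.mult = (\<lambda>X Y. \<Union>\<alpha>\<in>X. \<Union>\<beta>\<in>Y. conv_equiv `` {\<lambda>n. grp_mult (\<alpha> n) (\<beta> n)}),
      one = conv_equiv `` {\<lambda>n. Poly_Mapping.single id 1},
      zero = conv_equiv `` {\<lambda>n. 0},
      add = (\<lambda>X Y. \<Union>\<alpha>\<in>X. \<Union>\<beta>\<in>Y. conv_equiv `` {\<lambda>n. \<alpha> n + \<beta> n}),
      smult = (\<lambda>c X. \<Union>\<alpha>\<in>X. conv_equiv `` {\<lambda>n. scale c (\<alpha> n)}) \<rparr>"

definition sub_B :: "nat \<Rightarrow> (nat \<Rightarrow> grp_alg) set set" where
  "sub_B m = {X \<in> carrier alg_B. \<exists>\<alpha>\<in>X. \<forall>\<^sub>F n in sequentially. \<alpha> n \<in> cB m n}"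

text \<open>
  An element of the product of the algebras \<open>End_T \<mu>\<close> over all Young diagrams is a function on
  \<open>Young\<close>, \<open>undefined\<close> elsewhere.
\<close>

definition iota_B :: "(nat \<Rightarrow> grp_alg) set \<Rightarrow> nat list \<Rightarrow> hvec \<Rightarrow> hvec" where
  "iota_B X = (\<lambda>\<mu>\<in>Young. THE L. \<exists>\<alpha>\<in>X. L = T_lim \<mu> \<alpha>)"


section \<open>The centralizer construction\<close>

text \<open>Only the terms with index at least \<open>m\<close> of a sequence in \<open>seq_A m\<close> are meaningful.\<close>

definition seq_A :: "nat \<Rightarrow> (nat \<Rightarrow> sg_alg) set" where
  "seq_A m = {a. (\<forall>n\<ge>m. a n \<in> cA m n) \<and>
     (\<forall>n>m. a (n - 1) = theta n (a n)) \<and>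
     bdd_above ((\<lambda>n. max_deg (Gam_deg n) (a n)) ` {m..})}"

text \<open>
  The union over \<open>m\<close> is taken along the embeddings that forget the first term; that is, sequences
  are identified when they agree from some index on. Since each term determines the preceding one
  by \<open>theta\<close>, two sequences in \<open>seq_A m\<close> are identified only if all their terms with index at least
  \<open>m\<close> agree.
\<close>

definition A_equiv :: "((nat \<Rightarrow> sg_alg) \<times> (nat \<Rightarrow> sg_alg)) set" where
  "A_equiv = {(a, b). a \<in> (\<Union>m. seq_A m) \<and> b \<in> (\<Union>m. seq_A m) \<and>
     (\<forall>\<^sub>F n in sequentially. a n = b n)}"

definition alg_A :: "(complex, (nat \<Rightarrow> sg_alg) set) module" where
  "alg_A =
    \<lparr> carrier = (\<Union>m. seq_A m) // A_equiv,
      monoid.mult = (\<lambda>X Y. \<Union>a\<in>X. \<Union>b\<in>Y. A_equiv `` {\<lambda>n. convolve mmult (a n) (b n)}),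
      one = A_equiv `` {\<lambda>n. Poly_Mapping.single (id_matr n) 1},
      zero = A_equiv `` {\<lambda>n. 0},
      add = (\<lambda>X Y. \<Union>a\<in>X. \<Union>b\<in>Y. A_equiv `` {\<lambda>n. a n + b n}),
      smult = (\<lambda>c X. \<Union>a\<in>X. A_equiv `` {\<lambda>n. scale c (a n)}) \<rparr>"

definition sub_A :: "nat \<Rightarrow> (nat \<Rightarrow> sg_alg) set set" where
  "sub_A m = {X \<in> carrier alg_A. \<exists>a\<in>X. a \<in> seq_A m}"

definition H_fin :: "nat list \<Rightarrow> nat \<Rightarrow> hvec set" where
  "H_fin \<mu> n = {\<phi> \<in> H_T \<mu>. \<forall>g\<in>Sym_inf. (\<forall>i\<in>{1..n}. g i = i) \<longrightarrow> T_grp \<mu> g \<phi> = \<phi>}"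

definition T_sg :: "nat list \<Rightarrow> nat \<Rightarrow> matr \<Rightarrow> hvec \<Rightarrow> hvec" where
  "T_sg \<mu> n \<gamma> \<phi> = (\<lambda>\<omega>. if \<omega> \<in> Omega_fin (ysize \<mu>) n \<and> mmult \<omega> \<gamma> \<in> Omega_fin (ysize \<mu>) n
     then \<phi> (mmult \<omega> \<gamma>) else 0)"

definition T_sg_alg :: "nat list \<Rightarrow> nat \<Rightarrow> sg_alg \<Rightarrow> hvec \<Rightarrow> hvec" where
  "T_sg_alg \<mu> n x \<phi> = (\<lambda>\<omega>.
     \<Sum>\<gamma>\<in>Poly_Mapping.keys x. scale (Poly_Mapping.lookup x \<gamma>) (T_sg \<mu> n \<gamma> \<phi> \<omega>))"

text \<open>
  The operator on the whole Hilbert space: the bounded operator with the prescribed restrictions.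
  It is unique because the union of the spaces \<open>H_fin \<mu> n\<close> is dense.
\<close>

definition T_tilde :: "nat list \<Rightarrow> nat \<Rightarrow> (nat \<Rightarrow> sg_alg) \<Rightarrow> hvec \<Rightarrow> hvec" where
  "T_tilde \<mu> m a = (THE L. L \<in> End_T \<mu> \<and>
     (\<forall>n\<ge>max m (ysize \<mu>). \<forall>\<phi>\<in>H_fin \<mu> n. L \<phi> = T_sg_alg \<mu> n (a n) \<phi>))"

definition iota_A :: "(nat \<Rightarrow> sg_alg) set \<Rightarrow> nat list \<Rightarrow> hvec \<Rightarrow> hvec" where
  "iota_A X = (\<lambda>\<mu>\<in>Young. THE L. \<exists>m. \<exists>a\<in>X \<inter> seq_A m. L = T_tilde \<mu> m a)"


section \<open>Isomorphisms of algebras\<close>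

definition alg_iso ::
  "(complex, 'a, 'm) module_scheme \<Rightarrow> (complex, 'b, 'n) module_scheme \<Rightarrow> ('a \<Rightarrow> 'b) set" where
  "alg_iso R S = {h \<in> ring_iso R S.
     \<forall>c. \<forall>x\<in>carrier R. h (c \<odot>\<^bsub>R\<^esub> x) = c \<odot>\<^bsub>S\<^esub> h x}"

end

theory Submission
  imports Defs "HOL-Combinatorics.Cycles" "HOL-Analysis.Convex"
begin

text \<open>
  For an element \<open>x\<close> of a group algebra or semigroup algebra and a finite partial injection \<open>R\<close>, the
  incidence function \<open>hatG x\<close> or \<open>hatA x\<close> takes at \<open>R\<close> the sum of the coefficients of \<open>x\<close> over
  the elements extending \<open>R\<close>. On the function space of a diagram with \<open>l\<close> boxes \<open>x\<close> acts with the
  kernel \<open>hatG x (link l \<omega> \<omega>')\<close>, where \<open>link l \<omega> \<omega>'\<close> matches the positions of the ones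
  in \<open>\<omega>\<close> and \<open>\<omega>'\<close>.

  For \<open>\<alpha> n \<in> cB m n\<close> with bounded incidence functions, invariance forces \<open>hatG (\<alpha> n) R\<close> to decay by
  a factor \<open>1 / n\<close> for each point outside \<open>{1..m}\<close> that is in the range but not in the domain of
  \<open>R\<close>, or vice versa. Hence the Schur test applies uniformly, and pointwise convergence of the
  incidence functions to a kernel \<open>h\<close> implies strong convergence to the operator with kernel \<open>h\<close>.
  Conversely the operators for all diagrams with \<open>l\<close> boxes determine the kernel on all \<open>R\<close> with
  \<open>l\<close> elements, because the unit of the group algebra lies in the sum of the two-sided ideals
  generated by the Young symmetrizers.

  On the other side the maps \<open>theta\<close> preserve incidence functions, and by Moebius inversion the
  members of \<open>seq_A m\<close> are the kernels \<open>h\<close> that are invariant, vanish unless domain and range agree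
  outside \<open>{1..m}\<close>, and have bounded degree. Such an \<open>h\<close> is the limit of the averages, over the
  conjugations fixing \<open>{1..m}\<close>, of finitely many group algebra elements whose incidence functions
  are concentrated on prescribed points and equal there to the cumulants of \<open>h\<close>. Both algebras are
  thus identified with one algebra of kernels, in which products are compositions.
\<close>

section \<open>Linear functionals on semigroup algebras\<close>

text \<open>The delicate point is the approximation of a given kernel. A fixed element u is
  conjugated by the permutations \<tau> fixing {1..m}, and its value at R depends on how many
  support points of R are moved by \<tau> into the finite window on which u lives. Each further
  point in the window makes such \<tau> rarer by a factor of order 1 / n. If u responded to fewer
  than r points, those \<tau> would swamp the average; what it does on more than r points disappears
  in the limit. So u must vanish below r points and be prescribed at exactly r, and the sum is
  divided by the number of \<tau> preserving the prescribed set of r points, not by the order of the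
  group. This is also the origin of the cumulants: diagonal pairs moved out of the window are
  invisible to u, so one average produces the sum over all deletions of diagonal pairs that leave r
  support points, and what is prescribed has to be the Moebius inverse of such sums.\<close>

abbreviation keys where "keys \<equiv> Poly_Mapping.keys"
abbreviation lookup where "lookup \<equiv> Poly_Mapping.lookup"
abbreviation single where "single \<equiv> Poly_Mapping.single"
abbreviation ginv :: "('a \<Rightarrow> 'a) \<Rightarrow> 'a \<Rightarrow> 'a" where "ginv \<equiv> inv_into UNIV"

text \<open>Elements are compared through all linear functionals at once
  (\<open>pairing_eqI\<close>). Products and pushforwards become substitutions in \<phi>, so
  identities such as associativity reduce to identities of functions and cancellations in supports
  never have to be tracked.\<close>

definition pairing :: "('g \<Rightarrow> complex) \<Rightarrow> ('g \<Rightarrow>\<^sub>0 complex) \<Rightarrow> complex" where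
  "pairing \<phi> x = (\<Sum>g\<in>keys x. lookup x g * \<phi> g)"

lemma pairing_superset:
  assumes "finite A" "keys x \<subseteq> A"
  shows "pairing \<phi> x = (\<Sum>g\<in>A. lookup x g * \<phi> g)"
  unfolding pairing_def
  by (rule sum.mono_neutral_left) (use assms in \<open>auto simp: in_keys_iff\<close>)

lemma pairing_zero [simp]: "pairing \<phi> 0 = 0"
  by (simp add: pairing_def)

lemma pairing_add: "pairing \<phi> (x + y) = pairing \<phi> x + pairing \<phi> y"
proof -
  let ?A = "keys x \<union> keys y"
  have "keys (x + y) \<subseteq> ?A" by (rule Poly_Mapping.keys_add)
  then show ?thesis
    by (simp add: pairing_superset[of ?A] lookup_add distrib_right sum.distrib)
qed

lemma pairing_sum: "pairing \<phi> (\<Sum>i\<in>I. x i) = (\<Sum>i\<in>I. pairing \<phi> (x i))"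
  by (induction I rule: infinite_finite_induct) (auto simp: pairing_add)

lemma pairing_single [simp]: "pairing \<phi> (single g c) = c * \<phi> g"
  by (simp add: pairing_def)

lemma lookup_scale [simp]: "lookup (scale c x) g = c * lookup x g"
  by (simp add: scale_def Poly_Mapping.map.rep_eq when_def)

lemma keys_scale: "keys (scale c x) \<subseteq> keys x"
  by (auto simp: in_keys_iff)

lemma pairing_scale [simp]: "pairing \<phi> (scale c x) = c * pairing \<phi> x"
  using pairing_superset[OF _ keys_scale, of x \<phi> c]
  by (simp add: pairing_def sum_distrib_left mult.assoc)

lemma pairing_cong: "(\<And>g. g \<in> keys x \<Longrightarrow> \<phi> g = \<psi> g) \<Longrightarrow> pairing \<phi> x = pairing \<psi> x"
  by (simp add: pairing_def)

lemma pairing_eq_0: "(\<And>g. g \<in> keys x \<Longrightarrow> \<phi> g = 0) \<Longrightarrow> pairing \<phi> x = 0"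
  by (simp add: pairing_def)

lemma pairing_linear_ext: "pairing \<phi> (linear_ext f x) = pairing (\<lambda>g. \<phi> (f g)) x"
  unfolding linear_ext_def pairing_sum pairing_def[of "\<lambda>g. \<phi> (f g)"] by simp

lemma pairing_convolve:
  "pairing \<phi> (convolve f x y) = pairing (\<lambda>g. pairing (\<lambda>h. \<phi> (f g h)) y) x"
  unfolding convolve_def pairing_sum pairing_single
  by (simp add: pairing_def sum_distrib_left mult.assoc)

lemma pairing_fun_add: "pairing (\<lambda>g. \<phi> g + \<psi> g) x = pairing \<phi> x + pairing \<psi> x"
  by (simp add: pairing_def distrib_left sum.distrib)

lemma pairing_fun_cmult: "pairing (\<lambda>g. c * \<phi> g) x = c * pairing \<phi> x"
  by (simp add: pairing_def sum_distrib_left mult.left_commute)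

lemma pairing_fun_sum: "pairing (\<lambda>g. \<Sum>i\<in>I. \<phi> i g) x = (\<Sum>i\<in>I. pairing (\<phi> i) x)"
  unfolding pairing_def sum_distrib_left by (rule sum.swap)

lemma pairing_swap:
  "pairing (\<lambda>g. pairing (\<lambda>h. F g h) y) x = pairing (\<lambda>h. pairing (\<lambda>g. F g h) x) y"
  unfolding pairing_def sum_distrib_left
  by (subst sum.swap) (simp add: mult.left_commute)

lemma lookup_pairing: "lookup x k = pairing (\<lambda>g. of_bool (g = k)) x"
proof -
  have "pairing (\<lambda>g. of_bool (g = k)) x = (\<Sum>g\<in>keys x. if g = k then lookup x g else 0)"
    unfolding pairing_def by (rule sum.cong) auto
  then show ?thesis by (simp add: in_keys_iff)
qed

lemma pairing_eqI: "(\<And>\<phi>. pairing \<phi> x = pairing \<phi> y) \<Longrightarrow> x = y"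
  by (rule poly_mapping_eqI) (simp add: lookup_pairing)

lemma keys_sum_subset: "keys (\<Sum>i\<in>I. x i) \<subseteq> (\<Union>i\<in>I. keys (x i))"
proof (induction I rule: infinite_finite_induct)
  case (insert i I)
  then show ?case using Poly_Mapping.keys_add[of "x i" "\<Sum>i\<in>I. x i"] by auto
qed auto

lemma keys_convolve: "keys (convolve f x y) \<subseteq> (\<lambda>(g, h). f g h) ` (keys x \<times> keys y)"
proof
  fix k assume k: "k \<in> keys (convolve f x y)"
  show "k \<in> (\<lambda>(g, h). f g h) ` (keys x \<times> keys y)"
  proof (rule ccontr)
    assume *: "k \<notin> (\<lambda>(g, h). f g h) ` (keys x \<times> keys y)"
    have "lookup (convolve f x y) k = 0"
      unfolding lookup_pairing pairing_convolve
      by (intro pairing_eq_0) (use * in force)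
    with k show False by (simp add: in_keys_iff)
  qed
qed

lemma alg_over_zero [simp]: "0 \<in> alg_over G"
  and alg_over_single: "g \<in> G \<Longrightarrow> single g c \<in> alg_over G"
  and alg_over_scale: "x \<in> alg_over G \<Longrightarrow> scale c x \<in> alg_over G"
  and alg_over_add: "x \<in> alg_over G \<Longrightarrow> y \<in> alg_over G \<Longrightarrow> x + y \<in> alg_over G"
  using keys_scale[of c x] Poly_Mapping.keys_add[of x y]
  by (auto simp: alg_over_def)

lemma alg_over_sum: "(\<And>i. i \<in> I \<Longrightarrow> x i \<in> alg_over G) \<Longrightarrow> (\<Sum>i\<in>I. x i) \<in> alg_over G"
  using keys_sum_subset[of x I] by (fastforce simp: alg_over_def)

lemma alg_over_convolve:
  assumes "x \<in> alg_over G" "y \<in> alg_over H" "\<And>g h. g \<in> G \<Longrightarrow> h \<in> H \<Longrightarrow> f g h \<in> K"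
  shows "convolve f x y \<in> alg_over K"
  using keys_convolve[of f x y] assms by (fastforce simp: alg_over_def)

lemma alg_over_mono: "x \<in> alg_over G \<Longrightarrow> G \<subseteq> H \<Longrightarrow> x \<in> alg_over H"
  by (auto simp: alg_over_def)

lemma grp_mult_assoc: "grp_mult (grp_mult x y) z = grp_mult x (grp_mult y z)"
  by (rule pairing_eqI) (simp add: pairing_convolve comp_assoc)

lemma convolve_sum_left: "convolve f (\<Sum>i\<in>I. x i) y = (\<Sum>i\<in>I. convolve f (x i) y)"
  by (rule pairing_eqI) (simp add: pairing_convolve pairing_sum)

lemma convolve_sum_right: "convolve f x (\<Sum>i\<in>I. y i) = (\<Sum>i\<in>I. convolve f x (y i))"
  by (rule pairing_eqI) (simp add: pairing_convolve pairing_sum pairing_fun_sum)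

lemma convolve_add_left: "convolve f (x + x') y = convolve f x y + convolve f x' y"
  by (rule pairing_eqI) (simp add: pairing_convolve pairing_add)

lemma convolve_add_right: "convolve f x (y + y') = convolve f x y + convolve f x y'"
  by (rule pairing_eqI) (simp add: pairing_convolve pairing_add pairing_fun_add)

lemma convolve_scale_left: "convolve f (scale c x) y = scale c (convolve f x y)"
  by (rule pairing_eqI) (simp add: pairing_convolve)

lemma convolve_scale_right: "convolve f x (scale c y) = scale c (convolve f x y)"
  by (rule pairing_eqI) (simp add: pairing_convolve pairing_fun_cmult)

lemma convolve_zero_left [simp]: "convolve f 0 y = 0"
  and convolve_zero_right [simp]: "convolve f x 0 = 0"
  by (simp_all add: convolve_def)

lemma convolve_single_single [simp]:
  "convolve f (single g a) (single h b) = single (f g h) (a * b)"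
  by (rule pairing_eqI) (simp add: pairing_convolve)

lemma grp_mult_id_left [simp]: "grp_mult (single id 1) x = x"
  and grp_mult_id_right [simp]: "grp_mult x (single id 1) = x"
  by (rule pairing_eqI; simp add: pairing_convolve)+

lemma scale_add: "scale c (x + y) = scale c x + scale c y"
  and scale_scale: "scale c (scale d x) = scale (c * d) x"
  and scale_one [simp]: "scale 1 x = x"
  and scale_zero_right [simp]: "scale c 0 = 0"
  and scale_zero_left [simp]: "scale 0 x = 0"
  and scale_add_left: "scale (c + d) x = scale c x + scale d x"
  and scale_minus_one: "scale (- 1) x = - x"
  and scale_single [simp]: "scale c (single g d) = single g (c * d)"
  by (rule poly_mapping_eqI; simp add: lookup_add algebra_simps lookup_single when_def)+

lemma scale_sum: "scale c (\<Sum>i\<in>I. x i) = (\<Sum>i\<in>I. scale c (x i))"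
  by (rule poly_mapping_eqI) (simp add: lookup_sum sum_distrib_left)

lemma poly_mapping_as_sum:
  fixes x :: "'g \<Rightarrow>\<^sub>0 complex"
  assumes "finite A" "keys x \<subseteq> A"
  shows "x = (\<Sum>g\<in>A. single g (lookup x g))"
  by (rule pairing_eqI) (simp add: pairing_sum pairing_superset[OF assms])

section \<open>Permutations\<close>

lemma Sym_permutes: "g \<in> Sym n \<longleftrightarrow> g permutes {1..n}"
  by (simp add: Sym_def)

lemma finite_Sym [simp]: "finite (Sym n)"
  unfolding Sym_def by (rule finite_permutations) simp

lemma id_Sym [simp]: "id \<in> Sym n"
  by (simp add: Sym_def permutes_id)

lemma comp_Sym [simp]: "g \<in> Sym n \<Longrightarrow> h \<in> Sym n \<Longrightarrow> g \<circ> h \<in> Sym n"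
  unfolding Sym_def by (simp add: permutes_compose)

lemma inv_Sym [simp]: "g \<in> Sym n \<Longrightarrow> ginv g \<in> Sym n"
  unfolding Sym_def by (simp add: permutes_inv)

lemma Sym_bij: "g \<in> Sym n \<Longrightarrow> bij g"
  unfolding Sym_def by (simp add: permutes_bij)

lemma Sym_mono: "k \<le> n \<Longrightarrow> Sym k \<subseteq> Sym n"
  unfolding Sym_def by (auto intro: permutes_subset)

lemma inv_left: "bij g \<Longrightarrow> ginv g (g x) = x"
  and inv_right: "bij g \<Longrightarrow> g (ginv g x) = x"
  by (simp_all add: bij_is_inj bij_is_surj surj_f_inv_f)

lemma inv_comp_id: "bij g \<Longrightarrow> ginv g \<circ> g = id"
  and comp_inv_id: "bij g \<Longrightarrow> g \<circ> ginv g = id"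
  by (auto simp: fun_eq_iff inv_left inv_right)

lemma Sym_fix: "g \<in> Sym n \<Longrightarrow> x \<notin> {1..n} \<Longrightarrow> g x = x"
  unfolding Sym_def permutes_def by blast

lemma Sym_in: "g \<in> Sym n \<Longrightarrow> g x \<in> {1..n} \<longleftrightarrow> x \<in> {1..n}"
  unfolding Sym_def by (simp only: mem_Collect_eq permutes_in_image)

lemma Sym_pos: "g \<in> Sym n \<Longrightarrow> 1 \<le> x \<Longrightarrow> 1 \<le> g x"
  using Sym_fix[of g n x] Sym_in[of g n x] by (cases "x \<in> {1..n}") auto

lemma Sym_stab_subset: "Sym_stab m n \<subseteq> Sym n"
  by (auto simp: Sym_stab_def)

lemma inv_Sym_stab: "\<sigma> \<in> Sym_stab m n \<Longrightarrow> ginv \<sigma> \<in> Sym_stab m n"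
  by (auto simp: Sym_stab_def) (metis Sym_bij atLeastAtMost_iff inv_left)

lemma Sym_stab_fix: "\<sigma> \<in> Sym_stab m n \<Longrightarrow> x \<le> m \<Longrightarrow> \<sigma> x = x"
  using Sym_fix[of \<sigma> n x] by (cases "x = 0") (auto simp: Sym_stab_def)

lemma Sym_stab_permutes: "m \<le> n \<Longrightarrow> \<sigma> \<in> Sym_stab m n \<longleftrightarrow> \<sigma> permutes {m<..n}"
proof
  assume "\<sigma> \<in> Sym_stab m n"
  then have "\<sigma> permutes {1..n}" "\<And>x. x \<le> m \<Longrightarrow> \<sigma> x = x"
    by (auto simp: Sym_stab_fix) (simp add: Sym_stab_def Sym_def)
  then show "\<sigma> permutes {m<..n}"
    unfolding permutes_def by (metis atLeastAtMost_iff greaterThanAtMost_iff not_le)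
next
  assume a: "m \<le> n" "\<sigma> permutes {m<..n}"
  then have "\<sigma> permutes {1..n}" by (rule_tac permutes_subset) auto
  with a show "\<sigma> \<in> Sym_stab m n" by (auto simp: Sym_stab_def Sym_def permutes_def)
qed

text \<open>Commuting with \<sigma> is invariance under conjugation by \<sigma>, in dual form: the
  functional \<open>\<phi> (k \<circ> ginv \<sigma>)\<close> is applied to both sides of the
  commutation relation.\<close>

lemma cB_invariant:
  assumes "x \<in> cB m n" "\<sigma> \<in> Sym_stab m n"
  shows "pairing \<phi> x = pairing (\<lambda>g. \<phi> (\<sigma> \<circ> g \<circ> ginv \<sigma>)) x"
proof -
  have b: "bij \<sigma>" using assms Sym_stab_subset Sym_bij by blast
  have "pairing (\<lambda>k. \<phi> (k \<circ> ginv \<sigma>)) (grp_mult (single \<sigma> 1) x) = pairing (\<lambda>k. \<phi> (k \<circ> ginv \<sigma>)) (grp_mult x (single \<sigma> 1))"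
    using assms by (simp add: cB_def alg_centralizer_def)
  then show ?thesis by (simp add: pairing_convolve comp_assoc comp_inv_id[OF b])
qed

lemma cB_I:
  assumes "x \<in> alg_over (Sym n)"
    and "\<And>\<phi> \<sigma>. \<sigma> \<in> Sym_stab m n \<Longrightarrow> pairing \<phi> x = pairing (\<lambda>g. \<phi> (\<sigma> \<circ> g \<circ> ginv \<sigma>)) x"
  shows "x \<in> cB m n"
  unfolding cB_def alg_centralizer_def
proof (intro CollectI conjI ballI assms(1))
  fix \<sigma> assume s: "\<sigma> \<in> Sym_stab m n"
  then have b: "bij \<sigma>" using Sym_stab_subset Sym_bij by blast
  show "grp_mult (single \<sigma> 1) x = grp_mult x (single \<sigma> 1)"
  proof (rule pairing_eqI)
    fix \<phi>
    show "pairing \<phi> (grp_mult (single \<sigma> 1) x) = pairing \<phi> (grp_mult x (single \<sigma> 1))"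
      using assms(2)[OF s, of "\<lambda>k. \<phi> (k \<circ> \<sigma>)"]
      by (simp add: pairing_convolve comp_assoc inv_comp_id[OF b])
  qed
qed

lemma cB_alg_over: "x \<in> cB m n \<Longrightarrow> x \<in> alg_over (Sym n)"
  by (simp add: cB_def alg_centralizer_def)

text \<open>The complements of A and B in the finite set S have equal size, so any bijection between
  them completes f.\<close>

lemma bij_betw_extend_permutes:
  assumes "finite S" "bij_betw f A B" "A \<subseteq> S" "B \<subseteq> S"
  obtains p where "p permutes S" "\<And>x. x \<in> A \<Longrightarrow> p x = f x"
proof -
  have fin: "finite A" "finite B" using assms finite_subset by blast+
  have "card A = card B" using assms(2) by (rule bij_betw_same_card)
  then have "card (S - A) = card (S - B)" using assms fin by (simp add: card_Diff_subset)
  then obtain g where g: "bij_betw g (S - A) (S - B)"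
    using finite_same_card_bij[of "S - A" "S - B"] assms(1) by auto
  define h where "h = (\<lambda>x. if x \<in> A then f x else g x)"
  have "bij_betw h (A \<union> (S - A)) (B \<union> (S - B))"
  proof (rule bij_betw_combine)
    show "bij_betw h A B" using assms(2) by (simp add: h_def cong: bij_betw_cong)
    show "bij_betw h (S - A) (S - B)"
      using g by (rule bij_betw_cong[THEN iffD1, rotated]) (simp add: h_def)
  qed auto
  moreover have "A \<union> (S - A) = S" "B \<union> (S - B) = S" using assms by auto
  ultimately have h: "bij_betw h S S" by simp
  define p where "p = (\<lambda>x. if x \<in> S then h x else x)"
  have "p permutes S"
  proof (rule bij_imp_permutes)
    show "bij_betw p S S" using h by (rule bij_betw_cong[THEN iffD1, rotated]) (simp add: p_def)
  qed (simp add: p_def)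
  moreover have "p x = f x" if "x \<in> A" for x using that assms by (auto simp: p_def h_def)
  ultimately show thesis by (rule that)
qed

section \<open>Partial injections and incidence functions\<close>

definition rel :: "matr \<Rightarrow> (nat \<times> nat) set" where
  "rel \<gamma> = {(i, j). \<gamma> i j \<noteq> 0}"

definition matr_of :: "(nat \<times> nat) set \<Rightarrow> matr" where
  "matr_of R = (\<lambda>i j. if (i, j) \<in> R then 1 else 0)"

definition pinj :: "(nat \<times> nat) set \<Rightarrow> bool" where
  "pinj R \<longleftrightarrow> inj_on fst R \<and> inj_on snd R"

definition PI :: "nat \<Rightarrow> (nat \<times> nat) set set" where
  "PI n = {R. R \<subseteq> {1..n} \<times> {1..n} \<and> pinj R}"

lemma pinj_D: "pinj R \<Longrightarrow> (a, b) \<in> R \<Longrightarrow> (a, b') \<in> R \<Longrightarrow> b = b'"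
  "pinj R \<Longrightarrow> (a, b) \<in> R \<Longrightarrow> (a', b) \<in> R \<Longrightarrow> a = a'"
  using inj_onD[of fst R "(a, b)" "(a, b')"] inj_onD[of snd R "(a, b)" "(a', b)"]
  by (auto simp: pinj_def)

lemma pinjI: "(\<And>a b b'. (a, b) \<in> R \<Longrightarrow> (a, b') \<in> R \<Longrightarrow> b = b') \<Longrightarrow>
   (\<And>a a' b. (a, b) \<in> R \<Longrightarrow> (a', b) \<in> R \<Longrightarrow> a = a') \<Longrightarrow> pinj R"
  by (auto simp: pinj_def inj_on_def)

lemma pinj_subset: "pinj R \<Longrightarrow> S \<subseteq> R \<Longrightarrow> pinj S"
  by (auto simp: pinj_def intro: inj_on_subset)

lemma PI_subset: "R \<in> PI n \<Longrightarrow> S \<subseteq> R \<Longrightarrow> S \<in> PI n"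
  by (auto simp: PI_def intro: pinj_subset)

lemma finite_PI [simp]: "finite (PI n)"
  by (rule finite_subset[of _ "Pow ({1..n} \<times> {1..n})"]) (auto simp: PI_def)

lemma PI_finite: "R \<in> PI n \<Longrightarrow> finite R"
  unfolding PI_def by (rule finite_subset[of _ "{1..n} \<times> {1..n}"]) auto

lemma PI_mono: "k \<le> n \<Longrightarrow> PI k \<subseteq> PI n"
  by (fastforce simp: PI_def)

lemma PI_pinj: "R \<in> PI n \<Longrightarrow> pinj R"
  by (simp add: PI_def)

lemma PI_bounds: "R \<in> PI n \<Longrightarrow> (a, b) \<in> R \<Longrightarrow> a \<in> {1..n} \<and> b \<in> {1..n}"
  by (auto simp: PI_def)

lemma PI_converse: "R \<in> PI n \<Longrightarrow> R\<inverse> \<in> PI n"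
  unfolding PI_def by (auto intro!: pinjI dest: pinj_D)

lemma rel_matr_of [simp]: "rel (matr_of R) = R"
  by (auto simp: rel_def matr_of_def)

lemma Gam_01: "\<gamma> \<in> Gam n \<Longrightarrow> \<gamma> i j = 0 \<or> \<gamma> i j = 1"
  unfolding Gam_def by blast

lemma matr_of_rel:
  assumes "\<gamma> \<in> Gam n"
  shows "matr_of (rel \<gamma>) = \<gamma>"
proof (intro ext)
  fix i j
  show "matr_of (rel \<gamma>) i j = \<gamma> i j"
    using Gam_01[OF assms, of i j] unfolding rel_def matr_of_def by auto
qed

lemma rel_PI:
  assumes g: "\<gamma> \<in> Gam n"
  shows "rel \<gamma> \<in> PI n"
proof -
  have "i \<in> {1..n} \<and> j \<in> {1..n}" if "\<gamma> i j \<noteq> 0" for i j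
    using g that unfolding Gam_def by blast
  then have "rel \<gamma> \<subseteq> {1..n} \<times> {1..n}" unfolding rel_def by blast
  moreover have "pinj (rel \<gamma>)"
  proof (rule pinjI)
    fix a b c
    have u: "\<gamma> a b = 1 \<Longrightarrow> \<gamma> a c = 1 \<Longrightarrow> b = c" "\<gamma> a c = 1 \<Longrightarrow> \<gamma> b c = 1 \<Longrightarrow> a = b" for a b c
      using g unfolding Gam_def by blast+
    { assume "(a, b) \<in> rel \<gamma>" "(a, c) \<in> rel \<gamma>"
      then have "\<gamma> a b \<noteq> 0" "\<gamma> a c \<noteq> 0" by (simp_all add: rel_def)
      then show "b = c" using u(1) Gam_01[OF g] by metis }
    { assume "(a, c) \<in> rel \<gamma>" "(b, c) \<in> rel \<gamma>"
      then have "\<gamma> a c \<noteq> 0" "\<gamma> b c \<noteq> 0" by (simp_all add: rel_def)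
      then show "a = b" using u(2) Gam_01[OF g] by metis }
  qed
  ultimately show ?thesis by (simp add: PI_def)
qed

lemma matr_of_Gam: "R \<in> PI n \<Longrightarrow> matr_of R \<in> Gam n"
  using pinj_D[OF PI_pinj] PI_bounds[of R n]
  by (auto simp: Gam_def matr_of_def split: if_splits)

lemma bij_betw_rel: "bij_betw rel (Gam n) (PI n)"
  by (rule bij_betw_byWitness[where f' = matr_of])
    (auto simp: matr_of_rel rel_PI matr_of_Gam)

lemma finite_Gam [simp]: "finite (Gam n)"
  using bij_betw_finite[OF bij_betw_rel] by simp

lemma mmult_row:
  assumes "A i k = 1" "\<And>k'. A i k' \<noteq> 0 \<Longrightarrow> k' = k"
  shows "mmult A B i j = B k j"
proof -
  have "{k. A i k \<noteq> 0} = {k}" using assms by auto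
  then show ?thesis by (simp add: mmult_def assms)
qed

lemma mmult_row_zero: "(\<And>k. A i k = 0) \<Longrightarrow> mmult A B i j = 0"
  by (simp add: mmult_def)

lemma mmult_Gam:
  assumes "\<gamma> \<in> Gam n" "\<delta> \<in> Gam n"
  shows "mmult \<gamma> \<delta> = matr_of (rel \<gamma> O rel \<delta>)"
proof (intro ext)
  fix i j
  show "mmult \<gamma> \<delta> i j = matr_of (rel \<gamma> O rel \<delta>) i j"
  proof (cases "\<exists>k. \<gamma> i k \<noteq> 0")
    case True
    then obtain k where k: "\<gamma> i k \<noteq> 0" by blast
    have u: "\<And>k'. \<gamma> i k' \<noteq> 0 \<Longrightarrow> k' = k"
      using pinj_D(1)[OF PI_pinj[OF rel_PI[OF assms(1)]]] k unfolding rel_def by blast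
    have "mmult \<gamma> \<delta> i j = \<delta> k j"
    proof (rule mmult_row)
      show "\<gamma> i k = 1" using k Gam_01[OF assms(1), of i k] by simp
    qed (rule u)
    moreover have "(i, j) \<in> rel \<gamma> O rel \<delta> \<longleftrightarrow> \<delta> k j \<noteq> 0"
      unfolding rel_def using k u by blast
    ultimately show ?thesis using Gam_01[OF assms(2), of k j] by (auto simp: matr_of_def)
  next
    case False
    then show ?thesis by (auto simp: mmult_row_zero matr_of_def rel_def)
  qed
qed

lemma relcomp_PI: "R \<in> PI n \<Longrightarrow> S \<in> PI n \<Longrightarrow> R O S \<in> PI n"
proof -
  assume a: "R \<in> PI n" "S \<in> PI n"
  have "pinj (R O S)"
    by (rule pinjI) (use a[THEN PI_pinj] in \<open>(elim relcompE, metis pinj_D prod.inject)+\<close>)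
  moreover have "R O S \<subseteq> {1..n} \<times> {1..n}" using a unfolding PI_def by blast
  ultimately show ?thesis by (simp add: PI_def)
qed

lemma mmult_in_Gam: "\<gamma> \<in> Gam n \<Longrightarrow> \<delta> \<in> Gam n \<Longrightarrow> mmult \<gamma> \<delta> \<in> Gam n"
  by (simp add: mmult_Gam matr_of_Gam relcomp_PI rel_PI)

text \<open>The order within a pair follows the matrix, row first: \<open>(a, b)\<close> prescribes
  \<open>g b = a\<close>. First components are values and second components are arguments
  throughout.\<close>

definition covers :: "(nat \<Rightarrow> nat) \<Rightarrow> (nat \<times> nat) set \<Rightarrow> bool" where
  "covers g R \<longleftrightarrow> (\<forall>(a, b)\<in>R. g b = a)"

definition hatG :: "grp_alg \<Rightarrow> (nat \<times> nat) set \<Rightarrow> complex" where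
  "hatG x R = pairing (\<lambda>g. of_bool (covers g R)) x"

definition hatA :: "sg_alg \<Rightarrow> (nat \<times> nat) set \<Rightarrow> complex" where
  "hatA x R = pairing (\<lambda>\<gamma>. of_bool (R \<subseteq> rel \<gamma>)) x"

abbreviation act :: "(nat \<Rightarrow> nat) \<Rightarrow> (nat \<times> nat) set \<Rightarrow> (nat \<times> nat) set" where
  "act \<sigma> R \<equiv> map_prod \<sigma> \<sigma> ` R"

lemma covers_mono: "covers g R \<Longrightarrow> S \<subseteq> R \<Longrightarrow> covers g S"
  by (auto simp: covers_def)

lemma covers_conj: "bij \<sigma> \<Longrightarrow> covers (\<sigma> \<circ> g \<circ> ginv \<sigma>) R \<longleftrightarrow> covers g (act (ginv \<sigma>) R)"
proof -
  assume b: "bij \<sigma>"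
  then have "\<sigma> x = a \<longleftrightarrow> x = ginv \<sigma> a" for x a
    using inv_left inv_right by metis
  then show ?thesis by (auto simp: covers_def)
qed

lemma covers_inv: "bij g \<Longrightarrow> covers (ginv g) R \<longleftrightarrow> covers g (R\<inverse>)"
proof -
  assume b: "bij g"
  have "ginv g y = x \<longleftrightarrow> g x = y" for x y
    using inv_left[OF b] inv_right[OF b] by metis
  then show ?thesis unfolding covers_def by blast
qed

lemma hatG_not_pinj: "x \<in> alg_over (Sym n) \<Longrightarrow> \<not> pinj R \<Longrightarrow> hatG x R = 0"
  unfolding hatG_def
proof (rule pairing_eq_0)
  fix g assume "x \<in> alg_over (Sym n)" "\<not> pinj R" "g \<in> keys x"
  then have "inj g" using Sym_bij bij_is_inj by (auto simp: alg_over_def)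
  have "pinj R" if c: "covers g R"
  proof (rule pinjI)
    fix a b b' assume "(a, b) \<in> R" "(a, b') \<in> R"
    with c have "g b = a" "g b' = a" unfolding covers_def by blast+
    then show "b = b'" using \<open>inj g\<close> by (metis injD)
  next
    fix a a' b assume "(a, b) \<in> R" "(a', b) \<in> R"
    with c have "g b = a" "g b = a'" unfolding covers_def by blast+
    then show "a = a'" by simp
  qed
  then show "of_bool (covers g R) = (0::complex)" using \<open>\<not> pinj R\<close> by auto
qed

lemma hatG_invariant:
  assumes "x \<in> cB m n" "\<sigma> \<in> Sym_stab m n"
  shows "hatG x (act \<sigma> R) = hatG x R"
proof -
  have "bij \<sigma>" using assms Sym_stab_subset Sym_bij by blast
  moreover have "act (ginv \<sigma>) (act \<sigma> R) = R"
    by (simp add: image_image map_prod.comp[unfolded fun_eq_iff comp_def] map_prod_def split_beta inv_left[OF \<open>bij \<sigma>\<close>])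
  ultimately show ?thesis
    unfolding hatG_def by (subst cB_invariant[OF assms]) (simp add: covers_conj)
qed

lemma hatG_add: "hatG (x + y) R = hatG x R + hatG y R"
  and hatG_scale: "hatG (scale c x) R = c * hatG x R"
  by (simp_all add: hatG_def pairing_add)

lemma hatA_add: "hatA (x + y) R = hatA x R + hatA y R"
  and hatA_scale: "hatA (scale c x) R = c * hatA x R"
  by (simp_all add: hatA_def pairing_add)

section \<open>The sets \<open>\<Omega>\<close>\<close>

definition pos :: "matr \<Rightarrow> nat \<Rightarrow> nat" where
  "pos \<omega> i = (THE j. \<omega> i j = 1)"

definition place :: "nat \<Rightarrow> (nat \<Rightarrow> nat) \<Rightarrow> matr" where
  "place l w = (\<lambda>i j. if i \<in> {1..l} \<and> j = w i then 1 else 0)"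

definition link :: "nat \<Rightarrow> matr \<Rightarrow> matr \<Rightarrow> (nat \<times> nat) set" where
  "link l \<omega> \<omega>' = (\<lambda>i. (pos \<omega> i, pos \<omega>' i)) ` {1..l}"

lemma Omega_entry:
  assumes "\<omega> \<in> Omega_inf l" "i \<in> {1..l}"
  shows "\<omega> i j = (if j = pos \<omega> i then 1 else 0)"
proof -
  have u: "\<exists>!j. \<omega> i j = 1" and z: "\<omega> i j \<in> {0, 1}"
    using assms unfolding Omega_inf_def by blast+
  have "\<omega> i (pos \<omega> i) = 1" unfolding pos_def by (rule theI'[OF u])
  with u z show ?thesis by auto
qed

lemma Omega_outside: "\<omega> \<in> Omega_inf l \<Longrightarrow> i \<notin> {1..l} \<Longrightarrow> \<omega> i j = 0"
  unfolding Omega_inf_def by blast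

lemma Omega_place: "\<omega> \<in> Omega_inf l \<Longrightarrow> place l (pos \<omega>) = \<omega>"
proof (intro ext)
  fix i j assume "\<omega> \<in> Omega_inf l"
  then show "place l (pos \<omega>) i j = \<omega> i j"
    using Omega_entry[of \<omega> l i j] Omega_outside[of \<omega> l i j] unfolding place_def
    by (cases "i \<in> {1..l}") presburger+
qed

lemma pos_ge_1: "\<omega> \<in> Omega_inf l \<Longrightarrow> i \<in> {1..l} \<Longrightarrow> 1 \<le> pos \<omega> i"
proof -
  assume a: "\<omega> \<in> Omega_inf l" "i \<in> {1..l}"
  then have "\<omega> i (pos \<omega> i) \<noteq> 0" by (simp add: Omega_entry)
  with a(1) show ?thesis unfolding Omega_inf_def by blast
qed

lemma pos_inj: "\<omega> \<in> Omega_inf l \<Longrightarrow> inj_on (pos \<omega>) {1..l}"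
proof (rule inj_onI)
  fix i j assume a: "\<omega> \<in> Omega_inf l" "i \<in> {1..l}" "j \<in> {1..l}" "pos \<omega> i = pos \<omega> j"
  then have "\<omega> i (pos \<omega> i) = 1" "\<omega> j (pos \<omega> i) = 1" by (simp_all add: Omega_entry)
  with a(1) show "i = j" unfolding Omega_inf_def by blast
qed

lemma place_Omega:
  assumes "inj_on w {1..l}" "\<And>i. i \<in> {1..l} \<Longrightarrow> 1 \<le> w i"
  shows "place l w \<in> Omega_inf l"
proof -
  have e: "place l w i j = 1 \<longleftrightarrow> i \<in> {1..l} \<and> j = w i" "place l w i j \<noteq> 0 \<longleftrightarrow> i \<in> {1..l} \<and> j = w i" for i j
    by (simp_all add: place_def)
  have "place l w i j \<in> {0, 1}" for i j by (simp add: place_def)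
  moreover have "i = i'" if "i \<in> {1..l}" "i' \<in> {1..l}" "w i = w i'" for i i'
    using assms(1) that by (auto dest: inj_onD)
  moreover have "\<exists>!j. i \<in> {1..l} \<and> j = w i" if "i \<in> {1..l}" for i using that by blast
  ultimately show ?thesis
    unfolding Omega_inf_def mem_Collect_eq e using assms(2) by auto
qed

lemma pos_place: "i \<in> {1..l} \<Longrightarrow> pos (place l w) i = w i"
  by (simp add: pos_def place_def)

lemma Omega_eqI:
  assumes "\<omega> \<in> Omega_inf l" "\<omega>' \<in> Omega_inf l" "\<And>i. i \<in> {1..l} \<Longrightarrow> pos \<omega> i = pos \<omega>' i"
  shows "\<omega> = \<omega>'"
  by (intro ext) (metis Omega_entry Omega_outside assms)

lemma Omega_fin_iff:
  "\<omega> \<in> Omega_fin l n \<longleftrightarrow> \<omega> \<in> Omega_inf l \<and> (\<forall>i\<in>{1..l}. pos \<omega> i \<le> n)"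
proof (cases "\<omega> \<in> Omega_inf l")
  case True
  have "(\<forall>i j. n < j \<longrightarrow> \<omega> i j = 0) \<longleftrightarrow> (\<forall>i\<in>{1..l}. pos \<omega> i \<le> n)"
  proof (intro iffI allI ballI impI)
    fix i assume "\<forall>i j. n < j \<longrightarrow> \<omega> i j = 0" "i \<in> {1..l}"
    then show "pos \<omega> i \<le> n" using Omega_entry[OF True, of i "pos \<omega> i"] by (metis not_le zero_neq_one)
  next
    fix i j assume "\<forall>i\<in>{1..l}. pos \<omega> i \<le> n" "n < j"
    then show "\<omega> i j = 0"
      using Omega_entry[OF True, of i j] Omega_outside[OF True, of i j] by (cases "i \<in> {1..l}") fastforce+
  qed
  then show ?thesis unfolding Omega_fin_def by blast
qed (simp add: Omega_fin_def)

lemma link_pinj: "\<omega> \<in> Omega_inf l \<Longrightarrow> \<omega>' \<in> Omega_inf l \<Longrightarrow> pinj (link l \<omega> \<omega>')"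
  by (intro pinjI) (auto simp: link_def dest!: pos_inj inj_onD)

lemma fst_link: "fst ` link l \<omega> \<omega>' = pos \<omega> ` {1..l}"
  and snd_link: "snd ` link l \<omega> \<omega>' = pos \<omega>' ` {1..l}"
  by (auto simp: link_def image_image)

lemma finite_link [simp]: "finite (link l \<omega> \<omega>')"
  by (simp add: link_def)

lemma card_link: "\<omega> \<in> Omega_inf l \<Longrightarrow> card (link l \<omega> \<omega>') = l"
proof -
  assume "\<omega> \<in> Omega_inf l"
  then have "inj_on (\<lambda>i. (pos \<omega> i, pos \<omega>' i)) {1..l}"
    using pos_inj[of \<omega> l] unfolding inj_on_def by blast
  then show ?thesis by (simp add: link_def card_image)
qed

lemma link_PI: "\<omega> \<in> Omega_fin l n \<Longrightarrow> \<omega>' \<in> Omega_fin l n \<Longrightarrow> link l \<omega> \<omega>' \<in> PI n"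
  using pos_ge_1 by (auto simp: PI_def Omega_fin_iff link_pinj) (auto simp: link_def)

lemma link_converse: "(link l \<omega> \<omega>')\<inverse> = link l \<omega>' \<omega>"
  by (auto simp: link_def)

lemma Omega_inf_fin: "\<omega> \<in> Omega_inf l \<Longrightarrow> \<exists>k. \<forall>n\<ge>k. \<omega> \<in> Omega_fin l n"
proof -
  assume o: "\<omega> \<in> Omega_inf l"
  have "\<forall>i\<in>{1..l}. pos \<omega> i \<le> Max (insert 0 (pos \<omega> ` {1..l}))" by (intro ballI Max_ge) auto
  with o show ?thesis
    by (intro exI[of _ "Max (insert 0 (pos \<omega> ` {1..l}))"]) (auto simp: Omega_fin_iff)
qed

text \<open>An enumeration of R yields the two words. Together with \<open>card_link\<close> this
  shows that diagrams with l boxes see the incidence function exactly on the relations with l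
  elements.\<close>

lemma PI_is_link:
  assumes "R \<in> PI n"
  obtains \<omega> \<omega>' where "\<omega> \<in> Omega_fin (card R) n" "\<omega>' \<in> Omega_fin (card R) n"
    "link (card R) \<omega> \<omega>' = R"
proof -
  let ?l = "card R"
  obtain e where e: "bij_betw e {1..?l} R"
    using ex_bij_betw_nat_finite_1[OF PI_finite[OF assms]] by blast
  have eR: "e i \<in> R" if "i \<in> {1..?l}" for i using e that by (auto simp: bij_betw_def)
  have inj: "inj_on (fst \<circ> e) {1..?l}" "inj_on (snd \<circ> e) {1..?l}"
    using e PI_pinj[OF assms] unfolding pinj_def bij_betw_def by (auto intro: comp_inj_on)
  have b: "fst (e i) \<in> {1..n} \<and> snd (e i) \<in> {1..n}" if "i \<in> {1..?l}" for i
    using PI_bounds[OF assms, of "fst (e i)" "snd (e i)"] eR[OF that] by simp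
  show thesis
  proof (rule that)
    show "place ?l (fst \<circ> e) \<in> Omega_fin ?l n" "place ?l (snd \<circ> e) \<in> Omega_fin ?l n"
      using b by (auto simp: Omega_fin_iff pos_place intro!: place_Omega inj)
    show "link ?l (place ?l (fst \<circ> e)) (place ?l (snd \<circ> e)) = R"
      using e by (auto simp: link_def pos_place bij_betw_def image_def)
  qed
qed

lemma bij_perm_matr:
  assumes "bij g" "\<omega> \<in> Omega_inf l" "i \<in> {1..l}"
  shows "mmult \<omega> (perm_matr g) i j = (if j = ginv g (pos \<omega> i) then 1 else 0)"
proof -
  have "mmult \<omega> (perm_matr g) i j = perm_matr g (pos \<omega> i) j"
    by (rule mmult_row) (use assms in \<open>auto simp: Omega_entry split: if_splits\<close>)
  also have "\<dots> = (if j = ginv g (pos \<omega> i) then 1 else 0)"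
    using inv_left[OF assms(1)] inv_right[OF assms(1)] unfolding perm_matr_def by metis
  finally show ?thesis .
qed

lemma mmult_perm_right:
  assumes "g \<in> Sym_inf" "\<omega> \<in> Omega_inf l"
  shows "mmult \<omega> (perm_matr g) = place l (\<lambda>i. ginv g (pos \<omega> i))"
    and "mmult \<omega> (perm_matr g) \<in> Omega_inf l"
proof -
  obtain n where n: "g \<in> Sym n" using assms by (auto simp: Sym_inf_def)
  have b: "bij g" using n by (rule Sym_bij)
  show eq: "mmult \<omega> (perm_matr g) = place l (\<lambda>i. ginv g (pos \<omega> i))"
  proof (intro ext)
    fix i j show "mmult \<omega> (perm_matr g) i j = place l (\<lambda>i. ginv g (pos \<omega> i)) i j"
      using assms(2) by (cases "i \<in> {1..l}")
        (auto simp: bij_perm_matr[OF b] place_def Omega_outside mmult_row_zero)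
  qed
  have "inj (ginv g)" using b by (simp add: bij_is_inj bij_imp_bij_inv)
  then show "mmult \<omega> (perm_matr g) \<in> Omega_inf l"
    unfolding eq
  proof (intro place_Omega inj_onI)
    fix i j assume "i \<in> {1..l}" "j \<in> {1..l}" "ginv g (pos \<omega> i) = ginv g (pos \<omega> j)"
    then show "i = j" using \<open>inj (ginv g)\<close> pos_inj[OF assms(2)] by (metis injD inj_onD)
  next
    fix i assume "i \<in> {1..l}"
    then show "1 \<le> ginv g (pos \<omega> i)" using Sym_pos[OF inv_Sym[OF n]] pos_ge_1[OF assms(2)] by blast
  qed
qed

text \<open>Right multiplication by g replaces each position of \<omega> by its preimage under g.
  This is the reason why the matrix coefficients of the group action are values of
  \<open>hatG\<close> at links.\<close>

lemma mmult_perm_right_iff: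
  assumes "g \<in> Sym_inf" "\<omega> \<in> Omega_inf l" "\<omega>' \<in> Omega_inf l"
  shows "mmult \<omega> (perm_matr g) = \<omega>' \<longleftrightarrow> covers g (link l \<omega> \<omega>')"
proof -
  have b: "bij g" using assms(1) Sym_bij by (auto simp: Sym_inf_def)
  have "mmult \<omega> (perm_matr g) = \<omega>' \<longleftrightarrow> (\<forall>i\<in>{1..l}. ginv g (pos \<omega> i) = pos \<omega>' i)"
  proof -
    have "pos (mmult \<omega> (perm_matr g)) i = ginv g (pos \<omega> i)" if "i \<in> {1..l}" for i
      by (simp only: mmult_perm_right(1)[OF assms(1,2)] pos_place[OF that])
    then show ?thesis
      using Omega_eqI[OF mmult_perm_right(2)[OF assms(1,2)] assms(3)] by metis
  qed
  also have "\<dots> \<longleftrightarrow> covers g (link l \<omega> \<omega>')"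
  proof -
    have "ginv g y = x \<longleftrightarrow> g x = y" for x y using inv_left[OF b] inv_right[OF b] by metis
    then show ?thesis unfolding covers_def link_def by auto
  qed
  finally show ?thesis .
qed

lemma mmult_perm_left:
  assumes "s \<in> Sym l" "\<omega> \<in> Omega_inf l"
  shows "mmult (perm_matr s) \<omega> = place l (\<lambda>i. pos \<omega> (ginv s i))"
    and "mmult (perm_matr s) \<omega> \<in> Omega_inf l"
proof -
  have b: "bij s" using assms(1) by (rule Sym_bij)
  show eq: "mmult (perm_matr s) \<omega> = place l (\<lambda>i. pos \<omega> (ginv s i))"
  proof (intro ext)
    fix i j
    have "mmult (perm_matr s) \<omega> i j = \<omega> (ginv s i) j"
      by (rule mmult_row) (auto simp: perm_matr_def inv_left[OF b] inv_right[OF b] split: if_splits)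
    then show "mmult (perm_matr s) \<omega> i j = place l (\<lambda>i. pos \<omega> (ginv s i)) i j"
      using Sym_in[OF inv_Sym[OF assms(1)], of i] assms(2)
      by (auto simp: place_def Omega_entry Omega_outside)
  qed
  have "inj (ginv s)" using b by (simp add: bij_is_inj bij_imp_bij_inv)
  then show "mmult (perm_matr s) \<omega> \<in> Omega_inf l"
    unfolding eq
  proof (intro place_Omega inj_onI)
    fix i j assume "i \<in> {1..l}" "j \<in> {1..l}" "pos \<omega> (ginv s i) = pos \<omega> (ginv s j)"
    then show "i = j"
      using \<open>inj (ginv s)\<close> pos_inj[OF assms(2)] Sym_in[OF inv_Sym[OF assms(1)]] by (metis injD inj_onD)
  next
    fix i assume "i \<in> {1..l}"
    then show "1 \<le> pos \<omega> (ginv s i)"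
      using Sym_in[OF inv_Sym[OF assms(1)]] pos_ge_1[OF assms(2)] by blast
  qed
qed

lemma pos_perm_left:
  "s \<in> Sym l \<Longrightarrow> \<omega> \<in> Omega_inf l \<Longrightarrow> i \<in> {1..l} \<Longrightarrow> pos (mmult (perm_matr s) \<omega>) i = pos \<omega> (ginv s i)"
  by (simp add: mmult_perm_left(1) pos_place)

lemma mmult_perm_left_assoc:
  assumes "s \<in> Sym l" "t \<in> Sym l" "\<omega> \<in> Omega_inf l"
  shows "mmult (perm_matr s) (mmult (perm_matr t) \<omega>) = mmult (perm_matr (s \<circ> t)) \<omega>"
proof (rule Omega_eqI)
  have b: "bij s" "bij t" using assms Sym_bij by blast+
  fix i assume i: "i \<in> {1..l}"
  then show "pos (mmult (perm_matr s) (mmult (perm_matr t) \<omega>)) i = pos (mmult (perm_matr (s \<circ> t)) \<omega>) i"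
  proof -
    have j: "ginv s i \<in> {1..l}" using i Sym_in[OF inv_Sym[OF assms(1)]] by blast
    show ?thesis
      unfolding pos_perm_left[OF assms(1) mmult_perm_left(2)[OF assms(2,3)] i] pos_perm_left[OF assms(2,3) j]
        pos_perm_left[OF comp_Sym[OF assms(1,2)] assms(3) i]
      by (simp add: o_inv_distrib b)
  qed
qed (use assms mmult_perm_left(2) in auto)

lemma mmult_perm_left_inj:
  assumes "s \<in> Sym l" "t \<in> Sym l" "\<omega> \<in> Omega_inf l"
    and "mmult (perm_matr s) \<omega> = mmult (perm_matr t) \<omega>"
  shows "s = t"
proof -
  have b: "bij s" "bij t" using assms Sym_bij by blast+
  have "ginv s = ginv t"
  proof
    fix i
    show "ginv s i = ginv t i"
    proof (cases "i \<in> {1..l}")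
      case True
      then have "pos \<omega> (ginv s i) = pos \<omega> (ginv t i)"
        using assms pos_perm_left by metis
      then show ?thesis
        using pos_inj[OF assms(3)] True Sym_in[OF inv_Sym[OF assms(1)], of i]
          Sym_in[OF inv_Sym[OF assms(2)], of i] by (metis inj_onD)
    next
      case False
      then show ?thesis using Sym_fix inv_Sym assms(1,2) by metis
    qed
  qed
  then show ?thesis using b by (metis inv_inv_eq)
qed

text \<open>The simultaneous left action only reorders the enumeration of the pairs. Kernels that
  are functions of links therefore commute with \<open>Sym l\<close> and act on equivariant
  functions.\<close>

lemma link_perm_left:
  assumes "s \<in> Sym l" "\<omega> \<in> Omega_inf l" "\<omega>' \<in> Omega_inf l"
  shows "link l (mmult (perm_matr s) \<omega>) (mmult (perm_matr s) \<omega>') = link l \<omega> \<omega>'"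
proof -
  have "ginv s ` {1..l} = {1..l}"
    using inv_Sym[OF assms(1)] by (simp add: Sym_def permutes_image)
  then have "link l \<omega> \<omega>' = (\<lambda>i. (pos \<omega> i, pos \<omega>' i)) ` (ginv s ` {1..l})"
    by (simp add: link_def)
  also have "\<dots> = (\<lambda>i. (pos \<omega> (ginv s i), pos \<omega>' (ginv s i))) ` {1..l}" by (rule image_image)
  also have "\<dots> = link l (mmult (perm_matr s) \<omega>) (mmult (perm_matr s) \<omega>')"
    unfolding link_def by (rule image_cong[OF refl]) (simp only: pos_perm_left[OF assms(1,2)] pos_perm_left[OF assms(1,3)])
  finally show ?thesis ..
qed

text \<open>Semigroup counterpart of \<open>mmult_perm_right_iff\<close>. If the product loses a
  row, no \<omega>' satisfies either side, which matches the value 0 in \<open>T_sg\<close>.\<close>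

lemma mmult_Gam_iff:
  assumes "\<gamma> \<in> Gam n" "\<omega> \<in> Omega_fin l n" "\<omega>' \<in> Omega_fin l n"
  shows "mmult \<omega> \<gamma> = \<omega>' \<longleftrightarrow> link l \<omega> \<omega>' \<subseteq> rel \<gamma>"
proof -
  have o: "\<omega> \<in> Omega_inf l" "\<omega>' \<in> Omega_inf l" using assms by (auto simp: Omega_fin_def)
  have row: "mmult \<omega> \<gamma> i j = \<gamma> (pos \<omega> i) j" if "i \<in> {1..l}" for i j
    by (rule mmult_row) (use that o in \<open>auto simp: Omega_entry split: if_splits\<close>)
  have row0: "mmult \<omega> \<gamma> i j = 0" if "i \<notin> {1..l}" for i j
    using that o by (simp add: mmult_row_zero Omega_outside)
  show ?thesis
  proof
    assume eq: "mmult \<omega> \<gamma> = \<omega>'"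
    then have "\<gamma> (pos \<omega> i) (pos \<omega>' i) = 1" if "i \<in> {1..l}" for i
      using row[OF that, of "pos \<omega>' i"] Omega_entry[OF o(2) that] by simp
    then show "link l \<omega> \<omega>' \<subseteq> rel \<gamma>" by (auto simp: link_def rel_def)
  next
    assume sub: "link l \<omega> \<omega>' \<subseteq> rel \<gamma>"
    show "mmult \<omega> \<gamma> = \<omega>'"
    proof (intro ext)
      fix i j
      show "mmult \<omega> \<gamma> i j = \<omega>' i j"
      proof (cases "i \<in> {1..l}")
        case True
        then have "(pos \<omega> i, pos \<omega>' i) \<in> rel \<gamma>" using sub by (auto simp: link_def)
        then have "\<gamma> (pos \<omega> i) j = (if j = pos \<omega>' i then 1 else 0)"
          using pinj_D(1)[OF PI_pinj[OF rel_PI[OF assms(1)]], of "pos \<omega> i"] Gam_01[OF assms(1), of "pos \<omega> i" j]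
          by (auto simp: rel_def)
        then show ?thesis using row[OF True] Omega_entry[OF o(2) True] by simp
      qed (use row0 o in \<open>simp add: Omega_outside\<close>)
    qed
  qed
qed

section \<open>Young tableaux\<close>

definition Young_of :: "nat \<Rightarrow> nat list set" where
  "Young_of l = {\<mu> \<in> Young. ysize \<mu> = l}"

lemma sum_take_Suc: "r < length \<mu> \<Longrightarrow> sum_list (take (Suc r) \<mu>) = sum_list (take r \<mu>) + \<mu> ! r"
  for \<mu> :: "nat list"
  by (simp add: take_Suc_conv_app_nth)

lemma sum_take_mono: "r \<le> r' \<Longrightarrow> sum_list (take r \<mu>) \<le> sum_list (take r' \<mu>)"
  for \<mu> :: "nat list"
proof -
  assume "r \<le> r'"
  then have "take r' \<mu> = take r \<mu> @ take (r' - r) (drop r \<mu>)"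
    by (metis le_add_diff_inverse take_add)
  then show ?thesis by simp
qed

lemma tab_row_le_iff: "tab_row \<mu> k \<le> i \<longleftrightarrow> k \<le> sum_list (take (Suc i) \<mu>)" if "k \<le> ysize \<mu>"
proof
  have "k \<le> sum_list (take (Suc (length \<mu>)) \<mu>)" using that by simp
  then have "k \<le> sum_list (take (Suc (tab_row \<mu> k)) \<mu>)"
    unfolding tab_row_def by (rule LeastI)
  moreover assume "tab_row \<mu> k \<le> i"
  then have "sum_list (take (Suc (tab_row \<mu> k)) \<mu>) \<le> sum_list (take (Suc i) \<mu>)"
    by (intro sum_take_mono) simp
  ultimately show "k \<le> sum_list (take (Suc i) \<mu>)" by simp
next
  assume "k \<le> sum_list (take (Suc i) \<mu>)"
  then show "tab_row \<mu> k \<le> i" unfolding tab_row_def by (rule Least_le)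
qed

lemma tab_row_less_iff: "tab_row \<mu> k < i \<longleftrightarrow> k \<le> sum_list (take i \<mu>)" if "k \<in> {1..ysize \<mu>}"
  using that tab_row_le_iff[of k \<mu> "i - 1"] by (cases i) auto

lemma tab_row_bounds:
  assumes "k \<in> {1..ysize \<mu>}"
  shows "tab_row \<mu> k < length \<mu>" "sum_list (take (tab_row \<mu> k) \<mu>) < k"
    "1 \<le> tab_col \<mu> k" "tab_col \<mu> k \<le> \<mu> ! tab_row \<mu> k"
    "k = sum_list (take (tab_row \<mu> k) \<mu>) + tab_col \<mu> k"
proof -
  show 1: "tab_row \<mu> k < length \<mu>" using assms by (simp add: tab_row_less_iff)
  show 2: "sum_list (take (tab_row \<mu> k) \<mu>) < k"
    using tab_row_less_iff[OF assms, of "tab_row \<mu> k"] by simp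
  then show "1 \<le> tab_col \<mu> k" "k = sum_list (take (tab_row \<mu> k) \<mu>) + tab_col \<mu> k"
    by (simp_all add: tab_col_def)
  have "k \<le> sum_list (take (Suc (tab_row \<mu> k)) \<mu>)"
    using assms tab_row_le_iff[of k \<mu> "tab_row \<mu> k"] by simp
  with 1 show "tab_col \<mu> k \<le> \<mu> ! tab_row \<mu> k"
    by (simp add: tab_col_def sum_take_Suc)
qed

lemma tab_box:
  assumes "r < length \<mu>" "1 \<le> c" "c \<le> \<mu> ! r"
  defines "k \<equiv> sum_list (take r \<mu>) + c"
  shows "k \<in> {1..ysize \<mu>}" "tab_row \<mu> k = r" "tab_col \<mu> k = c"
proof -
  have le: "k \<le> sum_list (take (Suc r) \<mu>)" using assms by (simp add: sum_take_Suc)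
  also have "\<dots> \<le> ysize \<mu>" using sum_take_mono[of "Suc r" "length \<mu>" \<mu>] assms(1) by simp
  finally show k: "k \<in> {1..ysize \<mu>}" using assms by simp
  have "tab_row \<mu> k \<le> r" using le k by (simp add: tab_row_le_iff)
  moreover have "\<not> tab_row \<mu> k < r" unfolding tab_row_less_iff[OF k] using assms(2) by (simp add: k_def)
  ultimately show "tab_row \<mu> k = r" by simp
  then show "tab_col \<mu> k = c" by (simp add: tab_col_def k_def)
qed

lemma tab_inj:
  assumes "j \<in> {1..ysize \<mu>}" "k \<in> {1..ysize \<mu>}" "tab_row \<mu> j = tab_row \<mu> k" "tab_col \<mu> j = tab_col \<mu> k"
  shows "j = k"
  using tab_row_bounds(5)[OF assms(1)] tab_row_bounds(5)[OF assms(2)] assms(3,4) by simp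

lemma card_tab_row_less: "card {k \<in> {1..ysize \<mu>}. tab_row \<mu> k < i} = sum_list (take i \<mu>)"
proof -
  have "sum_list (take i \<mu>) \<le> ysize \<mu>"
    using sum_take_mono[of i "max i (length \<mu>)" \<mu>] by simp
  then have "{k \<in> {1..ysize \<mu>}. tab_row \<mu> k < i} = {1..sum_list (take i \<mu>)}"
    using tab_row_less_iff by fastforce
  then show ?thesis by simp
qed

text \<open>Column by column: a column of \<open>\<mu>\<close> meets the first \<open>k\<close> rows of \<open>\<nu>\<close> in at most as many boxes as it
  meets the first \<open>k\<close> rows of \<open>\<mu>\<close>.\<close>

lemma dominance:
  assumes Y: "\<nu> \<in> Young_of l" "\<mu> \<in> Young_of l" and g: "g \<in> Sym l"
    and sep: "\<And>i j. i \<in> {1..l} \<Longrightarrow> j \<in> {1..l} \<Longrightarrow> tab_row \<nu> (g i) = tab_row \<nu> (g j) \<Longrightarrow>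
      tab_col \<mu> i = tab_col \<mu> j \<Longrightarrow> i = j"
  shows "sum_list (take k \<nu>) \<le> sum_list (take k \<mu>)"
proof -
  have s: "ysize \<nu> = l" "ysize \<mu> = l" and srt: "sorted_wrt (\<ge>) \<mu>"
    using Y by (auto simp: Young_of_def Young_def)
  define E where "E = {j \<in> {1..l}. tab_row \<nu> (g j) < k}"
  define D where "D = {j \<in> {1..l}. tab_row \<mu> j < k}"
  have "bij_betw g E {i \<in> {1..l}. tab_row \<nu> i < k}"
    using g Sym_in[OF g] inv_right[OF Sym_bij[OF g]]  Sym_in[OF inv_Sym[OF g]] inv_left[OF Sym_bij[OF g]]
    unfolding E_def by (intro bij_betw_byWitness[where f' = "ginv g"]) auto
  then have cE: "card E = sum_list (take k \<nu>)"
    using card_tab_row_less[of \<nu> k] s by (simp add: bij_betw_same_card)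
  have cD: "card D = sum_list (take k \<mu>)"
    using card_tab_row_less[of \<mu> k] s by (simp add: D_def)
  have fin: "finite E" "finite D" by (simp_all add: E_def D_def)
  let ?C = "tab_col \<mu> ` {1..l}"
  have part: "card X = (\<Sum>c\<in>?C. card {j \<in> X. tab_col \<mu> j = c})" if "X \<subseteq> {1..l}" for X
  proof -
    have "finite X" using that finite_subset by blast
    moreover have "tab_col \<mu> ` X \<subseteq> ?C" using that by blast
    ultimately show ?thesis using sum.group[of X ?C "tab_col \<mu>" "\<lambda>_. 1::nat"] by simp
  qed
  \<comment> \<open>If column c of \<mu> has a box in row k or beyond, it has a box in each of the
    rows 0, ..., k - 1, while its members in E lie in different rows of \<nu> with index less than
    k, by \<open>sep\<close>. Otherwise the whole column lies in D.\<close>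
  have "card {j \<in> E. tab_col \<mu> j = c} \<le> card {j \<in> D. tab_col \<mu> j = c}" for c
  proof (cases "\<exists>j\<in>{1..l}. tab_col \<mu> j = c \<and> k \<le> tab_row \<mu> j")
    case True
    then obtain j where j: "j \<in> {1..l}" "tab_col \<mu> j = c" "k \<le> tab_row \<mu> j" by blast
    have b: "tab_row \<mu> j < length \<mu>" "1 \<le> c" "c \<le> \<mu> ! tab_row \<mu> j"
      using tab_row_bounds[of j \<mu>] j s by auto
    have box: "sum_list (take r \<mu>) + c \<in> {j \<in> D. tab_col \<mu> j = c}" "tab_row \<mu> (sum_list (take r \<mu>) + c) = r"
      if "r < k" for r
    proof -
      have "\<mu> ! tab_row \<mu> j \<le> \<mu> ! r"
        using sorted_wrt_nth_less[OF srt, of r "tab_row \<mu> j"] that j b by simp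
      then have "r < length \<mu>" "c \<le> \<mu> ! r" using b j that by auto
      from tab_box[OF this(1) b(2) this(2)] s that
      show "sum_list (take r \<mu>) + c \<in> {j \<in> D. tab_col \<mu> j = c}" "tab_row \<mu> (sum_list (take r \<mu>) + c) = r"
        by (auto simp: D_def)
    qed
    have "card {j \<in> E. tab_col \<mu> j = c} \<le> card {..<k}"
      by (rule card_inj_on_le[where f = "\<lambda>j. tab_row \<nu> (g j)"]) (auto simp: E_def inj_on_def intro: sep)
    also have "\<dots> \<le> card {j \<in> D. tab_col \<mu> j = c}"
    proof (rule card_inj_on_le[where f = "\<lambda>r. sum_list (take r \<mu>) + c"])
      show "inj_on (\<lambda>r. sum_list (take r \<mu>) + c) {..<k}"
        by (rule inj_on_inverseI[where g = "tab_row \<mu>"]) (use box in auto)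
    qed (use box fin in auto)
    finally show ?thesis .
  next
    case False
    then have "{j \<in> E. tab_col \<mu> j = c} \<subseteq> {j \<in> D. tab_col \<mu> j = c}"
      by (auto simp: E_def D_def)
    then show ?thesis using fin by (intro card_mono) auto
  qed
  then have "(\<Sum>c\<in>?C. card {j \<in> E. tab_col \<mu> j = c}) \<le> (\<Sum>c\<in>?C. card {j \<in> D. tab_col \<mu> j = c})"
    by (rule sum_mono)
  moreover have "E \<subseteq> {1..l}" "D \<subseteq> {1..l}" by (auto simp: E_def D_def)
  ultimately have "card E \<le> card D" by (simp only: part)
  with cE cD show ?thesis by simp
qed

text \<open>Differences of partial sums are the entries. Equality of lengths comes from positivity
  of the entries: a longer list would continue with an entry 0.\<close>

lemma Young_eqI:
  assumes "\<nu> \<in> Young" "\<mu> \<in> Young" and eq: "\<And>k. sum_list (take k \<nu>) = sum_list (take k \<mu>)"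
  shows "\<nu> = \<mu>"
proof -
  have le: "length \<nu> \<le> length \<mu>" if "\<nu> \<in> Young" "\<mu> \<in> Young" "\<And>k. sum_list (take k \<nu>) = sum_list (take k \<mu>)" for \<nu> \<mu>
  proof (rule ccontr)
    assume n: "\<not> length \<nu> \<le> length \<mu>"
    then have "sum_list (take (Suc (length \<mu>)) \<nu>) = sum_list (take (length \<mu>) \<nu>) + \<nu> ! length \<mu>"
      by (intro sum_take_Suc) simp
    then have "\<nu> ! length \<mu> = 0" using that(3)[of "length \<mu>"] that(3)[of "Suc (length \<mu>)"] by simp
    then have "0 \<in> set \<nu>" using n by (metis not_le nth_mem)
    with that(1) show False by (simp add: Young_def)
  qed
  have len: "length \<nu> = length \<mu>" using le[OF assms] le[OF assms(2,1)] eq by (metis le_antisym)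
  show ?thesis
  proof (rule nth_equalityI[OF len])
    fix i assume "i < length \<nu>"
    then show "\<nu> ! i = \<mu> ! i"
      using sum_take_Suc[of i \<nu>] sum_take_Suc[of i \<mu>] eq[of i] eq[of "Suc i"] len by simp
  qed
qed

section \<open>Young symmetrizers\<close>

definition row_sum :: "nat list \<Rightarrow> grp_alg" where
  "row_sum \<mu> = (\<Sum>p\<in>row_group \<mu>. single p 1)"

definition col_sum :: "nat list \<Rightarrow> grp_alg" where
  "col_sum \<mu> = (\<Sum>q\<in>col_group \<mu>. single q (of_int (sign q)))"

lemma row_group_Sym: "row_group \<mu> \<subseteq> Sym (ysize \<mu>)"
  and col_group_Sym: "col_group \<mu> \<subseteq> Sym (ysize \<mu>)"
  by (auto simp: row_group_def col_group_def)

lemma young_symmetrizer_eq: "young_symmetrizer \<mu> = grp_mult (row_sum \<mu>) (col_sum \<mu>)"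
  by (simp add: young_symmetrizer_def row_sum_def col_sum_def convolve_sum_left convolve_sum_right, rule sum.swap)

lemma row_sum_alg: "row_sum \<mu> \<in> alg_over (Sym (ysize \<mu>))"
  and col_sum_alg: "col_sum \<mu> \<in> alg_over (Sym (ysize \<mu>))"
  unfolding row_sum_def col_sum_def using row_group_Sym col_group_Sym
  by (blast intro: alg_over_sum alg_over_single)+

lemma grp_mult_alg: "x \<in> alg_over (Sym l) \<Longrightarrow> y \<in> alg_over (Sym l) \<Longrightarrow> grp_mult x y \<in> alg_over (Sym l)"
  by (rule alg_over_convolve) auto

lemma young_symmetrizer_alg: "young_symmetrizer \<mu> \<in> alg_over (Sym (ysize \<mu>))"
  unfolding young_symmetrizer_eq by (intro grp_mult_alg row_sum_alg col_sum_alg)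

lemma row_sum_transpose:
  assumes "i \<in> {1..ysize \<mu>}" "j \<in> {1..ysize \<mu>}" "tab_row \<mu> i = tab_row \<mu> j"
  shows "grp_mult (row_sum \<mu>) (single (transpose i j) 1) = row_sum \<mu>"
proof -
  let ?t = "transpose i j"
  have t: "?t \<in> Sym (ysize \<mu>)" using assms by (simp add: Sym_def permutes_swap_id)
  have mem: "p \<circ> ?t \<in> row_group \<mu>" if "p \<in> row_group \<mu>" for p
  proof -
    have "tab_row \<mu> (p (?t k)) = tab_row \<mu> k" if k: "k \<in> {1..ysize \<mu>}" for k
    proof -
      have "?t k \<in> {1..ysize \<mu>}" using Sym_in[OF t] k by blast
      then have "tab_row \<mu> (p (?t k)) = tab_row \<mu> (?t k)" using \<open>p \<in> row_group \<mu>\<close> by (simp add: row_group_def)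
      also have "\<dots> = tab_row \<mu> k" using assms(3) by (simp add: transpose_def)
      finally show ?thesis .
    qed
    then show ?thesis using that t by (simp add: row_group_def)
  qed
  have "grp_mult (row_sum \<mu>) (single ?t 1) = (\<Sum>p\<in>row_group \<mu>. single (p \<circ> ?t) 1)"
    by (simp add: row_sum_def convolve_sum_left)
  also have "\<dots> = (\<Sum>p\<in>row_group \<mu>. single p 1)"
  proof (rule sum.reindex_bij_witness[where i = "\<lambda>p. p \<circ> ?t" and j = "\<lambda>p. p \<circ> ?t"])
    show "p \<circ> ?t \<circ> ?t = p" "p \<circ> ?t \<circ> ?t = p" for p :: "nat \<Rightarrow> nat"
      by (simp_all add: comp_assoc)
  qed (simp_all add: mem)
  finally show ?thesis by (simp add: row_sum_def)
qed

lemma col_sum_transpose: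
  assumes "i \<in> {1..ysize \<mu>}" "j \<in> {1..ysize \<mu>}" "tab_col \<mu> i = tab_col \<mu> j" "i \<noteq> j"
  shows "grp_mult (single (transpose i j) 1) (col_sum \<mu>) = scale (- 1) (col_sum \<mu>)"
proof -
  let ?t = "transpose i j"
  have t: "?t \<in> Sym (ysize \<mu>)" using assms by (simp add: Sym_def permutes_swap_id)
  have mem: "?t \<circ> q \<in> col_group \<mu>" if "q \<in> col_group \<mu>" for q
  proof -
    have "tab_col \<mu> (?t (q k)) = tab_col \<mu> k" if k: "k \<in> {1..ysize \<mu>}" for k
    proof -
      have "tab_col \<mu> (?t (q k)) = tab_col \<mu> (q k)" using assms(3) by (simp add: transpose_def)
      also have "\<dots> = tab_col \<mu> k" using k \<open>q \<in> col_group \<mu>\<close> unfolding col_group_def by blast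
      finally show ?thesis .
    qed
    then show ?thesis using that t by (simp add: col_group_def)
  qed
  have sgn: "sign (?t \<circ> q) = - sign q" if "q \<in> col_group \<mu>" for q
  proof -
    have "q permutes {1..ysize \<mu>}" using that col_group_Sym by (auto simp: Sym_def)
    then have "permutation q" by (auto simp: permutation_permutes)
    then show ?thesis
      by (simp add: sign_compose permutation_swap_id sign_swap_id assms(4))
  qed
  have "grp_mult (single ?t 1) (col_sum \<mu>) = (\<Sum>q\<in>col_group \<mu>. single (?t \<circ> q) (of_int (sign q)))"
    by (simp add: col_sum_def convolve_sum_right)
  also have "\<dots> = (\<Sum>q\<in>col_group \<mu>. single q (- of_int (sign q)))"
  proof (rule sum.reindex_bij_witness[where i = "\<lambda>p. ?t \<circ> p" and j = "\<lambda>p. ?t \<circ> p"])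
    show "?t \<circ> (?t \<circ> p) = p" "?t \<circ> (?t \<circ> p) = p" for p :: "nat \<Rightarrow> nat"
      by (simp_all flip: comp_assoc)
  qed (simp_all add: mem sgn)
  also have "\<dots> = scale (- 1) (col_sum \<mu>)"
    by (simp add: col_sum_def scale_sum)
  finally show ?thesis .
qed

text \<open>By \<open>dominance\<close>, every g has two entries that share a row of \<nu> and a
  column of \<mu>. Their transposition is absorbed by \<open>row_sum \<nu>\<close> and costs a sign
  at \<open>col_sum \<mu>\<close>, so the product equals its own negative.\<close>

lemma row_col_zero:
  assumes Y: "\<nu> \<in> Young_of l" "\<mu> \<in> Young_of l"
    and k: "\<not> sum_list (take k \<nu>) \<le> sum_list (take k \<mu>)"
    and x: "x \<in> alg_over (Sym l)"
  shows "grp_mult (row_sum \<nu>) (grp_mult x (col_sum \<mu>)) = 0"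
proof -
  have s: "ysize \<nu> = l" "ysize \<mu> = l" using Y by (auto simp: Young_of_def)
  have g0: "grp_mult (row_sum \<nu>) (grp_mult (single g 1) (col_sum \<mu>)) = 0" if g: "g \<in> Sym l" for g
  proof -
    obtain i j where ij: "i \<in> {1..l}" "j \<in> {1..l}" "tab_row \<nu> (g i) = tab_row \<nu> (g j)"
      "tab_col \<mu> i = tab_col \<mu> j" "i \<noteq> j"
      using dominance[OF Y g] k by blast
    have gi: "g i \<in> {1..l}" "g j \<in> {1..l}" using ij Sym_in[OF g] by blast+
    have "inj g" using g by (simp add: Sym_bij bij_is_inj)
    then have sw: "transpose (g i) (g j) \<circ> g = g \<circ> transpose i j"
      by (auto simp: fun_eq_iff transpose_def dest: injD)
    let ?X = "grp_mult (row_sum \<nu>) (grp_mult (single g 1) (col_sum \<mu>))"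
    have "?X = grp_mult (grp_mult (row_sum \<nu>) (single (transpose (g i) (g j)) 1)) (grp_mult (single g 1) (col_sum \<mu>))"
      using row_sum_transpose[of "g i" \<nu> "g j"] gi ij s by simp
    also have "\<dots> = grp_mult (row_sum \<nu>) (grp_mult (single g 1) (grp_mult (single (transpose i j) 1) (col_sum \<mu>)))"
      by (simp add: grp_mult_assoc sw flip: grp_mult_assoc[of "single _ _" "single _ _"])
    also have "\<dots> = scale (- 1) ?X"
      using col_sum_transpose[of i \<mu> j] ij s by (simp add: convolve_scale_right)
    finally have "?X = - ?X" by (simp only: scale_minus_one)
    then have "lookup ?X k = - lookup ?X k" for k by (metis lookup_uminus)
    then show ?thesis by (intro poly_mapping_eqI) simp
  qed
  have "x = (\<Sum>g\<in>Sym l. scale (lookup x g) (single g 1))"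
    using poly_mapping_as_sum[of "Sym l" x] x by (simp add: alg_over_def)
  from arg_cong[OF this, of "\<lambda>z. grp_mult (row_sum \<nu>) (grp_mult z (col_sum \<mu>))"]
  show ?thesis
    by (simp only: convolve_sum_left convolve_sum_right convolve_scale_left convolve_scale_right g0
        scale_zero_right sum.neutral_const cong: sum.cong)
qed

lemma young_symmetrizer_orthogonal:
  assumes Y: "\<nu> \<in> Young_of l" "\<mu> \<in> Young_of l"
    and k: "\<not> sum_list (take k \<nu>) \<le> sum_list (take k \<mu>)"
    and x: "x \<in> alg_over (Sym l)"
  shows "grp_mult (young_symmetrizer \<nu>) (grp_mult x (young_symmetrizer \<mu>)) = 0"
proof -
  have s: "ysize \<nu> = l" "ysize \<mu> = l" using Y by (auto simp: Young_of_def)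
  have "grp_mult (col_sum \<nu>) (grp_mult x (row_sum \<mu>)) \<in> alg_over (Sym l)"
    using x col_sum_alg[of \<nu>] row_sum_alg[of \<mu>] s by (simp add: grp_mult_alg)
  from row_col_zero[OF Y k this] show ?thesis
    by (simp add: young_symmetrizer_eq grp_mult_assoc)
qed

text \<open>The coefficient of \<open>id\<close> is 1: if \<open>p \<circ> q = id\<close>, then q
  preserves columns by definition and rows because p undoes it, so every box stays in place.\<close>

lemma young_symmetrizer_nonzero:
  assumes "\<mu> \<in> Young_of l"
  shows "young_symmetrizer \<mu> \<noteq> 0"
proof
  assume z: "young_symmetrizer \<mu> = 0"
  have s: "ysize \<mu> = l" using assms by (auto simp: Young_of_def)
  have pq: "p = id \<and> q = id" if "p \<in> row_group \<mu>" "q \<in> col_group \<mu>" "p \<circ> q = id" for p q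
  proof -
    have P: "p \<in> Sym l" "q \<in> Sym l" using that row_group_Sym col_group_Sym s by blast+
    have "q k = k" for k
    proof (cases "k \<in> {1..l}")
      case True
      then have qk: "q k \<in> {1..l}" using Sym_in[OF P(2)] by blast
      have "tab_row \<mu> (p (q k)) = tab_row \<mu> (q k)" using that(1) qk s by (simp add: row_group_def)
      moreover have "p (q k) = k" using that(3) by (metis comp_apply id_apply)
      moreover have "tab_col \<mu> (q k) = tab_col \<mu> k" using that(2) True s by (simp add: col_group_def)
      ultimately show ?thesis using tab_inj[of "q k" \<mu> k] True qk s by simp
    qed (use Sym_fix[OF P(2)] in blast)
    then have "q = id" by auto
    then show ?thesis using that(3) by simp
  qed
  have fin: "finite (row_group \<mu>)" "finite (col_group \<mu>)"
    by (rule finite_subset[OF row_group_Sym finite_Sym], rule finite_subset[OF col_group_Sym finite_Sym])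
  have idm: "id \<in> row_group \<mu>" "id \<in> col_group \<mu>" by (simp_all add: row_group_def col_group_def)
  have "lookup (young_symmetrizer \<mu>) id
      = (\<Sum>p\<in>row_group \<mu>. \<Sum>q\<in>col_group \<mu>. if p \<circ> q = id then of_int (sign q) else 0)"
    by (simp add: young_symmetrizer_def lookup_sum lookup_single when_def)
  also have "\<dots> = (\<Sum>p\<in>row_group \<mu>. \<Sum>q\<in>col_group \<mu>. if q = id then (if p = id then 1 else 0) else 0)"
    by (intro sum.cong refl) (use pq in \<open>auto simp: sign_id\<close>)
  also have "\<dots> = 1" using fin idm by (simp add: sum.delta)
  finally show False using z by simp
qed

section \<open>Adjoints and central elements attached to diagrams\<close>

definition star :: "grp_alg \<Rightarrow> grp_alg" where
  "star x = (\<Sum>g\<in>keys x. single (ginv g) (cnj (lookup x g)))"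

lemma pairing_star: "pairing \<phi> (star x) = cnj (pairing (\<lambda>g. cnj (\<phi> (ginv g))) x)"
  unfolding star_def pairing_sum pairing_single by (simp add: pairing_def)

lemma star_alg: "x \<in> alg_over (Sym l) \<Longrightarrow> star x \<in> alg_over (Sym l)"
  unfolding star_def by (intro alg_over_sum alg_over_single inv_Sym) (auto simp: alg_over_def)

lemma star_single [simp]: "star (single g c) = single (ginv g) (cnj c)"
  by (rule pairing_eqI) (simp add: pairing_star)

lemma star_sum: "star (\<Sum>i\<in>I. x i) = (\<Sum>i\<in>I. star (x i))"
  by (rule pairing_eqI) (simp add: pairing_star pairing_sum)

lemma star_star: "x \<in> alg_over (Sym l) \<Longrightarrow> star (star x) = x"
proof (rule pairing_eqI)
  fix \<phi> assume "x \<in> alg_over (Sym l)"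
  then have "ginv (ginv g) = g" if "g \<in> keys x" for g
    using that Sym_bij inv_inv_eq by (auto simp: alg_over_def)
  then show "pairing \<phi> (star (star x)) = pairing \<phi> x"
    by (simp add: pairing_star cong: pairing_cong)
qed

lemma star_mult:
  assumes "x \<in> alg_over (Sym l)" "y \<in> alg_over (Sym l)"
  shows "star (grp_mult x y) = grp_mult (star y) (star x)"
proof (rule pairing_eqI)
  fix \<phi> :: "_ \<Rightarrow> complex"
  have "ginv (g \<circ> h) = ginv h \<circ> ginv g" if "g \<in> keys x" "h \<in> keys y" for g h
    using that assms Sym_bij by (auto simp: alg_over_def intro!: o_inv_distrib)
  then show "pairing \<phi> (star (grp_mult x y)) = pairing \<phi> (grp_mult (star y) (star x))"
    by (simp add: pairing_star pairing_convolve pairing_swap[of _ y x] cong: pairing_cong)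
qed

lemma cnj_of_bool [simp]: "cnj (of_bool b) = of_bool b"
  by (cases b) auto

text \<open>Positivity of this coefficient is the source of the nonvanishing of the central elements
  below; it stands in for an evaluation of the square of a Young symmetrizer.\<close>

lemma lookup_mult_star:
  assumes "x \<in> alg_over (Sym l)"
  shows "lookup (grp_mult x (star x)) id = (\<Sum>g\<in>keys x. of_real ((cmod (lookup x g))\<^sup>2))"
proof -
  have e: "g \<circ> ginv h = id \<longleftrightarrow> h = g" if "g \<in> keys x" "h \<in> keys x" for g h
  proof -
    have b: "bij h" using that assms Sym_bij by (auto simp: alg_over_def)
    show ?thesis
    proof
      assume "g \<circ> ginv h = id"
      then have "g \<circ> ginv h \<circ> h = h" by simp
      then show "h = g" by (simp add: comp_assoc inv_comp_id[OF b])
    qed (use comp_inv_id[OF b] in simp)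
  qed
  have "lookup (grp_mult x (star x)) id = pairing (\<lambda>g. cnj (pairing (\<lambda>h. of_bool (g \<circ> ginv h = id)) x)) x"
    by (simp add: lookup_pairing pairing_convolve pairing_star)
  also have "\<dots> = pairing (\<lambda>g. cnj (lookup x g)) x"
    using e by (simp add: lookup_pairing[of x] cong: pairing_cong)
  also have "\<dots> = (\<Sum>g\<in>keys x. of_real ((cmod (lookup x g))\<^sup>2))"
    by (simp only: pairing_def complex_norm_square)
  finally show ?thesis .
qed

lemma lookup_mult_star_nonzero:
  assumes "x \<in> alg_over (Sym l)" "x \<noteq> 0"
  shows "lookup (grp_mult x (star x)) id \<noteq> 0"
proof -
  have "(\<Sum>g\<in>keys x. (cmod (lookup x g))\<^sup>2) > 0"
    using assms(2) by (intro sum_pos) (auto simp: in_keys_iff)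
  then show ?thesis
    unfolding lookup_mult_star[OF assms(1)] of_real_sum[symmetric] by (simp only: of_real_eq_0_iff)
qed

text \<open>A central self-adjoint element of the two-sided ideal generated by the Young
  symmetrizer. Multiplying by the adjoint before averaging makes the coefficient of
  \<open>id\<close> positive, so the average cannot cancel.\<close>

definition central_young :: "nat \<Rightarrow> nat list \<Rightarrow> grp_alg" where
  "central_young l \<mu> = (\<Sum>g\<in>Sym l. grp_mult (single g 1) (grp_mult
     (grp_mult (young_symmetrizer \<mu>) (star (young_symmetrizer \<mu>))) (single (ginv g) 1)))"

lemma central_young_alg: "\<mu> \<in> Young_of l \<Longrightarrow> central_young l \<mu> \<in> alg_over (Sym l)"
  unfolding central_young_def
  using young_symmetrizer_alg[of \<mu>]
  by (intro alg_over_sum grp_mult_alg alg_over_single star_alg inv_Sym) (auto simp: Young_of_def)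

lemma central_young_central:
  assumes "h \<in> Sym l"
  shows "grp_mult (single h 1) (central_young l \<mu>) = grp_mult (central_young l \<mu>) (single h 1)"
proof -
  let ?w = "grp_mult (young_symmetrizer \<mu>) (star (young_symmetrizer \<mu>))"
  have b: "bij h" using assms by (rule Sym_bij)
  have "grp_mult (single h 1) (central_young l \<mu>)
      = (\<Sum>g\<in>Sym l. grp_mult (single (h \<circ> g) 1) (grp_mult ?w (single (ginv g) 1)))"
    unfolding central_young_def convolve_sum_right by (simp flip: grp_mult_assoc)
  also have "\<dots> = (\<Sum>g\<in>Sym l. grp_mult (single g 1) (grp_mult ?w (single (ginv (ginv h \<circ> g)) 1)))"
  proof (rule sum.reindex_bij_witness[where i = "\<lambda>g. ginv h \<circ> g" and j = "\<lambda>g. h \<circ> g"])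
    fix g :: "nat \<Rightarrow> nat"
    show "ginv h \<circ> (h \<circ> g) = g" "h \<circ> (ginv h \<circ> g) = g"
      by (simp_all add: inv_comp_id[OF b] comp_inv_id[OF b] flip: comp_assoc)
    show "grp_mult (single (h \<circ> g) 1) (grp_mult ?w (single (ginv (ginv h \<circ> (h \<circ> g))) 1)) =
         grp_mult (single (h \<circ> g) 1) (grp_mult ?w (single (ginv g) 1))"
      by (simp add: inv_comp_id[OF b] flip: comp_assoc)
  qed (use assms in auto)
  also have "\<dots> = (\<Sum>g\<in>Sym l. grp_mult (grp_mult (single g 1) (grp_mult ?w (single (ginv g) 1))) (single h 1))"
  proof (rule sum.cong[OF refl])
    fix g assume "g \<in> Sym l"
    then have "ginv (ginv h \<circ> g) = ginv g \<circ> h"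
      using b Sym_bij by (subst o_inv_distrib) (auto simp: inv_inv_eq intro: bij_imp_bij_inv)
    then show "grp_mult (single g 1) (grp_mult ?w (single (ginv (ginv h \<circ> g)) 1)) =
      grp_mult (grp_mult (single g 1) (grp_mult ?w (single (ginv g) 1))) (single h 1)"
      by (simp add: grp_mult_assoc)
  qed
  finally show ?thesis by (simp add: central_young_def convolve_sum_left)
qed

lemma central_commute:
  assumes "x \<in> alg_over (Sym l)" "\<And>h. h \<in> Sym l \<Longrightarrow> grp_mult (single h 1) z = grp_mult z (single h 1)"
  shows "grp_mult x z = grp_mult z x"
proof -
  have x: "x = (\<Sum>g\<in>Sym l. scale (lookup x g) (single g 1))"
    using poly_mapping_as_sum[of "Sym l" x] assms(1) by (simp add: alg_over_def)
  show ?thesis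
    by (subst (1 2) x) (simp only: convolve_sum_left convolve_sum_right convolve_scale_left convolve_scale_right assms(2) cong: sum.cong)
qed

lemma central_young_star: "\<mu> \<in> Young_of l \<Longrightarrow> star (central_young l \<mu>) = central_young l \<mu>"
proof -
  assume m: "\<mu> \<in> Young_of l"
  then have c: "young_symmetrizer \<mu> \<in> alg_over (Sym l)"
    using young_symmetrizer_alg[of \<mu>] by (simp add: Young_of_def)
  let ?w = "grp_mult (young_symmetrizer \<mu>) (star (young_symmetrizer \<mu>))"
  have w: "?w \<in> alg_over (Sym l)" "star ?w = ?w"
    using c by (simp_all add: grp_mult_alg star_alg star_mult[OF c star_alg[OF c]] star_star)
  have "star (grp_mult (single g 1) (grp_mult w (single (ginv g) 1))) =
      grp_mult (single g 1) (grp_mult w (single (ginv g) 1))"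
    if g: "g \<in> Sym l" and w: "w \<in> alg_over (Sym l)" "star w = w" for g w
  proof -
    have "ginv (ginv g) = g" using g Sym_bij inv_inv_eq by blast
    then show ?thesis
      using g w by (simp add: star_mult[where l = l] grp_mult_alg alg_over_single grp_mult_assoc)
  qed
  note this[OF _ w]
  then show ?thesis unfolding central_young_def star_sum by simp
qed

text \<open>Conjugation does not change the coefficient of \<open>id\<close>, so that of the average
  is \<open>card (Sym l)\<close> times the squared norm of the symmetrizer. The average is
  self-adjoint, so its square has the form x times \<open>star x\<close> and the same positivity
  applies again.\<close>

lemma central_young_nonzero:
  assumes m: "\<mu> \<in> Young_of l"
  shows "grp_mult (central_young l \<mu>) (central_young l \<mu>) \<noteq> 0"
proof -
  have c: "young_symmetrizer \<mu> \<in> alg_over (Sym l)"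
    using young_symmetrizer_alg[of \<mu>] m by (simp add: Young_of_def)
  let ?w = "grp_mult (young_symmetrizer \<mu>) (star (young_symmetrizer \<mu>))"
  have cj: "lookup (grp_mult (single g 1) (grp_mult ?w (single (ginv g) 1))) id = lookup ?w id" if "g \<in> Sym l" for g
  proof -
    have b: "bij g" using that by (rule Sym_bij)
    have "g \<circ> (h \<circ> ginv g) = id \<longleftrightarrow> h = id" for h
    proof
      assume "g \<circ> (h \<circ> ginv g) = id"
      then have "ginv g \<circ> (g \<circ> (h \<circ> ginv g)) \<circ> g = ginv g \<circ> g" by simp
      then show "h = id" by (simp add: inv_comp_id[OF b] comp_assoc) (simp add: inv_comp_id[OF b] flip: comp_assoc)
    qed (simp add: comp_inv_id[OF b])
    then show ?thesis by (simp add: lookup_pairing pairing_convolve[of _ _ "single g 1"] pairing_convolve[of _ _ ?w])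
  qed
  have "lookup (central_young l \<mu>) id = of_nat (card (Sym l)) * lookup ?w id"
    unfolding central_young_def lookup_sum by (simp add: cj)
  moreover have "card (Sym l) \<noteq> 0" using id_Sym[of l] finite_Sym[of l] by (metis card_0_eq empty_iff)
  ultimately have "lookup (central_young l \<mu>) id \<noteq> 0"
    using lookup_mult_star_nonzero[OF c young_symmetrizer_nonzero[OF m]] by simp
  then have "central_young l \<mu> \<noteq> 0" by auto
  from lookup_mult_star_nonzero[OF central_young_alg[OF m] this] show ?thesis
    by (auto simp: central_young_star[OF m])
qed

text \<open>Distinct diagrams differ in some partial sum, so domination fails in one direction and
  \<open>young_symmetrizer_orthogonal\<close> kills the product in that order of factors; centrality
  gives the other order.\<close>

lemma central_young_orthogonal:
  assumes Y: "\<nu> \<in> Young_of l" "\<mu> \<in> Young_of l" "\<nu> \<noteq> \<mu>"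
  shows "grp_mult (central_young l \<nu>) (central_young l \<mu>) = 0"
proof -
  have z: "grp_mult (central_young l \<nu>) (central_young l \<mu>) = 0"
    if Y: "\<nu> \<in> Young_of l" "\<mu> \<in> Young_of l" and k: "\<not> sum_list (take k \<nu>) \<le> sum_list (take k \<mu>)" for \<nu> \<mu> k
  proof -
    let ?c = "young_symmetrizer \<nu>" and ?d = "young_symmetrizer \<mu>"
    have c: "?c \<in> alg_over (Sym l)" "?d \<in> alg_over (Sym l)"
      using young_symmetrizer_alg[of \<nu>] young_symmetrizer_alg[of \<mu>] Y by (simp_all add: Young_of_def)
    have "grp_mult (grp_mult (single g 1) (grp_mult (grp_mult ?c (star ?c)) (single (ginv g) 1)))
        (grp_mult (single h 1) (grp_mult (grp_mult ?d (star ?d)) (single (ginv h) 1))) = 0"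
      if "g \<in> Sym l" "h \<in> Sym l" for g h
    proof -
      have "grp_mult (star ?c) (grp_mult (single (ginv g) 1) (single h 1)) \<in> alg_over (Sym l)"
        using that c by (intro grp_mult_alg star_alg alg_over_single) auto
      from young_symmetrizer_orthogonal[OF Y k this]
      have "grp_mult (grp_mult ?c (grp_mult (star ?c) (grp_mult (single (ginv g) 1) (grp_mult (single h 1) ?d)))) X = 0" for X
        by (simp only: grp_mult_assoc convolve_zero_left)
      then show ?thesis by (simp only: grp_mult_assoc convolve_zero_right)
    qed
    then show ?thesis
      unfolding central_young_def convolve_sum_left convolve_sum_right by (intro sum.neutral ballI)
  qed
  obtain k where "sum_list (take k \<nu>) \<noteq> sum_list (take k \<mu>)"
    using Young_eqI[of \<nu> \<mu>] Y by (auto simp: Young_of_def)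
  then consider "\<not> sum_list (take k \<nu>) \<le> sum_list (take k \<mu>)" | "\<not> sum_list (take k \<mu>) \<le> sum_list (take k \<nu>)"
    by linarith
  then show ?thesis
  proof cases
    case 1 then show ?thesis using z Y by blast
  next
    case 2
    then have "grp_mult (central_young l \<mu>) (central_young l \<nu>) = 0" using z Y by blast
    then show ?thesis
      using central_commute[OF central_young_alg[OF Y(1)] central_young_central] by simp
  qed
qed

section \<open>Conjugacy classes and the decomposition of the unit\<close>

text \<open>Fixed points are listed as cycles of length one, so the cycle lengths of a permutation
  of \<open>{1..l}\<close> form a partition of l.\<close>

definition cycles_of :: "(nat \<Rightarrow> nat) \<Rightarrow> nat list list \<Rightarrow> nat set \<Rightarrow> bool" where
  "cycles_of g css S \<longleftrightarrow> distinct (concat css) \<and> set (concat css) = S \<and> [] \<notin> set css \<and>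
     (\<forall>cs\<in>set css. \<forall>x\<in>set cs. g x = cycle_of_list cs x)"

lemma cycle_decomp_cycles_of:
  "cycle_decomp S g \<Longrightarrow> (\<exists>css. cycles_of g css S) \<and> (\<forall>x. x \<notin> S \<longrightarrow> g x = x)"
proof (induction rule: cycle_decomp.induct)
  case empty
  show ?case by (auto simp: cycles_of_def intro: exI[of _ "[]"])
next
  case (comp I p cs)
  then obtain css where css: "cycles_of p css I" and pfix: "\<And>x. x \<notin> I \<Longrightarrow> p x = x" by blast
  \<comment> \<open>\<open>cycle_decomp\<close> admits the empty cycle, which is dropped to keep all
    parts positive.\<close>
  have "cycles_of (cycle_of_list cs \<circ> p) (if cs = [] then css else cs # css) (set cs \<union> I)"
  proof (cases "cs = []")
    case False
    have "cycle_of_list cs (p x) = cycle_of_list ds x" if "ds \<in> set css" "x \<in> set ds" for ds x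
    proof -
      have px: "p x = cycle_of_list ds x" using css that by (auto simp: cycles_of_def)
      moreover have "cycle_of_list ds x \<in> set ds"
        using cycle_permutes[of ds] that(2) by (simp add: permutes_in_image)
      ultimately have "p x \<in> I" using css that(1) by (auto simp: cycles_of_def)
      then have "p x \<notin> set cs" using comp.hyps by blast
      then show ?thesis by (simp add: id_outside_supp px)
    qed
    moreover have "cycle_of_list cs (p x) = cycle_of_list cs x" if "x \<in> set cs" for x
    proof -
      have "x \<notin> I" using that comp.hyps by blast
      then show ?thesis using pfix by simp
    qed
    ultimately show ?thesis
      using css comp.hyps False by (auto simp: cycles_of_def)
  qed (use css in \<open>simp add: cycles_of_def\<close>)
  moreover have "(cycle_of_list cs \<circ> p) x = x" if "x \<notin> set cs \<union> I" for x
    using that pfix[of x] by (simp add: id_outside_supp)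
  ultimately show ?case by blast
qed

lemma cycle_type_exists:
  assumes "g \<in> Sym l"
  obtains css where "cycles_of g css {1..l}" "map length css \<in> Young_of l"
proof -
  have "cycle_decomp {1..l} g" using assms by (intro cycle_decomposition) (auto simp: Sym_def)
  then obtain css0 where c0: "cycles_of g css0 {1..l}" using cycle_decomp_cycles_of by blast
  define css where "css = rev (sort_key length css0)"
  have set_eq: "set css = set css0" by (simp add: css_def)
  have "mset (concat css) = mset (concat css0)"
    by (simp add: css_def mset_concat mset_map flip: sum_mset_sum_list)
  then have dist: "distinct (concat css)"
    using c0 mset_eq_imp_distinct_iff by (auto simp: cycles_of_def)
  have cyc: "cycles_of g css {1..l}"
    using c0 dist set_eq by (auto simp: cycles_of_def)
  have "sorted (map length (sort_key length css0))" by (rule sorted_sort_key)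
  then have "sorted_wrt (\<ge>) (map length css)"
    by (simp add: css_def rev_map[symmetric] sorted_wrt_rev)
  moreover have "0 \<notin> set (map length css)" using cyc by (auto simp: cycles_of_def)
  moreover have "sum_list (map length css) = l"
  proof -
    have "sum_list (map length css) = length (concat css)" by (simp add: length_concat)
    also have "\<dots> = card {1..l}" using cyc distinct_card[of "concat css"] by (simp only: cycles_of_def)
    finally show ?thesis by simp
  qed
  ultimately have "map length css \<in> Young_of l" by (simp add: Young_of_def Young_def)
  with cyc show thesis by (rule that)
qed

text \<open>Concatenated, the two cycle lists are words enumerating {1..l}, and \<sigma> matches
  them letter by letter. Equal block lengths make it carry cycles to cycles, to which
  \<open>conjugation_of_cycle\<close> applies.\<close>

lemma cycle_type_conj:
  assumes g: "g \<in> Sym l" "cycles_of g css {1..l}" and h: "h \<in> Sym l" "cycles_of h css' {1..l}"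
    and len: "map length css = map length css'"
  shows "\<exists>\<sigma>\<in>Sym l. h = \<sigma> \<circ> g \<circ> ginv \<sigma>"
proof -
  let ?xs = "concat css" and ?ys = "concat css'"
  have d: "distinct ?xs" "distinct ?ys" "set ?xs = {1..l}" "set ?ys = {1..l}"
    using g h by (simp_all only: cycles_of_def)
  have n: "length ?xs = length ?ys" using len by (simp add: length_concat)
  define f where "f = (\<lambda>x. ?ys ! (the_inv_into {..<length ?xs} (nth ?xs) x))"
  have b: "bij_betw (nth ?xs) {..<length ?xs} {1..l}" "bij_betw (nth ?ys) {..<length ?xs} {1..l}"
    using bij_betw_nth[of ?xs "{..<length ?xs}" "{1..l}"] bij_betw_nth[of ?ys "{..<length ?xs}" "{1..l}"] d n by simp_all
  have fb: "bij_betw f {1..l} {1..l}"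
    using bij_betw_trans[OF bij_betw_the_inv_into[OF b(1)] b(2)] by (simp add: f_def comp_def)
  obtain \<sigma> where s: "\<sigma> permutes {1..l}" "\<And>x. x \<in> {1..l} \<Longrightarrow> \<sigma> x = f x"
    using bij_betw_extend_permutes[OF _ fb, of "{1..l}"] by auto
  have bs: "bij \<sigma>" using s(1) by (rule permutes_bij)
  have "map \<sigma> ?xs = ?ys"
  proof (rule nth_equalityI)
    fix i assume i: "i < length (map \<sigma> ?xs)"
    then have "?xs ! i \<in> {1..l}" using d nth_mem[of i ?xs] by auto
    then show "map \<sigma> ?xs ! i = ?ys ! i"
      using i s(2) b(1) by (simp add: f_def bij_betw_def the_inv_into_f_f)
  qed (use n in simp)
  then have "concat (map (map \<sigma>) css) = concat css'" by (simp add: map_concat)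
  moreover have "map length (map (map \<sigma>) css) = map length css'" using len by (simp add: comp_def)
  ultimately have m: "map (map \<sigma>) css = css'"
  proof (induction css' arbitrary: css)
    case (Cons c css')
    then obtain d ds where "css = d # ds" by (cases css) auto
    with Cons show ?case by auto
  qed simp
  have "h y = (\<sigma> \<circ> g \<circ> ginv \<sigma>) y" for y
  proof (cases "y \<in> {1..l}")
    case True
    then obtain cs' where cs': "cs' \<in> set css'" "y \<in> set cs'" using d(4) True unfolding set_concat by blast
    then obtain cs where cs: "cs \<in> set css" "cs' = map \<sigma> cs" using m by auto
    then obtain x where x: "x \<in> set cs" "y = \<sigma> x" using cs' by auto
    have "distinct cs" using d(1) cs(1) by (simp add: distinct_concat_iff)
    then have "cycle_of_list cs' = \<sigma> \<circ> cycle_of_list cs \<circ> ginv \<sigma>"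
      using conjugation_of_cycle[OF _ bs, of cs] cs(2) by simp
    moreover have "h y = cycle_of_list cs' y" using h(2) cs' by (simp add: cycles_of_def)
    moreover have "g x = cycle_of_list cs x" using g(2) cs x by (simp add: cycles_of_def)
    ultimately show ?thesis using x by (simp add: inv_left[OF bs])
  next
    case False
    have S: "\<sigma> \<in> Sym l" using s(1) by (simp add: Sym_def)
    have "h y = y" "ginv \<sigma> y = y" "g y = y" "\<sigma> y = y"
      using False Sym_fix[OF h(1)] Sym_fix[OF inv_Sym[OF S]] Sym_fix[OF g(1)] Sym_fix[OF S] by blast+
    then show ?thesis by simp
  qed
  then have "h = \<sigma> \<circ> g \<circ> ginv \<sigma>" by (rule ext)
  then show ?thesis using s(1) by (auto simp: Sym_def)
qed

lemma finite_Young_of [simp]: "finite (Young_of l)"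
proof -
  have "length \<mu> \<le> l \<and> set \<mu> \<subseteq> {..l}" if "\<mu> \<in> Young_of l" for \<mu>
  proof -
    have m: "0 \<notin> set \<mu>" "sum_list \<mu> = l" using that by (auto simp: Young_of_def Young_def)
    have "length \<mu> \<le> sum_list \<mu>" using m(1) by (induction \<mu>) auto
    then show ?thesis using m member_le_sum_list[of _ \<mu>] by auto
  qed
  then have "Young_of l \<subseteq> {\<mu>. set \<mu> \<subseteq> {..l} \<and> length \<mu> \<le> l}" by blast
  then show ?thesis using finite_lists_length_le[of "{..l}" l] finite_subset by blast
qed

interpretation grp_alg_vs: vector_space "scale :: complex \<Rightarrow> grp_alg \<Rightarrow> grp_alg"
  by unfold_locales (simp_all add: scale_add scale_add_left scale_scale)

text \<open>A dimension count. The class sums span the centre and are indexed by cycle types, so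
  there are at most \<open>card (Young_of l)\<close> of them; the elements
  \<open>central_young l \<mu>\<close> are that many independent central elements. The unit is
  central and cannot be independent of them.\<close>

lemma unit_in_span: "single id 1 \<in> grp_alg_vs.span (central_young l ` Young_of l)"
proof -
  define ct where "ct g = (SOME \<mu>. \<exists>css. cycles_of g css {1..l} \<and> \<mu> = map length css \<and> \<mu> \<in> Young_of l)" for g
  have ct: "\<exists>css. cycles_of g css {1..l} \<and> ct g = map length css \<and> ct g \<in> Young_of l" if g: "g \<in> Sym l" for g
  proof -
    have "\<exists>\<mu>. \<exists>css. cycles_of g css {1..l} \<and> \<mu> = map length css \<and> \<mu> \<in> Young_of l"
      using cycle_type_exists[OF g] by metis
    from someI_ex[OF this] show ?thesis by (simp add: ct_def)
  qed
  have conj: "\<exists>\<sigma>\<in>Sym l. h = \<sigma> \<circ> g \<circ> ginv \<sigma>" if "g \<in> Sym l" "h \<in> Sym l" "ct g = ct h" for g h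
    using ct[OF that(1)] ct[OF that(2)] that(3) cycle_type_conj[OF that(1) _ that(2)] by metis
  define C where "C \<mu> = (\<Sum>g\<in>{g \<in> Sym l. ct g = \<mu>}. single g (1::complex))" for \<mu>
  have span_C: "z \<in> grp_alg_vs.span (C ` Young_of l)"
    if z: "z \<in> alg_over (Sym l)" "\<And>h. h \<in> Sym l \<Longrightarrow> grp_mult (single h 1) z = grp_mult z (single h 1)" for z
  proof -
    \<comment> \<open>Level 0 means commuting with all of \<open>Sym l\<close>, so
      \<open>cB_invariant\<close> gives constancy on conjugacy classes.\<close>
    have "z \<in> cB 0 l"
      using z by (auto simp: cB_def alg_centralizer_def Sym_stab_def)
    then have inv: "lookup z (\<sigma> \<circ> g \<circ> ginv \<sigma>) = lookup z g" if s: "\<sigma> \<in> Sym l" for \<sigma> g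
    proof -
      have b: "bij \<sigma>" using s by (rule Sym_bij)
      have e: "\<sigma> \<circ> k \<circ> ginv \<sigma> = \<sigma> \<circ> g \<circ> ginv \<sigma> \<longleftrightarrow> k = g" for k
      proof
        assume "\<sigma> \<circ> k \<circ> ginv \<sigma> = \<sigma> \<circ> g \<circ> ginv \<sigma>"
        then have "\<sigma> (k (ginv \<sigma> (\<sigma> x))) = \<sigma> (g (ginv \<sigma> (\<sigma> x)))" for x by (metis comp_apply)
        then have "k x = g x" for x by (metis inv_left[OF b])
        then show "k = g" by blast
      qed simp
      have "\<sigma> \<in> Sym_stab 0 l" using s by (simp add: Sym_stab_def)
      from cB_invariant[OF \<open>z \<in> cB 0 l\<close> this, of "\<lambda>k. of_bool (k = \<sigma> \<circ> g \<circ> ginv \<sigma>)"]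
      show ?thesis by (simp only: lookup_pairing e)
    qed
    \<comment> \<open>The value at an arbitrary element of type \<mu>. For a diagram that is not the
      type of any element the choice is arbitrary, but then \<open>C \<mu>\<close> is an empty
      sum.\<close>
    define k where "k \<mu> = lookup z (SOME g. g \<in> Sym l \<and> ct g = \<mu>)" for \<mu>
    have k: "lookup z g = k (ct g)" if g: "g \<in> Sym l" for g
    proof -
      have "(SOME h. h \<in> Sym l \<and> ct h = ct g) \<in> Sym l \<and> ct (SOME h. h \<in> Sym l \<and> ct h = ct g) = ct g"
        by (rule someI[of _ g]) (use g in simp)
      then show ?thesis unfolding k_def using conj[of _ g] g inv by metis
    qed
    have "z = (\<Sum>g\<in>Sym l. single g (lookup z g))"
      using poly_mapping_as_sum[of "Sym l" z] z(1) by (simp add: alg_over_def)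
    also have "\<dots> = (\<Sum>\<mu>\<in>Young_of l. \<Sum>g\<in>{g \<in> Sym l. ct g = \<mu>}. single g (lookup z g))"
      by (rule sum.group[symmetric]) (use ct in auto)
    also have "\<dots> = (\<Sum>\<mu>\<in>Young_of l. scale (k \<mu>) (C \<mu>))"
      by (intro sum.cong refl) (auto simp: C_def scale_sum k intro!: sum.cong)
    finally show ?thesis
      by (metis (no_types, lifting) grp_alg_vs.span_base grp_alg_vs.span_scale grp_alg_vs.span_sum imageI)
  qed
  let ?Z = "central_young l"
  have orth: "u \<mu> = 0" if s: "(\<Sum>\<nu>\<in>Young_of l. scale (u \<nu>) (?Z \<nu>)) = 0" and m: "\<mu> \<in> Young_of l" for u \<mu>
  proof -
    have "0 = (\<Sum>\<nu>\<in>Young_of l. scale (u \<nu>) (grp_mult (?Z \<nu>) (?Z \<mu>)))"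
      using arg_cong[OF s, of "\<lambda>x. grp_mult x (?Z \<mu>)"] by (simp add: convolve_sum_left convolve_scale_left)
    also have "\<dots> = (\<Sum>\<nu>\<in>Young_of l. if \<nu> = \<mu> then scale (u \<mu>) (grp_mult (?Z \<mu>) (?Z \<mu>)) else 0)"
      by (intro sum.cong refl) (auto simp: central_young_orthogonal[OF _ m])
    also have "\<dots> = scale (u \<mu>) (grp_mult (?Z \<mu>) (?Z \<mu>))" using m by simp
    finally show "u \<mu> = 0"
      using central_young_nonzero[OF m] grp_alg_vs.scale_eq_0_iff by metis
  qed
  have inj: "inj_on ?Z (Young_of l)"
  proof (rule inj_onI)
    fix \<mu> \<nu> assume "\<mu> \<in> Young_of l" "\<nu> \<in> Young_of l" "?Z \<mu> = ?Z \<nu>"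
    then show "\<mu> = \<nu>" using central_young_orthogonal[of \<mu> l \<nu>] central_young_nonzero[of \<mu> l] by metis
  qed
  have indep: "grp_alg_vs.independent (?Z ` Young_of l)"
  proof (rule grp_alg_vs.independent_if_scalars_zero)
    fix f x assume s: "(\<Sum>x\<in>?Z ` Young_of l. scale (f x) x) = 0" and x: "x \<in> ?Z ` Young_of l"
    then obtain \<mu> where "\<mu> \<in> Young_of l" "x = ?Z \<mu>" by blast
    then show "f x = 0" using orth[of "\<lambda>\<nu>. f (?Z \<nu>)" \<mu>] s by (simp add: sum.reindex[OF inj])
  qed simp
  have "?Z ` Young_of l \<subseteq> grp_alg_vs.span (C ` Young_of l)"
    using span_C central_young_alg central_young_central by blast
  moreover have one: "single id 1 \<in> grp_alg_vs.span (C ` Young_of l)"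
    by (rule span_C) (simp_all add: alg_over_single)
  ultimately have sub: "insert (single id 1) (?Z ` Young_of l) \<subseteq> grp_alg_vs.span (C ` Young_of l)"
    by blast
  show ?thesis
  proof (rule ccontr)
    assume n: "single id 1 \<notin> grp_alg_vs.span (?Z ` Young_of l)"
    then have "grp_alg_vs.independent (insert (single id 1) (?Z ` Young_of l))"
      by (intro grp_alg_vs.independent_insertI indep)
    then have "card (insert (single id 1) (?Z ` Young_of l)) \<le> card (C ` Young_of l)"
      using grp_alg_vs.independent_span_bound[OF finite_imageI[OF finite_Young_of] _ sub] by blast
    moreover have "single id 1 \<notin> ?Z ` Young_of l" using n grp_alg_vs.span_base by blast
    moreover have "card (?Z ` Young_of l) = card (Young_of l)" by (rule card_image[OF inj])
    ultimately show False using card_image_le[OF finite_Young_of, of C l] by simp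
  qed
qed

text \<open>Multiply x by the expansion of the unit in the central elements. An element is thereby
  recovered from its products with the vectors
  \<open>grp_mult (single g 1) (young_symmetrizer \<mu>)\<close> of \<open>H_pi \<mu>\<close>. The
  coefficients W do not depend on x, so the formula survives passage to limits.\<close>

lemma young_reconstruction:
  "\<exists>W. \<forall>x. x = (\<Sum>\<mu>\<in>Young_of l. \<Sum>g\<in>Sym l.
      grp_mult (grp_mult x (grp_mult (single g 1) (young_symmetrizer \<mu>))) (W \<mu> g))"
proof -
  obtain u where u: "single id 1 = (\<Sum>v\<in>central_young l ` Young_of l. scale (u v) v)"
    using unit_in_span[of l] unfolding grp_alg_vs.span_finite[OF finite_imageI[OF finite_Young_of]] by blast
  have "inj_on (central_young l) (Young_of l)"
  proof (rule inj_onI)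
    fix \<mu> \<nu> assume "\<mu> \<in> Young_of l" "\<nu> \<in> Young_of l" "central_young l \<mu> = central_young l \<nu>"
    then show "\<mu> = \<nu>" using central_young_orthogonal[of \<mu> l \<nu>] central_young_nonzero[of \<mu> l] by metis
  qed
  with u have u': "single id 1 = (\<Sum>\<mu>\<in>Young_of l. scale (u (central_young l \<mu>)) (central_young l \<mu>))"
    by (simp add: sum.reindex)
  define W where "W \<mu> g = scale (u (central_young l \<mu>)) (grp_mult (star (young_symmetrizer \<mu>)) (single (ginv g) 1))" for \<mu> g
  have "x = (\<Sum>\<mu>\<in>Young_of l. \<Sum>g\<in>Sym l.
      grp_mult (grp_mult x (grp_mult (single g 1) (young_symmetrizer \<mu>))) (W \<mu> g))" for x
  proof -
    have "x = grp_mult x (single id 1)" by simp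
    also have "\<dots> = (\<Sum>\<mu>\<in>Young_of l. \<Sum>g\<in>Sym l.
      grp_mult (grp_mult x (grp_mult (single g 1) (young_symmetrizer \<mu>))) (W \<mu> g))"
      unfolding u' W_def central_young_def
      by (simp only: convolve_sum_right convolve_scale_right scale_sum grp_mult_assoc)
    finally show ?thesis .
  qed
  then show ?thesis by blast
qed

section \<open>Operators with a kernel\<close>

lemma norm_sq_nonneg [simp]: "0 \<le> norm_sq v"
  by (simp add: norm_sq_def sum_nonneg)

lemma norm_sq_superset:
  assumes "finite A" "keys v \<subseteq> A"
  shows "norm_sq v = (\<Sum>k\<in>A. (cmod (lookup v k))\<^sup>2)"
  unfolding norm_sq_def by (rule sum.mono_neutral_left) (use assms in \<open>auto simp: in_keys_iff\<close>)

lemma norm_sq_zero [simp]: "norm_sq 0 = 0"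
  by (simp add: norm_sq_def)

lemma norm_sq_lookup: "(cmod (lookup v k))\<^sup>2 \<le> norm_sq v"
proof (cases "k \<in> keys v")
  case True
  then show ?thesis unfolding norm_sq_def by (intro member_le_sum) auto
qed (simp add: in_keys_iff)

lemma norm_sq_eq_0: "norm_sq v = 0 \<Longrightarrow> v = 0"
  by (rule poly_mapping_eqI) (use norm_sq_lookup[of v] in \<open>auto simp: sum_nonneg_eq_0_iff\<close>)

lemma norm_sq_scale: "norm_sq (scale c v) = (cmod c)\<^sup>2 * norm_sq v"
  unfolding norm_sq_superset[OF finite_keys keys_scale] by (simp add: norm_sq_def sum_distrib_left norm_mult power_mult_distrib)

lemma sum_swap_weight:
  fixes c :: real
  shows "(\<Sum>a\<in>F. c * (\<Sum>b\<in>U. K a b * w b)) = c * (\<Sum>b\<in>U. w b * (\<Sum>a\<in>F. K a b))"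
proof -
  have "(\<Sum>a\<in>F. c * (\<Sum>b\<in>U. K a b * w b)) = (\<Sum>a\<in>F. \<Sum>b\<in>U. c * (w b * K a b))"
    by (simp add: sum_distrib_left mult_ac)
  also have "\<dots> = (\<Sum>b\<in>U. \<Sum>a\<in>F. c * (w b * K a b))" by (rule sum.swap)
  finally show ?thesis by (simp only: sum_distrib_left)
qed

text \<open>Cauchy-Schwarz with the weight split as a square root times a square root: the row sum
  comes out as a factor and the second factor stays linear in the weight, as the Schur test
  requires.\<close>

lemma norm_sq_sum_le:
  assumes "finite B"
  shows "norm_sq (\<Sum>b\<in>B. scale (K b) (v b)) \<le> (\<Sum>b\<in>B. cmod (K b)) * (\<Sum>b\<in>B. cmod (K b) * norm_sq (v b))"
proof -
  let ?A = "\<Union>b\<in>B. keys (v b)"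
  have fin: "finite ?A" using assms by simp
  have "keys (\<Sum>b\<in>B. scale (K b) (v b)) \<subseteq> ?A"
    using keys_sum_subset[of "\<lambda>b. scale (K b) (v b)" B] keys_scale by fastforce
  then have "norm_sq (\<Sum>b\<in>B. scale (K b) (v b)) = (\<Sum>k\<in>?A. (cmod (\<Sum>b\<in>B. K b * lookup (v b) k))\<^sup>2)"
    by (simp add: norm_sq_superset[OF fin] lookup_sum)
  also have "\<dots> \<le> (\<Sum>k\<in>?A. (\<Sum>b\<in>B. cmod (K b)) * (\<Sum>b\<in>B. cmod (K b) * (cmod (lookup (v b) k))\<^sup>2))"
  proof (rule sum_mono)
    fix k
    have "(cmod (\<Sum>b\<in>B. K b * lookup (v b) k))\<^sup>2 \<le> (\<Sum>b\<in>B. cmod (K b) * cmod (lookup (v b) k))\<^sup>2"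
      by (intro power_mono order_trans[OF norm_sum]) (simp_all add: norm_mult)
    also have "\<dots> = (\<Sum>b\<in>B. sqrt (cmod (K b)) * (sqrt (cmod (K b)) * cmod (lookup (v b) k)))\<^sup>2"
      by (simp flip: mult.assoc)
    also have "\<dots> \<le> (\<Sum>b\<in>B. (sqrt (cmod (K b)))\<^sup>2) * (\<Sum>b\<in>B. (sqrt (cmod (K b)) * cmod (lookup (v b) k))\<^sup>2)"
      by (rule Cauchy_Schwarz_ineq_sum)
    finally show "(cmod (\<Sum>b\<in>B. K b * lookup (v b) k))\<^sup>2
      \<le> (\<Sum>b\<in>B. cmod (K b)) * (\<Sum>b\<in>B. cmod (K b) * (cmod (lookup (v b) k))\<^sup>2)"
      by (simp add: power_mult_distrib)
  qed
  also have "\<dots> = (\<Sum>b\<in>B. cmod (K b)) * (\<Sum>b\<in>B. cmod (K b) * (\<Sum>k\<in>?A. (cmod (lookup (v b) k))\<^sup>2))"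
    by (simp add: sum_distrib_left[symmetric] sum.swap[of _ B ?A])
  also have "\<dots> = (\<Sum>b\<in>B. cmod (K b)) * (\<Sum>b\<in>B. cmod (K b) * norm_sq (v b))"
  proof -
    have "norm_sq (v b) = (\<Sum>k\<in>?A. (cmod (lookup (v b) k))\<^sup>2)" if "b \<in> B" for b
      using that by (intro norm_sq_superset[OF fin]) auto
    then show ?thesis by simp
  qed
  finally show ?thesis .
qed

lemma norm_sq_add_le: "norm_sq (u + v) \<le> 2 * norm_sq u + 2 * norm_sq v"
  using norm_sq_sum_le[of "{True, False}" "\<lambda>_. 1" "\<lambda>b. if b then u else v"]
  by (simp add: algebra_simps)

lemma norm_sq_diff_le: "norm_sq (u - v) \<le> 2 * norm_sq u + 2 * norm_sq v"
proof -
  have "norm_sq (- v) = norm_sq v" by (simp add: norm_sq_def)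
  then show ?thesis using norm_sq_add_le[of u "- v"] by simp
qed

text \<open>Restricting the index set to nonzero terms makes the sum finite in both cases of
  interest: row-finite kernels on arbitrary \<phi>, and arbitrary kernels on finitely supported
  \<phi>. Outside these cases an infinite index set yields the default value 0.\<close>

definition kerop :: "nat \<Rightarrow> ((nat \<times> nat) set \<Rightarrow> complex) \<Rightarrow> hvec \<Rightarrow> hvec" where
  "kerop l h \<phi> \<omega> = (\<Sum>\<omega>' | \<omega>' \<in> Omega_inf l \<and> h (link l \<omega> \<omega>') \<noteq> 0 \<and> \<phi> \<omega>' \<noteq> 0.
     scale (h (link l \<omega> \<omega>')) (\<phi> \<omega>'))"

lemma kerop_superset:
  assumes "finite A" "A \<subseteq> Omega_inf l"
    and "\<And>\<omega>'. \<omega>' \<in> Omega_inf l \<Longrightarrow> \<omega>' \<notin> A \<Longrightarrow> h (link l \<omega> \<omega>') = 0 \<or> \<phi> \<omega>' = 0"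
  shows "kerop l h \<phi> \<omega> = (\<Sum>\<omega>'\<in>A. scale (h (link l \<omega> \<omega>')) (\<phi> \<omega>'))"
  unfolding kerop_def
  by (rule sum.mono_neutral_left) (use assms in auto)

definition row_finite :: "nat \<Rightarrow> ((nat \<times> nat) set \<Rightarrow> complex) \<Rightarrow> bool" where
  "row_finite l h \<longleftrightarrow> (\<forall>\<omega>\<in>Omega_inf l. finite {\<omega>' \<in> Omega_inf l. h (link l \<omega> \<omega>') \<noteq> 0})"

text \<open>Bounds over finite test sets stand for absolute row and column sums, so infinite sums of
  kernel values never occur. Row finiteness is included because \<open>kerop\<close> adds up
  finitely many terms only.\<close>

definition schur :: "nat \<Rightarrow> ((nat \<times> nat) set \<Rightarrow> complex) \<Rightarrow> real \<Rightarrow> bool" where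
  "schur l h C \<longleftrightarrow> row_finite l h \<and>
     (\<forall>\<omega>\<in>Omega_inf l. \<forall>B. finite B \<and> B \<subseteq> Omega_inf l \<longrightarrow> (\<Sum>\<omega>'\<in>B. cmod (h (link l \<omega> \<omega>'))) \<le> C) \<and>
     (\<forall>\<omega>\<in>Omega_inf l. \<forall>B. finite B \<and> B \<subseteq> Omega_inf l \<longrightarrow> (\<Sum>\<omega>'\<in>B. cmod (h (link l \<omega>' \<omega>))) \<le> C)"

lemma row_finite_kerop:
  assumes "row_finite l h" "\<omega> \<in> Omega_inf l"
  shows "kerop l h \<phi> \<omega> = (\<Sum>\<omega>' | \<omega>' \<in> Omega_inf l \<and> h (link l \<omega> \<omega>') \<noteq> 0. scale (h (link l \<omega> \<omega>')) (\<phi> \<omega>'))"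
  using assms by (intro kerop_superset) (auto simp: row_finite_def)

lemma kerop_add:
  assumes "row_finite l h" "\<omega> \<in> Omega_inf l"
  shows "kerop l h (\<lambda>\<omega>. \<phi> \<omega> + \<psi> \<omega>) \<omega> = kerop l h \<phi> \<omega> + kerop l h \<psi> \<omega>"
  by (simp add: row_finite_kerop[OF assms] scale_add sum.distrib)

lemma kerop_scale:
  assumes "row_finite l h" "\<omega> \<in> Omega_inf l"
  shows "kerop l h (\<lambda>\<omega>. scale c (\<phi> \<omega>)) \<omega> = scale c (kerop l h \<phi> \<omega>)"
  by (simp add: row_finite_kerop[OF assms] scale_sum scale_scale mult.commute)

lemma kerop_lincomb:
  assumes "row_finite l h" "row_finite l h'" "\<omega> \<in> Omega_inf l"
  shows "kerop l (\<lambda>R. a * h R + b * h' R) \<phi> \<omega> = scale a (kerop l h \<phi> \<omega>) + scale b (kerop l h' \<phi> \<omega>)"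
proof -
  let ?A = "{\<omega>' \<in> Omega_inf l. h (link l \<omega> \<omega>') \<noteq> 0} \<union> {\<omega>' \<in> Omega_inf l. h' (link l \<omega> \<omega>') \<noteq> 0}"
  have fin: "finite ?A" using assms by (simp add: row_finite_def)
  have "kerop l g \<phi> \<omega> = (\<Sum>\<omega>'\<in>?A. scale (g (link l \<omega> \<omega>')) (\<phi> \<omega>'))"
    if "\<And>R. h R = 0 \<Longrightarrow> h' R = 0 \<Longrightarrow> g R = 0" for g
    using fin that by (intro kerop_superset) auto
  from this[of h] this[of h'] this[of "\<lambda>R. a * h R + b * h' R"]
  have 1: "kerop l (\<lambda>R. a * h R + b * h' R) \<phi> \<omega> = (\<Sum>\<omega>'\<in>?A. scale (a * h (link l \<omega> \<omega>') + b * h' (link l \<omega> \<omega>')) (\<phi> \<omega>'))"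
    by simp
  have "kerop l h \<phi> \<omega> = (\<Sum>\<omega>'\<in>?A. scale (h (link l \<omega> \<omega>')) (\<phi> \<omega>'))"
    "kerop l h' \<phi> \<omega> = (\<Sum>\<omega>'\<in>?A. scale (h' (link l \<omega> \<omega>')) (\<phi> \<omega>'))"
    using fin by (auto intro!: kerop_superset)
  with 1 show ?thesis by (simp add: scale_sum scale_scale scale_add_left sum.distrib)
qed

text \<open>The Schur test: one factor C comes from the row sums through
  \<open>norm_sq_sum_le\<close>, the other from the column sums after exchanging the summations. The
  bound S is kept as a parameter so that the estimate can be applied to tails.\<close>

lemma schur_bound:
  assumes h: "schur l h C" and sum: "(\<lambda>\<omega>. norm_sq (\<phi> \<omega>)) summable_on Omega_inf l"
    and F: "finite F" "F \<subseteq> Omega_inf l"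
    and S: "\<And>G. finite G \<Longrightarrow> G \<subseteq> Omega_inf l \<Longrightarrow> (\<Sum>\<omega>\<in>G. norm_sq (\<phi> \<omega>)) \<le> S"
  shows "(\<Sum>\<omega>\<in>F. norm_sq (kerop l h \<phi> \<omega>)) \<le> C\<^sup>2 * S"
proof (cases "F = {}")
  case True
  then show ?thesis using S[of "{}"] by simp
next
  case False
  let ?B = "\<lambda>\<omega>. {\<omega>' \<in> Omega_inf l. h (link l \<omega> \<omega>') \<noteq> 0}"
  let ?U = "\<Union>\<omega>\<in>F. ?B \<omega>"
  have rf: "row_finite l h" using h by (simp add: schur_def)
  have fin: "finite ?U" using rf F by (auto simp: row_finite_def)
  have C: "0 \<le> C" using h False F unfolding schur_def by (metis all_not_in_conv empty_subsetI finite.emptyI subsetD sum.empty)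
  have K: "kerop l h \<phi> \<omega> = (\<Sum>\<omega>'\<in>?U. scale (h (link l \<omega> \<omega>')) (\<phi> \<omega>'))" if "\<omega> \<in> F" for \<omega>
    using fin that by (intro kerop_superset) auto
  have "(\<Sum>\<omega>\<in>F. norm_sq (kerop l h \<phi> \<omega>))
      \<le> (\<Sum>\<omega>\<in>F. C * (\<Sum>\<omega>'\<in>?U. cmod (h (link l \<omega> \<omega>')) * norm_sq (\<phi> \<omega>')))"
  proof (rule sum_mono)
    fix \<omega> assume w: "\<omega> \<in> F"
    have r: "(\<Sum>\<omega>'\<in>?U. cmod (h (link l \<omega> \<omega>'))) \<le> C"
      using h w F fin unfolding schur_def by (metis (no_types, lifting) UN_least mem_Collect_eq subsetD subsetI)
    have "norm_sq (kerop l h \<phi> \<omega>) \<le> (\<Sum>\<omega>'\<in>?U. cmod (h (link l \<omega> \<omega>'))) * (\<Sum>\<omega>'\<in>?U. cmod (h (link l \<omega> \<omega>')) * norm_sq (\<phi> \<omega>'))"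
      unfolding K[OF w] by (rule norm_sq_sum_le[OF fin])
    also have "\<dots> \<le> C * (\<Sum>\<omega>'\<in>?U. cmod (h (link l \<omega> \<omega>')) * norm_sq (\<phi> \<omega>'))"
      by (intro mult_right_mono r sum_nonneg) simp
    finally show "norm_sq (kerop l h \<phi> \<omega>) \<le> C * (\<Sum>\<omega>'\<in>?U. cmod (h (link l \<omega> \<omega>')) * norm_sq (\<phi> \<omega>'))" .
  qed
  also have "\<dots> = C * (\<Sum>\<omega>'\<in>?U. norm_sq (\<phi> \<omega>') * (\<Sum>\<omega>\<in>F. cmod (h (link l \<omega> \<omega>'))))"
    by (rule sum_swap_weight)
  also have "\<dots> \<le> C * (\<Sum>\<omega>'\<in>?U. norm_sq (\<phi> \<omega>') * C)"
  proof (intro mult_left_mono sum_mono C)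
    fix \<omega>' assume "\<omega>' \<in> ?U"
    then show "(\<Sum>\<omega>\<in>F. cmod (h (link l \<omega> \<omega>'))) \<le> C" using h F unfolding schur_def by blast
  qed simp
  also have "\<dots> = C\<^sup>2 * (\<Sum>\<omega>'\<in>?U. norm_sq (\<phi> \<omega>'))"
    by (simp add: sum_distrib_left sum_distrib_right power2_eq_square algebra_simps)
  also have "\<dots> \<le> C\<^sup>2 * S" by (intro mult_left_mono S fin) auto
  finally show ?thesis .
qed

section \<open>Square summable functions and strong convergence\<close>

definition nrm2 :: "nat \<Rightarrow> hvec \<Rightarrow> real" where
  "nrm2 l \<phi> = (\<Sum>\<^sub>\<infinity>\<omega>\<in>Omega_inf l. norm_sq (\<phi> \<omega>))"

abbreviation sqsum :: "nat \<Rightarrow> hvec \<Rightarrow> bool" where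
  "sqsum l \<phi> \<equiv> (\<lambda>\<omega>. norm_sq (\<phi> \<omega>)) summable_on Omega_inf l"

lemma norm_T_nrm2: "norm_T \<mu> \<phi> = sqrt (nrm2 (ysize \<mu>) \<phi>)"
  by (simp add: norm_T_def nrm2_def)

lemma nrm2_nonneg: "0 \<le> nrm2 l \<phi>"
  by (simp add: nrm2_def infsum_nonneg)

lemma sqsum_finite_le: "sqsum l \<phi> \<Longrightarrow> finite F \<Longrightarrow> F \<subseteq> Omega_inf l \<Longrightarrow> (\<Sum>\<omega>\<in>F. norm_sq (\<phi> \<omega>)) \<le> nrm2 l \<phi>"
  unfolding nrm2_def by (rule finite_sum_le_infsum) auto

lemma sqsumI:
  assumes "\<And>F. finite F \<Longrightarrow> F \<subseteq> Omega_inf l \<Longrightarrow> (\<Sum>\<omega>\<in>F. norm_sq (\<phi> \<omega>)) \<le> S"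
  shows "sqsum l \<phi>" "nrm2 l \<phi> \<le> S"
proof -
  show s: "sqsum l \<phi>"
    by (rule nonneg_bdd_above_summable_on) (auto intro!: bdd_aboveI[of _ S] assms)
  show "nrm2 l \<phi> \<le> S" unfolding nrm2_def by (rule infsum_le_finite_sums[OF s]) (use assms in auto)
qed

lemma nrm2_pointwise: "sqsum l \<phi> \<Longrightarrow> \<omega> \<in> Omega_inf l \<Longrightarrow> norm_sq (\<phi> \<omega>) \<le> nrm2 l \<phi>"
  using sqsum_finite_le[where F = "{\<omega>}"] by simp

lemma sqsum_diff:
  assumes "sqsum l \<phi>" "sqsum l \<psi>"
  shows "sqsum l (\<lambda>\<omega>. \<phi> \<omega> - \<psi> \<omega>)" "nrm2 l (\<lambda>\<omega>. \<phi> \<omega> - \<psi> \<omega>) \<le> 2 * nrm2 l \<phi> + 2 * nrm2 l \<psi>"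
proof -
  have "(\<Sum>\<omega>\<in>F. norm_sq (\<phi> \<omega> - \<psi> \<omega>)) \<le> 2 * nrm2 l \<phi> + 2 * nrm2 l \<psi>" if "finite F" "F \<subseteq> Omega_inf l" for F
  proof -
    have "(\<Sum>\<omega>\<in>F. norm_sq (\<phi> \<omega> - \<psi> \<omega>)) \<le> (\<Sum>\<omega>\<in>F. 2 * norm_sq (\<phi> \<omega>) + 2 * norm_sq (\<psi> \<omega>))"
      by (intro sum_mono norm_sq_diff_le)
    also have "\<dots> \<le> 2 * nrm2 l \<phi> + 2 * nrm2 l \<psi>"
      using sqsum_finite_le[OF assms(1) that] sqsum_finite_le[OF assms(2) that]
      by (simp add: sum.distrib sum_distrib_left[symmetric])
    finally show ?thesis .
  qed
  from sqsumI[OF this] show "sqsum l (\<lambda>\<omega>. \<phi> \<omega> - \<psi> \<omega>)"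
    "nrm2 l (\<lambda>\<omega>. \<phi> \<omega> - \<psi> \<omega>) \<le> 2 * nrm2 l \<phi> + 2 * nrm2 l \<psi>" by blast+
qed

lemma sqsum_tail:
  assumes "sqsum l \<phi>" "\<epsilon> > 0"
  obtains F where "finite F" "F \<subseteq> Omega_inf l"
    "\<And>G. finite G \<Longrightarrow> G \<subseteq> Omega_inf l - F \<Longrightarrow> (\<Sum>\<omega>\<in>G. norm_sq (\<phi> \<omega>)) \<le> \<epsilon>"
proof -
  have "\<exists>F. finite F \<and> F \<subseteq> Omega_inf l \<and> nrm2 l \<phi> - \<epsilon> < (\<Sum>\<omega>\<in>F. norm_sq (\<phi> \<omega>))"
  proof (rule ccontr)
    assume "\<not> ?thesis"
    then have "nrm2 l \<phi> \<le> nrm2 l \<phi> - \<epsilon>" by (intro sqsumI(2)) (meson not_less)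
    with assms(2) show False by simp
  qed
  then obtain F where F: "finite F" "F \<subseteq> Omega_inf l" "nrm2 l \<phi> - \<epsilon> < (\<Sum>\<omega>\<in>F. norm_sq (\<phi> \<omega>))" by blast
  have "(\<Sum>\<omega>\<in>G. norm_sq (\<phi> \<omega>)) \<le> \<epsilon>" if G: "finite G" "G \<subseteq> Omega_inf l - F" for G
  proof -
    have "(\<Sum>\<omega>\<in>F \<union> G. norm_sq (\<phi> \<omega>)) \<le> nrm2 l \<phi>"
      by (rule sqsum_finite_le[OF assms(1)]) (use F G in auto)
    moreover have "(\<Sum>\<omega>\<in>F \<union> G. norm_sq (\<phi> \<omega>)) = (\<Sum>\<omega>\<in>F. norm_sq (\<phi> \<omega>)) + (\<Sum>\<omega>\<in>G. norm_sq (\<phi> \<omega>))"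
      by (rule sum.union_disjoint) (use F G in auto)
    ultimately show ?thesis using F by simp
  qed
  with F show thesis by (intro that)
qed

text \<open>Cut \<phi> into finitely many coordinates F and a tail of small norm. The uniform Schur
  bound controls the image of the tail; on F only finitely many columns of the kernel enter, and
  these tend to 0 in square sum.\<close>

lemma strong_null:
  assumes h: "eventually (\<lambda>n. schur l (h n) C) sequentially"
    and col: "\<And>\<omega> \<epsilon>. \<omega> \<in> Omega_inf l \<Longrightarrow> \<epsilon> > 0 \<Longrightarrow> eventually (\<lambda>n. \<forall>F. finite F \<and> F \<subseteq> Omega_inf l \<longrightarrow>
      (\<Sum>\<omega>'\<in>F. (cmod (h n (link l \<omega>' \<omega>)))\<^sup>2) \<le> \<epsilon>) sequentially"
    and sum: "sqsum l \<phi>"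
  shows "(\<lambda>n. nrm2 l (kerop l (h n) \<phi>)) \<longlonglongrightarrow> 0"
proof (rule order_tendstoI)
  fix e :: real assume "e < 0"
  then show "\<forall>\<^sub>F n in sequentially. e < nrm2 l (kerop l (h n) \<phi>)"
    using nrm2_nonneg by (metis (mono_tags, lifting) always_eventually less_le_trans)
next
  fix e :: real assume e: "0 < e"
  \<comment> \<open>One half of e is reserved for the tail and the other for the finite part; the
    summand 4 here and in \<delta> keeps the denominators positive.\<close>
  define \<epsilon> where "\<epsilon> = e / (4 * C\<^sup>2 + 4)"
  have eps: "\<epsilon> > 0" "2 * C\<^sup>2 * \<epsilon> < e / 2"
  proof -
    have "0 < 4 * C\<^sup>2 + 4" by (simp add: add_nonneg_pos)
    then show "\<epsilon> > 0" "2 * C\<^sup>2 * \<epsilon> < e / 2" using e by (simp_all add: \<epsilon>_def field_simps)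
  qed
  obtain F where F: "finite F" "F \<subseteq> Omega_inf l"
    "\<And>G. finite G \<Longrightarrow> G \<subseteq> Omega_inf l - F \<Longrightarrow> (\<Sum>\<omega>\<in>G. norm_sq (\<phi> \<omega>)) \<le> \<epsilon>"
    using sqsum_tail[OF sum eps(1)] by blast
  \<comment> \<open>The factor \<open>card F\<close> arises from \<open>norm_sq_sum_le\<close> with
    unit weights when the finitely many columns in F are added.\<close>
  define M where "M = real (card F) * (\<Sum>\<omega>\<in>F. norm_sq (\<phi> \<omega>))"
  have M: "0 \<le> M" by (simp add: M_def sum_nonneg)
  define \<delta> where "\<delta> = e / (4 * M + 4)"
  have del: "\<delta> > 0" "2 * (M * \<delta>) < e / 2"
    using e M by (simp_all add: \<delta>_def field_simps)
  have "\<forall>\<^sub>F n in sequentially. \<forall>\<omega>\<in>F. \<forall>G. finite G \<and> G \<subseteq> Omega_inf l \<longrightarrow>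
      (\<Sum>\<omega>'\<in>G. (cmod (h n (link l \<omega>' \<omega>)))\<^sup>2) \<le> \<delta>"
    using F(1,2) col[OF _ del(1)] by (intro eventually_ball_finite) auto
  with h show "\<forall>\<^sub>F n in sequentially. nrm2 l (kerop l (h n) \<phi>) < e"
  proof eventually_elim
    case (elim n)
    note rf = elim(1)[unfolded schur_def, THEN conjunct1]
    let ?p = "\<lambda>\<omega>. if \<omega> \<in> F then \<phi> \<omega> else 0" and ?q = "\<lambda>\<omega>. if \<omega> \<in> F then 0 else \<phi> \<omega>"
    have pt: "(\<Sum>\<omega>\<in>G. norm_sq (?q \<omega>)) \<le> \<epsilon>" if "finite G" "G \<subseteq> Omega_inf l" for G
    proof -
      have "(\<Sum>\<omega>\<in>G. norm_sq (?q \<omega>)) = (\<Sum>\<omega>\<in>G - F. norm_sq (\<phi> \<omega>))"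
        by (rule sum.mono_neutral_cong_right) (use that in auto)
      also have "\<dots> \<le> \<epsilon>" by (rule F(3)) (use that in auto)
      finally show ?thesis .
    qed
    have "nrm2 l (kerop l (h n) \<phi>) \<le> 2 * (M * \<delta>) + 2 * (C\<^sup>2 * \<epsilon>)"
    proof (rule sqsumI(2))
      fix G assume G: "finite G" "G \<subseteq> Omega_inf l"
      have "(\<Sum>\<omega>\<in>G. norm_sq (kerop l (h n) \<phi> \<omega>))
          \<le> (\<Sum>\<omega>\<in>G. 2 * norm_sq (kerop l (h n) ?p \<omega>) + 2 * norm_sq (kerop l (h n) ?q \<omega>))"
      proof (rule sum_mono)
        fix \<omega> assume "\<omega> \<in> G"
        then have w: "\<omega> \<in> Omega_inf l" using G by blast
        have "(\<lambda>\<omega>. ?p \<omega> + ?q \<omega>) = \<phi>" by auto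
        then have "kerop l (h n) \<phi> \<omega> = kerop l (h n) ?p \<omega> + kerop l (h n) ?q \<omega>"
          using kerop_add[OF rf w, of ?p ?q] by simp
        then show "norm_sq (kerop l (h n) \<phi> \<omega>) \<le> 2 * norm_sq (kerop l (h n) ?p \<omega>) + 2 * norm_sq (kerop l (h n) ?q \<omega>)"
          by (simp only: norm_sq_add_le)
      qed
      also have "\<dots> = 2 * (\<Sum>\<omega>\<in>G. norm_sq (kerop l (h n) ?p \<omega>)) + 2 * (\<Sum>\<omega>\<in>G. norm_sq (kerop l (h n) ?q \<omega>))"
        by (simp add: sum.distrib sum_distrib_left)
      also have "(\<Sum>\<omega>\<in>G. norm_sq (kerop l (h n) ?q \<omega>)) \<le> C\<^sup>2 * \<epsilon>"
        by (rule schur_bound[OF elim(1) sqsumI(1)[OF pt] G pt])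
      also have "(\<Sum>\<omega>\<in>G. norm_sq (kerop l (h n) ?p \<omega>)) \<le> M * \<delta>"
      proof -
        have "(\<Sum>\<omega>\<in>G. norm_sq (kerop l (h n) ?p \<omega>))
            \<le> (\<Sum>\<omega>\<in>G. real (card F) * (\<Sum>\<omega>'\<in>F. (cmod (h n (link l \<omega> \<omega>')))\<^sup>2 * norm_sq (\<phi> \<omega>')))"
        proof (rule sum_mono)
          fix \<omega>
          have "kerop l (h n) ?p \<omega> = (\<Sum>\<omega>'\<in>F. scale (h n (link l \<omega> \<omega>')) (?p \<omega>'))"
            by (rule kerop_superset[OF F(1,2)]) simp
          also have "\<dots> = (\<Sum>\<omega>'\<in>F. scale 1 (scale (h n (link l \<omega> \<omega>')) (\<phi> \<omega>')))"
            by simp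
          finally have "norm_sq (kerop l (h n) ?p \<omega>) \<le> real (card F) * (\<Sum>\<omega>'\<in>F. norm_sq (scale (h n (link l \<omega> \<omega>')) (\<phi> \<omega>')))"
            using norm_sq_sum_le[OF F(1), of "\<lambda>_. 1" "\<lambda>\<omega>'. scale (h n (link l \<omega> \<omega>')) (\<phi> \<omega>')"] by simp
          also have "\<dots> = real (card F) * (\<Sum>\<omega>'\<in>F. (cmod (h n (link l \<omega> \<omega>')))\<^sup>2 * norm_sq (\<phi> \<omega>'))"
            by (simp only: norm_sq_scale)
          finally show "norm_sq (kerop l (h n) ?p \<omega>) \<le> real (card F) * (\<Sum>\<omega>'\<in>F. (cmod (h n (link l \<omega> \<omega>')))\<^sup>2 * norm_sq (\<phi> \<omega>'))" .
        qed
        also have "\<dots> = real (card F) * (\<Sum>\<omega>'\<in>F. norm_sq (\<phi> \<omega>') * (\<Sum>\<omega>\<in>G. (cmod (h n (link l \<omega> \<omega>')))\<^sup>2))"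
          by (rule sum_swap_weight)
        also have "\<dots> \<le> real (card F) * (\<Sum>\<omega>'\<in>F. norm_sq (\<phi> \<omega>') * \<delta>)"
          by (intro mult_left_mono sum_mono) (use elim(2) G in auto)
        also have "\<dots> = M * \<delta>" by (simp add: M_def sum_distrib_right)
        finally show ?thesis .
      qed
      finally show "(\<Sum>\<omega>\<in>G. norm_sq (kerop l (h n) \<phi> \<omega>)) \<le> 2 * (M * \<delta>) + 2 * (C\<^sup>2 * \<epsilon>)" by simp
    qed
    also have "\<dots> < e" using del eps by simp
    finally show ?case .
  qed
qed

section \<open>Kernel operators on the spaces of the tame representations\<close>

definition Op :: "nat list \<Rightarrow> ((nat \<times> nat) set \<Rightarrow> complex) \<Rightarrow> hvec \<Rightarrow> hvec" where
  "Op \<mu> h = (\<lambda>\<phi>\<in>H_T \<mu>. \<lambda>\<omega>. if \<omega> \<in> Omega_inf (ysize \<mu>) then kerop (ysize \<mu>) h \<phi> \<omega> else 0)"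

lemma H_pi_zero: "0 \<in> H_pi \<mu>"
  by (auto simp: H_pi_def intro: exI[of _ 0])

lemma H_pi_add: "u \<in> H_pi \<mu> \<Longrightarrow> v \<in> H_pi \<mu> \<Longrightarrow> u + v \<in> H_pi \<mu>"
  by (auto simp: H_pi_def convolve_add_left[symmetric] intro: alg_over_add)

lemma H_pi_scale: "v \<in> H_pi \<mu> \<Longrightarrow> scale c v \<in> H_pi \<mu>"
  by (auto simp: H_pi_def convolve_scale_left[symmetric] intro: alg_over_scale)

lemma H_pi_sum: "(\<And>i. i \<in> I \<Longrightarrow> v i \<in> H_pi \<mu>) \<Longrightarrow> (\<Sum>i\<in>I. v i) \<in> H_pi \<mu>"
  by (induction I rule: infinite_finite_induct) (auto intro: H_pi_add H_pi_zero)

lemma H_pi_rep: "s \<in> Sym (ysize \<mu>) \<Longrightarrow> v \<in> H_pi \<mu> \<Longrightarrow> pi_rep s v \<in> H_pi \<mu>"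
  unfolding H_pi_def pi_rep_def grp_mult_assoc[symmetric] mem_Collect_eq
  by (metis alg_over_single grp_mult_alg grp_mult_assoc)

lemma pi_rep_scale: "pi_rep s (scale c v) = scale c (pi_rep s v)"
  and pi_rep_sum: "pi_rep s (\<Sum>i\<in>I. w i) = (\<Sum>i\<in>I. pi_rep s (w i))"
  and pi_rep_comp: "pi_rep s (pi_rep t v) = pi_rep (s \<circ> t) v"
  by (simp_all add: pi_rep_def convolve_scale_right convolve_sum_right flip: grp_mult_assoc)

lemma H_T_sqsum: "\<phi> \<in> H_T \<mu> \<Longrightarrow> sqsum (ysize \<mu>) \<phi>"
  and H_T_outside: "\<phi> \<in> H_T \<mu> \<Longrightarrow> \<omega> \<notin> Omega_inf (ysize \<mu>) \<Longrightarrow> \<phi> \<omega> = 0"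
  and H_T_equivariant: "\<phi> \<in> H_T \<mu> \<Longrightarrow> s \<in> Sym (ysize \<mu>) \<Longrightarrow> \<omega> \<in> Omega_inf (ysize \<mu>) \<Longrightarrow>
    \<phi> (mmult (perm_matr s) \<omega>) = pi_rep s (\<phi> \<omega>)"
  by (simp_all add: H_T_def)

lemma H_T_pi: "\<phi> \<in> H_T \<mu> \<Longrightarrow> \<phi> \<omega> \<in> H_pi \<mu>"
  by (cases "\<omega> \<in> Omega_inf (ysize \<mu>)") (auto simp: H_T_def H_pi_zero)

text \<open>By \<open>link_perm_left\<close> the kernel does not change when s acts on both indices,
  so reindexing the sum by this action moves it onto \<phi>, which is equivariant.\<close>

lemma kerop_equivariant:
  assumes "\<phi> \<in> H_T \<mu>" "row_finite (ysize \<mu>) h" "s \<in> Sym (ysize \<mu>)" "\<omega> \<in> Omega_inf (ysize \<mu>)"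
  shows "kerop (ysize \<mu>) h \<phi> (mmult (perm_matr s) \<omega>) = pi_rep s (kerop (ysize \<mu>) h \<phi> \<omega>)"
proof -
  let ?l = "ysize \<mu>"
  let ?L = "\<lambda>\<omega>. mmult (perm_matr s) \<omega>" and ?I = "\<lambda>\<omega>. mmult (perm_matr (ginv s)) \<omega>"
  have b: "bij s" and i: "ginv s \<in> Sym ?l" using assms(3) by (simp_all add: Sym_bij)
  have idm: "mmult (perm_matr id) \<omega> = \<omega>" if "\<omega> \<in> Omega_inf ?l" for \<omega>
    using mmult_perm_left(1)[OF id_Sym that] Omega_place[OF that] by simp
  have LI: "?L (?I \<omega>) = \<omega>" "?I (?L \<omega>) = \<omega>" if "\<omega> \<in> Omega_inf ?l" for \<omega>
    using that by (simp_all add: mmult_perm_left_assoc[OF assms(3) i] mmult_perm_left_assoc[OF i assms(3)]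
      idm comp_inv_id[OF b] inv_comp_id[OF b])
  have "kerop ?l h \<phi> (?L \<omega>) = (\<Sum>\<omega>' | \<omega>' \<in> Omega_inf ?l \<and> h (link ?l (?L \<omega>) \<omega>') \<noteq> 0. scale (h (link ?l (?L \<omega>) \<omega>')) (\<phi> \<omega>'))"
    using assms mmult_perm_left(2) by (intro row_finite_kerop) auto
  also have "\<dots> = (\<Sum>\<omega>' | \<omega>' \<in> Omega_inf ?l \<and> h (link ?l \<omega> \<omega>') \<noteq> 0. scale (h (link ?l \<omega> \<omega>')) (\<phi> (?L \<omega>')))"
  proof (rule sum.reindex_bij_witness[where i = ?L and j = ?I])
    fix \<omega>' assume a: "\<omega>' \<in> {\<omega>' \<in> Omega_inf ?l. h (link ?l (?L \<omega>) \<omega>') \<noteq> 0}"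
    then have e: "link ?l (?L \<omega>) \<omega>' = link ?l \<omega> (?I \<omega>')"
      using link_perm_left[OF assms(3,4) mmult_perm_left(2)[OF i, of \<omega>']] LI(1)[of \<omega>'] by simp
    show "?L (?I \<omega>') = \<omega>'" using LI a by blast
    show "?I \<omega>' \<in> {\<omega>' \<in> Omega_inf ?l. h (link ?l \<omega> \<omega>') \<noteq> 0}"
      using a mmult_perm_left(2)[OF i] by (simp add: e)
    show "scale (h (link ?l \<omega> (?I \<omega>'))) (\<phi> (?L (?I \<omega>'))) = scale (h (link ?l (?L \<omega>) \<omega>')) (\<phi> \<omega>')"
      using LI a by (simp add: e)
  next
    fix \<omega>' assume a: "\<omega>' \<in> {\<omega>' \<in> Omega_inf ?l. h (link ?l \<omega> \<omega>') \<noteq> 0}"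
    then show "?I (?L \<omega>') = \<omega>'" "?L \<omega>' \<in> {\<omega>' \<in> Omega_inf ?l. h (link ?l (?L \<omega>) \<omega>') \<noteq> 0}"
      using LI mmult_perm_left(2)[OF assms(3)] link_perm_left[OF assms(3,4)] by simp_all
  qed
  also have "\<dots> = pi_rep s (kerop ?l h \<phi> \<omega>)"
    using assms by (simp add: row_finite_kerop pi_rep_sum pi_rep_scale H_T_equivariant)
  finally show ?thesis .
qed

lemma Op_H_T:
  assumes "schur (ysize \<mu>) h C" "\<phi> \<in> H_T \<mu>"
  shows "Op \<mu> h \<phi> \<in> H_T \<mu>" "nrm2 (ysize \<mu>) (Op \<mu> h \<phi>) \<le> C\<^sup>2 * nrm2 (ysize \<mu>) \<phi>"
proof -
  let ?l = "ysize \<mu>"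
  have rf: "row_finite ?l h" using assms by (simp add: schur_def)
  have "(\<Sum>\<omega>\<in>F. norm_sq (Op \<mu> h \<phi> \<omega>)) \<le> C\<^sup>2 * nrm2 ?l \<phi>" if "finite F" "F \<subseteq> Omega_inf ?l" for F
  proof -
    have "(\<Sum>\<omega>\<in>F. norm_sq (Op \<mu> h \<phi> \<omega>)) = (\<Sum>\<omega>\<in>F. norm_sq (kerop ?l h \<phi> \<omega>))"
      using that assms(2) by (intro sum.cong) (auto simp: Op_def)
    then show ?thesis
      using schur_bound[OF assms(1) H_T_sqsum[OF assms(2)] that] sqsum_finite_le[OF H_T_sqsum[OF assms(2)]] by auto
  qed
  note * = sqsumI[OF this]
  show "nrm2 ?l (Op \<mu> h \<phi>) \<le> C\<^sup>2 * nrm2 ?l \<phi>" by (rule *)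
  have "kerop ?l h \<phi> \<omega> \<in> H_pi \<mu>" for \<omega>
    unfolding kerop_def by (rule H_pi_sum, rule H_pi_scale, rule H_T_pi[OF assms(2)])
  then show "Op \<mu> h \<phi> \<in> H_T \<mu>"
    unfolding H_T_def mem_Collect_eq
  proof (intro conjI allI impI ballI *(1))
    fix s \<omega> assume s: "s \<in> Sym ?l" "\<omega> \<in> Omega_inf ?l"
    then show "Op \<mu> h \<phi> (mmult (perm_matr s) \<omega>) = pi_rep s (Op \<mu> h \<phi> \<omega>)"
      using kerop_equivariant[OF assms(2) rf s] mmult_perm_left(2)[OF s] assms(2) by (simp add: Op_def)
  qed (use assms(2) in \<open>simp_all add: Op_def\<close>)
qed

lemma H_T_add: "\<phi> \<in> H_T \<mu> \<Longrightarrow> \<psi> \<in> H_T \<mu> \<Longrightarrow> (\<lambda>\<omega>. \<phi> \<omega> + \<psi> \<omega>) \<in> H_T \<mu>"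
proof -
  assume a: "\<phi> \<in> H_T \<mu>" "\<psi> \<in> H_T \<mu>"
  let ?l = "ysize \<mu>"
  have "(\<Sum>\<omega>\<in>F. norm_sq (\<phi> \<omega> + \<psi> \<omega>)) \<le> 2 * nrm2 ?l \<phi> + 2 * nrm2 ?l \<psi>" if "finite F" "F \<subseteq> Omega_inf ?l" for F
  proof -
    have "(\<Sum>\<omega>\<in>F. norm_sq (\<phi> \<omega> + \<psi> \<omega>)) \<le> (\<Sum>\<omega>\<in>F. 2 * norm_sq (\<phi> \<omega>) + 2 * norm_sq (\<psi> \<omega>))"
      by (intro sum_mono norm_sq_add_le)
    also have "\<dots> \<le> 2 * nrm2 ?l \<phi> + 2 * nrm2 ?l \<psi>"
      using sqsum_finite_le[OF H_T_sqsum[OF a(1)] that] sqsum_finite_le[OF H_T_sqsum[OF a(2)] that]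
      by (simp add: sum.distrib sum_distrib_left[symmetric])
    finally show ?thesis .
  qed
  from sqsumI(1)[OF this] a show ?thesis
    by (auto simp: H_T_def H_pi_add pi_rep_def convolve_add_right)
qed

lemma H_T_scale: "\<phi> \<in> H_T \<mu> \<Longrightarrow> (\<lambda>\<omega>. scale c (\<phi> \<omega>)) \<in> H_T \<mu>"
proof -
  assume a: "\<phi> \<in> H_T \<mu>"
  have "sqsum (ysize \<mu>) (\<lambda>\<omega>. scale c (\<phi> \<omega>))"
    using H_T_sqsum[OF a] by (simp add: norm_sq_scale summable_on_cmult_right)
  with a show ?thesis by (auto simp: H_T_def H_pi_scale pi_rep_scale)
qed

lemma H_T_diff: "\<phi> \<in> H_T \<mu> \<Longrightarrow> \<psi> \<in> H_T \<mu> \<Longrightarrow> (\<lambda>\<omega>. \<phi> \<omega> - \<psi> \<omega>) \<in> H_T \<mu>"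
  using H_T_add[OF _ H_T_scale[of \<psi> \<mu> "- 1"], of \<phi>] by (simp add: scale_minus_one)

lemma Op_End:
  assumes "schur (ysize \<mu>) h C"
  shows "Op \<mu> h \<in> End_T \<mu>"
proof -
  have rf: "row_finite (ysize \<mu>) h" using assms by (simp add: schur_def)
  have "Op \<mu> h \<in> H_T \<mu> \<rightarrow>\<^sub>E H_T \<mu>"
    using Op_H_T(1)[OF assms] by (auto simp: Op_def PiE_def extensional_def)
  moreover have "norm_T \<mu> (Op \<mu> h \<phi>) \<le> \<bar>C\<bar> * norm_T \<mu> \<phi>" if "\<phi> \<in> H_T \<mu>" for \<phi>
    using real_sqrt_le_mono[OF Op_H_T(2)[OF assms that]] by (simp add: norm_T_nrm2 real_sqrt_mult)
  ultimately show ?thesis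
    unfolding End_T_def using kerop_add[OF rf] kerop_scale[OF rf] H_T_add H_T_scale
    by (auto simp: Op_def fun_eq_iff)
qed

text \<open>Grouping the elements g of x by the image of \<omega> puts in front of
  \<open>\<phi> \<omega>'\<close> the total coefficient of those g that cover
  \<open>link l \<omega> \<omega>'\<close>. Only finitely many images occur, hence row finiteness
  for every l.\<close>

lemma T_alg_Op:
  assumes "x \<in> alg_over Sym_inf"
  shows "T_alg \<mu> x = Op \<mu> (hatG x)" "row_finite l (hatG x)"
proof -
  have fin: "finite ((\<lambda>g. mmult \<omega> (perm_matr g)) ` keys x)" for \<omega> by simp
  have sub: "(\<lambda>g. mmult \<omega> (perm_matr g)) ` keys x \<subseteq> Omega_inf l" if "\<omega> \<in> Omega_inf l" for \<omega> l
    using mmult_perm_right(2)[OF _ that] assms by (auto simp: alg_over_def)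
  have zero: "hatG x (link l \<omega> \<omega>') = 0" if "\<omega> \<in> Omega_inf l" "\<omega>' \<in> Omega_inf l"
    "\<omega>' \<notin> (\<lambda>g. mmult \<omega> (perm_matr g)) ` keys x" for \<omega> \<omega>' l
    unfolding hatG_def
    by (rule pairing_eq_0) (use mmult_perm_right_iff[OF _ that(1,2)] that(3) assms in \<open>auto simp: alg_over_def\<close>)
  show "row_finite l (hatG x)"
    unfolding row_finite_def
  proof
    fix \<omega> assume w: "\<omega> \<in> Omega_inf l"
    show "finite {\<omega>' \<in> Omega_inf l. hatG x (link l \<omega> \<omega>') \<noteq> 0}"
      by (rule finite_subset[OF _ fin[of \<omega>]]) (use zero[OF w] in auto)
  qed
  show "T_alg \<mu> x = Op \<mu> (hatG x)"
    unfolding T_alg_def Op_def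
  proof (intro restrict_ext ext)
    fix \<phi> \<omega> assume "\<phi> \<in> H_T \<mu>"
    let ?l = "ysize \<mu>"
    show "(\<Sum>g\<in>keys x. scale (lookup x g) (T_grp \<mu> g \<phi> \<omega>)) =
        (if \<omega> \<in> Omega_inf ?l then kerop ?l (hatG x) \<phi> \<omega> else 0)"
    proof (cases "\<omega> \<in> Omega_inf ?l")
      case w: True
      let ?m = "\<lambda>g. mmult \<omega> (perm_matr g)"
      have "kerop ?l (hatG x) \<phi> \<omega> = (\<Sum>\<omega>'\<in>?m ` keys x. scale (hatG x (link ?l \<omega> \<omega>')) (\<phi> \<omega>'))"
        using sub[OF w] zero[OF w] by (intro kerop_superset fin) auto
      also have "\<dots> = (\<Sum>\<omega>'\<in>?m ` keys x. \<Sum>g\<in>{g \<in> keys x. ?m g = \<omega>'}. scale (lookup x g) (\<phi> (?m g)))"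
      proof (rule sum.cong[OF refl])
        fix \<omega>' assume w': "\<omega>' \<in> ?m ` keys x"
        have "hatG x (link ?l \<omega> \<omega>') = (\<Sum>g\<in>keys x. lookup x g * of_bool (?m g = \<omega>'))"
          unfolding hatG_def pairing_def
          by (rule sum.cong[OF refl]) (use mmult_perm_right_iff[OF _ w, of _ \<omega>'] w' sub[OF w] assms in \<open>auto simp: alg_over_def\<close>)
        also have "\<dots> = (\<Sum>g\<in>{g \<in> keys x. ?m g = \<omega>'}. lookup x g)"
          by (simp add: sum.inter_filter of_bool_def if_distrib cong: if_cong)
        finally show "scale (hatG x (link ?l \<omega> \<omega>')) (\<phi> \<omega>') = (\<Sum>g\<in>{g \<in> keys x. ?m g = \<omega>'}. scale (lookup x g) (\<phi> (?m g)))"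
          by (simp add: grp_alg_vs.scale_sum_left)
      qed
      also have "\<dots> = (\<Sum>g\<in>keys x. scale (lookup x g) (\<phi> (?m g)))"
        by (rule sum.group) auto
      finally show ?thesis using w by (simp add: T_grp_def)
    qed (simp add: T_grp_def)
  qed
qed

section \<open>Decay of invariant coefficients\<close>

text \<open>The arguments beyond m that are not values as well. In a partial injection such a point
  occurs in a single pair, so a transposition can exchange it for any unoccupied point beyond m and
  leave the rest of R alone.\<close>

definition fresh :: "nat \<Rightarrow> (nat \<times> nat) set \<Rightarrow> nat set" where
  "fresh m R = {b \<in> snd ` R. b \<notin> fst ` R \<and> m < b}"

lemma finite_fresh [simp]: "finite R \<Longrightarrow> finite (fresh m R)"
  by (simp add: fresh_def)

lemma pinj_act: "inj \<sigma> \<Longrightarrow> pinj R \<Longrightarrow> pinj (act \<sigma> R)"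
proof -
  assume "inj \<sigma>" "pinj R"
  show ?thesis
  proof (rule pinjI)
    fix a b b' assume "(a, b) \<in> act \<sigma> R" "(a, b') \<in> act \<sigma> R"
    then obtain x y x' y' where "(x, y) \<in> R" "(x', y') \<in> R" "a = \<sigma> x" "b = \<sigma> y" "a = \<sigma> x'" "b' = \<sigma> y'" by force
    then show "b = b'" using pinj_D(1)[OF \<open>pinj R\<close>] injD[OF \<open>inj \<sigma>\<close>] by metis
  next
    fix a a' b assume "(a, b) \<in> act \<sigma> R" "(a', b) \<in> act \<sigma> R"
    then obtain x y x' y' where "(x, y) \<in> R" "(x', y') \<in> R" "a = \<sigma> x" "b = \<sigma> y" "a' = \<sigma> x'" "b = \<sigma> y'" by force
    then show "a = a'" using pinj_D(2)[OF \<open>pinj R\<close>] injD[OF \<open>inj \<sigma>\<close>] by metis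
  qed
qed

lemma act_PI:
  assumes "\<sigma> \<in> Sym n" "R \<in> PI n"
  shows "act \<sigma> R \<in> PI n"
proof -
  have "inj \<sigma>" using assms(1) by (simp add: Sym_bij bij_is_inj)
  moreover have "act \<sigma> R \<subseteq> {1..n} \<times> {1..n}"
  proof
    fix p assume "p \<in> act \<sigma> R"
    then obtain a b where ab: "(a, b) \<in> R" "p = (\<sigma> a, \<sigma> b)" by auto
    then show "p \<in> {1..n} \<times> {1..n}"
      using PI_bounds[OF assms(2) ab(1)] Sym_in[OF assms(1)] by blast
  qed
  ultimately show ?thesis using assms(2) by (simp add: PI_def pinj_act)
qed

text \<open>At most k pairs touch at most 2 k points beyond m. Up to \<open>Sym_stab m n\<close>
  there are thus finitely many such R, with representatives in a set that does not depend on
  n.\<close>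

lemma compress:
  assumes n: "m + 2 * k \<le> n" and R: "R \<in> PI n" "card R \<le> k"
  obtains \<sigma> where "\<sigma> \<in> Sym_stab m n" "act \<sigma> R \<in> PI (m + 2 * k)"
proof -
  define U where "U = (fst ` R \<union> snd ` R) - {1..m}"
  have fR: "finite R" using R by (simp add: PI_finite)
  have bd: "x \<in> {1..n}" if "x \<in> fst ` R \<union> snd ` R" for x using that PI_bounds[OF R(1)] by fastforce
  have U: "U \<subseteq> {m<..n}"
  proof
    fix x assume "x \<in> U"
    then have "x \<in> fst ` R \<union> snd ` R" "x \<notin> {1..m}" unfolding U_def by blast+
    then show "x \<in> {m<..n}" using bd[of x] by simp
  qed
  have fU: "finite U" using U finite_subset by blast
  have "card U \<le> card (fst ` R \<union> snd ` R)" unfolding U_def by (rule card_mono) (use fR in auto)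
  also have "\<dots> \<le> card (fst ` R) + card (snd ` R)" by (rule card_Un_le)
  also have "\<dots> \<le> 2 * k" using card_image_le[OF fR, of fst] card_image_le[OF fR, of snd] R(2) by simp
  finally have cU: "card U \<le> 2 * k" .
  obtain f where f: "bij_betw f U {m<..m + card U}"
    using finite_same_card_bij[OF fU, of "{m<..m + card U}"] by auto
  obtain \<sigma> where s: "\<sigma> permutes {m<..n}" "\<And>x. x \<in> U \<Longrightarrow> \<sigma> x = f x"
    using bij_betw_extend_permutes[OF _ f U] n cU by (metis (no_types, lifting) add_left_mono finite_greaterThanAtMost greaterThanAtMost_subseteq_atLeastAtMost_iff
        order.trans greaterThanAtMost_iff subsetI)
  have st: "\<sigma> \<in> Sym_stab m n" using s(1) n by (simp add: Sym_stab_permutes)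
  have im: "\<sigma> x \<in> {1..m + 2 * k}" if x: "x \<in> fst ` R \<union> snd ` R" for x
  proof (cases "x \<in> U")
    case True
    then have "\<sigma> x \<in> {m<..m + card U}" using s(2) f by (auto simp: bij_betw_def)
    then show ?thesis using cU by auto
  next
    case False
    then have "x \<in> {1..m}" using x by (auto simp: U_def)
    then show ?thesis using Sym_stab_fix[OF st, of x] by simp
  qed
  have "inj \<sigma>" using s(1) by (simp add: permutes_inj)
  then have "pinj (act \<sigma> R)" using R by (simp add: pinj_act PI_pinj)
  moreover have "act \<sigma> R \<subseteq> {1..m + 2 * k} \<times> {1..m + 2 * k}" using im by force
  ultimately show thesis using st that by (simp add: PI_def)
qed

text \<open>A permutation of {1..n} has exactly one preimage of a there, so summing over all
  candidates b for it removes the constraint.\<close>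

lemma hatG_sum_row:
  assumes "x \<in> alg_over (Sym n)" "a \<in> {1..n}"
  shows "(\<Sum>b\<in>{1..n}. hatG x (insert (a, b) R)) = hatG x R"
  unfolding hatG_def pairing_fun_sum[symmetric]
proof (rule pairing_cong)
  fix g assume "g \<in> keys x"
  then have g: "g \<in> Sym n" using assms by (auto simp: alg_over_def)
  have e: "g b = a \<longleftrightarrow> b = ginv g a" for b
    using inv_left[OF Sym_bij[OF g]] inv_right[OF Sym_bij[OF g]] by metis
  have i: "ginv g a \<in> {1..n}" using Sym_in[OF inv_Sym[OF g]] assms(2) by blast
  have "(\<Sum>b\<in>{1..n}. of_bool (covers g (insert (a, b) R)))
      = (\<Sum>b\<in>{1..n}. if b = ginv g a then of_bool (covers g R) else (0::complex))"
    by (intro sum.cong refl) (auto simp: covers_def e)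
  then show "(\<Sum>b\<in>{1..n}. of_bool (covers g (insert (a, b) R))) = (of_bool (covers g R) :: complex)"
    using i by simp
qed

definition bounded_seq :: "nat \<Rightarrow> (nat \<Rightarrow> grp_alg) \<Rightarrow> bool" where
  "bounded_seq m \<alpha> \<longleftrightarrow> (\<forall>\<^sub>F n in sequentially. \<alpha> n \<in> cB m n) \<and>
     (\<forall>k. \<forall>R\<in>PI k. Bseq (\<lambda>n. hatG (\<alpha> n) R))"

text \<open>By \<open>compress\<close> and invariance all values at relations of bounded size occur
  among finitely many sequences, each of them bounded by assumption.\<close>

lemma bounded_seq_uniform:
  assumes "bounded_seq m \<alpha>"
  obtains C N where "0 \<le> C" "\<And>n R. n \<ge> N \<Longrightarrow> R \<in> PI n \<Longrightarrow> card R \<le> k \<Longrightarrow> cmod (hatG (\<alpha> n) R) \<le> C"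
proof -
  obtain N0 where N0: "\<And>n. n \<ge> N0 \<Longrightarrow> \<alpha> n \<in> cB m n"
    using assms by (auto simp: bounded_seq_def eventually_sequentially)
  have "\<forall>R\<in>PI (m + 2 * k). \<exists>B. \<forall>n. cmod (hatG (\<alpha> n) R) \<le> B"
    using assms by (fastforce simp: bounded_seq_def Bseq_def)
  then obtain B where B: "\<And>R n. R \<in> PI (m + 2 * k) \<Longrightarrow> cmod (hatG (\<alpha> n) R) \<le> B R" by metis
  have B0: "0 \<le> B R" if "R \<in> PI (m + 2 * k)" for R using B[OF that] norm_ge_zero order_trans by blast
  show thesis
  proof (rule that[of "\<Sum>R\<in>PI (m + 2 * k). B R" "max N0 (m + 2 * k)"])
    show "0 \<le> (\<Sum>R\<in>PI (m + 2 * k). B R)" by (rule sum_nonneg) (rule B0)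
    fix n R assume a: "max N0 (m + 2 * k) \<le> n" "R \<in> PI n" "card R \<le> k"
    then obtain \<sigma> where s: "\<sigma> \<in> Sym_stab m n" "act \<sigma> R \<in> PI (m + 2 * k)" using compress[of m k n R] by auto
    have "cmod (hatG (\<alpha> n) R) = cmod (hatG (\<alpha> n) (act \<sigma> R))"
      using hatG_invariant[OF N0 s(1)] a(1) by simp
    also have "\<dots> \<le> B (act \<sigma> R)" by (rule B[OF s(2)])
    also have "\<dots> \<le> (\<Sum>R\<in>PI (m + 2 * k). B R)" by (rule member_le_sum) (use s B0 in auto)
    finally show "cmod (hatG (\<alpha> n) R) \<le> (\<Sum>R\<in>PI (m + 2 * k). B R)" .
  qed
qed

text \<open>The coefficient sum over all images of one point is a coefficient of smaller rank, and by
  invariance all fresh images contribute equally; so every fresh point gains a factor \<open>1 / n\<close>.\<close>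

lemma bounded_seq_decay:
  assumes \<alpha>: "bounded_seq m \<alpha>"
  shows "\<exists>C N. 0 \<le> C \<and> (\<forall>n\<ge>N. \<forall>R\<in>PI n. card R \<le> k \<and> t \<le> card (fresh m R) \<longrightarrow> cmod (hatG (\<alpha> n) R) * real n ^ t \<le> C)"
proof (induction t)
  case 0
  from bounded_seq_uniform[OF \<alpha>, of k] show ?case
    by (metis (no_types, lifting) mult.right_neutral power_0)
next
  case (Suc t)
  then obtain C N where C: "0 \<le> C" and CN: "\<And>n R. n \<ge> N \<Longrightarrow> R \<in> PI n \<Longrightarrow> card R \<le> k \<Longrightarrow> t \<le> card (fresh m R) \<Longrightarrow>
      cmod (hatG (\<alpha> n) R) * real n ^ t \<le> C" by blast
  obtain N0 where N0: "\<And>n. n \<ge> N0 \<Longrightarrow> \<alpha> n \<in> cB m n"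
    using \<alpha> by (auto simp: bounded_seq_def eventually_sequentially)
  let ?q = "m + 2 * k"
  show ?case
  proof (intro exI conjI allI impI ballI)
    \<comment> \<open>The relation R0 and the at most ?q exceptional images in S contribute the
      factor 1 + ?q. The factor 2 appears because at least half of {1..n} lies outside S once n
      exceeds 2 * ?q.\<close>
    show "0 \<le> 2 * (1 + real ?q) * C" using C by simp
    fix n R assume n: "max (max N N0) (2 * ?q + 1) \<le> n" and R: "R \<in> PI n"
      and c: "card R \<le> k \<and> Suc t \<le> card (fresh m R)"
    have cB: "\<alpha> n \<in> cB m n" using N0 n by simp
    have al: "\<alpha> n \<in> alg_over (Sym n)" using cB by (rule cB_alg_over)
    have fR: "finite R" using R by (rule PI_finite)
    have "fresh m R \<noteq> {}" using c by auto
    then obtain b where "b \<in> fresh m R" by blast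
    then obtain a where ab: "(a, b) \<in> R" "b \<in> fresh m R" by (auto simp: fresh_def)
    have bf: "b \<notin> fst ` R" "m < b" using ab(2) by (auto simp: fresh_def)
    have rng: "a \<in> {1..n}" "b \<in> {1..n}" using PI_bounds[OF R ab(1)] by blast+
    define R0 where "R0 = R - {(a, b)}"
    have R0: "insert (a, b) R0 = R" "R0 \<subseteq> R" "finite R0" "card R0 \<le> k" "R0 \<in> PI n"
    proof -
      show "insert (a, b) R0 = R" "R0 \<subseteq> R" using ab(1) unfolding R0_def by blast+
      then show "finite R0" "R0 \<in> PI n" using fR finite_subset PI_subset[OF R] by blast+
      show "card R0 \<le> k" using card_mono[OF fR \<open>R0 \<subseteq> R\<close>] c by linarith
    qed
    have bR0: "b \<notin> snd ` R0"
    proof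
      assume "b \<in> snd ` R0"
      then obtain a' where "(a', b) \<in> R0" by auto
      then show False using pinj_D(2)[OF PI_pinj[OF R] ab(1), of a'] by (simp add: R0_def)
    qed
    define S where "S = fst ` R \<union> snd ` R0 \<union> {1..m}"
    have cS: "card S \<le> ?q"
    proof -
      have "card S \<le> card (fst ` R) + card (snd ` R0) + card {1..m}"
        unfolding S_def
        using card_Un_le[of "fst ` R \<union> snd ` R0" "{1..m}"] card_Un_le[of "fst ` R" "snd ` R0"] by linarith
      also have "\<dots> \<le> k + k + m"
        using card_image_le[OF fR, of fst] card_image_le[OF R0(3), of snd] R0(4) c by simp
      finally show ?thesis by simp
    qed
    have fS: "finite S" using fR R0(3) by (simp add: S_def)
    have frR: "y \<in> snd ` R0 \<and> y \<notin> fst ` R \<and> m < y" if y: "y \<in> fresh m R - {b}" for y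
    proof -
      obtain x where "(x, y) \<in> R" using y by (auto simp: fresh_def)
      then have "(x, y) \<in> R0" using y by (simp add: R0_def)
      then have "y \<in> snd ` R0" by (metis imageI snd_conv)
      then show ?thesis using y by (simp add: fresh_def)
    qed
    have aR: "a \<in> fst ` R" using ab(1) by (metis fst_conv imageI)
    have frR0: "fresh m R - {b} \<subseteq> fresh m (insert (a, b') R0)" for b'
    proof
      fix y assume "y \<in> fresh m R - {b}"
      then show "y \<in> fresh m (insert (a, b') R0)"
        using frR[of y] image_mono[OF R0(2), of fst] aR
        unfolding fresh_def image_insert mem_Collect_eq fst_conv snd_conv by blast
    qed
    have frR0': "fresh m R - {b} \<subseteq> fresh m R0"
    proof
      fix y assume "y \<in> fresh m R - {b}"
      then show "y \<in> fresh m R0"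
        using frR[of y] image_mono[OF R0(2), of fst] unfolding fresh_def mem_Collect_eq by blast
    qed
    have ct: "t \<le> card (fresh m R - {b})" 
      using c card_Diff_singleton[OF ab(2)] by linarith
    have t0: "t \<le> card (fresh m R0)" using card_mono[OF finite_fresh[OF R0(3)] frR0'] ct by linarith
    \<comment> \<open>The transposition of b and b' fixes {1..m} and touches no other entry of R,
      because b is fresh and b' is unoccupied.\<close>
    have gen: "hatG (\<alpha> n) (insert (a, b') R0) = hatG (\<alpha> n) R" if b': "b' \<in> {1..n} - S" for b'
    proof -
      have bm: "m < b'" using b' by (auto simp: S_def)
      let ?t = "transpose b b'"
      have st: "?t \<in> Sym_stab m n"
        using rng b' bf bm by (auto simp: Sym_stab_def Sym_def transpose_def intro!: permutes_swap_id)
      have fixed: "?t x = x" if "x \<in> fst ` R \<union> snd ` R0" for x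
        using that bf(1) bR0 R0(2) b' by (auto simp: S_def transpose_def)
      have "act ?t R = act ?t (insert (a, b) R0)" by (simp only: R0(1))
      also have "\<dots> = insert (?t a, ?t b) ((\<lambda>p. (?t (fst p), ?t (snd p))) ` R0)"
        by (simp add: map_prod_def split_beta)
      also have "(\<lambda>p. (?t (fst p), ?t (snd p))) ` R0 = (\<lambda>p. p) ` R0"
      proof (rule image_cong[OF refl])
        fix p assume p: "p \<in> R0"
        then have "fst p \<in> fst ` R" "snd p \<in> snd ` R0" using R0(2) by auto
        then show "(?t (fst p), ?t (snd p)) = p" using fixed by simp
      qed
      also have "?t a = a" using fixed ab(1) by force
      finally have "act ?t R = insert (a, b') R0" by simp
      then show ?thesis using hatG_invariant[OF cB st, of R] by simp
    qed
    \<comment> \<open>For every image b' the relation either fails to be injective, and the value is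
      0, or it retains t fresh points, and the induction hypothesis applies.\<close>
    have small: "cmod (hatG (\<alpha> n) (insert (a, b') R0)) * real n ^ t \<le> C" if b': "b' \<in> {1..n}" for b'
    proof (cases "pinj (insert (a, b') R0)")
      case True
      have "insert (a, b') R0 \<in> PI n" using True R0(5) rng b' by (auto simp: PI_def)
      moreover have "card (insert (a, b') R0) \<le> k"
        using card_insert_le_m1[of k R0 "(a, b')"] c R0 card_Suc_Diff1[OF fR ab(1)]
        by (simp add: card_insert_if R0_def)
      moreover have "t \<le> card (fresh m (insert (a, b') R0))"
        using card_mono[OF finite_fresh frR0, of b'] R0(3) ct by force
      ultimately show ?thesis using CN n by simp
    qed (use C hatG_not_pinj[OF al] in simp)
    have "hatG (\<alpha> n) R0 = (\<Sum>b'\<in>{1..n}. hatG (\<alpha> n) (insert (a, b') R0))"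
      using hatG_sum_row[OF al rng(1), of R0] by simp
    also have "\<dots> = (\<Sum>b'\<in>{1..n} - S. hatG (\<alpha> n) (insert (a, b') R0)) + (\<Sum>b'\<in>{1..n} \<inter> S. hatG (\<alpha> n) (insert (a, b') R0))"
      by (subst sum.union_disjoint[symmetric]) (auto intro!: arg_cong[where f = "sum _"] simp: fS)
    also have "(\<Sum>b'\<in>{1..n} - S. hatG (\<alpha> n) (insert (a, b') R0)) = of_nat (card ({1..n} - S)) * hatG (\<alpha> n) R"
      by (simp add: gen)
    finally have eq: "of_nat (card ({1..n} - S)) * hatG (\<alpha> n) R = hatG (\<alpha> n) R0 - (\<Sum>b'\<in>{1..n} \<inter> S. hatG (\<alpha> n) (insert (a, b') R0))"
      by simp
    let ?X = "cmod (hatG (\<alpha> n) R) * real n ^ t"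
    have "real (card ({1..n} - S)) * ?X = cmod (hatG (\<alpha> n) R0 - (\<Sum>b'\<in>{1..n} \<inter> S. hatG (\<alpha> n) (insert (a, b') R0))) * real n ^ t"
      unfolding eq[symmetric] by (simp add: norm_mult)
    also have "\<dots> \<le> (cmod (hatG (\<alpha> n) R0) + (\<Sum>b'\<in>{1..n} \<inter> S. cmod (hatG (\<alpha> n) (insert (a, b') R0)))) * real n ^ t"
      by (intro mult_right_mono order_trans[OF norm_triangle_ineq4] add_left_mono norm_sum) simp
    also have "\<dots> = cmod (hatG (\<alpha> n) R0) * real n ^ t + (\<Sum>b'\<in>{1..n} \<inter> S. cmod (hatG (\<alpha> n) (insert (a, b') R0)) * real n ^ t)"
      by (simp add: distrib_right sum_distrib_right)
    also have "\<dots> \<le> C + (\<Sum>b'\<in>{1..n} \<inter> S. C)"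
      using CN[of n R0] n R0(4,5) t0 by (intro add_mono sum_mono small) auto
    also have "\<dots> \<le> (1 + real ?q) * C"
    proof -
      have "card ({1..n} \<inter> S) \<le> ?q" using card_mono[OF fS, of "{1..n} \<inter> S"] cS by simp
      then have "real (card ({1..n} \<inter> S)) * C \<le> real ?q * C" using C by (intro mult_right_mono) simp_all
      then show ?thesis by (simp add: distrib_right)
    qed
    finally have up: "real (card ({1..n} - S)) * ?X \<le> (1 + real ?q) * C" .
    have "n - ?q \<le> card ({1..n} - S)"
      using diff_card_le_card_Diff[OF fS, of "{1..n}"] cS by simp
    moreover have "2 * ?q + 1 \<le> n" using n by simp
    ultimately have "n \<le> 2 * card ({1..n} - S)" by arith
    then have "real n / 2 \<le> real (card ({1..n} - S))" by linarith
    then have "real n / 2 * ?X \<le> real (card ({1..n} - S)) * ?X" by (intro mult_right_mono) simp_all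
    with up have "real n / 2 * ?X \<le> (1 + real ?q) * C" by linarith
    then show "cmod (hatG (\<alpha> n) R) * real n ^ Suc t \<le> 2 * (1 + real ?q) * C" by (simp add: mult_ac)
  qed
qed

text \<open>Designed to write the decay as a product over rows while the total mass stays bounded in
  n: at most \<open>card A + m\<close> points of weight 1 and at most n points of weight 1 / n.
  Points beyond n are fixed by \<open>Sym n\<close> and can be linked only to themselves, so outside
  A they may receive weight 0.\<close>

definition weight :: "nat \<Rightarrow> nat \<Rightarrow> nat set \<Rightarrow> nat \<Rightarrow> real" where
  "weight m n A z = (if z \<in> A \<union> {1..m} then 1 else if z \<in> {1..n} then 1 / real n else 0)"

lemma weight_nonneg: "0 \<le> weight m n A z"
  by (simp add: weight_def)

text \<open>Permutations in \<open>Sym n\<close> fix every point beyond n. Positions of \<omega> are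
  not confined to {1..n}, so a link has to be cut down to the square before the decay estimate
  applies to it.\<close>

lemma hatG_restrict:
  assumes x: "x \<in> alg_over (Sym n)" and h: "hatG x R \<noteq> 0"
  shows "hatG x R = hatG x (R \<inter> {1..n} \<times> {1..n})" "\<And>a b. (a, b) \<in> R \<Longrightarrow> b \<notin> {1..n} \<or> a \<notin> {1..n} \<Longrightarrow> a = b"
proof -
  obtain g where g: "g \<in> keys x" "covers g R"
  proof -
    have "\<exists>g\<in>keys x. covers g R"
    proof (rule ccontr)
      assume "\<not> (\<exists>g\<in>keys x. covers g R)"
      then have "hatG x R = 0" unfolding hatG_def by (intro pairing_eq_0) simp
      with h show False by simp
    qed
    then show thesis using that by blast
  qed
  have gS: "g \<in> Sym n" using x g by (auto simp: alg_over_def)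
  show d: "a = b" if "(a, b) \<in> R" "b \<notin> {1..n} \<or> a \<notin> {1..n}" for a b
  proof -
    have gb: "g b = a" using g(2) that(1) by (auto simp: covers_def)
    then have "b \<notin> {1..n}" using that(2) Sym_in[OF gS, of b] by metis
    then show ?thesis using Sym_fix[OF gS] gb by simp
  qed
  show "hatG x R = hatG x (R \<inter> {1..n} \<times> {1..n})"
    unfolding hatG_def
  proof (rule pairing_cong)
    fix k assume "k \<in> keys x"
    then have k: "k \<in> Sym n" using x by (auto simp: alg_over_def)
    have "covers k R \<longleftrightarrow> covers k (R \<inter> {1..n} \<times> {1..n})"
    proof
      assume c: "covers k (R \<inter> {1..n} \<times> {1..n})"
      show "covers k R" unfolding covers_def
      proof (clarify)
        fix a b assume ab: "(a, b) \<in> R"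
        show "k b = a"
        proof (cases "a \<in> {1..n} \<and> b \<in> {1..n}")
          case True
          then have "(a, b) \<in> R \<inter> {1..n} \<times> {1..n}" using ab by blast
          then show ?thesis using c unfolding covers_def by blast
        next
          case False then have "a = b" "b \<notin> {1..n}" using d[OF ab] by auto
          then show ?thesis using Sym_fix[OF k] by simp
        qed
      qed
    qed (auto intro: covers_mono)
    then show "of_bool (covers k R) = (of_bool (covers k (R \<inter> {1..n} \<times> {1..n})) :: complex)" by simp
  qed
qed

text \<open>The rows of \<omega>' with weight 1 / n form the set J, and their positions are fresh in
  the link cut down to the square. So \<open>bounded_seq_decay\<close> with t =
  \<open>card J\<close> supplies exactly the power of 1 / n contained in the product of
  weights.\<close>

lemma kernel_bound:
  assumes \<alpha>: "bounded_seq m \<alpha>"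
  shows "\<exists>C N. 0 \<le> C \<and> (\<forall>n\<ge>N. \<forall>\<omega>\<in>Omega_inf l. \<forall>\<omega>'\<in>Omega_inf l.
     cmod (hatG (\<alpha> n) (link l \<omega> \<omega>')) \<le> C * (\<Prod>i\<in>{1..l}. weight m n (pos \<omega> ` {1..l}) (pos \<omega>' i)))"
proof -
  have "\<forall>t. \<exists>p. 0 \<le> fst p \<and> (\<forall>n\<ge>snd p. \<forall>R\<in>PI n. card R \<le> l \<and> t \<le> card (fresh m R) \<longrightarrow> cmod (hatG (\<alpha> n) R) * real n ^ t \<le> fst p)"
    using bounded_seq_decay[OF \<alpha>, of l] by (metis fst_conv snd_conv)
  then obtain P :: "nat \<Rightarrow> real \<times> nat" where P: "\<And>t. 0 \<le> fst (P t)" "\<And>t n R. n \<ge> snd (P t) \<Longrightarrow> R \<in> PI n \<Longrightarrow> card R \<le> l \<Longrightarrow> t \<le> card (fresh m R) \<Longrightarrow>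
      cmod (hatG (\<alpha> n) R) * real n ^ t \<le> fst (P t)" by metis
  define C where "C = (\<Sum>t\<le>l. fst (P t))"
  define N where "N = (\<Sum>t\<le>l. snd (P t))"
  have C: "fst (P t) \<le> C" "snd (P t) \<le> N" if "t \<le> l" for t
    using that P(1) unfolding C_def N_def by (intro member_le_sum; simp)+
  obtain N0 where N0: "\<And>n. n \<ge> N0 \<Longrightarrow> \<alpha> n \<in> cB m n"
    using \<alpha> by (auto simp: bounded_seq_def eventually_sequentially)
  show ?thesis
  proof (intro exI conjI allI impI ballI)
    show C0: "0 \<le> C" unfolding C_def by (intro sum_nonneg P(1))
    fix n \<omega> \<omega>' assume n: "Suc (max N N0) \<le> n" and w: "\<omega> \<in> Omega_inf l" "\<omega>' \<in> Omega_inf l"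
    let ?R = "link l \<omega> \<omega>'" and ?W = "weight m n (pos \<omega> ` {1..l})"
    have "N0 \<le> n" "N \<le> n" "0 < n" using n by auto
    have al: "\<alpha> n \<in> alg_over (Sym n)" using cB_alg_over[OF N0[OF \<open>N0 \<le> n\<close>]] .
    show "cmod (hatG (\<alpha> n) ?R) \<le> C * (\<Prod>i\<in>{1..l}. ?W (pos \<omega>' i))"
    proof (cases "hatG (\<alpha> n) ?R = 0")
      case True
      then show ?thesis using C0 by (simp add: prod_nonneg weight_nonneg)
    next
      case False
      note r = hatG_restrict[OF al False]
      let ?Rn = "?R \<inter> {1..n} \<times> {1..n}"
      define J where "J = {i \<in> {1..l}. pos \<omega>' i \<notin> pos \<omega> ` {1..l} \<union> {1..m}}"
      have inN: "(pos \<omega> i, pos \<omega>' i) \<in> ?Rn" if "i \<in> J" for i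
      proof -
        have i: "(pos \<omega> i, pos \<omega>' i) \<in> ?R" using that by (auto simp: J_def link_def)
        have "pos \<omega>' i \<noteq> pos \<omega> i" using that by (auto simp: J_def)
        then show ?thesis using r(2)[OF i] i by auto
      qed
      have "(\<Prod>i\<in>{1..l}. ?W (pos \<omega>' i)) = (\<Prod>i\<in>{1..l}. if i \<in> J then 1 / real n else 1)"
        using inN by (intro prod.cong refl) (auto simp: weight_def J_def)
      also have "\<dots> = (1 / real n) ^ card J"
        by (simp add: prod.If_cases J_def Int_def)
      finally have W: "(\<Prod>i\<in>{1..l}. ?W (pos \<omega>' i)) = (1 / real n) ^ card J" .
      have sub: "pos \<omega>' ` J \<subseteq> fresh m ?Rn"
      proof
        fix b assume "b \<in> pos \<omega>' ` J"
        then obtain i where i: "i \<in> J" "b = pos \<omega>' i" by blast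
        have "fst ` ?Rn \<subseteq> pos \<omega> ` {1..l}" using fst_link[of l \<omega> \<omega>'] by blast
        then have "b \<notin> fst ` ?Rn" using i by (auto simp: J_def)
        moreover have "b \<in> snd ` ?Rn" using inN[OF i(1)] i(2) by force
        moreover have "m < b" using i pos_ge_1[OF w(2), of "pos \<omega>' i"] pos_ge_1[OF w(2), of i] by (auto simp: J_def)
        ultimately show "b \<in> fresh m ?Rn" by (simp add: fresh_def)
      qed
      have "inj_on (pos \<omega>') J" using pos_inj[OF w(2)] by (rule inj_on_subset) (auto simp: J_def)
      then have "card J = card (pos \<omega>' ` J)" by (simp add: card_image)
      also have "\<dots> \<le> card (fresh m ?Rn)" by (intro card_mono sub finite_fresh) simp
      finally have cJ: "card J \<le> card (fresh m ?Rn)" .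
      have Jl: "card J \<le> l" 
      proof -
        have "J \<subseteq> {1..l}" unfolding J_def by blast
        then show ?thesis using card_mono[of "{1..l}" J] by simp
      qed
      have "?Rn \<in> PI n" using pinj_subset[OF link_pinj[OF w]] by (auto simp: PI_def)
      moreover have "card ?Rn \<le> l" using card_mono[of ?R ?Rn] card_link[OF w(1)] by simp
      ultimately have "cmod (hatG (\<alpha> n) ?Rn) * real n ^ card J \<le> fst (P (card J))"
        using P(2)[of "card J" n ?Rn] cJ C(2)[OF Jl] n by simp
      also have "\<dots> \<le> C" by (rule C(1)[OF Jl])
      finally have "cmod (hatG (\<alpha> n) ?R) * real n ^ card J \<le> C" using r(1) by simp
      then show ?thesis unfolding W using n by (simp add: field_simps power_divide)
    qed
  qed
qed

text \<open>Enlarging the injective words to all functions from {1..l} to Z factors the sum into the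
  l-th power of a one-letter sum.\<close>

lemma weight_sum:
  assumes "B \<subseteq> Omega_inf l" "finite B" "finite A" "0 < n"
  shows "(\<Sum>\<omega>'\<in>B. \<Prod>i\<in>{1..l}. weight m n A (pos \<omega>' i)) \<le> (real (card A) + real m + 1) ^ l"
proof -
  define Z where "Z = (\<Union>\<omega>'\<in>B. pos \<omega>' ` {1..l})"
  have fZ: "finite Z" using assms by (simp add: Z_def)
  let ?e = "\<lambda>\<omega>'. restrict (pos \<omega>') {1..l}"
  have inj: "inj_on ?e B"
  proof (rule inj_onI)
    fix \<omega> \<omega>' assume a: "\<omega> \<in> B" "\<omega>' \<in> B" "?e \<omega> = ?e \<omega>'"
    have "pos \<omega> i = pos \<omega>' i" if "i \<in> {1..l}" for i using fun_cong[OF a(3), of i] that by simp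
    then show "\<omega> = \<omega>'" using Omega_eqI a(1,2) assms(1) by blast
  qed
  have "(\<Sum>\<omega>'\<in>B. \<Prod>i\<in>{1..l}. weight m n A (pos \<omega>' i)) = (\<Sum>f\<in>?e ` B. \<Prod>i\<in>{1..l}. weight m n A (f i))"
  proof -
    have "(\<Prod>i\<in>{1..l}. weight m n A (pos \<omega>' i)) = (\<Prod>i\<in>{1..l}. weight m n A (?e \<omega>' i))" for \<omega>'
      by (rule prod.cong) auto
    then show ?thesis by (simp only: sum.reindex[OF inj] comp_def)
  qed
  also have "\<dots> \<le> (\<Sum>f\<in>PiE {1..l} (\<lambda>_. Z). \<Prod>i\<in>{1..l}. weight m n A (f i))"
  proof (rule sum_mono2)
    show "finite (PiE {1..l} (\<lambda>_. Z))" using fZ by (intro finite_PiE) auto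
    show "?e ` B \<subseteq> PiE {1..l} (\<lambda>_. Z)" by (auto simp: Z_def)
  qed (intro prod_nonneg ballI weight_nonneg)
  also have "\<dots> = (\<Prod>i\<in>{1..l}. \<Sum>z\<in>Z. weight m n A z)"
    by (rule prod_sum_PiE[symmetric]) (use fZ in auto)
  also have "\<dots> = (\<Sum>z\<in>Z. weight m n A z) ^ l" by simp
  also have "\<dots> \<le> (real (card A) + real m + 1) ^ l"
  proof (rule power_mono)
    show "0 \<le> (\<Sum>z\<in>Z. weight m n A z)" by (intro sum_nonneg weight_nonneg)
    have "(\<Sum>z\<in>Z. weight m n A z) \<le> (\<Sum>z\<in>Z. of_bool (z \<in> A \<union> {1..m}) + of_bool (z \<in> {1..n}) * (1 / real n))"
      by (rule sum_mono) (auto simp: weight_def)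
    also have "\<dots> = real (card (Z \<inter> (A \<union> {1..m}))) + real (card (Z \<inter> {1..n})) * (1 / real n)"
      using fZ by (simp add: sum.distrib sum_of_bool_eq sum_divide_distrib[symmetric] Int_def of_bool_def sum.If_cases)
    also have "\<dots> \<le> (real (card A) + real m) + 1"
    proof (rule add_mono)
      have "card (Z \<inter> (A \<union> {1..m})) \<le> card (A \<union> {1..m})" using assms(3) by (intro card_mono) auto
      also have "\<dots> \<le> card A + m" using card_Un_le[of A "{1..m}"] by simp
      finally show "real (card (Z \<inter> (A \<union> {1..m}))) \<le> real (card A) + real m" by linarith
      have "card (Z \<inter> {1..n}) \<le> n" using card_mono[of "{1..n}" "Z \<inter> {1..n}"] by simp
      then show "real (card (Z \<inter> {1..n})) * (1 / real n) \<le> 1" using assms(4) by (simp add: field_simps)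
    qed
    finally show "(\<Sum>z\<in>Z. weight m n A z) \<le> real (card A) + real m + 1" .
  qed
  finally show ?thesis .
qed

text \<open>Inversion of group elements replaces R by its converse, hence transposes kernels, and it
  preserves the centralizers. The column estimates are the row estimates of the inverted
  sequence.\<close>

lemma linear_ext_inv_cB:
  assumes "x \<in> cB m n"
  shows "linear_ext ginv x \<in> cB m n"
proof (rule cB_I)
  have x: "x \<in> alg_over (Sym n)" using assms by (rule cB_alg_over)
  show "linear_ext ginv x \<in> alg_over (Sym n)"
    unfolding linear_ext_def using x by (intro alg_over_sum alg_over_single inv_Sym) (auto simp: alg_over_def)
  fix \<phi> :: "_ \<Rightarrow> complex" and \<sigma> assume s: "\<sigma> \<in> Sym_stab m n"
  then have b: "bij \<sigma>" using Sym_stab_subset Sym_bij by blast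
  have "ginv (\<sigma> \<circ> g \<circ> ginv \<sigma>) = \<sigma> \<circ> ginv g \<circ> ginv \<sigma>" if "g \<in> keys x" for g
  proof -
    have "bij g" using that x Sym_bij by (auto simp: alg_over_def)
    then show ?thesis using b by (simp add: o_inv_distrib inv_inv_eq bij_imp_bij_inv bij_comp comp_assoc)
  qed
  then show "pairing \<phi> (linear_ext ginv x) = pairing (\<lambda>g. \<phi> (\<sigma> \<circ> g \<circ> ginv \<sigma>)) (linear_ext ginv x)"
    unfolding pairing_linear_ext by (subst cB_invariant[OF assms s]) (simp cong: pairing_cong)
qed

lemma hatG_linear_ext_inv:
  assumes "x \<in> alg_over (Sym n)"
  shows "hatG (linear_ext ginv x) R = hatG x (R\<inverse>)"
  unfolding hatG_def pairing_linear_ext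
proof (rule pairing_cong)
  fix g assume "g \<in> keys x"
  then have "bij g" using assms Sym_bij by (auto simp: alg_over_def)
  then show "of_bool (covers (ginv g) R) = (of_bool (covers g (R\<inverse>)) :: complex)" by (simp add: covers_inv)
qed

lemma bounded_seq_inv:
  assumes "bounded_seq m \<alpha>"
  shows "bounded_seq m (\<lambda>n. linear_ext ginv (\<alpha> n))"
  unfolding bounded_seq_def
proof (intro conjI allI ballI)
  have ev: "\<forall>\<^sub>F n in sequentially. \<alpha> n \<in> cB m n" using assms by (simp add: bounded_seq_def)
  then show "\<forall>\<^sub>F n in sequentially. linear_ext ginv (\<alpha> n) \<in> cB m n"
    by eventually_elim (rule linear_ext_inv_cB)
  fix k R assume "R \<in> PI k"
  then have "Bseq (\<lambda>n. hatG (\<alpha> n) (R\<inverse>))" using assms PI_converse by (auto simp: bounded_seq_def)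
  moreover have "\<forall>\<^sub>F n in sequentially. norm (hatG (linear_ext ginv (\<alpha> n)) R) \<le> norm (hatG (\<alpha> n) (R\<inverse>))"
    using ev by eventually_elim (simp add: hatG_linear_ext_inv[OF cB_alg_over])
  ultimately show "Bseq (\<lambda>n. hatG (linear_ext ginv (\<alpha> n)) R)" by (rule Bseq_eventually_mono[rotated])
qed

lemma kernel_bound_col:
  assumes \<alpha>: "bounded_seq m \<alpha>"
  shows "\<exists>C N. 0 \<le> C \<and> (\<forall>n\<ge>N. \<forall>\<omega>\<in>Omega_inf l. \<forall>\<omega>'\<in>Omega_inf l.
     cmod (hatG (\<alpha> n) (link l \<omega>' \<omega>)) \<le> C * (\<Prod>i\<in>{1..l}. weight m n (pos \<omega> ` {1..l}) (pos \<omega>' i)))"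
proof -
  obtain C N where "0 \<le> C" and CN: "\<And>n \<omega> \<omega>'. n \<ge> N \<Longrightarrow> \<omega> \<in> Omega_inf l \<Longrightarrow> \<omega>' \<in> Omega_inf l \<Longrightarrow>
     cmod (hatG (linear_ext ginv (\<alpha> n)) (link l \<omega> \<omega>')) \<le> C * (\<Prod>i\<in>{1..l}. weight m n (pos \<omega> ` {1..l}) (pos \<omega>' i))"
    using kernel_bound[OF bounded_seq_inv[OF \<alpha>], of l] by blast
  obtain N0 where N0: "\<And>n. n \<ge> N0 \<Longrightarrow> \<alpha> n \<in> cB m n"
    using \<alpha> by (auto simp: bounded_seq_def eventually_sequentially)
  have "cmod (hatG (\<alpha> n) (link l \<omega>' \<omega>)) \<le> C * (\<Prod>i\<in>{1..l}. weight m n (pos \<omega> ` {1..l}) (pos \<omega>' i))"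
    if "n \<ge> max N N0" "\<omega> \<in> Omega_inf l" "\<omega>' \<in> Omega_inf l" for n \<omega> \<omega>'
    using CN[of n \<omega> \<omega>'] that hatG_linear_ext_inv[OF cB_alg_over[OF N0], of n "link l \<omega> \<omega>'"]
    by (simp add: link_converse)
  with \<open>0 \<le> C\<close> show ?thesis by blast
qed

lemma bounded_seq_schur:
  assumes \<alpha>: "bounded_seq m \<alpha>"
  shows "\<exists>C. \<forall>\<^sub>F n in sequentially. schur l (hatG (\<alpha> n)) C"
proof -
  obtain C N where C: "0 \<le> C" and CN: "\<And>n \<omega> \<omega>'. n \<ge> N \<Longrightarrow> \<omega> \<in> Omega_inf l \<Longrightarrow> \<omega>' \<in> Omega_inf l \<Longrightarrow>
     cmod (hatG (\<alpha> n) (link l \<omega> \<omega>')) \<le> C * (\<Prod>i\<in>{1..l}. weight m n (pos \<omega> ` {1..l}) (pos \<omega>' i))"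
    using kernel_bound[OF \<alpha>, of l] by blast
  obtain C' N' where C': "0 \<le> C'" and CN': "\<And>n \<omega> \<omega>'. n \<ge> N' \<Longrightarrow> \<omega> \<in> Omega_inf l \<Longrightarrow> \<omega>' \<in> Omega_inf l \<Longrightarrow>
     cmod (hatG (\<alpha> n) (link l \<omega>' \<omega>)) \<le> C' * (\<Prod>i\<in>{1..l}. weight m n (pos \<omega> ` {1..l}) (pos \<omega>' i))"
    using kernel_bound_col[OF \<alpha>, of l] by blast
  let ?D = "(C + C') * (real l + real m + 1) ^ l"
  have ev: "\<forall>\<^sub>F n in sequentially. \<alpha> n \<in> cB m n \<and> n \<ge> N \<and> n \<ge> N' \<and> 0 < n"
    using \<alpha>[unfolded bounded_seq_def, THEN conjunct1] eventually_ge_at_top[of "N + N' + 1"]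
    by eventually_elim simp
  have sum_le: "(\<Sum>\<omega>'\<in>B. K \<omega>') \<le> ?D"
    if K: "\<And>\<omega>'. \<omega>' \<in> B \<Longrightarrow> K \<omega>' \<le> c * (\<Prod>i\<in>{1..l}. weight m n (pos \<omega> ` {1..l}) (pos \<omega>' i))"
      and B: "finite B" "B \<subseteq> Omega_inf l" and c: "0 \<le> c" "c \<le> C + C'" and n: "0 < n" for B K c n \<omega>
  proof -
    have "(\<Sum>\<omega>'\<in>B. K \<omega>') \<le> c * (\<Sum>\<omega>'\<in>B. \<Prod>i\<in>{1..l}. weight m n (pos \<omega> ` {1..l}) (pos \<omega>' i))"
      unfolding sum_distrib_left by (intro sum_mono K)
    also have "\<dots> \<le> c * (real (card (pos \<omega> ` {1..l})) + real m + 1) ^ l"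
      by (intro mult_left_mono weight_sum B n c) simp
    also have "\<dots> \<le> c * (real l + real m + 1) ^ l"
      using card_image_le[of "{1..l}" "pos \<omega>"] by (intro mult_left_mono power_mono c) simp_all
    also have "\<dots> \<le> ?D" by (intro mult_right_mono c) simp
    finally show ?thesis .
  qed
  have "\<forall>\<^sub>F n in sequentially. schur l (hatG (\<alpha> n)) ?D"
    using ev
  proof eventually_elim
    case (elim n)
    have "\<alpha> n \<in> alg_over Sym_inf"
      using alg_over_mono[OF cB_alg_over, of "\<alpha> n" m n Sym_inf] elim by (auto simp: Sym_inf_def)
    then have "row_finite l (hatG (\<alpha> n))" by (rule T_alg_Op(2))
    moreover have "(\<Sum>\<omega>'\<in>B. cmod (hatG (\<alpha> n) (link l \<omega> \<omega>'))) \<le> ?D"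
      if "finite B" "B \<subseteq> Omega_inf l" "\<omega> \<in> Omega_inf l" for \<omega> B
      by (rule sum_le[of _ _ C n \<omega>]) (use CN[of n \<omega>] elim that C C' in auto)
    moreover have "(\<Sum>\<omega>'\<in>B. cmod (hatG (\<alpha> n) (link l \<omega>' \<omega>))) \<le> ?D"
      if "finite B" "B \<subseteq> Omega_inf l" "\<omega> \<in> Omega_inf l" for \<omega> B
      by (rule sum_le[of _ _ C' n \<omega>]) (use CN'[of n \<omega>] elim that C C' in auto)
    ultimately show ?case by (simp add: schur_def)
  qed
  then show ?thesis by blast
qed

section \<open>Convergent sequences and their kernels\<close>

lemma null_comparison:
  fixes f :: "nat \<Rightarrow> complex" and g :: "nat \<Rightarrow> real"
  assumes "\<forall>\<^sub>F n in sequentially. norm (f n) \<le> g n" "g \<longlonglongrightarrow> 0"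
  shows "f \<longlonglongrightarrow> 0"
proof (rule tendsto_0_le[OF assms(2), of _ 1])
  show "\<forall>\<^sub>F n in sequentially. norm (f n) \<le> norm (g n) * 1"
    using assms(1) by eventually_elim simp
qed

definition conv_hat :: "(nat \<Rightarrow> grp_alg) \<Rightarrow> ((nat \<times> nat) set \<Rightarrow> complex) \<Rightarrow> bool" where
  "conv_hat \<alpha> h \<longleftrightarrow> (\<forall>k. \<forall>R\<in>PI k. (\<lambda>n. hatG (\<alpha> n) R) \<longlonglongrightarrow> h R)"

text \<open>On the group side this is what remains of the decay in the limit; on the semigroup side
  it expresses commutation with diagonal idempotents (\<open>cA_balanced\<close>).\<close>

definition balanced :: "nat \<Rightarrow> ((nat \<times> nat) set \<Rightarrow> complex) \<Rightarrow> bool" where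
  "balanced m h \<longleftrightarrow> (\<forall>k. \<forall>R\<in>PI k. h R \<noteq> 0 \<longrightarrow> fst ` R - {1..m} = snd ` R - {1..m})"

definition invariant :: "nat \<Rightarrow> ((nat \<times> nat) set \<Rightarrow> complex) \<Rightarrow> bool" where
  "invariant m h \<longleftrightarrow> (\<forall>n. \<forall>\<sigma>\<in>Sym_stab m n. \<forall>k. \<forall>R\<in>PI k. h (act \<sigma> R) = h R)"

lemma conv_hat_bounded_seq:
  assumes "\<forall>\<^sub>F n in sequentially. \<alpha> n \<in> cB m n" "conv_hat \<alpha> h"
  shows "bounded_seq m \<alpha>"
  using assms convergent_imp_Bseq convergentI unfolding bounded_seq_def conv_hat_def by metis

lemma limit_fresh:
  assumes \<alpha>: "bounded_seq m \<alpha>" and R: "R \<in> PI k" and lim: "(\<lambda>n. hatG (\<alpha> n) R) \<longlonglongrightarrow> c"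
    and fr: "fresh m R \<noteq> {}"
  shows "c = 0"
proof -
  have "card (fresh m R) \<noteq> 0" using fr finite_fresh[OF PI_finite[OF R], of m] by simp
  then have c1: "1 \<le> card (fresh m R)" by simp
  obtain C N where CN: "\<And>n S. n \<ge> N \<Longrightarrow> S \<in> PI n \<Longrightarrow> card S \<le> card R \<Longrightarrow> 1 \<le> card (fresh m S) \<Longrightarrow> cmod (hatG (\<alpha> n) S) * real n ^ 1 \<le> C"
    using bounded_seq_decay[OF \<alpha>, of "card R" 1] by blast
  have "\<forall>\<^sub>F n in sequentially. norm (hatG (\<alpha> n) R) \<le> C / real n"
    using eventually_ge_at_top[of "N + k + 1"]
  proof eventually_elim
    case (elim n)
    then have "cmod (hatG (\<alpha> n) R) * real n \<le> C" using CN[of n R] PI_mono[of k n] R c1 by auto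
    then show ?case using elim by (simp add: field_simps)
  qed
  moreover have "(\<lambda>n. C / real n) \<longlonglongrightarrow> 0" by (rule lim_const_over_n)
  ultimately have "(\<lambda>n. hatG (\<alpha> n) R) \<longlonglongrightarrow> 0" by (rule null_comparison)
  with lim show ?thesis by (rule LIMSEQ_unique)
qed

text \<open>A fresh argument forces the limit 0 by decay. The same for the inverted sequence
  excludes values beyond m that are not arguments, so both projections agree there.\<close>

lemma limit_balanced:
  assumes cB: "\<forall>\<^sub>F n in sequentially. \<alpha> n \<in> cB m n" and h: "conv_hat \<alpha> h"
  shows "balanced m h"
  unfolding balanced_def
proof (intro allI ballI impI)
  fix k R assume R: "R \<in> PI k" and nz: "h R \<noteq> 0"
  have b: "bounded_seq m \<alpha>" by (rule conv_hat_bounded_seq[OF cB h])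
  have l: "(\<lambda>n. hatG (\<alpha> n) R) \<longlonglongrightarrow> h R" using h R by (simp add: conv_hat_def)
  have "\<forall>\<^sub>F n in sequentially. hatG (\<alpha> n) R = hatG (linear_ext ginv (\<alpha> n)) (R\<inverse>)"
    using cB by eventually_elim (simp add: hatG_linear_ext_inv[OF cB_alg_over])
  then have l': "(\<lambda>n. hatG (linear_ext ginv (\<alpha> n)) (R\<inverse>)) \<longlonglongrightarrow> h R"
    using l by (simp cong: tendsto_cong)
  have f: "fresh m R = {}" "fresh m (R\<inverse>) = {}"
    using limit_fresh[OF b R l] limit_fresh[OF bounded_seq_inv[OF b] PI_converse[OF R] l'] nz by blast+
  have s: "1 \<le> x" if "x \<in> fst ` R \<union> snd ` R" for x using that PI_bounds[OF R] by fastforce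
  have i: "fst ` (R\<inverse>) = snd ` R" "snd ` (R\<inverse>) = fst ` R" by force+
  show "fst ` R - {1..m} = snd ` R - {1..m}"
    using f s unfolding fresh_def i by (auto simp: not_less) (metis Un_iff One_nat_def atLeastAtMost_iff imageI fst_conv snd_conv)+
qed

lemma limit_invariant:
  assumes cB: "\<forall>\<^sub>F n in sequentially. \<alpha> n \<in> cB m n" and h: "conv_hat \<alpha> h"
  shows "invariant m h"
  unfolding invariant_def
proof (intro allI ballI)
  fix n0 \<sigma> k R assume s: "\<sigma> \<in> Sym_stab m n0" and R: "R \<in> PI k"
  have s': "\<sigma> \<in> Sym_stab m n" if "n \<ge> n0" for n using s Sym_mono[OF that] by (auto simp: Sym_stab_def)
  have R': "act \<sigma> R \<in> PI (max n0 k)"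
  proof (rule act_PI)
    show "\<sigma> \<in> Sym (max n0 k)" using s'[of "max n0 k"] Sym_stab_subset by auto
    show "R \<in> PI (max n0 k)" using PI_mono[of k "max n0 k"] R by auto
  qed
  have "\<forall>\<^sub>F n in sequentially. hatG (\<alpha> n) (act \<sigma> R) = hatG (\<alpha> n) R"
    using cB eventually_ge_at_top[of n0] by eventually_elim (rule hatG_invariant[OF _ s'])
  moreover have "(\<lambda>n. hatG (\<alpha> n) (act \<sigma> R)) \<longlonglongrightarrow> h (act \<sigma> R)" using h R' unfolding conv_hat_def by blast
  ultimately have "(\<lambda>n. hatG (\<alpha> n) R) \<longlonglongrightarrow> h (act \<sigma> R)" by (simp cong: tendsto_cong)
  then show "h (act \<sigma> R) = h R" using h R LIMSEQ_unique unfolding conv_hat_def by blast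
qed

lemma finite_Omega_within:
  assumes "finite Z"
  shows "finite {\<omega> \<in> Omega_inf l. pos \<omega> ` {1..l} \<subseteq> Z}"
proof (rule finite_imageD)
  let ?e = "\<lambda>\<omega>. restrict (pos \<omega>) {1..l}"
  have "?e ` {\<omega> \<in> Omega_inf l. pos \<omega> ` {1..l} \<subseteq> Z} \<subseteq> PiE {1..l} (\<lambda>_. Z)" by auto
  moreover have "finite (PiE {1..l} (\<lambda>_. Z))" using assms by (intro finite_PiE) auto
  ultimately show "finite (?e ` {\<omega> \<in> Omega_inf l. pos \<omega> ` {1..l} \<subseteq> Z})" by (rule finite_subset)
  show "inj_on ?e {\<omega> \<in> Omega_inf l. pos \<omega> ` {1..l} \<subseteq> Z}"
  proof (rule inj_onI)
    fix \<omega> \<omega>' assume a: "\<omega> \<in> {\<omega> \<in> Omega_inf l. pos \<omega> ` {1..l} \<subseteq> Z}" "\<omega>' \<in> {\<omega> \<in> Omega_inf l. pos \<omega> ` {1..l} \<subseteq> Z}" "?e \<omega> = ?e \<omega>'"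
    have "pos \<omega> i = pos \<omega>' i" if "i \<in> {1..l}" for i using fun_cong[OF a(3), of i] that by simp
    then show "\<omega> = \<omega>'" using Omega_eqI a(1,2) by blast
  qed
qed

lemma link_PI_inf:
  assumes "\<omega> \<in> Omega_inf l" "\<omega>' \<in> Omega_inf l"
  shows "\<exists>k. link l \<omega> \<omega>' \<in> PI k"
proof -
  obtain k k' where "\<forall>n\<ge>k. \<omega> \<in> Omega_fin l n" "\<forall>n\<ge>k'. \<omega>' \<in> Omega_fin l n"
    using Omega_inf_fin assms by meson
  then show ?thesis by (intro exI[of _ "max k k'"] link_PI) auto
qed

lemma balanced_link:
  assumes "balanced m h" "\<omega> \<in> Omega_inf l" "\<omega>' \<in> Omega_inf l" "h (link l \<omega> \<omega>') \<noteq> 0"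
  shows "pos \<omega> ` {1..l} - {1..m} = pos \<omega>' ` {1..l} - {1..m}"
  using assms link_PI_inf[OF assms(2,3)] unfolding balanced_def
  by (metis fst_link snd_link)

lemma balanced_row_finite:
  assumes "balanced m h"
  shows "row_finite l h"
  unfolding row_finite_def
proof
  fix \<omega> assume w: "\<omega> \<in> Omega_inf l"
  let ?Z = "pos \<omega> ` {1..l} \<union> {1..m}"
  have "{\<omega>' \<in> Omega_inf l. h (link l \<omega> \<omega>') \<noteq> 0} \<subseteq> {\<omega>' \<in> Omega_inf l. pos \<omega>' ` {1..l} \<subseteq> ?Z}"
    using balanced_link[OF assms w] by blast
  then show "finite {\<omega>' \<in> Omega_inf l. h (link l \<omega> \<omega>') \<noteq> 0}"
    by (rule finite_subset) (rule finite_Omega_within, simp)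
qed

lemma conv_hat_link: "conv_hat \<alpha> h \<Longrightarrow> \<omega> \<in> Omega_inf l \<Longrightarrow> \<omega>' \<in> Omega_inf l \<Longrightarrow>
   (\<lambda>n. hatG (\<alpha> n) (link l \<omega> \<omega>')) \<longlonglongrightarrow> h (link l \<omega> \<omega>')"
  using link_PI_inf unfolding conv_hat_def by blast

lemma limit_schur:
  assumes h: "conv_hat \<alpha> h" and rf: "row_finite l h"
    and s: "\<forall>\<^sub>F n in sequentially. schur l (hatG (\<alpha> n)) C"
  shows "schur l h C"
  unfolding schur_def
proof (intro conjI ballI allI impI rf)
  fix \<omega> B assume w: "\<omega> \<in> Omega_inf l" and B: "finite B \<and> B \<subseteq> Omega_inf l"
  show "(\<Sum>\<omega>'\<in>B. cmod (h (link l \<omega> \<omega>'))) \<le> C"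
  proof (rule tendsto_upperbound[of _ _ sequentially])
    show "(\<lambda>n. \<Sum>\<omega>'\<in>B. cmod (hatG (\<alpha> n) (link l \<omega> \<omega>'))) \<longlonglongrightarrow> (\<Sum>\<omega>'\<in>B. cmod (h (link l \<omega> \<omega>')))"
      using B by (intro tendsto_sum tendsto_norm conv_hat_link[OF h w]) auto
    show "\<forall>\<^sub>F n in sequentially. (\<Sum>\<omega>'\<in>B. cmod (hatG (\<alpha> n) (link l \<omega> \<omega>'))) \<le> C"
      using s by eventually_elim (use w B in \<open>auto simp: schur_def\<close>)
  qed simp
  show "(\<Sum>\<omega>'\<in>B. cmod (h (link l \<omega>' \<omega>))) \<le> C"
  proof (rule tendsto_upperbound[of _ _ sequentially])
    show "(\<lambda>n. \<Sum>\<omega>'\<in>B. cmod (hatG (\<alpha> n) (link l \<omega>' \<omega>))) \<longlonglongrightarrow> (\<Sum>\<omega>'\<in>B. cmod (h (link l \<omega>' \<omega>)))"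
      using B by (intro tendsto_sum tendsto_norm conv_hat_link[OF h _ w]) auto
    show "\<forall>\<^sub>F n in sequentially. (\<Sum>\<omega>'\<in>B. cmod (hatG (\<alpha> n) (link l \<omega>' \<omega>))) \<le> C"
      using s by eventually_elim (use w B in \<open>auto simp: schur_def\<close>)
  qed simp
qed

lemma schur_diff:
  assumes "schur l h C" "schur l h' C'"
  shows "schur l (\<lambda>R. 1 * h R + (- 1) * h' R) (C + C')"
proof -
  have t: "(\<Sum>b\<in>B. cmod (1 * u b + (- 1) * v b)) \<le> D + D'"
    if "(\<Sum>b\<in>B. cmod (u b)) \<le> D" "(\<Sum>b\<in>B. cmod (v b)) \<le> D'" for B D D' and u v :: "matr \<Rightarrow> complex"
  proof -
    have "(\<Sum>b\<in>B. cmod (1 * u b + (- 1) * v b)) \<le> (\<Sum>b\<in>B. cmod (u b) + cmod (v b))"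
      by (rule sum_mono) (simp add: norm_triangle_ineq4)
    then show ?thesis using that by (simp add: sum.distrib)
  qed
  have "row_finite l (\<lambda>R. 1 * h R + (- 1) * h' R)"
    unfolding row_finite_def
  proof
    fix \<omega> assume "\<omega> \<in> Omega_inf l"
    then have "finite ({\<omega>' \<in> Omega_inf l. h (link l \<omega> \<omega>') \<noteq> 0} \<union> {\<omega>' \<in> Omega_inf l. h' (link l \<omega> \<omega>') \<noteq> 0})"
      using assms by (simp add: schur_def row_finite_def)
    then show "finite {\<omega>' \<in> Omega_inf l. 1 * h (link l \<omega> \<omega>') + (- 1) * h' (link l \<omega> \<omega>') \<noteq> 0}"
      by (rule finite_subset[rotated]) auto
  qed
  with assms show ?thesis unfolding schur_def by (intro conjI ballI allI impI t) auto
qed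

text \<open>The words with all letters in ?Z are finitely many, and pointwise convergence handles
  them. Any other word has a letter of weight at most 1 / n, and h vanishes there by balancedness,
  so the squared entry is at most C / n times the entry itself, whose column sum is bounded by the
  Schur estimate.\<close>

lemma column_null:
  assumes cB: "\<forall>\<^sub>F n in sequentially. \<alpha> n \<in> cB m n" and h: "conv_hat \<alpha> h"
    and w: "\<omega> \<in> Omega_inf l" and eps: "\<epsilon> > 0"
  shows "\<forall>\<^sub>F n in sequentially. \<forall>F. finite F \<and> F \<subseteq> Omega_inf l \<longrightarrow>
      (\<Sum>\<omega>'\<in>F. (cmod (1 * hatG (\<alpha> n) (link l \<omega>' \<omega>) + (- 1) * h (link l \<omega>' \<omega>)))\<^sup>2) \<le> \<epsilon>"
proof -
  have b: "bounded_seq m \<alpha>" by (rule conv_hat_bounded_seq[OF cB h])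
  have bal: "balanced m h" by (rule limit_balanced[OF cB h])
  let ?Z = "pos \<omega> ` {1..l} \<union> {1..m}"
  let ?G = "{\<omega>' \<in> Omega_inf l. pos \<omega>' ` {1..l} \<subseteq> ?Z}"
  let ?d = "\<lambda>n \<omega>'. 1 * hatG (\<alpha> n) (link l \<omega>' \<omega>) + (- 1) * h (link l \<omega>' \<omega>)"
  have fG: "finite ?G" by (rule finite_Omega_within) simp
  have "(\<lambda>n. \<Sum>\<omega>'\<in>?G. (cmod (?d n \<omega>'))\<^sup>2) \<longlonglongrightarrow> (\<Sum>\<omega>'\<in>?G. (cmod (1 * h (link l \<omega>' \<omega>) + (- 1) * h (link l \<omega>' \<omega>)))\<^sup>2)"
    by (intro tendsto_intros conv_hat_link[OF h _ w]) auto
  then have "(\<lambda>n. \<Sum>\<omega>'\<in>?G. (cmod (?d n \<omega>'))\<^sup>2) \<longlonglongrightarrow> 0" by simp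
  then have e1: "\<forall>\<^sub>F n in sequentially. (\<Sum>\<omega>'\<in>?G. (cmod (?d n \<omega>'))\<^sup>2) < \<epsilon> / 2"
    using eps by (intro order_tendstoD) auto
  obtain C N where C: "0 \<le> C" and CN: "\<And>n \<omega>'. n \<ge> N \<Longrightarrow> \<omega>' \<in> Omega_inf l \<Longrightarrow>
     cmod (hatG (\<alpha> n) (link l \<omega>' \<omega>)) \<le> C * (\<Prod>i\<in>{1..l}. weight m n (pos \<omega> ` {1..l}) (pos \<omega>' i))"
    using kernel_bound_col[OF b, of l] w by meson
  obtain D where "\<forall>\<^sub>F n in sequentially. schur l (hatG (\<alpha> n)) D" using bounded_seq_schur[OF b] by blast
  then have e2: "\<forall>\<^sub>F n in sequentially. schur l (hatG (\<alpha> n)) \<bar>D\<bar>"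
    by eventually_elim (auto simp: schur_def intro: order_trans[OF _ abs_ge_self])
  have "(\<lambda>n. (C * \<bar>D\<bar>) / real n) \<longlonglongrightarrow> 0" by (rule lim_const_over_n)
  then have e3: "\<forall>\<^sub>F n in sequentially. (C * \<bar>D\<bar>) / real n < \<epsilon> / 2" using eps by (intro order_tendstoD) auto
  show ?thesis
    using e1 e2 e3 eventually_ge_at_top[of "N + 1"]
  proof eventually_elim
    case (elim n)
    show ?case
    proof (intro allI impI, elim conjE)
      fix F assume F: "finite F" "F \<subseteq> Omega_inf l"
      have off: "(cmod (?d n \<omega>'))\<^sup>2 \<le> C / real n * cmod (hatG (\<alpha> n) (link l \<omega>' \<omega>))" if o: "\<omega>' \<in> F - ?G" for \<omega>'
      proof -
        have w': "\<omega>' \<in> Omega_inf l" using o F by blast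
        obtain j where j: "j \<in> {1..l}" "pos \<omega>' j \<notin> ?Z" using o w' by blast
        then have "pos \<omega>' ` {1..l} - {1..m} \<noteq> pos \<omega> ` {1..l} - {1..m}" by blast
        then have h0: "h (link l \<omega>' \<omega>) = 0" using balanced_link[OF bal w' w] by blast
        let ?W = "weight m n (pos \<omega> ` {1..l})"
        have W1: "?W z \<le> 1" for z using elim by (simp add: weight_def)
        have "(\<Prod>i\<in>{1..l}. ?W (pos \<omega>' i)) = ?W (pos \<omega>' j) * (\<Prod>i\<in>{1..l} - {j}. ?W (pos \<omega>' i))"
          by (rule prod.remove) (use j in auto)
        also have "\<dots> \<le> ?W (pos \<omega>' j) * 1"
          by (intro mult_left_mono prod_le_1 conjI weight_nonneg W1)
        also have "\<dots> = (if pos \<omega>' j \<in> {1..n} then 1 / real n else 0)"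
          using j(2) unfolding weight_def by (simp only: if_False mult_1_right)
        also have "\<dots> \<le> 1 / real n" by simp
        finally have "C * (\<Prod>i\<in>{1..l}. ?W (pos \<omega>' i)) \<le> C * (1 / real n)" using C by (rule mult_left_mono)
        then have "cmod (hatG (\<alpha> n) (link l \<omega>' \<omega>)) \<le> C / real n" using CN[of n \<omega>'] w' elim by simp
        then have "cmod (hatG (\<alpha> n) (link l \<omega>' \<omega>)) * cmod (hatG (\<alpha> n) (link l \<omega>' \<omega>))
            \<le> C / real n * cmod (hatG (\<alpha> n) (link l \<omega>' \<omega>))" by (rule mult_right_mono) simp
        then show ?thesis by (simp add: h0 power2_eq_square)
      qed
      have "(\<Sum>\<omega>'\<in>F \<inter> ?G. (cmod (?d n \<omega>'))\<^sup>2) \<le> (\<Sum>\<omega>'\<in>?G. (cmod (?d n \<omega>'))\<^sup>2)"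
        by (rule sum_mono2[OF fG]) auto
      moreover have "(\<Sum>\<omega>'\<in>F - ?G. (cmod (?d n \<omega>'))\<^sup>2) \<le> C / real n * (\<Sum>\<omega>'\<in>F - ?G. cmod (hatG (\<alpha> n) (link l \<omega>' \<omega>)))"
        unfolding sum_distrib_left by (rule sum_mono) (rule off)
      moreover have "C / real n * (\<Sum>\<omega>'\<in>F - ?G. cmod (hatG (\<alpha> n) (link l \<omega>' \<omega>))) \<le> C / real n * \<bar>D\<bar>"
      proof (rule mult_left_mono)
        have "finite (F - ?G)" "F - ?G \<subseteq> Omega_inf l" using F by blast+
        then show "(\<Sum>\<omega>'\<in>F - ?G. cmod (hatG (\<alpha> n) (link l \<omega>' \<omega>))) \<le> \<bar>D\<bar>"
          using elim(2) w unfolding schur_def by blast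
      qed (use C in simp)
      moreover note sum.Int_Diff[OF F(1), of "\<lambda>\<omega>'. (cmod (?d n \<omega>'))\<^sup>2" ?G] elim(1)
      moreover have "C / real n * \<bar>D\<bar> < \<epsilon> / 2" using elim(3) by simp
      ultimately show "(\<Sum>\<omega>'\<in>F. (cmod (?d n \<omega>'))\<^sup>2) \<le> \<epsilon>" by linarith
    qed
  qed
qed

lemma conv_hat_schur:
  assumes cB: "\<forall>\<^sub>F n in sequentially. \<alpha> n \<in> cB m n" and h: "conv_hat \<alpha> h"
  shows "\<exists>C. schur l h C \<and> (\<forall>\<^sub>F n in sequentially. schur l (hatG (\<alpha> n)) C)"
  using bounded_seq_schur[OF conv_hat_bounded_seq[OF cB h], of l]
    limit_schur[OF h balanced_row_finite[OF limit_balanced[OF cB h]]] by blast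

text \<open>The difference kernel satisfies both hypotheses of \<open>strong_null\<close>: Schur
  bounds add up, and its columns tend to 0 by \<open>column_null\<close>.\<close>

lemma conv_hat_sot:
  assumes cB: "\<forall>\<^sub>F n in sequentially. \<alpha> n \<in> cB m n" and h: "conv_hat \<alpha> h"
    and al: "\<And>n. \<alpha> n \<in> alg_over Sym_inf"
  shows "sot_limit \<mu> (\<lambda>n. T_alg \<mu> (\<alpha> n)) (Op \<mu> h)"
proof -
  let ?l = "ysize \<mu>"
  obtain C where C: "schur ?l h C" "\<forall>\<^sub>F n in sequentially. schur ?l (hatG (\<alpha> n)) C"
    using conv_hat_schur[OF cB h] by blast
  have "(\<lambda>n. norm_T \<mu> (\<lambda>\<omega>. T_alg \<mu> (\<alpha> n) \<phi> \<omega> - Op \<mu> h \<phi> \<omega>)) \<longlonglongrightarrow> 0" if p: "\<phi> \<in> H_T \<mu>" for \<phi>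
  proof -
    let ?d = "\<lambda>n R. 1 * hatG (\<alpha> n) R + (- 1) * h R"
    have "(\<lambda>n. nrm2 ?l (kerop ?l (?d n) \<phi>)) \<longlonglongrightarrow> 0"
    proof (rule strong_null[OF _ _ H_T_sqsum[OF p]])
      show "\<forall>\<^sub>F n in sequentially. schur ?l (?d n) (C + C)"
        using C(2) by eventually_elim (rule schur_diff[OF _ C(1)])
    qed (rule column_null[OF cB h])
    then have "(\<lambda>n. sqrt (nrm2 ?l (kerop ?l (?d n) \<phi>))) \<longlonglongrightarrow> sqrt 0" by (rule tendsto_real_sqrt)
    moreover have "norm_T \<mu> (\<lambda>\<omega>. T_alg \<mu> (\<alpha> n) \<phi> \<omega> - Op \<mu> h \<phi> \<omega>) = sqrt (nrm2 ?l (kerop ?l (?d n) \<phi>))" for n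
    proof -
      have "T_alg \<mu> (\<alpha> n) \<phi> \<omega> - Op \<mu> h \<phi> \<omega> = kerop ?l (?d n) \<phi> \<omega>" if w: "\<omega> \<in> Omega_inf ?l" for \<omega>
      proof -
        have "kerop ?l (?d n) \<phi> \<omega> = scale 1 (kerop ?l (hatG (\<alpha> n)) \<phi> \<omega>) + scale (- 1) (kerop ?l h \<phi> \<omega>)"
          by (rule kerop_lincomb[OF T_alg_Op(2)[OF al] _ w]) (use C in \<open>simp add: schur_def\<close>)
        then show ?thesis using p w by (simp add: T_alg_Op(1)[OF al] Op_def scale_minus_one)
      qed
      then show ?thesis by (simp add: norm_T_nrm2 nrm2_def cong: infsum_cong)
    qed
    ultimately show ?thesis by simp
  qed
  then show ?thesis unfolding sot_limit_def using Op_End[OF C(1)] by blast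
qed

text \<open>For fixed g every word is linked to at most one other word in either direction, so row
  and column sums are bounded by the sum of the absolute coefficients. This holds for each single
  element, not only eventually along a sequence, and so places \<open>T_alg\<close> in
  \<open>H_T\<close> for all n.\<close>

lemma hatG_schur:
  assumes x: "x \<in> alg_over Sym_inf"
  shows "schur l (hatG x) (\<Sum>g\<in>keys x. cmod (lookup x g))"
proof -
  have le: "(\<Sum>b\<in>B. cmod (hatG x (S b))) \<le> (\<Sum>g\<in>keys x. cmod (lookup x g))"
    if "finite B" and one: "\<And>g b b'. g \<in> keys x \<Longrightarrow> b \<in> B \<Longrightarrow> b' \<in> B \<Longrightarrow> covers g (S b) \<Longrightarrow> covers g (S b') \<Longrightarrow> b = b'" for B :: "matr set" and S
  proof -
    have "(\<Sum>b\<in>B. cmod (hatG x (S b))) \<le> (\<Sum>b\<in>B. \<Sum>g\<in>keys x. cmod (lookup x g) * of_bool (covers g (S b)))"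
    proof (rule sum_mono)
      fix b
      have "cmod (hatG x (S b)) \<le> (\<Sum>g\<in>keys x. cmod (lookup x g * of_bool (covers g (S b))))"
        unfolding hatG_def pairing_def by (rule norm_sum)
      also have "\<dots> = (\<Sum>g\<in>keys x. cmod (lookup x g) * of_bool (covers g (S b)))"
        by (rule sum.cong) (auto simp: norm_mult)
      finally show "cmod (hatG x (S b)) \<le> (\<Sum>g\<in>keys x. cmod (lookup x g) * of_bool (covers g (S b)))" .
    qed
    also have "\<dots> = (\<Sum>g\<in>keys x. cmod (lookup x g) * (\<Sum>b\<in>B. of_bool (covers g (S b))))"
      by (subst sum.swap) (simp add: sum_distrib_left)
    also have "\<dots> \<le> (\<Sum>g\<in>keys x. cmod (lookup x g) * 1)"
    proof (intro sum_mono mult_left_mono)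
      fix g assume g: "g \<in> keys x"
      have "card {b \<in> B. covers g (S b)} \<le> 1"
        using one[OF g] that(1) by (auto simp: card_le_Suc0_iff_eq)
      then show "(\<Sum>b\<in>B. of_bool (covers g (S b))) \<le> (1::real)"
        using that(1) by (simp add: sum_of_bool_eq Int_def)
    qed simp
    finally show ?thesis by simp
  qed
  have pos: "pos \<omega> i = g (pos \<omega>' i)" if "covers g (link l \<omega> \<omega>')" "i \<in> {1..l}" for g \<omega> \<omega>' i
    using that unfolding covers_def link_def by auto
  have inj: "inj g" if "g \<in> keys x" for g
  proof -
    have "g \<in> Sym_inf" using that x by (auto simp: alg_over_def)
    then obtain n where "g \<in> Sym n" by (auto simp: Sym_inf_def)
    then show ?thesis by (rule bij_is_inj[OF Sym_bij])
  qed
  show ?thesis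
    unfolding schur_def
  proof (intro conjI T_alg_Op(2)[OF x] ballI allI impI le, goal_cases)
    case (2 \<omega> B g b b')
    show ?case
    proof (rule Omega_eqI)
      fix i assume i: "i \<in> {1..l}"
      show "pos b i = pos b' i" using pos[OF 2(6) i] pos[OF 2(7) i] injD[OF inj[OF 2(3)]] by metis
    qed (use 2 in auto)
  next
    case (4 \<omega> B g b b')
    show ?case
    proof (rule Omega_eqI)
      fix i assume i: "i \<in> {1..l}"
      show "pos b i = pos b' i" using pos[OF 4(6) i] pos[OF 4(7) i] by simp
    qed (use 4 in auto)
  qed auto
qed

lemma sot_lookup:
  assumes s: "sot_limit \<mu> (\<lambda>n. T_alg \<mu> (\<alpha> n)) L" and al: "\<And>n. \<alpha> n \<in> alg_over Sym_inf"
    and p: "\<phi> \<in> H_T \<mu>" and w: "\<omega> \<in> Omega_inf (ysize \<mu>)"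
  shows "(\<lambda>n. lookup (T_alg \<mu> (\<alpha> n) \<phi> \<omega>) k) \<longlonglongrightarrow> lookup (L \<phi> \<omega>) k"
proof -
  let ?l = "ysize \<mu>" and ?D = "\<lambda>n \<omega>. T_alg \<mu> (\<alpha> n) \<phi> \<omega> - L \<phi> \<omega>"
  have L: "L \<phi> \<in> H_T \<mu>" using s p by (auto simp: sot_limit_def End_T_def)
  have T: "T_alg \<mu> (\<alpha> n) \<phi> \<in> H_T \<mu>" for n
    unfolding T_alg_Op(1)[OF al] by (rule Op_H_T(1)[OF hatG_schur[OF al] p])
  have "cmod (lookup (T_alg \<mu> (\<alpha> n) \<phi> \<omega>) k - lookup (L \<phi> \<omega>) k) \<le> norm_T \<mu> (?D n)" for n
  proof -
    have "(cmod (lookup (?D n \<omega>) k))\<^sup>2 \<le> nrm2 ?l (?D n)"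
      using norm_sq_lookup nrm2_pointwise[OF sqsum_diff(1)[OF H_T_sqsum[OF T] H_T_sqsum[OF L]] w] order_trans by blast
    then show ?thesis unfolding norm_T_nrm2 lookup_minus[symmetric] by (rule real_le_rsqrt)
  qed
  moreover have "(\<lambda>n. norm_T \<mu> (?D n)) \<longlonglongrightarrow> 0" using s p by (simp add: sot_limit_def)
  ultimately have "(\<lambda>n. lookup (T_alg \<mu> (\<alpha> n) \<phi> \<omega>) k - lookup (L \<phi> \<omega>) k) \<longlonglongrightarrow> 0"
    by (intro null_comparison[of _ "\<lambda>n. norm_T \<mu> (?D n)"]) auto
  then show ?thesis by (simp add: LIM_zero_iff)
qed

lemma sot_unique:
  assumes "sot_limit \<mu> (\<lambda>n. T_alg \<mu> (\<alpha> n)) L" "sot_limit \<mu> (\<lambda>n. T_alg \<mu> (\<alpha> n)) L'"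
    and al: "\<And>n. \<alpha> n \<in> alg_over Sym_inf"
  shows "L = L'"
proof
  fix \<phi>
  have E: "L \<in> H_T \<mu> \<rightarrow>\<^sub>E H_T \<mu>" "L' \<in> H_T \<mu> \<rightarrow>\<^sub>E H_T \<mu>" using assms by (auto simp: sot_limit_def End_T_def)
  show "L \<phi> = L' \<phi>"
  proof (cases "\<phi> \<in> H_T \<mu>")
    case p: True
    show ?thesis
    proof
      fix \<omega>
      show "L \<phi> \<omega> = L' \<phi> \<omega>"
      proof (cases "\<omega> \<in> Omega_inf (ysize \<mu>)")
        case True
        show ?thesis
          by (rule poly_mapping_eqI)
            (rule LIMSEQ_unique[OF sot_lookup[OF assms(1) al p True] sot_lookup[OF assms(2) al p True]])
      next
        case False
        have "L \<phi> \<in> H_T \<mu>" "L' \<phi> \<in> H_T \<mu>" using E p by (auto simp: PiE_mem)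
        then show ?thesis using False by (simp add: H_T_outside)
      qed
    qed
  qed (use E in \<open>auto simp: PiE_def extensional_def\<close>)
qed

lemma T_lim_eq:
  assumes "sot_limit \<mu> (\<lambda>n. T_alg \<mu> (\<alpha> n)) L" "\<And>n. \<alpha> n \<in> alg_over Sym_inf"
  shows "T_lim \<mu> \<alpha> = L"
  unfolding T_lim_def by (rule the_equality) (use assms sot_unique in blast)+

section \<open>Recovering the kernel from the operators\<close>

text \<open>The equivariant delta function at \<omega>' with value v. The action of
  \<open>Sym l\<close> is free (\<open>mmult_perm_left_inj\<close>), so at most one term of the sum
  is nonzero and no representative of the orbit has to be chosen.\<close>

definition bump :: "nat \<Rightarrow> matr \<Rightarrow> grp_alg \<Rightarrow> hvec" where
  "bump l \<omega>' v = (\<lambda>\<omega>. \<Sum>s\<in>Sym l. if \<omega> = mmult (perm_matr s) \<omega>' then pi_rep s v else 0)"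

lemma bump_orbit:
  assumes "\<omega>' \<in> Omega_inf l" "s \<in> Sym l"
  shows "bump l \<omega>' v (mmult (perm_matr s) \<omega>') = pi_rep s v"
proof -
  have "bump l \<omega>' v (mmult (perm_matr s) \<omega>') = (\<Sum>t\<in>Sym l. if t = s then pi_rep s v else 0)"
    unfolding bump_def
    by (rule sum.cong[OF refl]) (use mmult_perm_left_inj[OF assms(2) _ assms(1)] in auto)
  then show ?thesis using assms(2) by simp
qed

lemma bump_off: "(\<And>s. s \<in> Sym l \<Longrightarrow> \<omega> \<noteq> mmult (perm_matr s) \<omega>') \<Longrightarrow> bump l \<omega>' v \<omega> = 0"
  unfolding bump_def by (rule sum.neutral) auto

lemma bump_H_T:
  assumes w: "\<omega>' \<in> Omega_inf (ysize \<mu>)" and v: "v \<in> H_pi \<mu>"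
  shows "bump (ysize \<mu>) \<omega>' v \<in> H_T \<mu>"
proof -
  let ?l = "ysize \<mu>" and ?b = "bump (ysize \<mu>) \<omega>' v"
  let ?O = "(\<lambda>s. mmult (perm_matr s) \<omega>') ` Sym ?l"
  have off: "?b \<omega> = 0" if "\<omega> \<notin> ?O" for \<omega> using that by (intro bump_off) blast
  have O: "?O \<subseteq> Omega_inf ?l" using mmult_perm_left(2)[OF _ w] by blast
  have "(\<Sum>\<omega>\<in>F. norm_sq (?b \<omega>)) \<le> (\<Sum>\<omega>\<in>?O. norm_sq (?b \<omega>))" if "finite F" for F
  proof -
    have "(\<Sum>\<omega>\<in>F. norm_sq (?b \<omega>)) = (\<Sum>\<omega>\<in>F \<inter> ?O. norm_sq (?b \<omega>))"
      by (rule sum.mono_neutral_right) (use that off in auto)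
    also have "\<dots> \<le> (\<Sum>\<omega>\<in>?O. norm_sq (?b \<omega>))" by (rule sum_mono2) auto
    finally show ?thesis .
  qed
  then have sq: "sqsum ?l ?b" using sqsumI(1) by blast
  show ?thesis
    unfolding H_T_def mem_Collect_eq
  proof (intro conjI allI impI ballI sq)
    fix \<omega> assume "\<omega> \<notin> Omega_inf ?l" then show "?b \<omega> = 0" using off O by blast
  next
    fix \<omega> show "?b \<omega> \<in> H_pi \<mu>" unfolding bump_def
      by (rule H_pi_sum) (simp add: H_pi_rep[OF _ v] H_pi_zero)
  next
    fix s \<omega> assume s: "s \<in> Sym ?l" and o: "\<omega> \<in> Omega_inf ?l"
    show "?b (mmult (perm_matr s) \<omega>) = pi_rep s (?b \<omega>)"
    proof (cases "\<omega> \<in> ?O")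
      case True
      then obtain t where t: "t \<in> Sym ?l" "\<omega> = mmult (perm_matr t) \<omega>'" by blast
      then show ?thesis
        using s bump_orbit[OF w t(1), of v] bump_orbit[OF w comp_Sym[OF s t(1)], of v]
        by (simp add: mmult_perm_left_assoc[OF s t(1) w] pi_rep_comp)
    next
      case False
      have "mmult (perm_matr s) \<omega> \<notin> ?O"
      proof
        assume "mmult (perm_matr s) \<omega> \<in> ?O"
        then obtain t where t: "t \<in> Sym ?l" "mmult (perm_matr s) \<omega> = mmult (perm_matr t) \<omega>'" by blast
        have i: "ginv s \<in> Sym ?l" using s by simp
        have "\<omega> = mmult (perm_matr (ginv s \<circ> s)) \<omega>"
          using mmult_perm_left(1)[OF id_Sym o] Omega_place[OF o] by (simp add: inv_comp_id[OF Sym_bij[OF s]])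
        also have "\<dots> = mmult (perm_matr (ginv s \<circ> t)) \<omega>'"
          using mmult_perm_left_assoc[OF i s o] mmult_perm_left_assoc[OF i t(1) w] t(2) by simp
        finally show False using False comp_Sym[OF i t(1)] by blast
      qed
      then show ?thesis using off False by (simp add: pi_rep_def)
    qed
  qed
qed

text \<open>The sum runs over one free orbit, so the operator multiplies v by a group algebra
  element made of kernel values. The coefficient of \<open>id\<close> in that element is
  \<open>h (link l \<omega> \<omega>')\<close>.\<close>

lemma kerop_bump:
  assumes w: "\<omega>' \<in> Omega_inf l"
  shows "kerop l h (bump l \<omega>' v) \<omega> =
    grp_mult (\<Sum>s\<in>Sym l. single s (h (link l \<omega> (mmult (perm_matr s) \<omega>')))) v"
proof -
  let ?m = "\<lambda>s. mmult (perm_matr s) \<omega>'"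
  have inj: "inj_on ?m (Sym l)" using mmult_perm_left_inj[OF _ _ w] by (auto simp: inj_on_def)
  have "kerop l h (bump l \<omega>' v) \<omega> = (\<Sum>\<omega>''\<in>?m ` Sym l. scale (h (link l \<omega> \<omega>'')) (bump l \<omega>' v \<omega>''))"
    using mmult_perm_left(2)[OF _ w] by (intro kerop_superset disjI2 bump_off) auto
  also have "\<dots> = (\<Sum>s\<in>Sym l. scale (h (link l \<omega> (?m s))) (pi_rep s v))"
    by (simp add: sum.reindex[OF inj] bump_orbit[OF w])
  also have "\<dots> = (\<Sum>s\<in>Sym l. grp_mult (single s (h (link l \<omega> (?m s)))) v)"
    by (simp add: pi_rep_def flip: convolve_scale_left)
  finally show ?thesis by (simp add: convolve_sum_left)
qed

text \<open>Write R as a link. Then \<open>h R\<close> is the coefficient of \<open>id\<close> in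
  the element x of \<open>kerop_bump\<close>, and \<open>young_reconstruction\<close> obtains x from
  its products with vectors of the \<open>H_pi \<mu>\<close>, which are values of operators at
  bumps. The vectors and coefficients depend on R only, so a single formula serves all h, limits
  included.\<close>

lemma recover:
  assumes R: "R \<in> PI n"
  shows "\<exists>\<omega> \<phi> c. \<omega> \<in> Omega_inf (card R) \<and>
    (\<forall>\<mu>\<in>Young_of (card R). \<forall>g\<in>Sym (card R). \<phi> \<mu> g \<in> H_T \<mu>) \<and>
    (\<forall>h. h R = (\<Sum>\<mu>\<in>Young_of (card R). \<Sum>g\<in>Sym (card R). \<Sum>k\<in>Sym (card R).
       c \<mu> g k * lookup (Op \<mu> h (\<phi> \<mu> g) \<omega>) k))"
proof -
  let ?l = "card R"
  obtain \<omega> \<omega>' where "\<omega> \<in> Omega_fin ?l n" "\<omega>' \<in> Omega_fin ?l n" and lk: "link ?l \<omega> \<omega>' = R"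
    by (rule PI_is_link[OF R])
  then have w: "\<omega> \<in> Omega_inf ?l" "\<omega>' \<in> Omega_inf ?l" "link ?l \<omega> \<omega>' = R"
    by (simp_all add: Omega_fin_def)
  obtain W where W: "\<forall>x. x = (\<Sum>\<mu>\<in>Young_of ?l. \<Sum>g\<in>Sym ?l.
      grp_mult (grp_mult x (grp_mult (single g 1) (young_symmetrizer \<mu>))) (W \<mu> g))"
    using young_reconstruction[of ?l] by (elim exE)
  define v where "v \<mu> g = grp_mult (single g 1) (young_symmetrizer \<mu>)" for \<mu> g
  define \<phi> where "\<phi> \<mu> g = bump ?l \<omega>' (v \<mu> g)" for \<mu> g
  have phi: "\<phi> \<mu> g \<in> H_T \<mu>" if "\<mu> \<in> Young_of ?l" "g \<in> Sym ?l" for \<mu> g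
  proof -
    have "ysize \<mu> = ?l" using that by (simp add: Young_of_def)
    moreover have "v \<mu> g \<in> H_pi \<mu>" unfolding H_pi_def v_def
      using alg_over_single[OF that(2), of 1] \<open>ysize \<mu> = ?l\<close> by auto
    ultimately show ?thesis using bump_H_T[of \<omega>' \<mu> "v \<mu> g"] w(2) by (simp add: \<phi>_def)
  qed
  show ?thesis
  proof (rule exI[of _ \<omega>], rule exI[of _ \<phi>], rule exI[of _ "\<lambda>\<mu> g k. pairing (\<lambda>h. of_bool (k \<circ> h = id)) (W \<mu> g)"],
      intro conjI w(1) ballI phi allI)
    fix h :: "(nat \<times> nat) set \<Rightarrow> complex"
    define x where "x = (\<Sum>s\<in>Sym ?l. single s (h (link ?l \<omega> (mmult (perm_matr s) \<omega>'))))"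
    have "mmult (perm_matr id) \<omega>' = \<omega>'" using mmult_perm_left(1)[OF id_Sym w(2)] Omega_place[OF w(2)] by simp
    then have "h R = lookup x id" using w(3) id_Sym[of ?l] by (simp add: x_def lookup_sum lookup_single when_def)
    also have "\<dots> = (\<Sum>\<mu>\<in>Young_of ?l. \<Sum>g\<in>Sym ?l. lookup (grp_mult (grp_mult x (v \<mu> g)) (W \<mu> g)) id)"
      unfolding v_def by (subst W[rule_format, of x]) (simp only: lookup_sum)
    also have "\<dots> = (\<Sum>\<mu>\<in>Young_of ?l. \<Sum>g\<in>Sym ?l. \<Sum>k\<in>Sym ?l.
       pairing (\<lambda>h. of_bool (k \<circ> h = id)) (W \<mu> g) * lookup (Op \<mu> h (\<phi> \<mu> g) \<omega>) k)"
    proof (intro sum.cong refl)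
      fix \<mu> g assume m: "\<mu> \<in> Young_of ?l" "g \<in> Sym ?l"
      have l: "ysize \<mu> = ?l" using m by (simp add: Young_of_def)
      have O: "Op \<mu> h (\<phi> \<mu> g) \<omega> = grp_mult x (v \<mu> g)"
        using phi[OF m] w(1) by (simp add: Op_def l x_def kerop_bump[OF w(2)] \<phi>_def)
      have "x \<in> alg_over (Sym ?l)" unfolding x_def by (intro alg_over_sum alg_over_single)
      moreover have "v \<mu> g \<in> alg_over (Sym ?l)"
        using young_symmetrizer_alg[of \<mu>] m l by (auto simp: v_def intro: grp_mult_alg alg_over_single)
      ultimately have "grp_mult x (v \<mu> g) \<in> alg_over (Sym ?l)" by (rule grp_mult_alg)
      then show "lookup (grp_mult (grp_mult x (v \<mu> g)) (W \<mu> g)) id = (\<Sum>k\<in>Sym ?l.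
          pairing (\<lambda>h. of_bool (k \<circ> h = id)) (W \<mu> g) * lookup (Op \<mu> h (\<phi> \<mu> g) \<omega>) k)"
        unfolding O lookup_pairing[of _ id] pairing_convolve[of _ _ "grp_mult x (v \<mu> g)"]
        by (subst pairing_superset[OF finite_Sym]) (auto simp: alg_over_def mult.commute)
    qed
    finally show "h R = (\<Sum>\<mu>\<in>Young_of ?l. \<Sum>g\<in>Sym ?l. \<Sum>k\<in>Sym ?l.
       pairing (\<lambda>h. of_bool (k \<circ> h = id)) (W \<mu> g) * lookup (Op \<mu> h (\<phi> \<mu> g) \<omega>) k)" .
  qed
qed

lemma Op_inj:
  assumes "\<And>\<mu>. \<mu> \<in> Young \<Longrightarrow> Op \<mu> h = Op \<mu> h'" "R \<in> PI k"
  shows "h R = h' R"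
proof -
  obtain \<omega> \<phi> c where r: "\<forall>h. h R = (\<Sum>\<mu>\<in>Young_of (card R). \<Sum>g\<in>Sym (card R). \<Sum>k\<in>Sym (card R).
       c \<mu> g k * lookup (Op \<mu> h (\<phi> \<mu> g) \<omega>) k)"
    using recover[OF assms(2)] by (elim exE conjE)
  show ?thesis using r[rule_format, of h] r[rule_format, of h'] assms(1) by (simp add: Young_of_def)
qed

text \<open>The formula of \<open>recover\<close> involves finitely many diagrams, vectors and
  coordinates, all independent of n; strong convergence for these diagrams forces
  \<open>hatG (\<alpha> n) R\<close> to converge.\<close>

lemma conv_seq_conv_hat:
  assumes "\<alpha> \<in> conv_seq"
  obtains h where "conv_hat \<alpha> h"
proof -
  have al: "\<And>n. \<alpha> n \<in> alg_over Sym_inf" using assms by (simp add: conv_seq_def)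
  obtain L where L: "\<And>\<mu>. \<mu> \<in> Young \<Longrightarrow> sot_limit \<mu> (\<lambda>n. T_alg \<mu> (\<alpha> n)) (L \<mu>)"
    using assms by (auto simp: conv_seq_def) metis
  have "convergent (\<lambda>n. hatG (\<alpha> n) R)" if R: "R \<in> PI k" for R k
  proof -
    let ?l = "card R"
    obtain \<omega> \<phi> c where r: "\<omega> \<in> Omega_inf ?l"
      "\<forall>\<mu>\<in>Young_of ?l. \<forall>g\<in>Sym ?l. \<phi> \<mu> g \<in> H_T \<mu>"
      "\<forall>h. h R = (\<Sum>\<mu>\<in>Young_of ?l. \<Sum>g\<in>Sym ?l. \<Sum>k\<in>Sym ?l. c \<mu> g k * lookup (Op \<mu> h (\<phi> \<mu> g) \<omega>) k)"
      using recover[OF R] by (elim exE conjE)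
    have "(\<lambda>n. hatG (\<alpha> n) R) \<longlonglongrightarrow> (\<Sum>\<mu>\<in>Young_of ?l. \<Sum>g\<in>Sym ?l. \<Sum>k\<in>Sym ?l. c \<mu> g k * lookup (L \<mu> (\<phi> \<mu> g) \<omega>) k)"
      unfolding r(3)[rule_format] T_alg_Op(1)[OF al, symmetric]
      by (intro tendsto_sum tendsto_mult tendsto_const sot_lookup[OF L al r(2)[rule_format]]) (use r(1) in \<open>auto simp: Young_of_def\<close>)
    then show ?thesis by (rule convergentI)
  qed
  then have "conv_hat \<alpha> (\<lambda>R. lim (\<lambda>n. hatG (\<alpha> n) R))"
    unfolding conv_hat_def convergent_LIMSEQ_iff by blast
  then show thesis by (rule that)
qed

lemma conv_seqI:
  assumes "\<And>n. \<alpha> n \<in> alg_over Sym_inf" "\<forall>\<^sub>F n in sequentially. \<alpha> n \<in> cB m n"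
    "bdd_above (range (\<lambda>n. max_deg perm_deg (\<alpha> n)))" "conv_hat \<alpha> h"
  shows "\<alpha> \<in> conv_seq"
proof -
  have "\<forall>\<^sub>F n in sequentially. \<alpha> n \<in> alg_over (Sym n)"
    using assms(2) by eventually_elim (rule cB_alg_over)
  then show ?thesis
    using assms conv_hat_sot[OF assms(2,4,1)] by (auto simp: conv_seq_def)
qed

lemma T_lim_Op:
  assumes "\<alpha> \<in> conv_seq" "conv_hat \<alpha> h"
  shows "T_lim \<mu> \<alpha> = Op \<mu> h"
proof -
  obtain m where "\<forall>\<^sub>F n in sequentially. \<alpha> n \<in> cB m n" using assms by (auto simp: conv_seq_def)
  moreover have "\<And>n. \<alpha> n \<in> alg_over Sym_inf" using assms by (simp add: conv_seq_def)
  ultimately show ?thesis by (intro T_lim_eq conv_hat_sot assms)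
qed

section \<open>Moebius inversion for partial injections\<close>

lemma alternating_Pow:
  assumes "finite A"
  shows "(\<Sum>U\<in>Pow A. (- 1) ^ card U) = (of_bool (A = {}) :: complex)"
  using assms
proof (induction A)
  case (insert a A)
  have "(\<Sum>U\<in>Pow (insert a A). (- 1) ^ card U) = (\<Sum>U\<in>Pow A. (- 1) ^ card U) + (\<Sum>U\<in>insert a ` Pow A. (- 1 :: complex) ^ card U)"
    unfolding Pow_insert by (rule sum.union_disjoint) (use insert in auto)
  also have "(\<Sum>U\<in>insert a ` Pow A. (- 1 :: complex) ^ card U) = (\<Sum>U\<in>Pow A. (- 1) ^ card (insert a U))"
    by (rule sum.reindex_cong[of "insert a"]) (use insert in \<open>auto simp: inj_on_def\<close>)
  also have "\<dots> = (\<Sum>U\<in>Pow A. - ((- 1) ^ card U))"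
  proof (rule sum.cong[OF refl])
    fix U assume "U \<in> Pow A"
    then have "a \<notin> U" "finite U" using insert finite_subset by blast+
    then show "(- 1) ^ card (insert a U) = (- ((- 1) ^ card U) :: complex)" by simp
  qed
  finally show ?case by (simp add: sum_negf)
qed simp

lemma alternating_interval:
  assumes "finite T" "R \<subseteq> T"
  shows "(\<Sum>S | R \<subseteq> S \<and> S \<subseteq> T. (- 1) ^ card (S - R)) = (of_bool (T = R) :: complex)"
    "(\<Sum>S | R \<subseteq> S \<and> S \<subseteq> T. (- 1) ^ card (T - S)) = (of_bool (T = R) :: complex)"
proof -
  have "(\<Sum>S | R \<subseteq> S \<and> S \<subseteq> T. (- 1) ^ card (S - R)) = (\<Sum>U\<in>Pow (T - R). (- 1 :: complex) ^ card U)"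
    by (rule sum.reindex_bij_witness[where i = "\<lambda>U. R \<union> U" and j = "\<lambda>S. S - R"]) (use assms in auto)
  also have "\<dots> = of_bool (T = R)" using assms by (subst alternating_Pow) auto
  finally show "(\<Sum>S | R \<subseteq> S \<and> S \<subseteq> T. (- 1) ^ card (S - R)) = (of_bool (T = R) :: complex)" .
  have "(\<Sum>S | R \<subseteq> S \<and> S \<subseteq> T. (- 1) ^ card (T - S)) = (\<Sum>U\<in>Pow (T - R). (- 1 :: complex) ^ card U)"
    by (rule sum.reindex_bij_witness[where i = "\<lambda>U. T - U" and j = "\<lambda>S. T - S"]) (use assms in auto)
  also have "\<dots> = of_bool (T = R)" using assms by (subst alternating_Pow) auto
  finally show "(\<Sum>S | R \<subseteq> S \<and> S \<subseteq> T. (- 1) ^ card (T - S)) = (of_bool (T = R) :: complex)" .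
qed

definition above :: "nat \<Rightarrow> (nat \<times> nat) set \<Rightarrow> (nat \<times> nat) set set" where
  "above n R = {S \<in> PI n. R \<subseteq> S}"

lemma finite_above [simp]: "finite (above n R)"
  by (simp add: above_def)

text \<open>Intervals in the inclusion order of partial injections are Boolean, hence the sign
  \<open>(- 1) ^ card (S - R)\<close>.\<close>

definition mobius :: "nat \<Rightarrow> ((nat \<times> nat) set \<Rightarrow> complex) \<Rightarrow> (nat \<times> nat) set \<Rightarrow> complex" where
  "mobius n h R = (\<Sum>S\<in>above n R. (- 1) ^ card (S - R) * h S)"

lemma above_sigma: "Sigma (above n R) (above n) = {(S, T). T \<in> above n R \<and> R \<subseteq> S \<and> S \<subseteq> T}"
  unfolding above_def using PI_subset by blast

lemma sum_above_swap:
  "(\<Sum>S\<in>above n R. \<Sum>T\<in>above n S. F S T) = (\<Sum>T\<in>above n R. \<Sum>S | R \<subseteq> S \<and> S \<subseteq> T. F S T)"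
  for F :: "_ \<Rightarrow> _ \<Rightarrow> complex"
proof -
  have "(\<Sum>S\<in>above n R. \<Sum>T\<in>above n S. F S T) = (\<Sum>(S, T)\<in>Sigma (above n R) (above n). F S T)"
    by (rule sum.Sigma) auto
  also have "\<dots> = (\<Sum>(T, S)\<in>Sigma (above n R) (\<lambda>T. {S. R \<subseteq> S \<and> S \<subseteq> T}). F S T)"
    unfolding above_sigma
    by (rule sum.reindex_bij_witness[where i = "\<lambda>(T, S). (S, T)" and j = "\<lambda>(S, T). (T, S)"]) auto
  also have "\<dots> = (\<Sum>T\<in>above n R. \<Sum>S | R \<subseteq> S \<and> S \<subseteq> T. F S T)"
  proof (rule sum.Sigma[symmetric])
    show "\<forall>T\<in>above n R. finite {S. R \<subseteq> S \<and> S \<subseteq> T}"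
      using PI_finite by (auto simp: above_def intro: finite_subset[of _ "Pow _"])
  qed simp
  finally show ?thesis .
qed

lemma mobius_sum:
  assumes "R \<in> PI n"
  shows "mobius n (\<lambda>S. \<Sum>T\<in>above n S. f T) R = f R" "(\<Sum>S\<in>above n R. mobius n h S) = h R"
proof -
  have fin: "finite T" "R \<subseteq> T" if "T \<in> above n R" for T using that PI_finite by (auto simp: above_def)
  have R: "R \<in> above n R" using assms by (simp add: above_def)
  have pick: "(\<Sum>T\<in>above n R. of_bool (T = R) * g T) = g R" for g :: "_ \<Rightarrow> complex"
    using R by (simp add: of_bool_def if_distrib[of "\<lambda>x. x * _"] cong: if_cong)
  show "mobius n (\<lambda>S. \<Sum>T\<in>above n S. f T) R = f R"
    unfolding mobius_def sum_distrib_left sum_above_swap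
    by (simp add: sum_distrib_right[symmetric] alternating_interval(1)[OF fin] pick cong: sum.cong)
  show "(\<Sum>S\<in>above n R. mobius n h S) = h R"
    unfolding mobius_def sum_above_swap
    by (simp add: sum_distrib_right[symmetric] alternating_interval(2)[OF fin] pick cong: sum.cong)
qed

lemma hatA_above:
  assumes "x \<in> alg_over (Gam n)"
  shows "hatA x R = (\<Sum>S\<in>above n R. lookup x (matr_of S))"
proof -
  have "hatA x R = (\<Sum>\<gamma>\<in>Gam n. lookup x \<gamma> * of_bool (R \<subseteq> rel \<gamma>))"
    unfolding hatA_def using assms by (intro pairing_superset) (auto simp: alg_over_def)
  also have "\<dots> = (\<Sum>S\<in>PI n. lookup x (matr_of S) * of_bool (R \<subseteq> S))"
    by (rule sum.reindex_bij_witness[where i = matr_of and j = rel])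
      (auto simp: matr_of_rel rel_PI matr_of_Gam)
  also have "\<dots> = (\<Sum>S\<in>PI n. if R \<subseteq> S then lookup x (matr_of S) else 0)"
    by (rule sum.cong) auto
  finally show ?thesis by (simp add: above_def sum.inter_filter)
qed

lemma lookup_mobius:
  assumes "x \<in> alg_over (Gam n)" "R \<in> PI n"
  shows "lookup x (matr_of R) = mobius n (hatA x) R"
proof -
  have "hatA x = (\<lambda>S. \<Sum>T\<in>above n S. lookup x (matr_of T))" by (rule ext) (rule hatA_above[OF assms(1)])
  then show ?thesis using mobius_sum(1)[OF assms(2), of "\<lambda>S. lookup x (matr_of S)"] by simp
qed

lemma hatA_eqI:
  assumes "x \<in> alg_over (Gam n)" "y \<in> alg_over (Gam n)" "\<And>R. R \<in> PI n \<Longrightarrow> hatA x R = hatA y R"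
  shows "x = y"
proof (rule poly_mapping_eqI)
  fix \<gamma>
  show "lookup x \<gamma> = lookup y \<gamma>"
  proof (cases "\<gamma> \<in> Gam n")
    case True
    have "mobius n (hatA x) (rel \<gamma>) = mobius n (hatA y) (rel \<gamma>)"
      unfolding mobius_def by (rule sum.cong) (auto simp: above_def assms(3))
    then show ?thesis
      using lookup_mobius[OF assms(1) rel_PI[OF True]] lookup_mobius[OF assms(2) rel_PI[OF True]]
      by (simp add: matr_of_rel[OF True])
  next
    case False
    then show ?thesis using assms(1,2) by (metis alg_over_def in_keys_iff mem_Collect_eq subsetD)
  qed
qed

text \<open>Every function on \<open>PI n\<close> is the incidence function of an element at level
  n, so semigroup algebra elements can be built from kernels directly.\<close>

definition of_hat :: "nat \<Rightarrow> ((nat \<times> nat) set \<Rightarrow> complex) \<Rightarrow> sg_alg" where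
  "of_hat n h = (\<Sum>R\<in>PI n. single (matr_of R) (mobius n h R))"

lemma of_hat_alg: "of_hat n h \<in> alg_over (Gam n)"
  unfolding of_hat_def by (intro alg_over_sum alg_over_single matr_of_Gam)

lemma hatA_of_hat:
  assumes "R \<in> PI n"
  shows "hatA (of_hat n h) R = h R"
proof -
  have "hatA (of_hat n h) R = (\<Sum>S\<in>PI n. if R \<subseteq> S then mobius n h S else 0)"
    unfolding hatA_def of_hat_def pairing_sum pairing_single by (rule sum.cong) auto
  also have "\<dots> = h R" using mobius_sum(2)[OF assms] by (simp add: above_def sum.inter_filter)
  finally show ?thesis .
qed

section \<open>The centralizers in terms of incidence functions\<close>

lemma truncate_rel: "rel (truncate k \<gamma>) = rel \<gamma> \<inter> {1..k} \<times> {1..k}"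
  by (auto simp: rel_def truncate_def)

lemma truncate_Gam:
  assumes "\<gamma> \<in> Gam n"
  shows "truncate k \<gamma> \<in> Gam k"
proof -
  have "rel \<gamma> \<inter> {1..k} \<times> {1..k} \<in> PI k"
    using pinj_subset[OF PI_pinj[OF rel_PI[OF assms]]] by (auto simp: PI_def)
  moreover have "truncate k \<gamma> = matr_of (rel \<gamma> \<inter> {1..k} \<times> {1..k})"
  proof (intro ext)
    fix i j show "truncate k \<gamma> i j = matr_of (rel \<gamma> \<inter> {1..k} \<times> {1..k}) i j"
      using Gam_01[OF assms, of i j] by (auto simp: truncate_def matr_of_def rel_def)
  qed
  ultimately show ?thesis by (simp add: matr_of_Gam)
qed

lemma theta_alg: "x \<in> alg_over (Gam n) \<Longrightarrow> theta n x \<in> alg_over (Gam (n - 1))"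
  unfolding theta_def linear_ext_def
  by (intro alg_over_sum alg_over_single truncate_Gam) (auto simp: alg_over_def)

lemma hatA_theta: "R \<in> PI (n - 1) \<Longrightarrow> hatA (theta n x) R = hatA x R"
  unfolding hatA_def theta_def pairing_linear_ext
  by (rule pairing_cong) (auto simp: truncate_rel PI_def)

text \<open>In a path through T and then G the middle point is determined by its starting point;
  composing R with the converse of T therefore strips off T.\<close>

lemma subset_relcomp_left:
  assumes "pinj T"
  shows "R \<subseteq> T O G \<longleftrightarrow> fst ` R \<subseteq> fst ` T \<and> T\<inverse> O R \<subseteq> G"
proof
  assume a: "R \<subseteq> T O G"
  show "fst ` R \<subseteq> fst ` T \<and> T\<inverse> O R \<subseteq> G"
  proof
    show "fst ` R \<subseteq> fst ` T" using a by force
    show "T\<inverse> O R \<subseteq> G"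
    proof (clarify)
      fix c b a' assume "(a', c) \<in> T" "(a', b) \<in> R"
      moreover from this(2) a obtain c' where "(a', c') \<in> T" "(c', b) \<in> G" by blast
      ultimately show "(c, b) \<in> G" using pinj_D(1)[OF assms] by metis
    qed
  qed
next
  assume a: "fst ` R \<subseteq> fst ` T \<and> T\<inverse> O R \<subseteq> G"
  show "R \<subseteq> T O G"
  proof (clarify)
    fix x b assume xb: "(x, b) \<in> R"
    then have "x \<in> fst ` T" using a by force
    then obtain c where "(x, c) \<in> T" by auto
    then show "(x, b) \<in> T O G" using a xb by blast
  qed
qed

lemma subset_relcomp_right:
  assumes "pinj T"
  shows "R \<subseteq> G O T \<longleftrightarrow> snd ` R \<subseteq> snd ` T \<and> R O T\<inverse> \<subseteq> G"
proof
  assume a: "R \<subseteq> G O T"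
  show "snd ` R \<subseteq> snd ` T \<and> R O T\<inverse> \<subseteq> G"
  proof
    show "snd ` R \<subseteq> snd ` T" using a by force
    show "R O T\<inverse> \<subseteq> G"
    proof (clarify)
      fix c b a' assume "(a', b) \<in> R" "(c, b) \<in> T"
      moreover from this(1) a obtain c' where "(a', c') \<in> G" "(c', b) \<in> T" by blast
      ultimately show "(a', c) \<in> G" using pinj_D(2)[OF assms] by metis
    qed
  qed
next
  assume a: "snd ` R \<subseteq> snd ` T \<and> R O T\<inverse> \<subseteq> G"
  show "R \<subseteq> G O T"
  proof (clarify)
    fix x b assume xb: "(x, b) \<in> R"
    then have "b \<in> snd ` T" using a by force
    then obtain c where "(c, b) \<in> T" by auto
    then show "(x, b) \<in> G O T" using a xb by blast
  qed
qed

lemma hatA_mult_left: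
  assumes "\<tau> \<in> Gam n" "x \<in> alg_over (Gam n)"
  shows "hatA (convolve mmult (single \<tau> 1) x) R = of_bool (fst ` R \<subseteq> fst ` rel \<tau>) * hatA x ((rel \<tau>)\<inverse> O R)"
proof -
  have "R \<subseteq> rel (mmult \<tau> \<gamma>) \<longleftrightarrow> fst ` R \<subseteq> fst ` rel \<tau> \<and> (rel \<tau>)\<inverse> O R \<subseteq> rel \<gamma>" if "\<gamma> \<in> keys x" for \<gamma>
  proof -
    have "\<gamma> \<in> Gam n" using that assms(2) by (auto simp: alg_over_def)
    then show ?thesis
      by (simp only: mmult_Gam[OF assms(1)] rel_matr_of subset_relcomp_left[OF PI_pinj[OF rel_PI[OF assms(1)]]])
  qed
  then show ?thesis
    unfolding hatA_def pairing_convolve pairing_single pairing_fun_cmult[symmetric]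
    by (intro pairing_cong) (simp only: of_bool_conj mult_1_left)
qed

lemma hatA_mult_right:
  assumes "\<tau> \<in> Gam n" "x \<in> alg_over (Gam n)"
  shows "hatA (convolve mmult x (single \<tau> 1)) R = of_bool (snd ` R \<subseteq> snd ` rel \<tau>) * hatA x (R O (rel \<tau>)\<inverse>)"
proof -
  have "R \<subseteq> rel (mmult \<gamma> \<tau>) \<longleftrightarrow> snd ` R \<subseteq> snd ` rel \<tau> \<and> R O (rel \<tau>)\<inverse> \<subseteq> rel \<gamma>" if "\<gamma> \<in> keys x" for \<gamma>
  proof -
    have "\<gamma> \<in> Gam n" using that assms(2) by (auto simp: alg_over_def)
    then show ?thesis
      by (simp only: mmult_Gam[OF _ assms(1)] rel_matr_of subset_relcomp_right[OF PI_pinj[OF rel_PI[OF assms(1)]]])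
  qed
  then show ?thesis
    unfolding hatA_def pairing_convolve pairing_single pairing_fun_cmult[symmetric]
    by (intro pairing_cong) (simp only: of_bool_conj mult_1_left)
qed

section \<open>Centralizer conditions as invariance and balancedness\<close>

lemma cA_alg_over: "x \<in> cA m n \<Longrightarrow> x \<in> alg_over (Gam n)"
  by (simp add: cA_def alg_centralizer_def)

lemma cA_hat:
  assumes "x \<in> cA m n" "\<tau> \<in> Gam_sub m n"
  shows "of_bool (fst ` R \<subseteq> fst ` rel \<tau>) * hatA x ((rel \<tau>)\<inverse> O R) = of_bool (snd ` R \<subseteq> snd ` rel \<tau>) * hatA x (R O (rel \<tau>)\<inverse>)"
proof -
  have "\<tau> \<in> Gam n" "x \<in> alg_over (Gam n)" using assms cA_alg_over by (auto simp: Gam_sub_def)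
  moreover have "convolve mmult (single \<tau> 1) x = convolve mmult x (single \<tau> 1)"
    using assms by (simp add: cA_def alg_centralizer_def)
  ultimately show ?thesis using hatA_mult_left hatA_mult_right by metis
qed

lemma Gam_sub_matr_of: "T \<in> PI n \<Longrightarrow> (\<And>i. i \<in> {1..m} \<Longrightarrow> (i, i) \<in> T) \<Longrightarrow> matr_of T \<in> Gam_sub m n"
  unfolding Gam_sub_def by (auto simp: matr_of_Gam) (simp add: matr_of_def)

lemma cA_invariant:
  assumes x: "x \<in> cA m n" and s: "\<sigma> \<in> Sym_stab m n" and m: "m \<le> n" and R: "R \<in> PI n"
  shows "hatA x (act \<sigma> R) = hatA x R"
proof -
  have S: "\<sigma> \<in> Sym n" using s Sym_stab_subset by blast
  have inj: "\<sigma> y = \<sigma> z \<longleftrightarrow> y = z" for y z using Sym_bij[OF S] by (metis inv_left)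
  define T where "T = (\<lambda>b. (\<sigma> b, b)) ` {1..n}"
  have "pinj T" by (rule pinjI) (auto simp: T_def inj)
  then have T: "T \<in> PI n" using Sym_in[OF S] unfolding PI_def T_def by blast
  have "matr_of T \<in> Gam_sub m n"
    by (rule Gam_sub_matr_of[OF T]) (use m Sym_stab_fix[OF s] in \<open>force simp: T_def\<close>)
  note h = cA_hat[OF x this, unfolded rel_matr_of]
  \<comment> \<open>Only first components are moved. Stripping T from the left of R' gives back R,
    stripping it from the right gives \<open>act \<sigma> R\<close>, so the commutation relation
    evaluated at R' compares the two.\<close>
  define R' where "R' = (\<lambda>(a, b). (\<sigma> a, b)) ` R"
  have bd: "a \<in> {1..n}" "b \<in> {1..n}" if "(a, b) \<in> R" for a b using PI_bounds[OF R that] by blast+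
  have 1: "fst ` R' \<subseteq> fst ` T"
  proof
    fix y assume "y \<in> fst ` R'"
    then obtain a b where "(a, b) \<in> R" "y = \<sigma> a" by (auto simp: R'_def)
    then show "y \<in> fst ` T" using bd(1) by (force simp: T_def)
  qed
  have 2: "snd ` R' \<subseteq> snd ` T"
  proof
    fix y assume "y \<in> snd ` R'"
    then obtain a where "(a, y) \<in> R" by (auto simp: R'_def)
    then show "y \<in> snd ` T" using bd(2) by (force simp: T_def)
  qed
  have 3: "T\<inverse> O R' = R"
  proof
    show "T\<inverse> O R' \<subseteq> R" by (auto simp: T_def R'_def inj)
    show "R \<subseteq> T\<inverse> O R'"
    proof (clarify)
      fix a b assume ab: "(a, b) \<in> R"
      then have "(a, \<sigma> a) \<in> T\<inverse>" "(\<sigma> a, b) \<in> R'" using bd(1)[OF ab] by (auto simp: T_def R'_def)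
      then show "(a, b) \<in> T\<inverse> O R'" by blast
    qed
  qed
  have 4: "R' O T\<inverse> = act \<sigma> R"
  proof
    show "R' O T\<inverse> \<subseteq> act \<sigma> R" by (auto simp: T_def R'_def)
    show "act \<sigma> R \<subseteq> R' O T\<inverse>"
    proof
      fix p assume "p \<in> act \<sigma> R"
      then obtain a b where ab: "(a, b) \<in> R" "p = (\<sigma> a, \<sigma> b)" by auto
      then have "(b, \<sigma> b) \<in> T\<inverse>" "(\<sigma> a, b) \<in> R'" using bd(2)[OF ab(1)] by (auto simp: T_def R'_def)
      then show "p \<in> R' O T\<inverse>" using ab(2) by blast
    qed
  qed
  from h[of R'] show ?thesis using 1 2 by (simp add: 3 4)
qed

text \<open>The test element is the diagonal idempotent with entry j deleted, which lies in
  \<open>Gam_sub m n\<close> for j beyond m. If j occurs in only one projection of R, one side of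
  \<open>cA_hat\<close> is \<open>hatA x R\<close> and the other side is 0.\<close>

lemma cA_balanced:
  assumes x: "x \<in> cA m n" and m: "m \<le> n" and R: "R \<in> PI n" and nz: "hatA x R \<noteq> 0"
  shows "fst ` R - {1..m} = snd ` R - {1..m}"
proof -
  have *: "j \<in> fst ` R \<longleftrightarrow> j \<in> snd ` R" if j: "j \<in> {1..n}" "j \<notin> {1..m}" for j
  proof -
    define T where "T = (\<lambda>i. (i, i)) ` ({1..n} - {j})"
    have "pinj T" by (rule pinjI) (auto simp: T_def)
    then have T: "T \<in> PI n" unfolding PI_def T_def by blast
    have "matr_of T \<in> Gam_sub m n"
      by (rule Gam_sub_matr_of[OF T]) (use m j in \<open>auto simp: T_def\<close>)
    note h = cA_hat[OF x this, unfolded rel_matr_of, of R]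
    have f: "fst ` T = {1..n} - {j}" "snd ` T = {1..n} - {j}" by (auto simp: T_def image_image)
    have r: "fst ` R \<subseteq> {1..n}" "snd ` R \<subseteq> {1..n}" using PI_bounds[OF R] by auto
    have c: "T\<inverse> O R = R" if "j \<notin> fst ` R"
    proof
      show "T\<inverse> O R \<subseteq> R" by (auto simp: T_def)
      show "R \<subseteq> T\<inverse> O R"
      proof (clarify)
        fix a b assume ab: "(a, b) \<in> R"
        then have "a \<in> {1..n} - {j}" using that PI_bounds[OF R ab] by force
        then have "(a, a) \<in> T\<inverse>" by (auto simp: T_def)
        then show "(a, b) \<in> T\<inverse> O R" using ab by blast
      qed
    qed
    have c': "R O T\<inverse> = R" if "j \<notin> snd ` R"
    proof
      show "R O T\<inverse> \<subseteq> R" by (auto simp: T_def)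
      show "R \<subseteq> R O T\<inverse>"
      proof (clarify)
        fix a b assume ab: "(a, b) \<in> R"
        then have "b \<in> {1..n} - {j}" using that PI_bounds[OF R ab] by force
        then have "(b, b) \<in> T\<inverse>" by (auto simp: T_def)
        then show "(a, b) \<in> R O T\<inverse>" using ab by blast
      qed
    qed
    show ?thesis
    proof (rule ccontr)
      assume n: "\<not> (j \<in> fst ` R \<longleftrightarrow> j \<in> snd ` R)"
      show False
      proof (cases "j \<in> fst ` R")
        case True
        then have j': "j \<notin> snd ` R" using n by blast
        have "snd ` R \<subseteq> {1..n} - {j}" "\<not> fst ` R \<subseteq> {1..n} - {j}" using r j' True by blast+
        then show False using h nz by (simp add: f c'[OF j'])
      next
        case False
        then have j': "j \<in> snd ` R" using n by blast
        have "fst ` R \<subseteq> {1..n} - {j}" "\<not> snd ` R \<subseteq> {1..n} - {j}" using r j' False by blast+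
        then show False using h nz by (simp add: f c[OF False])
      qed
    qed
  qed
  have "fst ` R \<subseteq> {1..n}" "snd ` R \<subseteq> {1..n}" using PI_bounds[OF R] by auto
  with * show ?thesis by blast
qed

lemma of_bool_mult_eq:
  fixes u v :: complex
  assumes "P \<Longrightarrow> u \<noteq> 0 \<Longrightarrow> Q" "Q \<Longrightarrow> v \<noteq> 0 \<Longrightarrow> P" "P \<Longrightarrow> Q \<Longrightarrow> v = u"
  shows "of_bool P * u = of_bool Q * v"
proof (cases "P \<and> Q")
  case True
  then have "v = u" using assms(3) by blast
  with True show ?thesis by simp
next
  case False
  have "of_bool P * u = 0" using assms(1) False by (cases P) auto
  moreover have "of_bool Q * v = 0" using assms(2) False by (cases Q) auto
  ultimately show ?thesis by simp
qed

text \<open>Every \<tau> in \<open>Gam_sub m n\<close> is contained in a permutation \<sigma> fixing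
  {1..m}. If R fits both projections of \<tau>, invariance under \<sigma> equates the two sides of
  the commutation relation; if it fails to fit one of them, balancedness makes both sides
  vanish.\<close>

lemma cA_I:
  assumes x: "x \<in> alg_over (Gam n)" and m: "m \<le> n"
    and inv: "\<And>\<sigma> R. \<sigma> \<in> Sym_stab m n \<Longrightarrow> R \<in> PI n \<Longrightarrow> hatA x (act \<sigma> R) = hatA x R"
    and bal: "\<And>R. R \<in> PI n \<Longrightarrow> hatA x R \<noteq> 0 \<Longrightarrow> fst ` R - {1..m} = snd ` R - {1..m}"
  shows "x \<in> cA m n"
  unfolding cA_def alg_centralizer_def
proof (intro CollectI conjI ballI x)
  fix \<tau> assume t: "\<tau> \<in> Gam_sub m n"
  then have tG: "\<tau> \<in> Gam n" and d: "\<And>i. i \<in> {1..m} \<Longrightarrow> \<tau> i i = 1"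
    unfolding Gam_sub_def by blast+
  let ?T = "rel \<tau>"
  have T: "?T \<in> PI n" by (rule rel_PI[OF tG])
  note Tp = pinj_D[OF PI_pinj[OF T]]
  have diag: "(i, i) \<in> ?T" if "i \<in> {1..m}" for i using d[OF that] by (simp add: rel_def)
  let ?f = "fst \<circ> inv_into ?T snd"
  have ij: "inj_on fst ?T" "inj_on snd ?T" using PI_pinj[OF T] by (simp_all add: pinj_def)
  then have "bij_betw fst ?T (fst ` ?T)" "bij_betw (inv_into ?T snd) (snd ` ?T) ?T"
    by (auto intro: inj_on_imp_bij_betw bij_betw_inv_into)
  then have "bij_betw ?f (snd ` ?T) (fst ` ?T)" by (rule bij_betw_trans[rotated])
  moreover have "fst ` ?T \<subseteq> {1..n}" "snd ` ?T \<subseteq> {1..n}" using PI_bounds[OF T] by auto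
  ultimately obtain \<sigma> where s: "\<sigma> permutes {1..n}" "\<And>b. b \<in> snd ` ?T \<Longrightarrow> \<sigma> b = ?f b"
    using bij_betw_extend_permutes[of "{1..n}" ?f "snd ` ?T" "fst ` ?T"] finite_atLeastAtMost by metis
  have sT: "\<sigma> b = a" if ab: "(a, b) \<in> ?T" for a b
  proof -
    have "?f b = a" using inv_into_f_f[OF ij(2) ab] by simp
    moreover have "b \<in> snd ` ?T" using ab by force
    ultimately show ?thesis using s(2) by simp
  qed
  have st: "\<sigma> \<in> Sym_stab m n" using s(1) sT[OF diag] by (auto simp: Sym_stab_def Sym_def)
  have inj: "\<sigma> y = \<sigma> z \<longleftrightarrow> y = z" for y z using s(1) by (metis permutes_inj injD)
  have m1: "i \<in> fst ` ?T" "i \<in> snd ` ?T" if "i \<in> {1..m}" for i using diag[OF that] by force+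
  show "convolve mmult (single \<tau> 1) x = convolve mmult x (single \<tau> 1)"
  proof (rule hatA_eqI)
    show "convolve mmult (single \<tau> 1) x \<in> alg_over (Gam n)" "convolve mmult x (single \<tau> 1) \<in> alg_over (Gam n)"
      using x tG by (auto intro!: alg_over_convolve[of _ "Gam n" _ "Gam n"] alg_over_single mmult_in_Gam)
    fix R assume R: "R \<in> PI n"
    let ?P = "?T\<inverse> O R" and ?Q = "R O ?T\<inverse>"
    have PQ: "?P \<in> PI n" "?Q \<in> PI n" using relcomp_PI PI_converse T R by blast+
    have eq: "hatA x ?Q = hatA x ?P" if c: "fst ` R \<subseteq> fst ` ?T" "snd ` R \<subseteq> snd ` ?T"
    proof -
      have "act \<sigma> ?P = ?Q"
      proof
        show "act \<sigma> ?P \<subseteq> ?Q"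
        proof
          fix p assume "p \<in> act \<sigma> ?P"
          then obtain a b c' where ab: "(a, b) \<in> R" "(a, c') \<in> ?T" "p = (\<sigma> c', \<sigma> b)" by auto
          have "b \<in> snd ` ?T" using c(2) ab(1) by force
          then obtain e where "(e, b) \<in> ?T" by auto
          then show "p \<in> ?Q" using ab sT by blast
        qed
        show "?Q \<subseteq> act \<sigma> ?P"
        proof
          fix p assume "p \<in> ?Q"
          then obtain a b e where ab: "(a, b) \<in> R" "(e, b) \<in> ?T" "p = (a, e)" by auto
          have "a \<in> fst ` ?T" using c(1) ab(1) by force
          then obtain c' where c': "(a, c') \<in> ?T" by auto
          then have "(c', b) \<in> ?P" using ab(1) by blast
          moreover have "p = map_prod \<sigma> \<sigma> (c', b)" using sT[OF c'] sT[OF ab(2)] ab(3) by simp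
          ultimately show "p \<in> act \<sigma> ?P" by blast
        qed
      qed
      then show ?thesis using inv[OF st PQ(1)] by simp
    qed
    have b1: "snd ` R \<subseteq> snd ` ?T" if c: "fst ` R \<subseteq> fst ` ?T" "hatA x ?P \<noteq> 0"
    proof
      fix b assume "b \<in> snd ` R"
      then obtain a where ab: "(a, b) \<in> R" by auto
      then have "a \<in> fst ` ?T" using c(1) by force
      then have "b \<in> snd ` ?P" using ab by force
      moreover have "fst ` ?P \<subseteq> snd ` ?T" by force
      ultimately show "b \<in> snd ` ?T" using bal[OF PQ(1) c(2)] m1 by blast
    qed
    have b2: "fst ` R \<subseteq> fst ` ?T" if c: "snd ` R \<subseteq> snd ` ?T" "hatA x ?Q \<noteq> 0"
    proof
      fix a assume "a \<in> fst ` R"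
      then obtain b where ab: "(a, b) \<in> R" by auto
      then have "b \<in> snd ` ?T" using c(1) by force
      then have "a \<in> fst ` ?Q" using ab by force
      moreover have "snd ` ?Q \<subseteq> fst ` ?T" by force
      ultimately show "a \<in> fst ` ?T" using bal[OF PQ(2) c(2)] m1 by blast
    qed
    have "of_bool (fst ` R \<subseteq> fst ` ?T) * hatA x ?P = of_bool (snd ` R \<subseteq> snd ` ?T) * hatA x ?Q"
      by (rule of_bool_mult_eq[OF b1 b2 eq])
    then show "hatA (convolve mmult (single \<tau> 1) x) R = hatA (convolve mmult x (single \<tau> 1)) R"
      by (simp add: hatA_mult_left[OF tG x] hatA_mult_right[OF tG x])
  qed
qed

section \<open>Sequences in the centralizer construction and their kernels\<close>

text \<open>The values become constant in n (\<open>seq_A_hat_stable\<close>). Taking the limit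
  gives a kernel that does not mention the level m and agrees for sequences that coincide
  eventually.\<close>

definition kerA :: "(nat \<Rightarrow> sg_alg) \<Rightarrow> (nat \<times> nat) set \<Rightarrow> complex" where
  "kerA a R = lim (\<lambda>n. hatA (a n) R)"

lemma seq_A_hat_stable:
  assumes a: "a \<in> seq_A m" and n: "m \<le> n" and R: "R \<in> PI n" and k: "n \<le> k"
  shows "hatA (a k) R = hatA (a n) R"
  using k
proof (induction k rule: dec_induct)
  case (step k)
  have "a k = theta (Suc k) (a (Suc k))" using a n step by (auto simp: seq_A_def dest: spec[of _ "Suc k"])
  moreover have "R \<in> PI k" using PI_mono[OF step(1)] R by blast
  ultimately have "hatA (a k) R = hatA (a (Suc k)) R" using hatA_theta[of R "Suc k"] by simp
  then show ?case using step by simp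
qed simp

lemma kerA_eq:
  assumes "a \<in> seq_A m" "m \<le> n" "R \<in> PI n"
  shows "kerA a R = hatA (a n) R"
  unfolding kerA_def
proof (rule limI)
  have "\<forall>\<^sub>F k in sequentially. hatA (a k) R = hatA (a n) R"
    using eventually_ge_at_top[of n] by eventually_elim (rule seq_A_hat_stable[OF assms])
  then show "(\<lambda>k. hatA (a k) R) \<longlonglongrightarrow> hatA (a n) R" by (rule tendsto_eventually)
qed

lemma kerA_cong: "\<forall>\<^sub>F n in sequentially. a n = b n \<Longrightarrow> kerA a R = kerA b R"
proof -
  assume "\<forall>\<^sub>F n in sequentially. a n = b n"
  then have "\<forall>\<^sub>F n in sequentially. hatA (a n) R = hatA (b n) R" by eventually_elim simp
  then show ?thesis unfolding kerA_def lim_def by (simp add: tendsto_cong)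
qed

lemma seq_A_alg: "a \<in> seq_A m \<Longrightarrow> m \<le> n \<Longrightarrow> a n \<in> alg_over (Gam n)"
  and seq_A_cA: "a \<in> seq_A m \<Longrightarrow> m \<le> n \<Longrightarrow> a n \<in> cA m n"
  by (auto simp: seq_A_def cA_alg_over)

lemma seq_A_balanced:
  assumes "a \<in> seq_A m"
  shows "balanced m (kerA a)"
  unfolding balanced_def
proof (intro allI ballI impI)
  fix k R assume R: "R \<in> PI k" and nz: "kerA a R \<noteq> 0"
  have R': "R \<in> PI (max m k)" using R PI_mono[of k "max m k"] by auto
  show "fst ` R - {1..m} = snd ` R - {1..m}"
    using cA_balanced[OF seq_A_cA[OF assms, of "max m k"] _ R'] nz kerA_eq[OF assms _ R'] by simp
qed

lemma seq_A_invariant: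
  assumes "a \<in> seq_A m"
  shows "invariant m (kerA a)"
  unfolding invariant_def
proof (intro allI ballI)
  fix n \<sigma> k R assume s: "\<sigma> \<in> Sym_stab m n" and R: "R \<in> PI k"
  let ?N = "max m (max n k)"
  have "n \<le> ?N" "k \<le> ?N" by simp_all
  then have s': "\<sigma> \<in> Sym_stab m ?N" using s Sym_mono[of n ?N] unfolding Sym_stab_def by blast
  have R': "R \<in> PI ?N" using R PI_mono[OF \<open>k \<le> ?N\<close>] by blast
  have "act \<sigma> R \<in> PI ?N" using act_PI[OF _ R'] s' Sym_stab_subset by blast
  then show "kerA a (act \<sigma> R) = kerA a R"
    using cA_invariant[OF seq_A_cA[OF assms] s' _ R'] kerA_eq[OF assms _ R'] kerA_eq[OF assms, of ?N "act \<sigma> R"] by simp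
qed

lemma kerA_inj:
  assumes "a \<in> seq_A m" "b \<in> seq_A m" "\<And>k R. R \<in> PI k \<Longrightarrow> kerA a R = kerA b R" "m \<le> n"
  shows "a n = b n"
proof (rule hatA_eqI)
  show "a n \<in> alg_over (Gam n)" "b n \<in> alg_over (Gam n)" using assms seq_A_alg by blast+
  fix R assume "R \<in> PI n"
  then show "hatA (a n) R = hatA (b n) R"
    using assms(3) kerA_eq[OF assms(1,4)] kerA_eq[OF assms(2,4)] by simp
qed

text \<open>Moebius inversion adds up the coefficients of the g whose graph inside the square is
  exactly R. A nonzero value exhibits a g in the support of x whose fixed points in {1..n} are all
  diagonal pairs of R; this carries degree bounds from the group to the semigroup.\<close>

lemma mobius_hatG:
  assumes x: "x \<in> alg_over Sym_inf" and R: "R \<in> PI n" and nz: "mobius n (hatG x) R \<noteq> 0"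
  shows "\<exists>g\<in>keys x. \<forall>i\<in>{1..n}. g i = i \<longrightarrow> (i, i) \<in> R"
proof -
  define G where "G g = {(a, b). a \<in> {1..n} \<and> b \<in> {1..n} \<and> g b = a}" for g :: "nat \<Rightarrow> nat"
  have G: "G g \<in> PI n" if "g \<in> keys x" for g
  proof -
    have "g \<in> Sym_inf" using that x by (auto simp: alg_over_def)
    then have i: "inj g" using Sym_bij bij_is_inj by (auto simp: Sym_inf_def)
    have "pinj (G g)" by (rule pinjI) (use i in \<open>auto simp: G_def dest: injD\<close>)
    then show ?thesis by (auto simp: PI_def G_def)
  qed
  have cov: "covers g S \<longleftrightarrow> S \<subseteq> G g" if "S \<in> PI n" for g S
    using PI_bounds[OF that] by (auto simp: covers_def G_def)
  have "mobius n (hatG x) R = pairing (\<lambda>g. \<Sum>S\<in>above n R. (- 1) ^ card (S - R) * of_bool (covers g S)) x"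
    by (simp only: mobius_def hatG_def pairing_fun_sum pairing_fun_cmult)
  also have "\<dots> = pairing (\<lambda>g. of_bool (G g = R)) x"
  proof (rule pairing_cong)
    fix g assume g: "g \<in> keys x"
    have "(\<Sum>S\<in>above n R. (- 1) ^ card (S - R) * of_bool (covers g S)) = (\<Sum>S | R \<subseteq> S \<and> S \<subseteq> G g. (- 1 :: complex) ^ card (S - R))"
    proof (rule sum.mono_neutral_cong_right)
      show "{S. R \<subseteq> S \<and> S \<subseteq> G g} \<subseteq> above n R" using PI_subset[OF G[OF g]] by (auto simp: above_def)
    qed (use PI_subset[OF G[OF g]] in \<open>auto simp: cov above_def\<close>)
    also have "\<dots> = of_bool (G g = R)"
    proof (cases "R \<subseteq> G g")
      case True
      then show ?thesis by (rule alternating_interval(1)[OF PI_finite[OF G[OF g]]])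
    next
      case False
      then have e: "{S. R \<subseteq> S \<and> S \<subseteq> G g} = {}" "G g \<noteq> R" by blast+
      show ?thesis unfolding e(1) using e(2) by simp
    qed
    finally show "(\<Sum>S\<in>above n R. (- 1) ^ card (S - R) * of_bool (covers g S)) = (of_bool (G g = R) :: complex)" .
  qed
  finally have "pairing (\<lambda>g. of_bool (G g = R)) x \<noteq> 0" using nz by simp
  then obtain g where "g \<in> keys x" "G g = R"
    using pairing_eq_0[of x "\<lambda>g. of_bool (G g = R)"] by fastforce
  then show ?thesis by (auto simp: G_def)
qed

lemma max_deg_le_iff: "max_deg d x \<le> D \<longleftrightarrow> (\<forall>g\<in>keys x. d g \<le> D)"
  by (auto simp: max_deg_def)

lemma seq_A_from_limit:
  assumes al: "\<And>n. \<alpha> n \<in> alg_over Sym_inf" and cB: "\<forall>\<^sub>F n in sequentially. \<alpha> n \<in> cB m n"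
    and deg: "bdd_above (range (\<lambda>n. max_deg perm_deg (\<alpha> n)))" and h: "conv_hat \<alpha> h"
    and b: "\<And>n. m \<le> n \<Longrightarrow> b n \<in> alg_over (Gam n)" "\<And>n R. m \<le> n \<Longrightarrow> R \<in> PI n \<Longrightarrow> hatA (b n) R = h R"
  shows "b \<in> seq_A m"
proof -
  have bal: "balanced m h" and inv: "invariant m h"
    using limit_balanced[OF cB h] limit_invariant[OF cB h] by blast+
  obtain D where D: "\<And>n g. g \<in> keys (\<alpha> n) \<Longrightarrow> perm_deg g \<le> D"
    using deg by (auto simp: bdd_above_def max_deg_le_iff)
  have c: "b n \<in> cA m n" if n: "m \<le> n" for n
  proof (rule cA_I[OF b(1)[OF n] n])
    fix \<sigma> R assume s: "\<sigma> \<in> Sym_stab m n" and R: "R \<in> PI n"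
    then have "act \<sigma> R \<in> PI n" using act_PI Sym_stab_subset by blast
    then show "hatA (b n) (act \<sigma> R) = hatA (b n) R"
      using inv s R b(2)[OF n] by (simp add: invariant_def)
  next
    fix R assume "R \<in> PI n" "hatA (b n) R \<noteq> 0"
    then show "fst ` R - {1..m} = snd ` R - {1..m}" using bal b(2)[OF n] by (simp add: balanced_def)
  qed
  have t: "b (n - 1) = theta n (b n)" if n: "m < n" for n
  proof (rule hatA_eqI)
    show "b (n - 1) \<in> alg_over (Gam (n - 1))" using b(1) n by simp
    show "theta n (b n) \<in> alg_over (Gam (n - 1))" using theta_alg b(1) n by simp
    fix R assume R: "R \<in> PI (n - 1)"
    then have "R \<in> PI n" using PI_mono[of "n - 1" n] by auto
    then show "hatA (b (n - 1)) R = hatA (theta n (b n)) R"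
      using b(2)[of "n - 1" R] b(2)[of n R] n R by (simp add: hatA_theta)
  qed
  \<comment> \<open>The coefficient of \<gamma> is a limit of Moebius sums of
    \<open>hatG (\<alpha> k)\<close>. If it is nonzero, one of these sums is nonzero, and
    \<open>mobius_hatG\<close> yields a permutation in some \<open>\<alpha> k\<close> that moves
    every point where \<gamma> has diagonal entry 0.\<close>
  have "Gam_deg n \<gamma> \<le> D" if n: "m \<le> n" and g: "\<gamma> \<in> keys (b n)" for n \<gamma>
  proof -
    have G: "\<gamma> \<in> Gam n" using b(1)[OF n] g by (auto simp: alg_over_def)
    let ?R = "rel \<gamma>"
    have R: "?R \<in> PI n" by (rule rel_PI[OF G])
    have "lookup (b n) \<gamma> = mobius n (hatA (b n)) ?R"
      using lookup_mobius[OF b(1)[OF n] R] by (simp add: matr_of_rel[OF G])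
    also have "\<dots> = mobius n h ?R"
      unfolding mobius_def by (rule sum.cong) (auto simp: above_def b(2)[OF n])
    finally have nz: "mobius n h ?R \<noteq> 0" using g by (simp add: in_keys_iff)
    have *: "(\<lambda>k. mobius n (hatG (\<alpha> k)) ?R) \<longlonglongrightarrow> mobius n h ?R"
      unfolding mobius_def using h by (intro tendsto_sum tendsto_mult tendsto_const) (auto simp: conv_hat_def above_def)
    have "\<exists>k. mobius n (hatG (\<alpha> k)) ?R \<noteq> 0"
    proof (rule ccontr)
      assume "\<not> ?thesis"
      with * have "(\<lambda>k. 0) \<longlonglongrightarrow> mobius n h ?R" by simp
      then show False using nz by (simp add: LIMSEQ_const_iff)
    qed
    then obtain k where "mobius n (hatG (\<alpha> k)) ?R \<noteq> 0" by blast
    then obtain p where p: "p \<in> keys (\<alpha> k)" "\<And>i. i \<in> {1..n} \<Longrightarrow> p i = i \<Longrightarrow> (i, i) \<in> ?R"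
      using mobius_hatG[OF al R] by blast
    have "p \<in> Sym_inf" using al p(1) by (auto simp: alg_over_def)
    then obtain N where N: "p \<in> Sym N" by (auto simp: Sym_inf_def)
    have "{i. p i \<noteq> i} \<subseteq> {1..N}" using Sym_fix[OF N] by blast
    then have fin: "finite {i. p i \<noteq> i}" by (rule finite_subset) simp
    have "{i \<in> {1..n}. \<gamma> i i = 0} \<subseteq> {i. p i \<noteq> i}"
    proof
      fix x assume "x \<in> {i \<in> {1..n}. \<gamma> i i = 0}"
      then have "x \<in> {1..n}" "(x, x) \<notin> ?R" by (simp_all add: rel_def)
      then show "x \<in> {i. p i \<noteq> i}" using p(2) by blast
    qed
    then have "Gam_deg n \<gamma> \<le> perm_deg p" unfolding Gam_deg_def perm_deg_def by (rule card_mono[OF fin])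
    also have "\<dots> \<le> D" by (rule D[OF p(1)])
    finally show ?thesis .
  qed
  then have "bdd_above ((\<lambda>n. max_deg (Gam_deg n) (b n)) ` {m..})"
    by (intro bdd_aboveI[of _ D]) (auto simp: max_deg_le_iff)
  with c t show ?thesis by (simp add: seq_A_def)
qed

section \<open>The action of the centralizer construction\<close>

lemma transpose_Sym_inf: "1 \<le> a \<Longrightarrow> 1 \<le> b \<Longrightarrow> transpose a b \<in> Sym (max a b)"
  by (simp add: Sym_def permutes_swap_id)

text \<open>An invariant vector is constant along the infinite orbits of the points moved away from
  \<open>{1..n}\<close>, so square summability forces it to vanish there.\<close>

lemma H_fin_support:
  assumes p: "\<phi> \<in> H_fin \<mu> n" and w: "\<omega> \<in> Omega_inf (ysize \<mu>)" "\<omega> \<notin> Omega_fin (ysize \<mu>) n"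
  shows "\<phi> \<omega> = 0"
proof -
  let ?l = "ysize \<mu>"
  have H: "\<phi> \<in> H_T \<mu>" using p by (simp add: H_fin_def)
  obtain i where i: "i \<in> {1..?l}" "n < pos \<omega> i" using w by (auto simp: Omega_fin_iff not_le)
  \<comment> \<open>Columns from b on lie beyond n, so moving the one of row i to such a column K
    uses a transposition that fixes {1..n}. The resulting matrices are distinct because row i shows
    K.\<close>
  define b where "b = pos \<omega> i + 1"
  define u where "u K = mmult \<omega> (perm_matr (transpose (pos \<omega> i) K))" for K
  have tS: "transpose (pos \<omega> i) K \<in> Sym_inf" if "b \<le> K" for K
    using transpose_Sym_inf[of "pos \<omega> i" K] that i(2) by (auto simp: Sym_inf_def b_def)
  have phi: "\<phi> (u K) = \<phi> \<omega>" if K: "b \<le> K" for K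
  proof -
    have "\<forall>j\<in>{1..n}. transpose (pos \<omega> i) K j = j" using i(2) K by (auto simp: b_def transpose_def)
    then have "T_grp \<mu> (transpose (pos \<omega> i) K) \<phi> = \<phi>" using p tS[OF K] by (simp add: H_fin_def)
    then have "T_grp \<mu> (transpose (pos \<omega> i) K) \<phi> \<omega> = \<phi> \<omega>" by simp
    then show ?thesis using w(1) by (simp add: T_grp_def u_def)
  qed
  have uO: "u K \<in> Omega_inf ?l" if "b \<le> K" for K
    unfolding u_def by (rule mmult_perm_right(2)[OF tS[OF that] w(1)])
  have upos: "pos (u K) i = K" if "b \<le> K" for K
    unfolding u_def mmult_perm_right(1)[OF tS[OF that] w(1)] pos_place[OF i(1)] by simp
  have inj: "inj_on u {b..<b + N}" for N
    by (rule inj_on_inverseI[where g = "\<lambda>\<omega>. pos \<omega> i"]) (use upos in auto)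
  have le: "real N * norm_sq (\<phi> \<omega>) \<le> nrm2 ?l \<phi>" for N
  proof -
    have "(\<Sum>\<omega>'\<in>u ` {b..<b + N}. norm_sq (\<phi> \<omega>')) \<le> nrm2 ?l \<phi>"
      by (rule sqsum_finite_le[OF H_T_sqsum[OF H]]) (use uO in auto)
    then show ?thesis by (simp add: sum.reindex[OF inj] phi)
  qed
  have "norm_sq (\<phi> \<omega>) = 0"
  proof (rule ccontr)
    assume "norm_sq (\<phi> \<omega>) \<noteq> 0"
    then have "0 < norm_sq (\<phi> \<omega>)" using norm_sq_nonneg[of "\<phi> \<omega>"] by linarith
    then obtain N where "nrm2 ?l \<phi> < real N * norm_sq (\<phi> \<omega>)" using reals_Archimedean3 by blast
    then show False using le[of N] by simp
  qed
  then show ?thesis by (rule norm_sq_eq_0)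
qed

lemma finite_Omega_fin [simp]: "finite (Omega_fin l n)"
proof (rule finite_subset)
  show "Omega_fin l n \<subseteq> {\<omega> \<in> Omega_inf l. pos \<omega> ` {1..l} \<subseteq> {1..n}}"
    using pos_ge_1 by (auto simp: Omega_fin_iff)
  show "finite {\<omega> \<in> Omega_inf l. pos \<omega> ` {1..l} \<subseteq> {1..n}}" by (rule finite_Omega_within) simp
qed

lemma T_sg_alg_hat:
  assumes x: "x \<in> alg_over (Gam n)" and w: "\<omega> \<in> Omega_fin (ysize \<mu>) n"
  shows "T_sg_alg \<mu> n x \<phi> \<omega> = (\<Sum>\<omega>'\<in>Omega_fin (ysize \<mu>) n. scale (hatA x (link (ysize \<mu>) \<omega> \<omega>')) (\<phi> \<omega>'))"
proof -
  let ?l = "ysize \<mu>"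
  have "T_sg \<mu> n \<gamma> \<phi> \<omega> = (\<Sum>\<omega>'\<in>Omega_fin ?l n. if link ?l \<omega> \<omega>' \<subseteq> rel \<gamma> then \<phi> \<omega>' else 0)"
    if g: "\<gamma> \<in> keys x" for \<gamma>
  proof -
    have G: "\<gamma> \<in> Gam n" using x g by (auto simp: alg_over_def)
    have "(\<Sum>\<omega>'\<in>Omega_fin ?l n. if link ?l \<omega> \<omega>' \<subseteq> rel \<gamma> then \<phi> \<omega>' else 0)
        = (\<Sum>\<omega>'\<in>Omega_fin ?l n. if \<omega>' = mmult \<omega> \<gamma> then \<phi> \<omega>' else 0)"
      by (rule sum.cong[OF refl]) (use mmult_Gam_iff[OF G w] in auto)
    also have "\<dots> = (if mmult \<omega> \<gamma> \<in> Omega_fin ?l n then \<phi> (mmult \<omega> \<gamma>) else 0)" by simp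
    finally show ?thesis using w by (simp add: T_sg_def)
  qed
  then have "T_sg_alg \<mu> n x \<phi> \<omega> = (\<Sum>\<gamma>\<in>keys x. scale (lookup x \<gamma>) (\<Sum>\<omega>'\<in>Omega_fin ?l n. if link ?l \<omega> \<omega>' \<subseteq> rel \<gamma> then \<phi> \<omega>' else 0))"
    by (simp add: T_sg_alg_def)
  also have "\<dots> = (\<Sum>\<omega>'\<in>Omega_fin ?l n. \<Sum>\<gamma>\<in>keys x. scale (lookup x \<gamma> * of_bool (link ?l \<omega> \<omega>' \<subseteq> rel \<gamma>)) (\<phi> \<omega>'))"
    unfolding scale_sum by (subst sum.swap) (intro sum.cong refl, simp)
  also have "\<dots> = (\<Sum>\<omega>'\<in>Omega_fin ?l n. scale (hatA x (link ?l \<omega> \<omega>')) (\<phi> \<omega>'))"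
    by (simp only: hatA_def pairing_def grp_alg_vs.scale_sum_left)
  finally show ?thesis .
qed

text \<open>On \<open>H_fin\<close> only positions up to n enter on the input side. On the output
  side balancedness forbids linking a position beyond n, hence beyond m, with positions in {1..n},
  so the kernel operator reduces to the finite sum of the semigroup action.\<close>

lemma Op_restrict:
  assumes a: "a \<in> seq_A m" and h: "\<And>k R. R \<in> PI k \<Longrightarrow> h R = kerA a R"
    and n: "m \<le> n" and p: "\<phi> \<in> H_fin \<mu> n"
  shows "Op \<mu> h \<phi> = T_sg_alg \<mu> n (a n) \<phi>"
proof
  fix \<omega>
  let ?l = "ysize \<mu>"
  have H: "\<phi> \<in> H_T \<mu>" using p by (simp add: H_fin_def)
  have sub: "Omega_fin ?l n \<subseteq> Omega_inf ?l" by (auto simp: Omega_fin_def)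
  show "Op \<mu> h \<phi> \<omega> = T_sg_alg \<mu> n (a n) \<phi> \<omega>"
  proof (cases "\<omega> \<in> Omega_inf ?l")
    case w: True
    have "kerop ?l h \<phi> \<omega> = (\<Sum>\<omega>'\<in>Omega_fin ?l n. scale (h (link ?l \<omega> \<omega>')) (\<phi> \<omega>'))"
      by (rule kerop_superset) (use sub H_fin_support[OF p] in auto)
    then have O: "Op \<mu> h \<phi> \<omega> = (\<Sum>\<omega>'\<in>Omega_fin ?l n. scale (h (link ?l \<omega> \<omega>')) (\<phi> \<omega>'))"
      using H w by (simp add: Op_def)
    show ?thesis
    proof (cases "\<omega> \<in> Omega_fin ?l n")
      case True
      show ?thesis
        unfolding O T_sg_alg_hat[OF seq_A_alg[OF a n] True]
      proof (rule sum.cong[OF refl])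
        fix \<omega>' assume "\<omega>' \<in> Omega_fin ?l n"
        then have l: "link ?l \<omega> \<omega>' \<in> PI n" by (rule link_PI[OF True])
        show "scale (h (link ?l \<omega> \<omega>')) (\<phi> \<omega>') = scale (hatA (a n) (link ?l \<omega> \<omega>')) (\<phi> \<omega>')"
          by (simp only: h[OF l] kerA_eq[OF a n l])
      qed
    next
      case False
      then obtain i where i: "i \<in> {1..?l}" "n < pos \<omega> i" using w by (auto simp: Omega_fin_iff not_le)
      have "h (link ?l \<omega> \<omega>') = 0" if w': "\<omega>' \<in> Omega_fin ?l n" for \<omega>'
      proof (rule ccontr)
        assume nz: "h (link ?l \<omega> \<omega>') \<noteq> 0"
        have w'': "\<omega>' \<in> Omega_inf ?l" using w' sub by blast
        obtain k where "link ?l \<omega> \<omega>' \<in> PI k" using link_PI_inf[OF w w''] by blast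
        then have "kerA a (link ?l \<omega> \<omega>') \<noteq> 0" using nz h by simp
        then have "pos \<omega> ` {1..?l} - {1..m} = pos \<omega>' ` {1..?l} - {1..m}"
          by (rule balanced_link[OF seq_A_balanced[OF a] w w''])
        moreover have "pos \<omega> i \<in> pos \<omega> ` {1..?l} - {1..m}" using i n by simp
        ultimately obtain j where j: "j \<in> {1..?l}" "pos \<omega> i = pos \<omega>' j" by blast
        have "pos \<omega>' j \<le> n" using w' j(1) unfolding Omega_fin_iff by blast
        then show False using j(2) i(2) by simp
      qed
      then have "Op \<mu> h \<phi> \<omega> = 0" unfolding O by simp
      then show ?thesis using False by (simp add: T_sg_alg_def T_sg_def)
    qed
  next
    case False
    then have "\<omega> \<notin> Omega_fin ?l n" using sub by blast
    then show ?thesis using False H by (simp add: Op_def T_sg_alg_def T_sg_def)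
  qed
qed

section \<open>Density of the finite levels and uniqueness of bounded extensions\<close>

definition cut :: "nat \<Rightarrow> nat \<Rightarrow> hvec \<Rightarrow> hvec" where
  "cut l n \<phi> = (\<lambda>\<omega>. if \<omega> \<in> Omega_fin l n then \<phi> \<omega> else 0)"

lemma Omega_fin_perm_left:
  assumes "s \<in> Sym l" "\<omega> \<in> Omega_inf l"
  shows "mmult (perm_matr s) \<omega> \<in> Omega_fin l n \<longleftrightarrow> \<omega> \<in> Omega_fin l n"
proof -
  have "pos (mmult (perm_matr s) \<omega>) ` {1..l} = (\<lambda>i. pos \<omega> (ginv s i)) ` {1..l}"
    by (rule image_cong[OF refl]) (rule pos_perm_left[OF assms])
  also have "\<dots> = pos \<omega> ` (ginv s ` {1..l})" by (simp only: image_image)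
  also have "ginv s ` {1..l} = {1..l}" using inv_Sym[OF assms(1)] by (simp only: Sym_permutes permutes_image)
  finally have "pos (mmult (perm_matr s) \<omega>) ` {1..l} = pos \<omega> ` {1..l}" .
  then have "(\<forall>x\<in>pos (mmult (perm_matr s) \<omega>) ` {1..l}. x \<le> n) \<longleftrightarrow> (\<forall>x\<in>pos \<omega> ` {1..l}. x \<le> n)" by (simp only:)
  then show ?thesis
    unfolding Omega_fin_iff using assms(2) mmult_perm_left(2)[OF assms] by blast
qed

lemma cut_H_fin:
  assumes p: "\<phi> \<in> H_T \<mu>"
  shows "cut (ysize \<mu>) n \<phi> \<in> H_fin \<mu> n"
proof -
  let ?l = "ysize \<mu>" and ?c = "cut (ysize \<mu>) n \<phi>"
  have le: "(\<Sum>\<omega>\<in>F. norm_sq (?c \<omega>)) \<le> nrm2 ?l \<phi>" if "finite F" "F \<subseteq> Omega_inf ?l" for F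
  proof -
    have "(\<Sum>\<omega>\<in>F. norm_sq (?c \<omega>)) \<le> (\<Sum>\<omega>\<in>F. norm_sq (\<phi> \<omega>))"
      by (rule sum_mono) (simp add: cut_def)
    also have "\<dots> \<le> nrm2 ?l \<phi>" by (rule sqsum_finite_le[OF H_T_sqsum[OF p] that])
    finally show ?thesis .
  qed
  have H: "?c \<in> H_T \<mu>"
    unfolding H_T_def mem_Collect_eq
  proof (intro conjI allI impI ballI sqsumI(1)[OF le])
    fix \<omega> assume "\<omega> \<notin> Omega_inf ?l" then show "?c \<omega> = 0" by (simp add: cut_def Omega_fin_def)
  next
    fix \<omega> show "?c \<omega> \<in> H_pi \<mu>" using H_T_pi[OF p] H_pi_zero by (simp add: cut_def)
  next
    fix s \<omega> assume s: "s \<in> Sym ?l" "\<omega> \<in> Omega_inf ?l"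
    show "?c (mmult (perm_matr s) \<omega>) = pi_rep s (?c \<omega>)"
      using Omega_fin_perm_left[OF s] H_T_equivariant[OF p s] by (simp add: cut_def pi_rep_def)
  qed
  have "T_grp \<mu> g ?c = ?c" if g: "g \<in> Sym_inf" "\<forall>i\<in>{1..n}. g i = i" for g
  proof
    fix \<omega>
    obtain N where N: "g \<in> Sym N" using g(1) by (auto simp: Sym_inf_def)
    have b: "bij g" using N by (rule Sym_bij)
    show "T_grp \<mu> g ?c \<omega> = ?c \<omega>"
    proof (cases "\<omega> \<in> Omega_inf ?l")
      case w: True
      let ?w = "mmult \<omega> (perm_matr g)"
      have w': "?w \<in> Omega_inf ?l" by (rule mmult_perm_right(2)[OF g(1) w])
      have ps: "pos ?w i = ginv g (pos \<omega> i)" if "i \<in> {1..?l}" for i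
        unfolding mmult_perm_right(1)[OF g(1) w] by (rule pos_place[OF that])
      have fx: "ginv g x = x" if "1 \<le> x" "x \<le> n" for x using g(2) that inv_left[OF b, of x] by simp
      have gt: "n < ginv g x" if "1 \<le> x" "n < x" for x
      proof (rule ccontr)
        assume "\<not> n < ginv g x"
        moreover have "1 \<le> ginv g x" using Sym_pos[OF inv_Sym[OF N]] that by simp
        ultimately have "g (ginv g x) = ginv g x" using g(2) by simp
        then show False using inv_right[OF b, of x] \<open>\<not> n < ginv g x\<close> that by simp
      qed
      show ?thesis
      proof (cases "\<omega> \<in> Omega_fin ?l n")
        case True
        have "?w = \<omega>"
        proof (rule Omega_eqI[OF w' w])
          fix i assume i: "i \<in> {1..?l}"
          then have "pos \<omega> i \<le> n" using True by (simp only: Omega_fin_iff)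
          then show "pos ?w i = pos \<omega> i" using ps[OF i] fx pos_ge_1[OF w i] by simp
        qed
        then show ?thesis using w by (simp add: T_grp_def)
      next
        case False
        then obtain i where i: "i \<in> {1..?l}" "n < pos \<omega> i" using w by (auto simp: Omega_fin_iff not_le)
        then have "n < pos ?w i" using ps[OF i(1)] gt[of "pos \<omega> i"] pos_ge_1[OF w i(1)] by simp
        then have "?w \<notin> Omega_fin ?l n" using i(1) unfolding Omega_fin_iff by (meson not_le)
        then show ?thesis using False w by (simp add: T_grp_def cut_def)
      qed
    next
      case False
      then show ?thesis by (simp add: T_grp_def cut_def Omega_fin_def)
    qed
  qed
  then show ?thesis using H by (simp add: H_fin_def)
qed

lemma cut_dense:
  assumes p: "\<phi> \<in> H_T \<mu>" and e: "\<epsilon> > 0"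
  shows "\<exists>n\<ge>n0. nrm2 (ysize \<mu>) (\<lambda>\<omega>. \<phi> \<omega> - cut (ysize \<mu>) n \<phi> \<omega>) \<le> \<epsilon>"
proof -
  let ?l = "ysize \<mu>"
  obtain F where F: "finite F" "F \<subseteq> Omega_inf ?l"
    "\<And>G. finite G \<Longrightarrow> G \<subseteq> Omega_inf ?l - F \<Longrightarrow> (\<Sum>\<omega>\<in>G. norm_sq (\<phi> \<omega>)) \<le> \<epsilon>"
    using sqsum_tail[OF H_T_sqsum[OF p] e] by blast
  have "\<forall>\<omega>\<in>F. \<forall>\<^sub>F n in sequentially. \<omega> \<in> Omega_fin ?l n"
    using F(2) Omega_inf_fin unfolding eventually_sequentially by blast
  then have "\<forall>\<^sub>F n in sequentially. \<forall>\<omega>\<in>F. \<omega> \<in> Omega_fin ?l n" by (rule eventually_ball_finite[OF F(1)])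
  then obtain N where N: "\<And>n \<omega>. n \<ge> N \<Longrightarrow> \<omega> \<in> F \<Longrightarrow> \<omega> \<in> Omega_fin ?l n"
    unfolding eventually_sequentially by blast
  let ?n = "max N n0"
  have "nrm2 ?l (\<lambda>\<omega>. \<phi> \<omega> - cut ?l ?n \<phi> \<omega>) \<le> \<epsilon>"
  proof (rule sqsumI(2))
    fix G assume G: "finite G" "G \<subseteq> Omega_inf ?l"
    have "(\<Sum>\<omega>\<in>G. norm_sq (\<phi> \<omega> - cut ?l ?n \<phi> \<omega>)) = (\<Sum>\<omega>\<in>G - F. norm_sq (\<phi> \<omega> - cut ?l ?n \<phi> \<omega>))"
      by (rule sum.mono_neutral_right) (use G N[of ?n] in \<open>auto simp: cut_def\<close>)
    also have "\<dots> \<le> (\<Sum>\<omega>\<in>G - F. norm_sq (\<phi> \<omega>))" by (rule sum_mono) (simp add: cut_def)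
    also have "\<dots> \<le> \<epsilon>" by (rule F(3)) (use G in auto)
    finally show "(\<Sum>\<omega>\<in>G. norm_sq (\<phi> \<omega> - cut ?l ?n \<phi> \<omega>)) \<le> \<epsilon>" .
  qed
  then show ?thesis by (intro exI[of _ ?n]) simp
qed

lemma End_T_bound:
  assumes L: "L \<in> End_T \<mu>"
  obtains C where "\<And>\<phi>. \<phi> \<in> H_T \<mu> \<Longrightarrow> nrm2 (ysize \<mu>) (L \<phi>) \<le> C\<^sup>2 * nrm2 (ysize \<mu>) \<phi>"
proof -
  obtain C where C: "\<forall>\<phi>\<in>H_T \<mu>. norm_T \<mu> (L \<phi>) \<le> C * norm_T \<mu> \<phi>" using L by (auto simp: End_T_def)
  show thesis
  proof (rule that[of C])
    fix \<phi> assume "\<phi> \<in> H_T \<mu>"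
    then have "(norm_T \<mu> (L \<phi>))\<^sup>2 \<le> (C * norm_T \<mu> \<phi>)\<^sup>2"
      using C by (intro power_mono) (auto simp: norm_T_nrm2 nrm2_nonneg)
    then show "nrm2 (ysize \<mu>) (L \<phi>) \<le> C\<^sup>2 * nrm2 (ysize \<mu>) \<phi>"
      by (simp add: power_mult_distrib norm_T_nrm2 nrm2_nonneg)
  qed
qed

text \<open>The maps agree on the cuts of \<phi>, and the remainder of a cut has arbitrarily small
  norm; boundedness makes both of its images small at each \<omega>.\<close>

lemma End_T_eqI:
  assumes L: "L \<in> End_T \<mu>" and L': "L' \<in> End_T \<mu>"
    and eq: "\<And>n \<phi>. n0 \<le> n \<Longrightarrow> \<phi> \<in> H_fin \<mu> n \<Longrightarrow> L \<phi> = L' \<phi>"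
  shows "L = L'"
proof
  fix \<phi>
  let ?l = "ysize \<mu>"
  have E: "L \<in> H_T \<mu> \<rightarrow>\<^sub>E H_T \<mu>" "L' \<in> H_T \<mu> \<rightarrow>\<^sub>E H_T \<mu>" using L L' by (auto simp: End_T_def)
  have add: "L (\<lambda>\<omega>. \<phi> \<omega> + \<psi> \<omega>) = (\<lambda>\<omega>. L \<phi> \<omega> + L \<psi> \<omega>)" "L' (\<lambda>\<omega>. \<phi> \<omega> + \<psi> \<omega>) = (\<lambda>\<omega>. L' \<phi> \<omega> + L' \<psi> \<omega>)"
    if "\<phi> \<in> H_T \<mu>" "\<psi> \<in> H_T \<mu>" for \<phi> \<psi>
    using L L' that by (auto simp: End_T_def)
  show "L \<phi> = L' \<phi>"
  proof (cases "\<phi> \<in> H_T \<mu>")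
    case p: True
    obtain C where C: "\<And>\<phi>. \<phi> \<in> H_T \<mu> \<Longrightarrow> nrm2 ?l (L \<phi>) \<le> C\<^sup>2 * nrm2 ?l \<phi>" using End_T_bound[OF L] by blast
    obtain C' where C': "\<And>\<phi>. \<phi> \<in> H_T \<mu> \<Longrightarrow> nrm2 ?l (L' \<phi>) \<le> C'\<^sup>2 * nrm2 ?l \<phi>" using End_T_bound[OF L'] by blast
    have HL: "L \<psi> \<in> H_T \<mu>" "L' \<psi> \<in> H_T \<mu>" if "\<psi> \<in> H_T \<mu>" for \<psi> using E that by (auto simp: PiE_mem)
    show ?thesis
    proof
      fix \<omega>
      show "L \<phi> \<omega> = L' \<phi> \<omega>"
      proof (cases "\<omega> \<in> Omega_inf ?l")
        case w: True
        let ?K = "2 * C\<^sup>2 + 2 * C'\<^sup>2"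
        have small: "norm_sq (L \<phi> \<omega> - L' \<phi> \<omega>) \<le> ?K * \<epsilon>" if e: "\<epsilon> > 0" for \<epsilon>
        proof -
          obtain n where n: "n \<ge> n0" "nrm2 ?l (\<lambda>\<omega>. \<phi> \<omega> - cut ?l n \<phi> \<omega>) \<le> \<epsilon>"
            using cut_dense[OF p e, of n0] by blast
          let ?c = "cut ?l n \<phi>" and ?d = "\<lambda>\<omega>. \<phi> \<omega> - cut ?l n \<phi> \<omega>"
          have c: "?c \<in> H_fin \<mu> n" by (rule cut_H_fin[OF p])
          then have cH: "?c \<in> H_T \<mu>" by (simp add: H_fin_def)
          have dH: "?d \<in> H_T \<mu>" by (rule H_T_diff[OF p cH])
          have s: "(\<lambda>\<omega>. ?c \<omega> + ?d \<omega>) = \<phi>" by simp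
          have "L \<phi> \<omega> - L' \<phi> \<omega> = L ?d \<omega> - L' ?d \<omega>"
            using fun_cong[OF add(1)[OF cH dH], of \<omega>] fun_cong[OF add(2)[OF cH dH], of \<omega>] eq[OF n(1) c]
            by (simp add: s)
          then have "norm_sq (L \<phi> \<omega> - L' \<phi> \<omega>) \<le> 2 * norm_sq (L ?d \<omega>) + 2 * norm_sq (L' ?d \<omega>)"
            by (simp only: norm_sq_diff_le)
          also have "\<dots> \<le> 2 * (C\<^sup>2 * nrm2 ?l ?d) + 2 * (C'\<^sup>2 * nrm2 ?l ?d)"
            using nrm2_pointwise[OF H_T_sqsum[OF HL(1)[OF dH]] w] C[OF dH]
              nrm2_pointwise[OF H_T_sqsum[OF HL(2)[OF dH]] w] C'[OF dH] by linarith
          also have "\<dots> = ?K * nrm2 ?l ?d" by (simp add: algebra_simps)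
          also have "\<dots> \<le> ?K * \<epsilon>" by (rule mult_left_mono[OF n(2)]) simp
          finally show ?thesis .
        qed
        have "norm_sq (L \<phi> \<omega> - L' \<phi> \<omega>) \<le> 0"
        proof (rule field_le_epsilon)
          fix e :: real assume e: "e > 0"
          have K: "0 < ?K + 1" by (simp add: add_nonneg_pos)
          have "norm_sq (L \<phi> \<omega> - L' \<phi> \<omega>) \<le> ?K * (e / (?K + 1))" by (rule small) (use e K in simp)
          also have "\<dots> \<le> e" using e K by (simp add: field_simps)
          finally show "norm_sq (L \<phi> \<omega> - L' \<phi> \<omega>) \<le> 0 + e" by simp
        qed
        then have "norm_sq (L \<phi> \<omega> - L' \<phi> \<omega>) = 0" using norm_sq_nonneg order_antisym by blast
        then have "L \<phi> \<omega> - L' \<phi> \<omega> = 0" by (rule norm_sq_eq_0)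
        then show ?thesis by simp
      next
        case False
        then show ?thesis using HL[OF p] by (simp add: H_T_outside)
      qed
    qed
  qed (use E in \<open>auto simp: PiE_def extensional_def\<close>)
qed

lemma T_tilde_Op:
  assumes a: "a \<in> seq_A m" and h: "\<And>k R. R \<in> PI k \<Longrightarrow> h R = kerA a R" and E: "Op \<mu> h \<in> End_T \<mu>"
  shows "T_tilde \<mu> m a = Op \<mu> h"
  unfolding T_tilde_def
proof (rule the_equality)
  show "Op \<mu> h \<in> End_T \<mu> \<and> (\<forall>n\<ge>max m (ysize \<mu>). \<forall>\<phi>\<in>H_fin \<mu> n. Op \<mu> h \<phi> = T_sg_alg \<mu> n (a n) \<phi>)"
    using E Op_restrict[OF a h] by simp
next
  fix L assume L: "L \<in> End_T \<mu> \<and> (\<forall>n\<ge>max m (ysize \<mu>). \<forall>\<phi>\<in>H_fin \<mu> n. L \<phi> = T_sg_alg \<mu> n (a n) \<phi>)"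
  show "L = Op \<mu> h"
    by (rule End_T_eqI[of _ _ _ "max m (ysize \<mu>)"]) (use L E Op_restrict[OF a h] in auto)
qed

section \<open>Cumulants\<close>

lemma pairing_nonzero: "pairing \<phi> x \<noteq> 0 \<Longrightarrow> \<exists>g\<in>keys x. \<phi> g \<noteq> 0"
  using pairing_eq_0[of x \<phi>] by blast

definition diagp :: "nat \<Rightarrow> (nat \<times> nat) set \<Rightarrow> (nat \<times> nat) set" where
  "diagp m R = {(a, b) \<in> R. a = b \<and> m < a}"

definition supp :: "nat \<Rightarrow> (nat \<times> nat) set \<Rightarrow> nat set" where
  "supp m R = (fst ` R \<union> snd ` R) - {1..m}"

text \<open>Moebius inversion over deletions of diagonal pairs beyond m. Such pairs hold for every
  element that fixes the points concerned, so a degree bound does not limit their number in R. The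
  inversion removes their influence and leaves a function that vanishes once \<open>supp m R\<close>
  is larger than the degree (\<open>cumulant_degree\<close>).\<close>

definition cumulant :: "nat \<Rightarrow> ((nat \<times> nat) set \<Rightarrow> complex) \<Rightarrow> (nat \<times> nat) set \<Rightarrow> complex" where
  "cumulant m h R = (\<Sum>T\<in>Pow (diagp m R). (- 1) ^ card T * h (R - T))"

lemma diagp_subset: "diagp m R \<subseteq> R"
  by (auto simp: diagp_def)

lemma diagp_diff: "diagp m (R - T) = diagp m R - T"
  by (auto simp: diagp_def)

lemma finite_diagp: "finite R \<Longrightarrow> finite (diagp m R)"
  using finite_subset[OF diagp_subset] .

lemma cumulant_sum:
  assumes "finite R"
  shows "(\<Sum>T\<in>Pow (diagp m R). cumulant m h (R - T)) = h R"
proof -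
  let ?A = "diagp m R"
  have fA: "finite ?A" using assms by (rule finite_diagp)
  have fs: "finite T" if "T \<in> Pow ?A" for T using that fA finite_subset by blast
  have "(\<Sum>T\<in>Pow ?A. cumulant m h (R - T)) = (\<Sum>T\<in>Pow ?A. \<Sum>U\<in>Pow (?A - T). (- 1) ^ card U * h (R - (T \<union> U)))"
  proof -
    have "R - T - U = R - (T \<union> U)" for T U by blast
    then show ?thesis by (simp only: cumulant_def diagp_diff)
  qed
  also have "\<dots> = (\<Sum>(T, U)\<in>Sigma (Pow ?A) (\<lambda>T. Pow (?A - T)). (- 1) ^ card U * h (R - (T \<union> U)))"
    by (rule sum.Sigma) (use fA in auto)
  also have "\<dots> = (\<Sum>(W, U)\<in>Sigma (Pow ?A) Pow. (- 1) ^ card U * h (R - W))"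
    by (rule sum.reindex_bij_witness[where i = "\<lambda>(W, U). (W - U, U)" and j = "\<lambda>(T, U). (T \<union> U, U)"]) auto
  also have "\<dots> = (\<Sum>W\<in>Pow ?A. \<Sum>U\<in>Pow W. (- 1) ^ card U * h (R - W))"
    by (rule sum.Sigma[symmetric]) (use fA fs in auto)
  also have "\<dots> = (\<Sum>W\<in>Pow ?A. if W = {} then h R else 0)"
  proof (rule sum.cong[OF refl])
    fix W assume W: "W \<in> Pow ?A"
    show "(\<Sum>U\<in>Pow W. (- 1) ^ card U * h (R - W)) = (if W = {} then h R else 0)"
      unfolding sum_distrib_right[symmetric] alternating_Pow[OF fs[OF W]] by simp
  qed
  also have "\<dots> = h R" using fA by simp
  finally show ?thesis .
qed

text \<open>In a partial injection the point of a diagonal pair occurs in no other pair, so deleting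
  the pair removes exactly that point from the support.\<close>

lemma supp_diff:
  assumes "pinj R" "T \<subseteq> diagp m R"
  shows "supp m (R - T) = supp m R - fst ` T"
proof
  show "supp m (R - T) \<subseteq> supp m R - fst ` T"
  proof
    fix x assume x: "x \<in> supp m (R - T)"
    then obtain a b where ab: "(a, b) \<in> R" "(a, b) \<notin> T" "x = a \<or> x = b" "x \<notin> {1..m}"
      by (auto simp: supp_def)
    have "x \<notin> fst ` T"
    proof
      assume "x \<in> fst ` T"
      then obtain y where "(x, y) \<in> T" by auto
      then have xx: "(x, x) \<in> T" "(x, x) \<in> R" using assms(2) by (auto simp: diagp_def)
      then show False using ab pinj_D[OF assms(1)] by metis
    qed
    moreover have "x \<in> supp m R" using ab unfolding supp_def by force
    ultimately show "x \<in> supp m R - fst ` T" by blast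
  qed
  show "supp m R - fst ` T \<subseteq> supp m (R - T)"
  proof
    fix x assume x: "x \<in> supp m R - fst ` T"
    then obtain a b where ab: "(a, b) \<in> R" "x = a \<or> x = b" "x \<notin> {1..m}" by (auto simp: supp_def)
    have "(a, b) \<notin> T"
    proof
      assume "(a, b) \<in> T"
      then have "a = b" "a \<in> fst ` T" using assms(2) by (force simp: diagp_def)+
      then show False using x ab(2) by blast
    qed
    then show "x \<in> supp m (R - T)" using ab unfolding supp_def by force
  qed
qed

lemma cumulant_balanced:
  assumes h: "balanced m h" and R: "R \<in> PI k" and nz: "cumulant m h R \<noteq> 0"
  shows "fst ` R - {1..m} = snd ` R - {1..m}"
proof -
  obtain T where T: "T \<subseteq> diagp m R" "h (R - T) \<noteq> 0"
    using nz unfolding cumulant_def by (metis (no_types, lifting) Pow_iff mult_eq_0_iff sum.neutral)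
  have RT: "R - T \<in> PI k" using PI_subset[OF R] by blast
  have b: "fst ` (R - T) - {1..m} = snd ` (R - T) - {1..m}"
    using h RT T(2) unfolding balanced_def by blast
  have d: "(a, b) \<in> T \<Longrightarrow> a = b" for a b using T(1) by (auto simp: diagp_def)
  show ?thesis
  proof
    show "fst ` R - {1..m} \<subseteq> snd ` R - {1..m}"
    proof
      fix x assume x: "x \<in> fst ` R - {1..m}"
      then obtain y where y: "(x, y) \<in> R" by auto
      show "x \<in> snd ` R - {1..m}"
      proof (cases "(x, y) \<in> T")
        case True then show ?thesis using d x y by force
      next
        case False
        then have "x \<in> fst ` (R - T) - {1..m}" using x y by force
        then show ?thesis using b by blast
      qed
    qed
    show "snd ` R - {1..m} \<subseteq> fst ` R - {1..m}"
    proof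
      fix y assume x: "y \<in> snd ` R - {1..m}"
      then obtain x where y: "(x, y) \<in> R" by auto
      show "y \<in> fst ` R - {1..m}"
      proof (cases "(x, y) \<in> T")
        case True then show ?thesis using d x y by force
      next
        case False
        then have "y \<in> snd ` (R - T) - {1..m}" using x y by force
        then show ?thesis using b by blast
      qed
    qed
  qed
qed

lemma cumulant_invariant:
  assumes h: "invariant m h" and s: "\<sigma> \<in> Sym_stab m n" and R: "R \<in> PI k"
  shows "cumulant m h (act \<sigma> R) = cumulant m h R"
proof -
  have S: "\<sigma> \<in> Sym n" using s Sym_stab_subset by blast
  have inj: "inj \<sigma>" using S by (simp add: Sym_bij bij_is_inj)
  then have injp: "inj (map_prod \<sigma> \<sigma>)" by (simp add: prod.inj_map)
  have gt: "m < \<sigma> x \<longleftrightarrow> m < x" for x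
  proof -
    have "\<sigma> y = y" if "y \<le> m" for y by (rule Sym_stab_fix[OF s that])
    then show ?thesis using inj by (metis injD not_le)
  qed
  have D: "diagp m (act \<sigma> R) = act \<sigma> (diagp m R)"
  proof (rule Set.set_eqI)
    fix p
    show "p \<in> diagp m (act \<sigma> R) \<longleftrightarrow> p \<in> act \<sigma> (diagp m R)"
    proof
      assume "p \<in> diagp m (act \<sigma> R)"
      then obtain a b where ab: "(a, b) \<in> R" "p = (\<sigma> a, \<sigma> b)" "\<sigma> a = \<sigma> b" "m < \<sigma> a"
        unfolding diagp_def by force
      then have "(a, b) \<in> diagp m R" using injD[OF inj ab(3)] gt by (simp add: diagp_def)
      then show "p \<in> act \<sigma> (diagp m R)" using ab(2) by force
    next
      assume "p \<in> act \<sigma> (diagp m R)"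
      then obtain a b where ab: "(a, b) \<in> diagp m R" "p = (\<sigma> a, \<sigma> b)" by auto
      then have R: "(a, b) \<in> R" "a = b" "m < a" unfolding diagp_def by blast+
      have "map_prod \<sigma> \<sigma> (a, b) \<in> act \<sigma> R" using R(1) by (rule imageI)
      then have "(\<sigma> a, \<sigma> b) \<in> act \<sigma> R" by (simp only: map_prod_simp)
      moreover have "\<sigma> a = \<sigma> b" "m < \<sigma> a" using R(2,3) gt[of a] by blast+
      ultimately show "p \<in> diagp m (act \<sigma> R)" unfolding diagp_def ab(2) by blast
    qed
  qed
  have "inj_on ((`) (map_prod \<sigma> \<sigma>)) (Pow (diagp m R))"
    by (rule inj_on_image_Pow) (rule inj_on_subset[OF injp subset_UNIV])
  then have "cumulant m h (act \<sigma> R) = (\<Sum>T\<in>Pow (diagp m R). (- 1) ^ card (act \<sigma> T) * h (act \<sigma> R - act \<sigma> T))"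
    unfolding cumulant_def D image_Pow_surj[OF refl, symmetric] by (simp add: sum.reindex)
  also have "\<dots> = cumulant m h R"
    unfolding cumulant_def
  proof (rule sum.cong[OF refl])
    fix T assume "T \<in> Pow (diagp m R)"
    have "h (act \<sigma> (R - T)) = h (R - T)" using h s PI_subset[OF R] unfolding invariant_def by blast
    then show "(- 1) ^ card (act \<sigma> T) * h (act \<sigma> R - act \<sigma> T) = (- 1) ^ card T * h (R - T)"
      using injp by (simp add: image_set_diff card_image inj_on_subset)
  qed
  finally show ?thesis .
qed

text \<open>In the cumulant the elements with a fixed point among the support points cancel.\<close>

lemma cumulant_degree:
  assumes a: "a \<in> seq_A m" and D: "\<And>n. m \<le> n \<Longrightarrow> max_deg (Gam_deg n) (a n) \<le> D"
    and R: "R \<in> PI k" and nz: "cumulant m (kerA a) R \<noteq> 0"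
  shows "card (supp m R) \<le> D"
proof -
  let ?n = "max m k" and ?A = "diagp m R"
  have n: "m \<le> ?n" "k \<le> ?n" by simp_all
  have R': "R \<in> PI ?n" using R PI_mono[OF n(2)] by blast
  have fA: "finite ?A" using finite_diagp[OF PI_finite[OF R]] .
  have "cumulant m (kerA a) R = (\<Sum>T\<in>Pow ?A. (- 1) ^ card T * hatA (a ?n) (R - T))"
    unfolding cumulant_def by (rule sum.cong) (use kerA_eq[OF a n(1)] PI_subset[OF R'] in auto)
  also have "\<dots> = pairing (\<lambda>\<gamma>. \<Sum>T\<in>Pow ?A. (- 1) ^ card T * of_bool (R - T \<subseteq> rel \<gamma>)) (a ?n)"
    by (simp only: hatA_def pairing_fun_sum pairing_fun_cmult)
  finally have "pairing (\<lambda>\<gamma>. \<Sum>T\<in>Pow ?A. (- 1) ^ card T * of_bool (R - T \<subseteq> rel \<gamma>)) (a ?n) \<noteq> 0"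
    using nz by simp
  then obtain \<gamma> where g: "\<gamma> \<in> keys (a ?n)" "(\<Sum>T\<in>Pow ?A. (- 1) ^ card T * of_bool (R - T \<subseteq> rel \<gamma>)) \<noteq> (0::complex)"
    using pairing_nonzero by blast
  have G: "\<gamma> \<in> Gam ?n" using g(1) seq_A_alg[OF a n(1)] by (auto simp: alg_over_def)
  have sub: "R - T \<subseteq> rel \<gamma> \<longleftrightarrow> R - ?A \<subseteq> rel \<gamma> \<and> ?A - rel \<gamma> \<subseteq> T" if "T \<subseteq> ?A" for T
    using that diagp_subset[of m R] by blast
  have 1: "R - ?A \<subseteq> rel \<gamma>"
  proof (rule ccontr)
    assume "\<not> R - ?A \<subseteq> rel \<gamma>"
    then have "\<not> R - T \<subseteq> rel \<gamma>" if "T \<in> Pow ?A" for T using sub[of T] that by blast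
    then have "(\<Sum>T\<in>Pow ?A. (- 1) ^ card T * of_bool (R - T \<subseteq> rel \<gamma>)) = (0::complex)"
      by (intro sum.neutral ballI) (simp only: of_bool_def if_False mult_zero_right)
    with g(2) show False by simp
  qed
  \<comment> \<open>The condition on T is to contain every diagonal pair missing from \<gamma>; the
    other diagonal pairs are free, and the alternating sum over the subsets of a nonempty set of
    free pairs is 0.\<close>
  have 2: "?A \<inter> rel \<gamma> = {}"
  proof (rule ccontr)
    assume ne: "?A \<inter> rel \<gamma> \<noteq> {}"
    let ?B = "?A - rel \<gamma>"
    have fB: "finite ?B" using fA by blast
    have "(\<Sum>T\<in>Pow ?A. (- 1) ^ card T * of_bool (R - T \<subseteq> rel \<gamma>)) = (\<Sum>T\<in>Pow ?A. if ?B \<subseteq> T then (- 1 :: complex) ^ card T else 0)"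
    proof (rule sum.cong[OF refl])
      fix T assume "T \<in> Pow ?A"
      then have "R - T \<subseteq> rel \<gamma> \<longleftrightarrow> ?B \<subseteq> T" using sub[of T] 1 by blast
      then show "(- 1) ^ card T * of_bool (R - T \<subseteq> rel \<gamma>) = (if ?B \<subseteq> T then (- 1 :: complex) ^ card T else 0)"
        by (simp only: of_bool_def if_distrib[of "\<lambda>x. _ * x"] mult_1_right mult_zero_right)
    qed
    also have "\<dots> = (\<Sum>T\<in>{T \<in> Pow ?A. ?B \<subseteq> T}. (- 1) ^ card T)"
      by (rule sum.inter_filter[symmetric]) (use fA in simp)
    also have "\<dots> = (\<Sum>T | ?B \<subseteq> T \<and> T \<subseteq> ?A. (- 1) ^ card T)"
      by (rule sum.cong) auto
    also have "\<dots> = (\<Sum>T | ?B \<subseteq> T \<and> T \<subseteq> ?A. (- 1) ^ card ?B * (- 1) ^ card (T - ?B))"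
    proof (rule sum.cong[OF refl])
      fix T assume T: "T \<in> {T. ?B \<subseteq> T \<and> T \<subseteq> ?A}"
      then have "finite T" using fA finite_subset by blast
      then have "card T = card ?B + card (T - ?B)"
        using T fB by (simp add: card_Diff_subset card_mono)
      then show "(- 1 :: complex) ^ card T = (- 1) ^ card ?B * (- 1) ^ card (T - ?B)" by (simp only: power_add)
    qed
    also have "\<dots> = (- 1) ^ card ?B * of_bool (?A = ?B)"
      unfolding sum_distrib_left[symmetric] using alternating_interval(1)[OF fA, of ?B] by simp
    also have "\<dots> = 0" using ne by auto
    finally show False using g(2) by simp
  qed
  have "supp m R \<subseteq> {i \<in> {1..?n}. \<gamma> i i = 0}"
  proof
    fix x assume "x \<in> supp m R"
    then obtain a' b where ab: "(a', b) \<in> R" "x = a' \<or> x = b" "x \<notin> {1..m}" by (auto simp: supp_def)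
    have x: "x \<in> {1..?n}" using PI_bounds[OF R' ab(1)] ab(2) by blast
    \<comment> \<open>If \<gamma> had diagonal entry 1 at a support point x, the pair of R at x
      would either be a diagonal pair shared with \<gamma>, excluded by fact 2, or lie in \<gamma>
      and then be diagonal by injectivity.\<close>
    have "(x, x) \<notin> rel \<gamma>"
    proof
      assume xx: "(x, x) \<in> rel \<gamma>"
      show False
      proof (cases "(a', b) \<in> ?A")
        case True
        then have "a' = b" by (auto simp: diagp_def)
        then show False using xx True 2 ab(2) by blast
      next
        case False
        then have "(a', b) \<in> rel \<gamma>" using 1 ab(1) by blast
        then have "a' = x" "b = x" using pinj_D[OF PI_pinj[OF rel_PI[OF G]]] xx ab(2) by metis+
        then have "(a', b) \<in> ?A" using ab x by (auto simp: diagp_def)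
        then show False using False by blast
      qed
    qed
    then show "x \<in> {i \<in> {1..?n}. \<gamma> i i = 0}" using x by (simp add: rel_def)
  qed
  then have "card (supp m R) \<le> Gam_deg ?n \<gamma>" unfolding Gam_deg_def by (rule card_mono[rotated]) simp
  also have "\<dots> \<le> D" using D[OF n(1)] g(1) by (simp add: max_deg_le_iff)
  finally show ?thesis .
qed

section \<open>Group elements with prescribed incidence functions\<close>

text \<open>Arguments on which R is undefined are sent out of the square, b going to b + k, so s has
  no pair inside {1..k} except those of R. This is the reason for using 2 k points.\<close>

lemma lift_permutation:
  assumes R: "R \<in> PI k"
  obtains s where "s \<in> Sym (2 * k)" "\<And>S. S \<in> PI k \<Longrightarrow> covers s S \<longleftrightarrow> S \<subseteq> R"
proof -
  have ij: "inj_on fst R" "inj_on snd R" using PI_pinj[OF R] by (simp_all add: pinj_def)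
  define f where "f b = (if b \<in> snd ` R then fst (inv_into R snd b) else b + k)" for b
  have fR: "f b = a" if ab: "(a, b) \<in> R" for a b
  proof -
    have "b \<in> snd ` R" using ab by force
    then show ?thesis using inv_into_f_f[OF ij(2) ab] by (simp add: f_def)
  qed
  have fval: "(f b, b) \<in> R \<and> f b \<le> k \<and> 1 \<le> f b \<or> f b = b + k" if "b \<in> {1..k}" for b
  proof (cases "b \<in> snd ` R")
    case True
    then obtain a where ab: "(a, b) \<in> R" by auto
    then show ?thesis using fR[OF ab] PI_bounds[OF R ab] by simp
  qed (simp add: f_def)
  have inj: "inj_on f {1..k}"
  proof (rule inj_onI)
    fix x y assume xy: "x \<in> {1..k}" "y \<in> {1..k}" "f x = f y"
    show "x = y"
    proof (cases "f x \<le> k")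
      case True
      then have "f x \<noteq> x + k" "f y \<noteq> y + k" using xy by auto
      then have "(f x, x) \<in> R" "(f y, y) \<in> R" using fval[OF xy(1)] fval[OF xy(2)] by blast+
      then show ?thesis using xy(3) pinj_D(1)[OF PI_pinj[OF R]] by metis
    next
      case False
      moreover have "\<not> f y \<le> k" using False xy(3) by simp
      ultimately have "f x = x + k" "f y = y + k" using fval[OF xy(1)] fval[OF xy(2)] by blast+
      then show ?thesis using xy(3) by linarith
    qed
  qed
  have "f ` {1..k} \<subseteq> {1..2 * k}"
  proof
    fix y assume "y \<in> f ` {1..k}"
    then obtain x where "x \<in> {1..k}" "y = f x" by blast
    then show "y \<in> {1..2 * k}" using fval[of x] by auto
  qed
  moreover have "{1..k} \<subseteq> {1..2 * k}" by auto
  ultimately obtain s where s: "s permutes {1..2 * k}" "\<And>x. x \<in> {1..k} \<Longrightarrow> s x = f x"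
    using bij_betw_extend_permutes[OF finite_atLeastAtMost inj_on_imp_bij_betw[OF inj], of 1 "2 * k"] by blast
  show thesis
  proof (rule that)
    show "s \<in> Sym (2 * k)" using s(1) by (simp add: Sym_def)
    fix S assume S: "S \<in> PI k"
    show "covers s S \<longleftrightarrow> S \<subseteq> R"
    proof
      assume c: "covers s S"
      show "S \<subseteq> R"
      proof (clarify)
        fix a b assume ab: "(a, b) \<in> S"
        then have bd: "a \<in> {1..k}" "b \<in> {1..k}" using PI_bounds[OF S] by blast+
        have "f b = a" using c ab s(2)[OF bd(2)] unfolding covers_def by force
        then show "(a, b) \<in> R" using fval[OF bd(2)] bd by auto
      qed
    next
      assume sub: "S \<subseteq> R"
      show "covers s S" unfolding covers_def
      proof (clarify)
        fix a b assume ab: "(a, b) \<in> S"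
        then have "b \<in> {1..k}" using PI_bounds[OF S] by blast
        then show "s b = a" using s(2) fR sub ab by auto
      qed
    qed
  qed
qed

text \<open>Seen from the square {1..k}, the lifted permutations behave like the matrices
  \<open>matr_of R\<close>, so Moebius inversion realizes arbitrary values there, as in
  \<open>of_hat\<close>.\<close>

lemma lift_hat: "\<exists>v\<in>alg_over (Sym (2 * k)). \<forall>S\<in>PI k. hatG v S = f S"
proof -
  have "\<forall>R\<in>PI k. \<exists>s. s \<in> Sym (2 * k) \<and> (\<forall>S\<in>PI k. covers s S \<longleftrightarrow> S \<subseteq> R)"
    by (meson lift_permutation)
  then obtain s where s: "\<And>R. R \<in> PI k \<Longrightarrow> s R \<in> Sym (2 * k)"
    "\<And>R S. R \<in> PI k \<Longrightarrow> S \<in> PI k \<Longrightarrow> covers (s R) S \<longleftrightarrow> S \<subseteq> R" by metis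
  define v where "v = (\<Sum>R\<in>PI k. single (s R) (mobius k f R))"
  have "hatG v S = f S" if S: "S \<in> PI k" for S
  proof -
    have "hatG v S = (\<Sum>R\<in>PI k. if S \<subseteq> R then mobius k f R else 0)"
      unfolding hatG_def v_def pairing_sum pairing_single by (rule sum.cong) (auto simp: s(2)[OF _ S])
    also have "\<dots> = f S" using mobius_sum(2)[OF S] by (simp add: above_def sum.inter_filter)
    finally show ?thesis .
  qed
  moreover have "v \<in> alg_over (Sym (2 * k))" unfolding v_def by (intro alg_over_sum alg_over_single s)
  ultimately show ?thesis by blast
qed

text \<open>The product of the transpositions of x and x + c for x in B. They are disjoint when B
  consists of points between 1 and c.\<close>

definition swp :: "nat \<Rightarrow> nat set \<Rightarrow> nat \<Rightarrow> nat" where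
  "swp c B x = (if x \<in> B then x + c else if c \<le> x \<and> x - c \<in> B then x - c else x)"

lemma swp_empty [simp]: "swp c {} = id"
  by (auto simp: swp_def)

lemma swp_Sym:
  assumes "B \<subseteq> {m<..m + r}" "m + r \<le> c" "c + m + r \<le> N"
  shows "swp c B \<in> Sym N"
proof -
  have small: "1 \<le> x \<and> x \<le> m + r" if "x \<in> B" for x using assms(1) that by force
  have inv: "swp c B (swp c B x) = x" for x
    using small[of x] small[of "x + c"] small[of "x - c"] assms(2) by (auto simp: swp_def)
  have rng: "swp c B x \<in> {1..N}" if "x \<in> {1..N}" for x
    using that small[of x] small[of "x - c"] assms(2,3) by (auto simp: swp_def)
  have fixed: "swp c B x = x" if "x \<notin> {1..N}" for x
    using that small[of x] small[of "x - c"] assms(2,3) by (auto simp: swp_def)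
  have "bij_betw (swp c B) {1..N} {1..N}"
    by (rule bij_betw_byWitness[where f' = "swp c B"]) (use inv rng in auto)
  then have "swp c B permutes {1..N}" by (rule bij_imp_permutes) (rule fixed)
  then show ?thesis by (simp add: Sym_def)
qed

lemma swp_insert: "y \<noteq> x \<Longrightarrow> y \<noteq> x + c \<Longrightarrow> swp c (insert x B) y = swp c B y"
  by (auto simp: swp_def)

text \<open>Pair each A without x with \<open>insert x A\<close>: equal values of F, opposite
  signs.\<close>

lemma sum_Pow_cancel:
  assumes "finite I" "x \<in> I" "\<And>A. A \<subseteq> I - {x} \<Longrightarrow> F (insert x A) = F A"
  shows "(\<Sum>A\<in>Pow I. (- 1) ^ card A * F A) = (0::complex)"
proof -
  let ?J = "I - {x}"
  have I: "Pow I = Pow ?J \<union> insert x ` Pow ?J"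
    using Pow_insert[of x ?J] assms(2) by (simp add: insert_absorb)
  have "(\<Sum>A\<in>Pow I. (- 1) ^ card A * F A) = (\<Sum>A\<in>Pow ?J. (- 1) ^ card A * F A) + (\<Sum>A\<in>insert x ` Pow ?J. (- 1) ^ card A * F A)"
    unfolding I by (rule sum.union_disjoint) (use assms(1) in auto)
  also have "(\<Sum>A\<in>insert x ` Pow ?J. (- 1) ^ card A * F A) = (\<Sum>A\<in>Pow ?J. (- 1) ^ card (insert x A) * F (insert x A))"
    by (rule sum.reindex_cong[of "insert x"]) (auto simp: inj_on_def)
  also have "\<dots> = (\<Sum>A\<in>Pow ?J. - ((- 1) ^ card A * F A))"
  proof (rule sum.cong[OF refl])
    fix A assume "A \<in> Pow ?J"
    then have "A \<subseteq> ?J" "x \<notin> A" "finite A" using assms(1) finite_subset by blast+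
    then show "(- 1) ^ card (insert x A) * F (insert x A) = - ((- 1) ^ card A * F A)"
      using assms(3) by simp
  qed
  finally show ?thesis by (simp add: sum_negf)
qed

text \<open>An element of the group algebra whose incidence function vanishes on relations meeting fewer
  than \<open>r\<close> of the points \<open>m + 1, m + 2, \<dots>\<close>, and among those meeting exactly \<open>r\<close> of them is
  concentrated on the first \<open>r\<close> points, where it is prescribed. It has the form
  \<open>\<Prod> (1 - (x, x + M)) v \<Prod> (1 - (x, x + 2 M))\<close>: the right factor kills what avoids both
  \<open>x\<close> and \<open>x + 2 M\<close>, the left factor what avoids both \<open>x\<close> and \<open>x + M\<close>.\<close>

lemma sandwich:
  fixes m r :: nat and f :: "(nat \<times> nat) set \<Rightarrow> complex"
  defines "N \<equiv> 6 * (m + r)" and "I \<equiv> {m<..m + r}"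
  shows "\<exists>u\<in>alg_over (Sym N). \<forall>n. \<forall>S\<in>PI n. card (supp m S \<inter> {1..N}) \<le> r \<longrightarrow>
    hatG u S = (if supp m S \<inter> {1..N} = I \<and> (\<forall>(a, b)\<in>S. a \<in> {1..N} \<and> b \<in> {1..N} \<or> a = b) \<and>
      I \<subseteq> fst ` S \<and> I \<subseteq> snd ` S then f (S \<inter> {1..N} \<times> {1..N}) else 0)"
proof -
  \<comment> \<open>By \<open>lift_hat\<close> the element v moves only points up to ?M. Shifting I
    by ?M and by 2 * ?M gives two blocks beyond ?M, disjoint from each other, and N is large enough
    to contain both.\<close>
  let ?M = "2 * (m + r)"
  obtain v where v: "v \<in> alg_over (Sym ?M)" "\<And>S. S \<in> PI (m + r) \<Longrightarrow> hatG v S = f S"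
    using lift_hat[of "m + r" f] by blast
  have fI: "finite I" "card I = r" by (simp_all add: I_def)
  define E where "E B A = grp_mult (single (swp ?M B) 1) (grp_mult v (single (swp (2 * ?M) A) 1))" for A B
  \<comment> \<open>The expansion of the two products of factors 1 minus a transposition: B marks
    the transpositions taken on the left of v, A those on the right.\<close>
  define u where "u = (\<Sum>B\<in>Pow I. \<Sum>A\<in>Pow I. scale ((- 1) ^ card B * (- 1) ^ card A) (E B A))"
  have S1: "swp ?M B \<in> Sym N" "swp (2 * ?M) B \<in> Sym N" if "B \<subseteq> I" for B
    using swp_Sym[of B m r ?M N] swp_Sym[of B m r "2 * ?M" N] that by (auto simp: I_def N_def)
  have vN: "v \<in> alg_over (Sym N)" by (rule alg_over_mono[OF v(1) Sym_mono]) (simp add: N_def)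
  have uN: "u \<in> alg_over (Sym N)"
    unfolding u_def E_def by (intro alg_over_sum alg_over_scale grp_mult_alg alg_over_single vN S1) auto
  have hatE: "hatG (E B A) S = pairing (\<lambda>s. of_bool (covers (swp ?M B \<circ> (s \<circ> swp (2 * ?M) A)) S)) v" for A B S
    by (simp add: E_def hatG_def pairing_convolve)
  have hatu: "hatG u S = (\<Sum>B\<in>Pow I. (- 1) ^ card B * (\<Sum>A\<in>Pow I. (- 1) ^ card A * hatG (E B A) S))" for S
    unfolding u_def by (simp add: hatG_def pairing_sum sum_distrib_left mult.assoc)
  have zero_right: "hatG u S = 0" if x: "x \<in> I" "x \<notin> snd ` S" "x + 2 * ?M \<notin> snd ` S" for x S
  proof -
    have "hatG (E B (insert x A)) S = hatG (E B A) S" for A B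
      unfolding hatE
    proof (rule pairing_cong)
      fix s
      have "swp (2 * ?M) (insert x A) b = swp (2 * ?M) A b" if "(a, b) \<in> S" for a b
        by (rule swp_insert) (use x that in force)+
      then have "covers (swp ?M B \<circ> (s \<circ> swp (2 * ?M) (insert x A))) S \<longleftrightarrow> covers (swp ?M B \<circ> (s \<circ> swp (2 * ?M) A)) S"
        unfolding covers_def by (intro ball_cong refl) auto
      then show "of_bool (covers (swp ?M B \<circ> (s \<circ> swp (2 * ?M) (insert x A))) S) = (of_bool (covers (swp ?M B \<circ> (s \<circ> swp (2 * ?M) A)) S) :: complex)"
        by simp
    qed
    then have "(\<Sum>A\<in>Pow I. (- 1) ^ card A * hatG (E B A) S) = 0" for B
      by (intro sum_Pow_cancel[OF fI(1) x(1)]) auto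
    then show ?thesis by (simp add: hatu)
  qed
  have zero_left: "hatG u S = 0" if x: "x \<in> I" "x \<notin> fst ` S" "x + ?M \<notin> fst ` S" for x S
  proof -
    have "hatG (E (insert x B) A) S = hatG (E B A) S" if B: "B \<subseteq> I - {x}" for A B
      unfolding hatE
    proof (rule pairing_cong)
      fix s
      have small: "y \<le> m + r" "1 \<le> y" if "y \<in> insert x B" for y using that x(1) B by (auto simp: I_def)
      have inv: "swp ?M C (swp ?M C z) = z" if "C \<subseteq> I" for C z
      proof -
        have "swp ?M C \<in> Sym N" by (rule S1(1)[OF that])
        have "y \<le> m + r" "1 \<le> y" if "y \<in> C" for y using that \<open>C \<subseteq> I\<close> by (auto simp: I_def)
        from this[of z] this[of "z + ?M"] this[of "z - ?M"] show ?thesis by (auto simp: swp_def)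
      qed
      have "swp ?M (insert x B) y = a \<longleftrightarrow> swp ?M B y = a" if "(a, b) \<in> S" for a b y
      proof -
        have a: "a \<noteq> x" "a \<noteq> x + ?M" using x that by force+
        have "swp ?M (insert x B) a = swp ?M B a" by (rule swp_insert[OF a])
        moreover have "swp ?M (insert x B) y = a \<longleftrightarrow> y = swp ?M (insert x B) a" "swp ?M B y = a \<longleftrightarrow> y = swp ?M B a"
          using inv[of "insert x B"] inv[of B] B x(1) by (metis insert_subset Diff_subset subset_trans)+
        ultimately show ?thesis by simp
      qed
      then have "covers (swp ?M (insert x B) \<circ> (s \<circ> swp (2 * ?M) A)) S \<longleftrightarrow> covers (swp ?M B \<circ> (s \<circ> swp (2 * ?M) A)) S"
        unfolding covers_def by (intro ball_cong refl) auto
      then show "of_bool (covers (swp ?M (insert x B) \<circ> (s \<circ> swp (2 * ?M) A)) S) = (of_bool (covers (swp ?M B \<circ> (s \<circ> swp (2 * ?M) A)) S) :: complex)"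
        by simp
    qed
    then have "(\<Sum>B\<in>Pow I. (- 1) ^ card B * (\<Sum>A\<in>Pow I. (- 1) ^ card A * hatG (E B A) S)) = 0"
      by (intro sum_Pow_cancel[OF fI(1) x(1)]) auto
    then show ?thesis by (simp add: hatu)
  qed
  have key: "hatG u S = (if supp m S \<inter> {1..N} = I \<and> (\<forall>(a, b)\<in>S. a \<in> {1..N} \<and> b \<in> {1..N} \<or> a = b) \<and>
      I \<subseteq> fst ` S \<and> I \<subseteq> snd ` S then f (S \<inter> {1..N} \<times> {1..N}) else 0)"
    if S: "S \<in> PI n" and c: "card (supp m S \<inter> {1..N}) \<le> r" for S n
  proof -
    let ?P = "supp m S \<inter> {1..N}" and ?S1 = "S \<inter> {1..N} \<times> {1..N}"
    have xN: "x + 2 * ?M \<le> N" "x + ?M \<le> N" "m < x" if "x \<in> I" for x using that by (auto simp: I_def N_def)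
    have nec: "?P = I \<and> (\<forall>(a, b)\<in>S. a \<in> {1..N} \<and> b \<in> {1..N} \<or> a = b) \<and> I \<subseteq> fst ` S \<and> I \<subseteq> snd ` S"
      if nz: "hatG u S \<noteq> 0"
    proof -
      have r: "x \<in> snd ` S \<or> x + 2 * ?M \<in> snd ` S" "x \<in> fst ` S \<or> x + ?M \<in> fst ` S" if "x \<in> I" for x
        using zero_right[OF that, of S] zero_left[OF that, of S] nz by blast+
      have inP: "y \<in> ?P" if "y \<in> fst ` S \<union> snd ` S" "m < y" "y \<le> N" for y
        using that by (auto simp: supp_def)
      define e where "e x = (if x \<in> ?P then x else x + 2 * ?M)" for x
      have eP: "e x \<in> ?P" if "x \<in> I" for x
      proof (cases "x \<in> ?P")
        case False
        then have "x \<notin> snd ` S" using inP[of x] xN[OF that] by auto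
        then have "x + 2 * ?M \<in> snd ` S" using r(1)[OF that] by blast
        then show ?thesis using False inP[of "x + 2 * ?M"] xN[OF that] unfolding e_def by simp
      qed (simp add: e_def)
      have einj: "inj_on e I"
        by (rule inj_onI) (auto simp: e_def I_def split: if_splits)
      have "card I \<le> card (e ` I)" using einj by (simp add: card_image)
      then have "card ?P \<le> card (e ` I)" using c fI by simp
      then have eI: "e ` I = ?P" using eP by (intro card_seteq) auto
      have IP: "x \<in> ?P" if x: "x \<in> I" for x
      proof (rule ccontr)
        assume n: "x \<notin> ?P"
        then have "x \<notin> fst ` S" using inP[of x] xN[OF x] by auto
        then have "x + ?M \<in> fst ` S" using r(2)[OF x] by blast
        then have "x + ?M \<in> e ` I" unfolding eI using inP[of "x + ?M"] xN[OF x] by simp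
        then obtain y where "y \<in> I" "x + ?M = y \<or> x + ?M = y + 2 * ?M" by (auto simp: e_def split: if_splits)
        then show False using x by (auto simp: I_def)
      qed
      have P: "?P = I" using IP eI fI c card_seteq[of ?P I] by (metis finite_Int finite_atLeastAtMost subsetI)
      have d: "\<forall>(a, b)\<in>S. a \<in> {1..N} \<and> b \<in> {1..N} \<or> a = b"
        using hatG_restrict(2)[OF uN nz] by blast
      have "x \<in> snd ` S" "x \<in> fst ` S" if x: "x \<in> I" for x
      proof -
        have "x + 2 * ?M \<notin> snd ` S"
        proof
          assume "x + 2 * ?M \<in> snd ` S"
          then have "x + 2 * ?M \<in> I" using inP[of "x + 2 * ?M"] xN[OF x] P by auto
          then show False using x by (auto simp: I_def)
        qed
        then show "x \<in> snd ` S" using r(1)[OF x] by blast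
        have "x + ?M \<notin> fst ` S"
        proof
          assume "x + ?M \<in> fst ` S"
          then have "x + ?M \<in> I" using inP[of "x + ?M"] xN[OF x] P by auto
          then show False using x by (auto simp: I_def)
        qed
        then show "x \<in> fst ` S" using r(2)[OF x] by blast
      qed
      with P d show ?thesis by blast
    qed
    show ?thesis
    proof (cases "?P = I \<and> (\<forall>(a, b)\<in>S. a \<in> {1..N} \<and> b \<in> {1..N} \<or> a = b) \<and> I \<subseteq> fst ` S \<and> I \<subseteq> snd ` S")
      case False
      then show ?thesis using nec by auto
    next
      case True
      note P = True[THEN conjunct1] and d = True[THEN conjunct2, THEN conjunct1]
        and Is = True[THEN conjunct2, THEN conjunct2]
      \<comment> \<open>Inside the window all points of S beyond m belong to I, so the relation lies
        in the square {1..m + r}, on which the values of v are prescribed.\<close>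
      have S1: "?S1 \<in> PI (m + r)"
      proof -
        have "a \<le> m + r \<and> b \<le> m + r" if ab: "(a, b) \<in> ?S1" for a b
        proof -
          have "y \<le> m + r" if "y \<in> {1..N}" "y \<in> fst ` S \<union> snd ` S" for y
          proof (cases "y \<le> m")
            case False
            then have "y \<in> ?P" using that by (auto simp: supp_def)
            then show ?thesis unfolding P by (simp add: I_def)
          qed simp
          moreover have "a \<in> fst ` S \<union> snd ` S" "b \<in> fst ` S \<union> snd ` S" using ab by force+
          ultimately show ?thesis using ab by blast
        qed
        then have "?S1 \<subseteq> {1..m + r} \<times> {1..m + r}" by auto
        then show ?thesis using pinj_subset[OF PI_pinj[OF S]] by (auto simp: PI_def)
      qed
      have Is1: "x \<in> fst ` ?S1" "x \<in> snd ` ?S1" if x: "x \<in> I" for x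
      proof -
        have xN': "x \<in> {1..N}" using xN[OF x] by auto
        have "x \<in> fst ` S" "x \<in> snd ` S" using Is x by blast+
        then obtain a b where b: "(x, b) \<in> S" and a: "(a, x) \<in> S" by auto
        have "b \<in> {1..N}" using bspec[OF d b] xN' by auto
        then have "(x, b) \<in> ?S1" using b xN' by blast
        then show "x \<in> fst ` ?S1" by (metis fst_conv imageI)
        have "a \<in> {1..N}" using bspec[OF d a] xN' by auto
        then have "(a, x) \<in> ?S1" using a xN' by blast
        then show "x \<in> snd ` ?S1" by (metis snd_conv imageI)
      qed
      \<comment> \<open>Nonzero values are covered by \<open>hatG_restrict\<close>. For the value 0
        the pairs outside the window are diagonal by d and hold for every element of
        \<open>Sym N\<close>.\<close>
      have "hatG u S = hatG u ?S1"
      proof (cases "hatG u S = 0")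
        case False
        then show ?thesis by (rule hatG_restrict(1)[OF uN])
      next
        case True
        have "covers k S \<longleftrightarrow> covers k ?S1" if k: "k \<in> Sym N" for k
        proof
          assume c1: "covers k ?S1"
          show "covers k S" unfolding covers_def
          proof (clarify)
            fix a b assume ab: "(a, b) \<in> S"
            show "k b = a"
            proof (cases "a \<in> {1..N} \<and> b \<in> {1..N}")
              case True
              then have "(a, b) \<in> ?S1" using ab by blast
              then show ?thesis using c1 unfolding covers_def by blast
            next
              case False
              then have "a = b" "b \<notin> {1..N}" using bspec[OF d ab] by auto
              then show ?thesis using Sym_fix[OF k] by blast
            qed
          qed
        qed (auto intro: covers_mono)
        then show ?thesis unfolding hatG_def
          using uN by (intro pairing_cong) (auto simp: alg_over_def)
      qed
      also have "\<dots> = (\<Sum>B\<in>Pow I. (- 1) ^ card B * (\<Sum>A\<in>Pow I. (- 1) ^ card A * hatG (E B A) ?S1))" by (rule hatu)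
      also have "\<dots> = (\<Sum>B\<in>Pow I. if B = {} then hatG v ?S1 else 0)"
      proof (rule sum.cong[OF refl])
        fix B assume B: "B \<in> Pow I"
        \<comment> \<open>Only the term without any transposition survives. For x in A the argument
          x is shifted to x + 2 * ?M, where neither v nor the left swap brings it back into the
          square. For A empty and x in B the value x would have to come from x + ?M, which v never
          reaches from the square.\<close>
        have zero: "hatG (E B A) ?S1 = 0" if A: "A \<in> Pow I" and ne: "A \<noteq> {} \<or> B \<noteq> {}" for A
          unfolding hatE
        proof (rule pairing_eq_0)
          fix s assume "s \<in> keys v"
          then have s: "s \<in> Sym ?M" using v(1) by (auto simp: alg_over_def)
          have "\<not> covers (swp ?M B \<circ> (s \<circ> swp (2 * ?M) A)) ?S1"
          proof
            assume c: "covers (swp ?M B \<circ> (s \<circ> swp (2 * ?M) A)) ?S1"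
            have bnd: "1 \<le> a" "a \<le> m + r" "1 \<le> b" "b \<le> m + r" if "(a, b) \<in> ?S1" for a b
              using PI_bounds[OF S1 that] by auto
            have A0: "x \<notin> A" for x
            proof
              assume x: "x \<in> A"
              then have xI: "x \<in> I" using A by blast
              then obtain a where a: "(a, x) \<in> ?S1" using Is1(2) by force
              have "swp ?M B (s (swp (2 * ?M) A x)) = a"
                using bspec[OF c[unfolded covers_def] a] by simp
              moreover have "swp (2 * ?M) A x = x + 2 * ?M" using x by (simp add: swp_def)
              moreover have "s (x + 2 * ?M) = x + 2 * ?M" by (rule Sym_fix[OF s]) (use xI in \<open>auto simp: I_def\<close>)
              moreover have "swp ?M B (x + 2 * ?M) = x + 2 * ?M"
                using B xI by (auto simp: swp_def I_def)
              ultimately show False using bnd[OF a] xI by (auto simp: I_def)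
            qed
            then have "B \<noteq> {}" "A = {}" using ne by auto
            then obtain x where x: "x \<in> B" by blast
            then have xI: "x \<in> I" using B by blast
            then obtain b where b: "(x, b) \<in> ?S1" using Is1(1) by force
            have sb: "swp ?M B (s b) = x"
              using bspec[OF c[unfolded covers_def] b] \<open>A = {}\<close> by simp
            have "s b \<in> {1..?M}" using Sym_in[OF s, of b] bnd[OF b] by auto
            then show False using sb x B xI by (auto simp: swp_def I_def split: if_splits)
          qed
          then show "of_bool (covers (swp ?M B \<circ> (s \<circ> swp (2 * ?M) A)) ?S1) = (0::complex)" by simp
        qed
        show "(- 1) ^ card B * (\<Sum>A\<in>Pow I. (- 1) ^ card A * hatG (E B A) ?S1) = (if B = {} then hatG v ?S1 else 0)"
        proof (cases "B = {}")
          case True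
          have "(\<Sum>A\<in>Pow I. (- 1) ^ card A * hatG (E B A) ?S1) = (\<Sum>A\<in>Pow I. if A = {} then hatG v ?S1 else 0)"
            by (rule sum.cong[OF refl]) (use zero True in \<open>auto simp: E_def\<close>)
          also have "\<dots> = hatG v ?S1" using fI by simp
          finally show ?thesis using True by simp
        next
          case False
          then have "(\<Sum>A\<in>Pow I. (- 1) ^ card A * hatG (E B A) ?S1) = 0"
            using zero by (intro sum.neutral) simp
          then show ?thesis using False by simp
        qed
      qed
      also have "\<dots> = hatG v ?S1" using fI by simp
      also have "\<dots> = f ?S1" by (rule v(2)[OF S1])
      finally show ?thesis using True by simp
    qed
  qed
  with uN show ?thesis by blast
qed

section \<open>Approximation by group algebra elements\<close>

text \<open>After composition with one permutation extending p, what is counted are the permutations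
  of S that fix A pointwise.\<close>

lemma card_permutes_prescribed:
  assumes "finite S" "A \<subseteq> S" "inj_on p A" "p ` A \<subseteq> S"
  shows "card {\<tau>. \<tau> permutes S \<and> (\<forall>x\<in>A. \<tau> x = p x)} = fact (card S - card A)"
proof -
  obtain \<rho> where r: "\<rho> permutes S" "\<And>x. x \<in> A \<Longrightarrow> \<rho> x = p x"
    using bij_betw_extend_permutes[OF assms(1) inj_on_imp_bij_betw[OF assms(3)] assms(2,4)] by blast
  have b: "bij \<rho>" using r(1) by (rule permutes_bij)
  have "{\<tau>. \<tau> permutes S \<and> (\<forall>x\<in>A. \<tau> x = p x)} = (\<lambda>q. \<rho> \<circ> q) ` {q. q permutes S - A}" (is "?L = ?R")
  proof
    show "?L \<subseteq> ?R"
    proof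
      fix \<tau> assume t: "\<tau> \<in> ?L"
      have "ginv \<rho> \<circ> \<tau> permutes S" using t r(1) by (simp add: permutes_compose permutes_inv)
      moreover have "(ginv \<rho> \<circ> \<tau>) x = x" if "x \<in> A" for x
      proof -
        have "\<tau> x = \<rho> x" using t r(2) that by simp
        then show ?thesis by (simp add: inv_left[OF b])
      qed
      ultimately have "ginv \<rho> \<circ> \<tau> permutes S - A" by (simp only: permutes_def) blast
      moreover have "\<tau> = \<rho> \<circ> (ginv \<rho> \<circ> \<tau>)" by (simp add: fun_eq_iff inv_right[OF b])
      ultimately show "\<tau> \<in> ?R" by blast
    qed
    show "?R \<subseteq> ?L"
    proof
      fix \<tau> assume "\<tau> \<in> ?R"
      then obtain q where q: "q permutes S - A" "\<tau> = \<rho> \<circ> q" by blast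
      have "q permutes S" by (rule permutes_subset[OF q(1)]) blast
      then have "\<tau> permutes S" using r(1) q(2) by (simp add: permutes_compose)
      moreover have "\<tau> x = p x" if "x \<in> A" for x
        using permutes_not_in[OF q(1), of x] that r(2) q(2) by simp
      ultimately show "\<tau> \<in> ?L" by simp
    qed
  qed
  moreover have "inj_on (\<lambda>q. \<rho> \<circ> q) {q. q permutes S - A}"
  proof (rule inj_onI)
    fix q q' assume "\<rho> \<circ> q = \<rho> \<circ> q'"
    then have "ginv \<rho> \<circ> (\<rho> \<circ> q) = ginv \<rho> \<circ> (\<rho> \<circ> q')" by simp
    then show "q = q'" by (simp add: inv_comp_id[OF b] flip: comp_assoc)
  qed
  moreover have "card {q. q permutes S - A} = fact (card S - card A)"
    using assms finite_subset[OF assms(2,1)] by (intro card_permutations) (simp_all add: card_Diff_subset)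
  ultimately show ?thesis by (simp add: card_image)
qed

text \<open>Composition with a permutation carrying I to A. The count is thus the same for every
  support of size r, so one divisor serves all terms of the limit in
  \<open>conj_sum_limit\<close>.\<close>

lemma card_permutes_image:
  assumes "finite S" "A \<subseteq> S" "I \<subseteq> S" "card A = card I"
  shows "card {\<tau>. \<tau> permutes S \<and> \<tau> ` A = I} = card {\<tau>. \<tau> permutes S \<and> \<tau> ` I = I}"
proof -
  have "finite A" "finite I" using assms finite_subset by blast+
  then obtain g where "bij_betw g I A" using finite_same_card_bij[of I A] assms(4) by auto
  then obtain \<rho> where r: "\<rho> permutes S" "\<And>x. x \<in> I \<Longrightarrow> \<rho> x = g x"
    using bij_betw_extend_permutes[OF assms(1) _ assms(3,2)] by blast
  have b: "bij \<rho>" using r(1) by (rule permutes_bij)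
  have rI: "\<rho> ` I = A" using \<open>bij_betw g I A\<close> r(2) by (auto simp: bij_betw_def image_def)
  have rA: "ginv \<rho> ` A = I" using rI inv_left[OF b] by (auto simp: image_image simp flip: rI)
  have im: "(\<tau> \<circ> \<rho>) ` I = \<tau> ` A" "(\<tau> \<circ> ginv \<rho>) ` A = \<tau> ` I" for \<tau> :: "_ \<Rightarrow> 'a"
    by (simp_all only: image_comp[symmetric] rI rA)
  have "bij_betw (\<lambda>\<tau>. \<tau> \<circ> \<rho>) {\<tau>. \<tau> permutes S \<and> \<tau> ` A = I} {\<tau>. \<tau> permutes S \<and> \<tau> ` I = I}"
  proof (rule bij_betw_byWitness[where f' = "\<lambda>\<tau>. \<tau> \<circ> ginv \<rho>"])
    show "\<forall>\<tau>\<in>{\<tau>. \<tau> permutes S \<and> \<tau> ` A = I}. \<tau> \<circ> \<rho> \<circ> ginv \<rho> = \<tau>"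
      by (simp add: comp_assoc comp_inv_id[OF b])
    show "\<forall>\<tau>\<in>{\<tau>. \<tau> permutes S \<and> \<tau> ` I = I}. \<tau> \<circ> ginv \<rho> \<circ> \<rho> = \<tau>"
      by (simp add: comp_assoc inv_comp_id[OF b])
    show "(\<lambda>\<tau>. \<tau> \<circ> \<rho>) ` {\<tau>. \<tau> permutes S \<and> \<tau> ` A = I} \<subseteq> {\<tau>. \<tau> permutes S \<and> \<tau> ` I = I}"
      by (rule image_subsetI, unfold mem_Collect_eq im) (blast intro: permutes_compose r(1))
    show "(\<lambda>\<tau>. \<tau> \<circ> ginv \<rho>) ` {\<tau>. \<tau> permutes S \<and> \<tau> ` I = I} \<subseteq> {\<tau>. \<tau> permutes S \<and> \<tau> ` A = I}"
      by (rule image_subsetI, unfold mem_Collect_eq im) (blast intro: permutes_compose permutes_inv r(1))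
  qed
  then show ?thesis by (rule bij_betw_same_card)
qed

section \<open>Averages over the conjugations fixing {1..m}\<close>

lemma cB_sum: "(\<And>i. i \<in> J \<Longrightarrow> x i \<in> cB m n) \<Longrightarrow> (\<Sum>i\<in>J. x i) \<in> cB m n"
proof (rule cB_I)
  assume x: "\<And>i. i \<in> J \<Longrightarrow> x i \<in> cB m n"
  then show "(\<Sum>i\<in>J. x i) \<in> alg_over (Sym n)" by (intro alg_over_sum cB_alg_over)
  fix \<phi> :: "_ \<Rightarrow> complex" and \<sigma> assume "\<sigma> \<in> Sym_stab m n"
  then show "pairing \<phi> (\<Sum>i\<in>J. x i) = pairing (\<lambda>g. \<phi> (\<sigma> \<circ> g \<circ> ginv \<sigma>)) (\<Sum>i\<in>J. x i)"
    unfolding pairing_sum by (intro sum.cong[OF refl] cB_invariant[OF x])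
qed

lemma cB_scale: "x \<in> cB m n \<Longrightarrow> scale c x \<in> cB m n"
proof (rule cB_I)
  assume x: "x \<in> cB m n"
  then show "scale c x \<in> alg_over (Sym n)" by (intro alg_over_scale cB_alg_over)
  fix \<phi> :: "_ \<Rightarrow> complex" and \<sigma> assume "\<sigma> \<in> Sym_stab m n"
  then show "pairing \<phi> (scale c x) = pairing (\<lambda>g. \<phi> (\<sigma> \<circ> g \<circ> ginv \<sigma>)) (scale c x)"
    unfolding pairing_scale using cB_invariant[OF x] by metis
qed

text \<open>Left unnormalized on purpose: dividing by the order of \<open>Sym_stab m n\<close> would
  send the interesting contributions to 0. The divisor used in \<open>conj_sum_limit\<close> depends
  on r.\<close>

definition conj_sum :: "nat \<Rightarrow> nat \<Rightarrow> grp_alg \<Rightarrow> grp_alg" where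
  "conj_sum m n u = (\<Sum>\<tau>\<in>Sym_stab m n. grp_mult (single (ginv \<tau>) 1) (grp_mult u (single \<tau> 1)))"

lemma Sym_stab_comp: "\<sigma> \<in> Sym_stab m n \<Longrightarrow> \<tau> \<in> Sym_stab m n \<Longrightarrow> \<sigma> \<circ> \<tau> \<in> Sym_stab m n"
  by (auto simp: Sym_stab_def)

lemma Sym_stab_bij: "\<sigma> \<in> Sym_stab m n \<Longrightarrow> bij \<sigma>"
  using Sym_stab_subset Sym_bij by blast

lemma pairing_conj_sum: "pairing \<phi> (conj_sum m n u) = (\<Sum>\<tau>\<in>Sym_stab m n. pairing (\<lambda>g. \<phi> (ginv \<tau> \<circ> g \<circ> \<tau>)) u)"
  by (simp add: conj_sum_def pairing_sum pairing_convolve comp_assoc)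

lemma conj_sum_cB:
  assumes "u \<in> alg_over (Sym N)" "N \<le> n"
  shows "conj_sum m n u \<in> cB m n"
proof (rule cB_I)
  have u: "u \<in> alg_over (Sym n)" using assms alg_over_mono Sym_mono by blast
  show "conj_sum m n u \<in> alg_over (Sym n)"
    unfolding conj_sum_def
    by (intro alg_over_sum grp_mult_alg alg_over_single u inv_Sym) (use Sym_stab_subset in auto)
  fix \<phi> :: "_ \<Rightarrow> complex" and \<sigma> assume s: "\<sigma> \<in> Sym_stab m n"
  have b: "bij \<sigma>" using s by (rule Sym_stab_bij)
  show "pairing \<phi> (conj_sum m n u) = pairing (\<lambda>g. \<phi> (\<sigma> \<circ> g \<circ> ginv \<sigma>)) (conj_sum m n u)"
    unfolding pairing_conj_sum
  proof (rule sum.reindex_bij_witness[where i = "\<lambda>\<tau>. \<tau> \<circ> ginv \<sigma>" and j = "\<lambda>\<tau>. \<tau> \<circ> \<sigma>"])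
    fix \<tau> assume t: "\<tau> \<in> Sym_stab m n"
    show "\<tau> \<circ> \<sigma> \<circ> ginv \<sigma> = \<tau>" "\<tau> \<circ> ginv \<sigma> \<circ> \<sigma> = \<tau>"
      by (simp_all add: comp_assoc inv_comp_id[OF b] comp_inv_id[OF b])
    show "\<tau> \<circ> \<sigma> \<in> Sym_stab m n" "\<tau> \<circ> ginv \<sigma> \<in> Sym_stab m n"
      using s t inv_Sym_stab Sym_stab_comp by blast+
    have bt: "bij \<tau>" using t by (rule Sym_stab_bij)
    have e: "\<sigma> \<circ> (ginv (\<tau> \<circ> \<sigma>) \<circ> g \<circ> (\<tau> \<circ> \<sigma>)) \<circ> ginv \<sigma> = ginv \<tau> \<circ> g \<circ> \<tau>" for g
      by (simp add: fun_eq_iff o_inv_distrib[OF bt b] inv_right[OF b])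
    show "pairing (\<lambda>g. \<phi> (\<sigma> \<circ> (ginv (\<tau> \<circ> \<sigma>) \<circ> g \<circ> (\<tau> \<circ> \<sigma>)) \<circ> ginv \<sigma>)) u = pairing (\<lambda>g. \<phi> (ginv \<tau> \<circ> g \<circ> \<tau>)) u"
      by (simp only: e)
  qed
qed

lemma conj_sum_deg:
  assumes u: "u \<in> alg_over (Sym N)" and k: "k \<in> keys (conj_sum m n u)"
  shows "perm_deg k \<le> N"
proof -
  obtain \<tau> where t: "\<tau> \<in> Sym_stab m n" "k \<in> keys (grp_mult (single (ginv \<tau>) 1) (grp_mult u (single \<tau> 1)))"
    using subsetD[OF keys_sum_subset k[unfolded conj_sum_def]] by (elim UN_E)
  then obtain g where g: "g \<in> keys u" "k = ginv \<tau> \<circ> (g \<circ> \<tau>)"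
  proof -
    obtain b where b: "b \<in> keys (grp_mult u (single \<tau> 1))" "k = ginv \<tau> \<circ> b"
      using subsetD[OF keys_convolve t(2)] by (auto split: if_splits)
    obtain g where "g \<in> keys u" "b = g \<circ> \<tau>"
      using subsetD[OF keys_convolve b(1)] by (auto split: if_splits)
    then show thesis using that b(2) by blast
  qed
  have b: "bij \<tau>" using t(1) by (rule Sym_stab_bij)
  have "g \<in> Sym N" using u g(1) by (auto simp: alg_over_def)
  have "perm_deg k \<le> card {1..N}"
    unfolding perm_deg_def
  proof (rule card_inj_on_le)
    show "inj_on \<tau> {i. k i \<noteq> i}" by (rule inj_on_subset[OF bij_is_inj[OF b] subset_UNIV])
    show "\<tau> ` {i. k i \<noteq> i} \<subseteq> {1..N}"
    proof
      fix y assume "y \<in> \<tau> ` {i. k i \<noteq> i}"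
      then obtain i where i: "y = \<tau> i" "k i \<noteq> i" by blast
      then have "g y \<noteq> y" using g(2) inv_left[OF b] by auto
      then show "y \<in> {1..N}" using Sym_fix[OF \<open>g \<in> Sym N\<close>] by blast
    qed
  qed simp
  then show ?thesis by simp
qed

lemma hatG_conj_sum: "hatG (conj_sum m n u) R = (\<Sum>\<tau>\<in>Sym_stab m n. hatG u (act \<tau> R))"
proof -
  have "covers (ginv \<tau> \<circ> g \<circ> \<tau>) R \<longleftrightarrow> covers g (act \<tau> R)" if "\<tau> \<in> Sym_stab m n" for \<tau> g
    using covers_conj[OF bij_imp_bij_inv[OF Sym_stab_bij[OF that]], of g R] inv_inv_eq[OF Sym_stab_bij[OF that]] by simp
  then show ?thesis unfolding hatG_def pairing_conj_sum by simp
qed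

lemma supp_act:
  assumes s: "\<sigma> \<in> Sym_stab m n"
  shows "supp m (act \<sigma> R) = \<sigma> ` supp m R"
proof -
  have b: "bij \<sigma>" using s by (rule Sym_stab_bij)
  have "\<sigma> ` {1..m} = {1..m}" using Sym_stab_fix[OF s] by force
  then have "\<sigma> ` supp m R = \<sigma> ` (fst ` R \<union> snd ` R) - {1..m}"
    unfolding supp_def by (metis bij_is_inj[OF b] image_set_diff)
  also have "\<sigma> ` (fst ` R \<union> snd ` R) = fst ` act \<sigma> R \<union> snd ` act \<sigma> R"
    by (simp add: image_Un image_image)
  finally show ?thesis by (simp add: supp_def)
qed

text \<open>If at most r support points of R land in the window {1..N}, at most one T contributes:
  it consists of the diagonal pairs whose points \<tau> moves out of the window. Deleting them
  leaves the part of R seen by u, and invariance of the cumulant undoes \<tau>. When \<tau> does not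
  fill I exactly, or moves a nondiagonal pair out of the window, both sides are 0.\<close>

lemma sandwich_value:
  fixes m r n :: nat and h :: "(nat \<times> nat) set \<Rightarrow> complex"
  defines "N \<equiv> 6 * (m + r)" and "I \<equiv> {m<..m + r}"
  assumes u: "\<And>n S. S \<in> PI n \<Longrightarrow> card (supp m S \<inter> {1..N}) \<le> r \<Longrightarrow>
    hatG u S = (if supp m S \<inter> {1..N} = I \<and> (\<forall>(a, b)\<in>S. a \<in> {1..N} \<and> b \<in> {1..N} \<or> a = b) \<and>
      I \<subseteq> fst ` S \<and> I \<subseteq> snd ` S then cumulant m h (S \<inter> {1..N} \<times> {1..N}) else 0)"
    and bal: "balanced m h" and inv: "invariant m h" and R: "R \<in> PI n"
    and t: "\<tau> \<in> Sym_stab m n" and good: "card (\<tau> ` supp m R \<inter> {1..N}) \<le> r"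
  shows "hatG u (act \<tau> R) = (\<Sum>T | T \<subseteq> diagp m R \<and> card (supp m (R - T)) = r.
     of_bool (\<tau> ` supp m (R - T) = I) * cumulant m h (R - T))"
proof -
  let ?X = "supp m R" and ?S = "act \<tau> R"
  let ?D = "\<forall>(a, b)\<in>?S. a \<in> {1..N} \<and> b \<in> {1..N} \<or> a = b"
  have fR: "finite R" using R by (rule PI_finite)
  have pR: "pinj R" using R by (rule PI_pinj)
  have tS: "\<tau> \<in> Sym n" using t Sym_stab_subset by blast
  have inj: "\<tau> x = \<tau> y \<Longrightarrow> x = y" for x y using Sym_bij[OF tS] by (metis inv_left)
  have S: "?S \<in> PI n" by (rule act_PI[OF tS R])
  have IN: "I \<subseteq> {1..N}" "card I = r" "finite I" "m \<le> N" by (auto simp: I_def N_def)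
  have X: "x \<in> {1..n}" "m < x" if "x \<in> ?X" for x
    using that PI_bounds[OF R] by (auto simp: supp_def)
  have tX: "\<tau> x \<in> {1..n}" if "x \<in> ?X" for x using Sym_in[OF tS] X(1)[OF that] by blast
  have fin: "finite {T. T \<subseteq> diagp m R \<and> card (supp m (R - T)) = r}"
    by (rule finite_subset[of _ "Pow (diagp m R)"]) (use finite_diagp[OF fR] in auto)
  have val: "hatG u ?S = (if \<tau> ` ?X \<inter> {1..N} = I \<and> ?D \<and> I \<subseteq> fst ` ?S \<and> I \<subseteq> snd ` ?S
      then cumulant m h (?S \<inter> {1..N} \<times> {1..N}) else 0)"
    using u[OF S] good unfolding supp_act[OF t] by blast
  have ab_X: "a \<in> ?X \<or> a \<in> {1..m}" "b \<in> ?X \<or> b \<in> {1..m}" if "(a, b) \<in> R" for a b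
    using that by (force simp: supp_def)+
  have tm: "\<tau> x = x" if "x \<in> {1..m}" for x using Sym_stab_fix[OF t] that by simp
  show ?thesis
  proof (cases "\<tau> ` ?X \<inter> {1..N} = I \<and> ?D")
    case False
    have "\<not> \<tau> ` supp m (R - T) = I" if T: "T \<subseteq> diagp m R" "card (supp m (R - T)) = r" for T
    proof
      assume e: "\<tau> ` supp m (R - T) = I"
      have "supp m (R - T) \<subseteq> ?X" using supp_diff[OF pR T(1)] by blast
      then have "I \<subseteq> \<tau> ` ?X \<inter> {1..N}" using e IN(1) by blast
      then have 1: "\<tau> ` ?X \<inter> {1..N} = I" using good IN(2) card_seteq[of "\<tau> ` ?X \<inter> {1..N}" I] by auto
      have "a \<in> {1..N} \<and> b \<in> {1..N}" if ab: "(a, b) \<in> ?S" and ne: "a \<noteq> b" for a b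
      proof -
        obtain x y where xy: "(x, y) \<in> R" "a = \<tau> x" "b = \<tau> y" "x \<noteq> y" using ab ne by auto
        then have "(x, y) \<in> R - T" using T(1) by (auto simp: diagp_def)
        then have "x \<in> supp m (R - T) \<or> x \<in> {1..m}" "y \<in> supp m (R - T) \<or> y \<in> {1..m}"
          by (force simp: supp_def)+
        then have "\<tau> x \<in> I \<or> \<tau> x \<in> {1..m}" "\<tau> y \<in> I \<or> \<tau> y \<in> {1..m}" using e tm by (metis imageI)+
        then show ?thesis using xy(2,3) IN(1,4) by auto
      qed
      then have ?D by blast
      with 1 False show False by blast
    qed
    then have "(\<Sum>T | T \<subseteq> diagp m R \<and> card (supp m (R - T)) = r.
       of_bool (\<tau> ` supp m (R - T) = I) * cumulant m h (R - T)) = 0"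
      by (intro sum.neutral) simp
    moreover have "hatG u ?S = 0" unfolding val by (rule if_not_P) (use False in blast)
    ultimately show ?thesis by simp
  next
    case True
    note P = True[THEN conjunct1] and D = True[THEN conjunct2]
    define X1 where "X1 = {x \<in> ?X. \<tau> x \<in> I}"
    define T0 where "T0 = (\<lambda>x. (x, x)) ` (?X - X1)"
    have off: "\<tau> x \<notin> {1..N}" if "x \<in> ?X - X1" for x
      using that P unfolding X1_def by blast
    have same: "a = b" if ab: "(a, b) \<in> R" "\<tau> a \<notin> {1..N} \<or> \<tau> b \<notin> {1..N}" for a b
    proof -
      have "map_prod \<tau> \<tau> (a, b) \<in> ?S" using ab(1) by (rule imageI)
      then have "(\<tau> a, \<tau> b) \<in> ?S" by (simp only: map_prod_simp)
      from bspec[OF D this] have "\<tau> a = \<tau> b" using ab(2) by auto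
      then show ?thesis by (rule inj)
    qed
    have T0: "T0 \<subseteq> diagp m R"
    proof
      fix p assume "p \<in> T0"
      then obtain x where x: "x \<in> ?X - X1" "p = (x, x)" by (auto simp: T0_def)
      then obtain a b where ab: "(a, b) \<in> R" "x = a \<or> x = b" by (auto simp: supp_def)
      then have "a = b" using same[OF ab(1)] off[OF x(1)] by blast
      then show "p \<in> diagp m R" using ab x X(2)[of x] by (auto simp: diagp_def)
    qed
    have fT0: "fst ` T0 = ?X - X1" by (auto simp: T0_def image_image)
    have sT0: "supp m (R - T0) = X1" unfolding supp_diff[OF pR T0] fT0 by (auto simp: X1_def)
    have tX1: "\<tau> ` X1 = I" using P unfolding X1_def by blast
    have "inj_on \<tau> X1" using inj by (auto simp: inj_on_def)
    then have cX1: "card X1 = r" using card_image[of \<tau> X1] tX1 IN(2) by simp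
    have uniq: "T = T0" if T: "T \<subseteq> diagp m R" "\<tau> ` supp m (R - T) = I" for T
    proof -
      have s: "supp m (R - T) = ?X - fst ` T" by (rule supp_diff[OF pR T(1)])
      have "?X - fst ` T = X1"
      proof
        show "?X - fst ` T \<subseteq> X1" using T(2) s unfolding X1_def by blast
        show "X1 \<subseteq> ?X - fst ` T"
        proof
          fix x assume "x \<in> X1"
          then have "\<tau> x \<in> \<tau> ` (?X - fst ` T)" using T(2) s unfolding X1_def by blast
          then show "x \<in> ?X - fst ` T" using inj by blast
        qed
      qed
      moreover have "fst ` T \<subseteq> ?X"
      proof
        fix x assume "x \<in> fst ` T"
        then have "(x, x) \<in> R" "m < x" using T(1) by (auto simp: diagp_def)
        then show "x \<in> ?X" by (force simp: supp_def)
      qed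
      ultimately have f: "fst ` T = ?X - X1" by blast
      have "T = (\<lambda>x. (x, x)) ` fst ` T" using T(1) by (force simp: diagp_def image_image)
      then show ?thesis unfolding f T0_def .
    qed
    have "(\<Sum>T | T \<subseteq> diagp m R \<and> card (supp m (R - T)) = r.
       of_bool (\<tau> ` supp m (R - T) = I) * cumulant m h (R - T))
      = (\<Sum>T | T \<subseteq> diagp m R \<and> card (supp m (R - T)) = r. if T = T0 then cumulant m h (R - T0) else 0)"
    proof (rule sum.cong[OF refl])
      fix T assume "T \<in> {T. T \<subseteq> diagp m R \<and> card (supp m (R - T)) = r}"
      then show "of_bool (\<tau> ` supp m (R - T) = I) * cumulant m h (R - T) = (if T = T0 then cumulant m h (R - T0) else 0)"
        using uniq[of T] sT0 tX1 by (cases "T = T0") auto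
    qed
    also have "\<dots> = cumulant m h (R - T0)" using fin T0 sT0 cX1 by simp
    finally have H: "(\<Sum>T | T \<subseteq> diagp m R \<and> card (supp m (R - T)) = r.
       of_bool (\<tau> ` supp m (R - T) = I) * cumulant m h (R - T)) = cumulant m h (R - T0)" .
    have RT: "R - T0 \<in> PI n" by (rule PI_subset[OF R]) blast
    have eqS: "?S \<inter> {1..N} \<times> {1..N} = act \<tau> (R - T0)"
    proof
      show "?S \<inter> {1..N} \<times> {1..N} \<subseteq> act \<tau> (R - T0)"
      proof
        fix p assume p: "p \<in> ?S \<inter> {1..N} \<times> {1..N}"
        then obtain a b where ab: "(a, b) \<in> R" "p = map_prod \<tau> \<tau> (a, b)" by auto
        have "(a, b) \<notin> T0"
        proof
          assume "(a, b) \<in> T0"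
          then have "a \<in> ?X - X1" by (auto simp: T0_def)
          then show False using off p ab(2) by auto
        qed
        then show "p \<in> act \<tau> (R - T0)" using ab by blast
      qed
      show "act \<tau> (R - T0) \<subseteq> ?S \<inter> {1..N} \<times> {1..N}"
      proof
        fix p assume "p \<in> act \<tau> (R - T0)"
        then obtain a b where ab: "(a, b) \<in> R" "(a, b) \<notin> T0" "p = map_prod \<tau> \<tau> (a, b)" by auto
        have "\<tau> a \<in> {1..N} \<and> \<tau> b \<in> {1..N}"
        proof (rule ccontr)
          assume n: "\<not> ?thesis"
          then have e: "a = b" using same[OF ab(1)] by blast
          then have na: "\<tau> a \<notin> {1..N}" using n by blast
          then have "a \<notin> {1..m}" using tm[of a] IN(4) by auto
          then have "a \<in> ?X" using ab_X(1)[OF ab(1)] by blast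
          moreover have "a \<notin> X1" using na IN(1) unfolding X1_def by blast
          ultimately show False using ab(2) e by (auto simp: T0_def)
        qed
        then show "p \<in> ?S \<inter> {1..N} \<times> {1..N}" using ab by auto
      qed
    qed
    have c: "cumulant m h (?S \<inter> {1..N} \<times> {1..N}) = cumulant m h (R - T0)"
      unfolding eqS by (rule cumulant_invariant[OF inv t RT])
    show ?thesis
    proof (cases "I \<subseteq> fst ` ?S \<and> I \<subseteq> snd ` ?S")
      case True
      then show ?thesis unfolding H val c using P D by simp
    next
      \<comment> \<open>Here u yields 0 since I is not filled by both values and arguments; the
        cumulant on the other side vanishes as well, because its support would have to occur in both
        projections.\<close>
      case False
      have "cumulant m h (R - T0) = 0"
      proof (rule ccontr)
        assume "cumulant m h (R - T0) \<noteq> 0"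
        then have "fst ` (R - T0) - {1..m} = snd ` (R - T0) - {1..m}" by (rule cumulant_balanced[OF bal RT])
        then have "X1 \<subseteq> fst ` (R - T0)" "X1 \<subseteq> snd ` (R - T0)" using sT0 by (auto simp: supp_def)
        then have "X1 \<subseteq> fst ` R" "X1 \<subseteq> snd ` R" by blast+
        then have "\<tau> ` X1 \<subseteq> \<tau> ` fst ` R" "\<tau> ` X1 \<subseteq> \<tau> ` snd ` R" by blast+
        then have "I \<subseteq> fst ` ?S \<and> I \<subseteq> snd ` ?S" by (simp add: tX1 image_image)
        with False show False by blast
      qed
      moreover have "hatG u ?S = 0" unfolding val by (rule if_not_P) (use False in blast)
      ultimately show ?thesis unfolding H by simp
    qed
  qed
qed

text \<open>For each T the permutations sending the r points of \<open>supp m (R - T)\<close> onto I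
  are exactly as many as the divisor. Permutations with more than r support points in the window are
  rarer by a factor of order 1 / n, and on all others \<open>sandwich_value\<close> is an exact
  equality.\<close>

lemma conj_sum_limit:
  fixes m r :: nat and h :: "(nat \<times> nat) set \<Rightarrow> complex"
  defines "N \<equiv> 6 * (m + r)" and "I \<equiv> {m<..m + r}"
  assumes u: "\<And>n S. S \<in> PI n \<Longrightarrow> card (supp m S \<inter> {1..N}) \<le> r \<Longrightarrow>
    hatG u S = (if supp m S \<inter> {1..N} = I \<and> (\<forall>(a, b)\<in>S. a \<in> {1..N} \<and> b \<in> {1..N} \<or> a = b) \<and>
      I \<subseteq> fst ` S \<and> I \<subseteq> snd ` S then cumulant m h (S \<inter> {1..N} \<times> {1..N}) else 0)"
    and bal: "balanced m h" and inv: "invariant m h" and R: "R \<in> PI k"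
  shows "(\<lambda>n. hatG (scale (1 / of_nat (card {\<tau>. \<tau> permutes {m<..n} \<and> \<tau> ` I = I})) (conj_sum m n u)) R)
     \<longlonglongrightarrow> (\<Sum>T | T \<subseteq> diagp m R \<and> card (supp m (R - T)) = r. cumulant m h (R - T))"
proof -
  let ?X = "supp m R" and ?TT = "{T. T \<subseteq> diagp m R \<and> card (supp m (R - T)) = r}"
  let ?c = "\<lambda>T. cumulant m h (R - T)"
  let ?L = "\<Sum>T\<in>?TT. ?c T"
  let ?e = "\<lambda>n. card {\<tau>. \<tau> permutes {m<..n} \<and> \<tau> ` I = I}"
  let ?K = "\<lambda>n. hatG (scale (1 / of_nat (?e n)) (conj_sum m n u)) R"
  have pR: "pinj R" using R by (rule PI_pinj)
  have fX: "finite ?X" using PI_finite[OF R] by (simp add: supp_def)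
  \<comment> \<open>A bad \<tau> sends some r + 1 support points into the window; Z lists the
    possible restrictions of \<tau> to such points. It is finite and independent of n.\<close>
  define Z where "Z = {(A, p). A \<subseteq> ?X \<and> card A = r + 1 \<and> p \<in> PiE A (\<lambda>_. {m<..N}) \<and> inj_on p A}"
  have fZ: "finite Z"
  proof (rule finite_subset)
    show "Z \<subseteq> Sigma (Pow ?X) (\<lambda>A. PiE A (\<lambda>_. {m<..N}))" by (auto simp: Z_def)
    show "finite (Sigma (Pow ?X) (\<lambda>A. PiE A (\<lambda>_. {m<..N})))"
      using fX finite_subset by (intro finite_SigmaI finite_PiE) auto
  qed
  define C where "C = (\<Sum>g\<in>keys u. cmod (lookup u g)) + (\<Sum>T\<in>?TT. cmod (?c T))"
  have C0: "0 \<le> C" unfolding C_def by (intro add_nonneg_nonneg sum_nonneg) auto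
  have main: "cmod (?K n - ?L) \<le> (C * real (card Z)) / real (n - m - r)" if n: "n \<ge> N + k + m + r + 1" for n
  proof -
    let ?S = "{m<..n}"
    have nn: "m \<le> n" "N \<le> n" "k \<le> n" "m + r < n" using n by auto
    have R': "R \<in> PI n" using R PI_mono[OF nn(3)] by blast
    have G: "Sym_stab m n = {\<tau>. \<tau> permutes ?S}" using Sym_stab_permutes[OF nn(1)] by blast
    have fG: "finite (Sym_stab m n)" unfolding G by (simp add: finite_permutations)
    have XS: "?X \<subseteq> ?S" using PI_bounds[OF R'] by (auto simp: supp_def)
    have IS: "I \<subseteq> ?S" "card I = r" "finite I" using nn by (auto simp: I_def)
    define F where "F \<tau> = hatG u (act \<tau> R)" for \<tau>
    define H where "H \<tau> = (\<Sum>T\<in>?TT. of_bool (\<tau> ` supp m (R - T) = I) * ?c T)" for \<tau>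
    define Bad where "Bad = {\<tau> \<in> Sym_stab m n. r < card (\<tau> ` ?X \<inter> {1..N})}"
    have FH: "F \<tau> = H \<tau>" if "\<tau> \<in> Sym_stab m n - Bad" for \<tau>
      unfolding F_def H_def I_def using that
      by (intro sandwich_value[OF u[unfolded N_def I_def] bal inv R']) (auto simp: Bad_def N_def)
    have FHb: "cmod (F \<tau> - H \<tau>) \<le> C" for \<tau>
    proof -
      have "cmod (F \<tau>) \<le> (\<Sum>g\<in>keys u. cmod (lookup u g))"
        unfolding F_def hatG_def pairing_def
        by (rule order_trans[OF norm_sum], rule sum_mono) (simp add: norm_mult of_bool_def)
      moreover have "cmod (H \<tau>) \<le> (\<Sum>T\<in>?TT. cmod (?c T))"
        unfolding H_def by (rule order_trans[OF norm_sum], rule sum_mono) (simp add: norm_mult of_bool_def)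
      ultimately show ?thesis using norm_triangle_ineq4[of "F \<tau>" "H \<tau>"] unfolding C_def by linarith
    qed
    have cnt: "card {\<tau> \<in> Sym_stab m n. \<tau> ` supp m (R - T) = I} = ?e n" if T: "T \<in> ?TT" for T
    proof -
      have "supp m (R - T) \<subseteq> ?S" using supp_diff[OF pR, of T m] T XS by auto
      then show ?thesis unfolding G
        using card_permutes_image[of ?S "supp m (R - T)" I] T IS by simp
    qed
    have "(\<Sum>\<tau>\<in>Sym_stab m n. H \<tau>) = (\<Sum>T\<in>?TT. (\<Sum>\<tau>\<in>Sym_stab m n. of_bool (\<tau> ` supp m (R - T) = I)) * ?c T)"
      unfolding H_def sum_distrib_right by (rule sum.swap)
    also have "\<dots> = (\<Sum>T\<in>?TT. of_nat (?e n) * ?c T)"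
    proof (rule sum.cong[OF refl])
      fix T assume T: "T \<in> ?TT"
      have "(\<Sum>\<tau>\<in>Sym_stab m n. of_bool (\<tau> ` supp m (R - T) = I)) = (of_nat (card {\<tau> \<in> Sym_stab m n. \<tau> ` supp m (R - T) = I}) :: complex)"
        using fG by (simp add: sum_of_bool_eq Int_def)
      then show "(\<Sum>\<tau>\<in>Sym_stab m n. of_bool (\<tau> ` supp m (R - T) = I)) * ?c T = of_nat (?e n) * ?c T"
        by (simp only: cnt[OF T])
    qed
    finally have sumH: "(\<Sum>\<tau>\<in>Sym_stab m n. H \<tau>) = of_nat (?e n) * ?L" by (simp add: sum_distrib_left)
    have sumF: "(\<Sum>\<tau>\<in>Sym_stab m n. F \<tau>) = (\<Sum>\<tau>\<in>Sym_stab m n. H \<tau>) + (\<Sum>\<tau>\<in>Bad. F \<tau> - H \<tau>)"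
    proof -
      have "(\<Sum>\<tau>\<in>Sym_stab m n. F \<tau> - H \<tau>) = (\<Sum>\<tau>\<in>Bad. F \<tau> - H \<tau>)"
        by (rule sum.mono_neutral_right[OF fG]) (use FH in \<open>auto simp: Bad_def\<close>)
      then show ?thesis by (simp add: sum_subtractf algebra_simps)
    qed
    \<comment> \<open>Permutations fixing I pointwise certainly preserve it. A bad \<tau> has r + 1
      prescribed values instead of r, and the quotient of the two factorials supplies the factor 1 /
      (n - m - r).\<close>
    have e_lower: "fact (n - m - r) \<le> ?e n"
    proof -
      have "fact (n - m - r) = card {\<tau>. \<tau> permutes ?S \<and> (\<forall>x\<in>I. \<tau> x = id x)}"
        using card_permutes_prescribed[of ?S I id] IS by simp
      also have "\<dots> \<le> ?e n"
        by (rule card_mono) (auto simp: finite_permutations image_def intro: finite_subset[OF _ finite_permutations[of ?S]])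
      finally show ?thesis .
    qed
    have bad_card: "card Bad \<le> card Z * fact (n - m - r - 1)"
    proof -
      have sub: "Bad \<subseteq> (\<Union>(A, p)\<in>Z. {\<tau>. \<tau> permutes ?S \<and> (\<forall>x\<in>A. \<tau> x = p x)})"
      proof
        fix \<tau> assume t: "\<tau> \<in> Bad"
        then have tp: "\<tau> permutes ?S" using G by (auto simp: Bad_def)
        have ti: "inj_on \<tau> B" for B using tp by (metis permutes_inj inj_on_subset subset_UNIV)
        let ?Y = "{x \<in> ?X. \<tau> x \<in> {1..N}}"
        have "\<tau> ` ?Y = \<tau> ` ?X \<inter> {1..N}" by blast
        then have "card ?Y = card (\<tau> ` ?X \<inter> {1..N})" using card_image[OF ti, of ?Y] by simp
        then have "r + 1 \<le> card ?Y" using t by (simp add: Bad_def)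
        then obtain A where A: "A \<subseteq> ?Y" "card A = r + 1" by (meson obtain_subset_with_card_n)
        have "restrict \<tau> A \<in> PiE A (\<lambda>_. {m<..N})"
        proof
          fix x assume x: "x \<in> A"
          then have "x \<in> ?S" "\<tau> x \<le> N" using A XS by auto
          then have "\<tau> x \<in> ?S" using permutes_in_image[OF tp] by blast
          then show "restrict \<tau> A x \<in> {m<..N}" using x \<open>\<tau> x \<le> N\<close> by simp
        qed simp
        moreover have "inj_on (restrict \<tau> A) A" using ti[of A] by (simp add: inj_on_restrict_eq)
        ultimately have "(A, restrict \<tau> A) \<in> Z" using A by (auto simp: Z_def)
        then show "\<tau> \<in> (\<Union>(A, p)\<in>Z. {\<tau>. \<tau> permutes ?S \<and> (\<forall>x\<in>A. \<tau> x = p x)})"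
          using tp by (intro UN_I[of "(A, restrict \<tau> A)"]) auto
      qed
      have fin: "finite {\<tau>. \<tau> permutes ?S \<and> (\<forall>x\<in>A. \<tau> x = p x)}" for A and p :: "nat \<Rightarrow> nat"
        by (rule finite_subset[OF _ finite_permutations[of ?S]]) auto
      have "card Bad \<le> card (\<Union>(A, p)\<in>Z. {\<tau>. \<tau> permutes ?S \<and> (\<forall>x\<in>A. \<tau> x = p x)})"
        by (rule card_mono[OF _ sub]) (use fZ fin in auto)
      also have "\<dots> \<le> (\<Sum>(A, p)\<in>Z. card {\<tau>. \<tau> permutes ?S \<and> (\<forall>x\<in>A. \<tau> x = p x)})"
        unfolding split_def by (rule card_UN_le[OF fZ])
      also have "\<dots> \<le> (\<Sum>z\<in>Z. fact (n - m - r - 1))"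
      proof (rule sum_mono)
        fix z assume "z \<in> Z"
        then obtain A p where z: "z = (A, p)" "A \<subseteq> ?X" "card A = r + 1" "p \<in> PiE A (\<lambda>_. {m<..N})" "inj_on p A"
          by (auto simp: Z_def)
        have "p ` A \<subseteq> ?S" using z(4) nn(2) by fastforce
        then have "card {\<tau>. \<tau> permutes ?S \<and> (\<forall>x\<in>A. \<tau> x = p x)} = fact (card ?S - card A)"
          using z XS by (intro card_permutes_prescribed) auto
        then show "(case z of (A, p) \<Rightarrow> card {\<tau>. \<tau> permutes ?S \<and> (\<forall>x\<in>A. \<tau> x = p x)}) \<le> fact (n - m - r - 1)"
          using z by simp
      qed
      finally show ?thesis by simp
    qed
    have e0: "0 < ?e n" using e_lower fact_gt_zero[of "n - m - r"] by (metis le_zero_eq neq0_conv fact_nonzero)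
    have "?K n - ?L = (\<Sum>\<tau>\<in>Bad. F \<tau> - H \<tau>) / of_nat (?e n)"
      using e0 by (simp add: hatG_scale hatG_conj_sum F_def[symmetric] sumF sumH add_divide_distrib)
    then have "cmod (?K n - ?L) = cmod (\<Sum>\<tau>\<in>Bad. F \<tau> - H \<tau>) / real (?e n)" by (simp add: norm_divide)
    also have "\<dots> \<le> (real (card Bad) * C) / real (?e n)"
      by (rule divide_right_mono[OF sum_norm_bound]) (use FHb in auto)
    also have "\<dots> \<le> (real (card Z) * fact (n - m - r - 1) * C) / fact (n - m - r)"
    proof (rule frac_le)
      have "real (card Bad) \<le> real (card Z * fact (n - m - r - 1))" using bad_card by (simp only: of_nat_le_iff)
      then show "real (card Bad) * C \<le> real (card Z) * fact (n - m - r - 1) * C"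
        by (intro mult_right_mono C0) simp
      have "real (fact (n - m - r)) \<le> real (?e n)" using e_lower by (simp only: of_nat_le_iff)
      then show "fact (n - m - r) \<le> real (?e n)" by simp
    qed (use C0 in auto)
    also have "\<dots> = (C * real (card Z)) / real (n - m - r)"
    proof -
      obtain q where q: "n - m - r = Suc q" using nn(4) by (metis diff_diff_left less_imp_Suc_add add_diff_cancel_left' add_Suc_right)
      have "real (card Z) * fact q * C / (real (Suc q) * fact q) = (C * real (card Z)) / real (Suc q)"
        by (simp add: field_simps del: of_nat_Suc)
      then show ?thesis unfolding q fact_Suc by simp
    qed
    finally show ?thesis .
  qed
  have "(\<lambda>n. (C * real (card Z)) / real (n - (m + r))) \<longlonglongrightarrow> 0"
    using lim_const_over_n[of "C * real (card Z)"]
    by (rule filterlim_compose) (rule filterlim_minus_const_nat_at_top)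
  then have lim0: "(\<lambda>n. (C * real (card Z)) / real (n - m - r)) \<longlonglongrightarrow> 0" by simp
  have "(\<lambda>n. ?K n - ?L) \<longlonglongrightarrow> 0"
  proof (rule null_comparison[OF _ lim0])
    show "\<forall>\<^sub>F n in sequentially. norm (?K n - ?L) \<le> (C * real (card Z)) / real (n - m - r)"
      using eventually_ge_at_top[of "N + k + m + r + 1"] by eventually_elim (rule main)
  qed
  then show ?thesis by (simp add: LIM_zero_iff)
qed

text \<open>Layer r of the kernel collects the cumulants with r support points. The degree bound D
  of a makes all layers beyond D vanish, so finitely many averages are added and the degrees in the
  group stay bounded by 6 * (m + D). \<open>cumulant_sum\<close> reassembles the kernel from its
  layers.\<close>

lemma approximation:
  assumes a: "a \<in> seq_A m"
  shows "\<exists>\<alpha>. (\<forall>n. \<alpha> n \<in> alg_over Sym_inf) \<and> (\<forall>\<^sub>F n in sequentially. \<alpha> n \<in> cB m n) \<and>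
     bdd_above (range (\<lambda>n. max_deg perm_deg (\<alpha> n))) \<and> conv_hat \<alpha> (kerA a)"
proof -
  let ?h = "kerA a"
  have bal: "balanced m ?h" and inv: "invariant m ?h"
    using seq_A_balanced[OF a] seq_A_invariant[OF a] by blast+
  obtain D where D: "\<And>n. m \<le> n \<Longrightarrow> max_deg (Gam_deg n) (a n) \<le> D"
    using a by (auto simp: seq_A_def bdd_above_def)
  let ?N = "\<lambda>r. 6 * (m + r)" and ?I = "\<lambda>r. {m<..m + r}"
  let ?w = "\<lambda>r n. 1 / of_nat (card {\<tau>. \<tau> permutes {m<..n} \<and> \<tau> ` ?I r = ?I r})"
  have "\<exists>u. u \<in> alg_over (Sym (?N r)) \<and> (\<forall>k. \<forall>R\<in>PI k.
    (\<lambda>n. hatG (scale (?w r n) (conj_sum m n u)) R)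
     \<longlonglongrightarrow> (\<Sum>T | T \<subseteq> diagp m R \<and> card (supp m (R - T)) = r. cumulant m ?h (R - T)))" for r
  proof -
    from sandwich[of m r "cumulant m ?h"]
    show ?thesis
    proof (elim bexE)
      fix u
      assume u: "u \<in> alg_over (Sym (?N r))" "\<forall>n. \<forall>S\<in>PI n. card (supp m S \<inter> {1..?N r}) \<le> r \<longrightarrow>
        hatG u S = (if supp m S \<inter> {1..?N r} = ?I r \<and> (\<forall>(a, b)\<in>S. a \<in> {1..?N r} \<and> b \<in> {1..?N r} \<or> a = b) \<and>
          ?I r \<subseteq> fst ` S \<and> ?I r \<subseteq> snd ` S then cumulant m ?h (S \<inter> {1..?N r} \<times> {1..?N r}) else 0)"
      have "(\<lambda>n. hatG (scale (?w r n) (conj_sum m n u)) R)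
     \<longlonglongrightarrow> (\<Sum>T | T \<subseteq> diagp m R \<and> card (supp m (R - T)) = r. cumulant m ?h (R - T))" if R: "R \<in> PI k" for k R
        by (rule conj_sum_limit[OF u(2)[rule_format] bal inv R])
      with u(1) show ?thesis by (intro exI[of _ u] conjI allI ballI)
    qed
  qed
  then have "\<exists>u. \<forall>r. u r \<in> alg_over (Sym (?N r)) \<and> (\<forall>k. \<forall>R\<in>PI k.
    (\<lambda>n. hatG (scale (?w r n) (conj_sum m n (u r))) R)
     \<longlonglongrightarrow> (\<Sum>T | T \<subseteq> diagp m R \<and> card (supp m (R - T)) = r. cumulant m ?h (R - T)))"
    by (intro choice allI)
  then obtain u where uu: "\<forall>r. u r \<in> alg_over (Sym (?N r)) \<and> (\<forall>k. \<forall>R\<in>PI k.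
    (\<lambda>n. hatG (scale (?w r n) (conj_sum m n (u r))) R)
     \<longlonglongrightarrow> (\<Sum>T | T \<subseteq> diagp m R \<and> card (supp m (R - T)) = r. cumulant m ?h (R - T)))" by (elim exE)
  have u: "u r \<in> alg_over (Sym (?N r))" for r using uu by (elim allE[of _ r] conjE)
  have ulim: "(\<lambda>n. hatG (scale (?w r n) (conj_sum m n (u r))) R)
     \<longlonglongrightarrow> (\<Sum>T | T \<subseteq> diagp m R \<and> card (supp m (R - T)) = r. cumulant m ?h (R - T))" if "R \<in> PI k" for r k R
    using bspec[OF spec[OF conjunct2[OF spec[OF uu]]] that] .
  define \<beta> where "\<beta> r n = scale (1 / of_nat (card {\<tau>. \<tau> permutes {m<..n} \<and> \<tau> ` ?I r = ?I r})) (conj_sum m n (u r))" for r n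
  define \<alpha> where "\<alpha> n = (\<Sum>r\<le>D. \<beta> r n)" for n
  have cB: "\<alpha> n \<in> cB m n" if "6 * (m + D) \<le> n" for n
    unfolding \<alpha>_def \<beta>_def by (intro cB_sum cB_scale conj_sum_cB[OF u]) (use that in auto)
  have al: "\<alpha> n \<in> alg_over Sym_inf" for n
  proof -
    have "conj_sum m n (u r) \<in> alg_over Sym_inf" for r
    proof -
      have "u r \<in> alg_over (Sym (max n (?N r)))" by (rule alg_over_mono[OF u Sym_mono]) simp
      moreover have "\<tau> \<in> Sym (max n (?N r))" if "\<tau> \<in> Sym_stab m n" for \<tau>
        using that Sym_mono[of n "max n (?N r)"] Sym_stab_subset by auto
      ultimately have "conj_sum m n (u r) \<in> alg_over (Sym (max n (?N r)))"
        unfolding conj_sum_def by (intro alg_over_sum grp_mult_alg alg_over_single inv_Sym) auto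
      then show ?thesis by (rule alg_over_mono) (auto simp: Sym_inf_def)
    qed
    then show ?thesis unfolding \<alpha>_def \<beta>_def by (intro alg_over_sum alg_over_scale)
  qed
  have deg: "max_deg perm_deg (\<alpha> n) \<le> 6 * (m + D)" for n
    unfolding max_deg_le_iff
  proof
    fix g assume "g \<in> keys (\<alpha> n)"
    from subsetD[OF keys_sum_subset this[unfolded \<alpha>_def]]
    obtain r where r: "r \<le> D" "g \<in> keys (\<beta> r n)" by (elim UN_E) simp
    have "g \<in> keys (conj_sum m n (u r))" by (rule subsetD[OF keys_scale r(2)[unfolded \<beta>_def]])
    then have "perm_deg g \<le> ?N r" by (rule conj_sum_deg[OF u])
    then show "perm_deg g \<le> 6 * (m + D)" using r(1) by simp
  qed
  have "conv_hat \<alpha> ?h"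
    unfolding conv_hat_def
  proof (intro allI ballI)
    fix k R assume R: "R \<in> PI k"
    have fin: "finite (Pow (diagp m R))" using finite_diagp[OF PI_finite[OF R]] by simp
    have "(\<lambda>n. \<Sum>r\<le>D. hatG (\<beta> r n) R) \<longlonglongrightarrow> (\<Sum>r\<le>D. \<Sum>T | T \<subseteq> diagp m R \<and> card (supp m (R - T)) = r. cumulant m ?h (R - T))"
      unfolding \<beta>_def by (intro tendsto_sum ulim[OF R])
    moreover have "hatG (\<alpha> n) R = (\<Sum>r\<le>D. hatG (\<beta> r n) R)" for n
      by (simp add: \<alpha>_def hatG_def pairing_sum)
    moreover have "(\<Sum>r\<le>D. \<Sum>T | T \<subseteq> diagp m R \<and> card (supp m (R - T)) = r. cumulant m ?h (R - T)) = ?h R"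
    proof -
      let ?P = "{T \<in> Pow (diagp m R). card (supp m (R - T)) \<le> D}"
      have "(\<Sum>r\<le>D. \<Sum>T | T \<subseteq> diagp m R \<and> card (supp m (R - T)) = r. cumulant m ?h (R - T))
          = (\<Sum>r\<le>D. \<Sum>T\<in>{T \<in> ?P. card (supp m (R - T)) = r}. cumulant m ?h (R - T))"
        by (intro sum.cong refl) auto
      also have "\<dots> = (\<Sum>T\<in>?P. cumulant m ?h (R - T))"
        by (rule sum.group) (use fin in auto)
      also have "\<dots> = (\<Sum>T\<in>Pow (diagp m R). cumulant m ?h (R - T))"
      proof (rule sum.mono_neutral_left[OF fin])
        show "\<forall>T\<in>Pow (diagp m R) - ?P. cumulant m ?h (R - T) = 0"
          using cumulant_degree[OF a D PI_subset[OF R Diff_subset]] by blast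
      qed auto
      also have "\<dots> = ?h R" by (rule cumulant_sum[OF PI_finite[OF R]])
      finally show ?thesis .
    qed
    ultimately show "(\<lambda>n. hatG (\<alpha> n) R) \<longlonglongrightarrow> ?h R" by simp
  qed
  moreover have "\<forall>\<^sub>F n in sequentially. \<alpha> n \<in> cB m n"
    using eventually_ge_at_top[of "6 * (m + D)"] by eventually_elim (rule cB)
  moreover have "bdd_above (range (\<lambda>n. max_deg perm_deg (\<alpha> n)))"
    by (rule bdd_aboveI[of _ "6 * (m + D)"]) (use deg in auto)
  ultimately show ?thesis using al by blast
qed

section \<open>Products and kernels\<close>

text \<open>The middle point of a path through G and H is determined by its start, so exactly one
  intermediate word contributes. Composition of relations thus becomes matrix multiplication of
  kernels.\<close>

lemma link_relcomp:
  assumes G: "G \<in> PI N" and H: "H \<in> PI N" and w: "\<omega> \<in> Omega_fin l N" "\<omega>'' \<in> Omega_fin l N"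
  shows "(of_bool (link l \<omega> \<omega>'' \<subseteq> G O H) :: complex) =
    (\<Sum>\<omega>'\<in>Omega_fin l N. of_bool (link l \<omega> \<omega>' \<subseteq> G) * of_bool (link l \<omega>' \<omega>'' \<subseteq> H))"
proof (cases "link l \<omega> \<omega>'' \<subseteq> G O H")
  case True
  have "\<exists>b. (pos \<omega> i, b) \<in> G \<and> (b, pos \<omega>'' i) \<in> H" if "i \<in> {1..l}" for i
  proof -
    have "(pos \<omega> i, pos \<omega>'' i) \<in> link l \<omega> \<omega>''" using that unfolding link_def by blast
    then show ?thesis using True by blast
  qed
  then obtain b where b: "\<And>i. i \<in> {1..l} \<Longrightarrow> (pos \<omega> i, b i) \<in> G \<and> (b i, pos \<omega>'' i) \<in> H" by metis
  have b1: "b i \<in> {1..N}" if "i \<in> {1..l}" for i using PI_bounds[OF G] b[OF that] by blast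
  have inj: "inj_on b {1..l}"
  proof (rule inj_onI)
    fix i j assume ij: "i \<in> {1..l}" "j \<in> {1..l}" "b i = b j"
    then have "pos \<omega> i = pos \<omega> j" using b[OF ij(1)] b[OF ij(2)] pinj_D(2)[OF PI_pinj[OF G]] by metis
    then show "i = j" using pos_inj[of \<omega> l] w(1) ij by (auto simp: Omega_fin_iff dest: inj_onD)
  qed
  let ?w = "place l b"
  have wf: "?w \<in> Omega_fin l N" using b1 by (auto simp: Omega_fin_iff pos_place intro!: place_Omega inj)
  have in_w: "link l \<omega> ?w \<subseteq> G" "link l ?w \<omega>'' \<subseteq> H" using b by (auto simp: link_def pos_place)
  have uniq: "\<omega>' = ?w" if o: "\<omega>' \<in> Omega_fin l N" and s: "link l \<omega> \<omega>' \<subseteq> G" for \<omega>'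
  proof (rule Omega_eqI)
    show "\<omega>' \<in> Omega_inf l" "?w \<in> Omega_inf l" using o wf by (simp_all add: Omega_fin_iff)
    fix i assume i: "i \<in> {1..l}"
    then have "(pos \<omega> i, pos \<omega>' i) \<in> G" using s by (auto simp: link_def)
    then show "pos \<omega>' i = pos ?w i" using b[OF i] pinj_D(1)[OF PI_pinj[OF G]] pos_place[OF i] by metis
  qed
  have "(\<Sum>\<omega>'\<in>Omega_fin l N. of_bool (link l \<omega> \<omega>' \<subseteq> G) * of_bool (link l \<omega>' \<omega>'' \<subseteq> H))
      = (\<Sum>\<omega>'\<in>{?w}. of_bool (link l \<omega> \<omega>' \<subseteq> G) * (of_bool (link l \<omega>' \<omega>'' \<subseteq> H) :: complex))"
    using wf uniq by (intro sum.mono_neutral_right) auto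
  then show ?thesis using True in_w by simp
next
  case False
  have "\<not> (link l \<omega> \<omega>' \<subseteq> G \<and> link l \<omega>' \<omega>'' \<subseteq> H)" for \<omega>'
  proof
    assume "link l \<omega> \<omega>' \<subseteq> G \<and> link l \<omega>' \<omega>'' \<subseteq> H"
    then have "link l \<omega> \<omega>'' \<subseteq> G O H" unfolding link_def by blast
    with False show False by contradiction
  qed
  then have "(\<Sum>\<omega>'\<in>Omega_fin l N. of_bool (link l \<omega> \<omega>' \<subseteq> G) * (of_bool (link l \<omega>' \<omega>'' \<subseteq> H) :: complex)) = 0"
    by (intro sum.neutral ballI) simp
  then show ?thesis using False by simp
qed

lemma pairing_sum_product:
  "pairing (\<lambda>g. pairing (\<lambda>h. \<Sum>i\<in>I. A i g * B i h) y) x = (\<Sum>i\<in>I. pairing (A i) x * pairing (B i) y)"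
proof -
  have "pairing (\<lambda>g. A i g * c) x = pairing (A i) x * c" for i c
    by (simp add: pairing_def sum_distrib_right mult.assoc)
  then show ?thesis by (simp add: pairing_fun_sum pairing_fun_cmult)
qed

lemma hatA_mult:
  assumes x: "x \<in> alg_over (Gam N)" and y: "y \<in> alg_over (Gam N)"
    and w: "\<omega> \<in> Omega_fin l N" "\<omega>'' \<in> Omega_fin l N"
  shows "hatA (convolve mmult x y) (link l \<omega> \<omega>'') =
    (\<Sum>\<omega>'\<in>Omega_fin l N. hatA x (link l \<omega> \<omega>') * hatA y (link l \<omega>' \<omega>''))"
proof -
  have "of_bool (link l \<omega> \<omega>'' \<subseteq> rel (mmult \<gamma> \<delta>)) =
    (\<Sum>\<omega>'\<in>Omega_fin l N. of_bool (link l \<omega> \<omega>' \<subseteq> rel \<gamma>) * (of_bool (link l \<omega>' \<omega>'' \<subseteq> rel \<delta>) :: complex))"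
    if "\<gamma> \<in> keys x" "\<delta> \<in> keys y" for \<gamma> \<delta>
  proof -
    have g: "\<gamma> \<in> Gam N" "\<delta> \<in> Gam N" using that x y by (auto simp: alg_over_def)
    have "rel (mmult \<gamma> \<delta>) = rel \<gamma> O rel \<delta>" by (simp add: mmult_Gam[OF g] rel_matr_of)
    then show ?thesis using link_relcomp[OF rel_PI[OF g(1)] rel_PI[OF g(2)] w] by simp
  qed
  then have "hatA (convolve mmult x y) (link l \<omega> \<omega>'') = pairing (\<lambda>\<gamma>. pairing (\<lambda>\<delta>.
     \<Sum>\<omega>'\<in>Omega_fin l N. of_bool (link l \<omega> \<omega>' \<subseteq> rel \<gamma>) * of_bool (link l \<omega>' \<omega>'' \<subseteq> rel \<delta>)) y) x"
    unfolding hatA_def pairing_convolve by (intro pairing_cong)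
  then show ?thesis unfolding pairing_sum_product hatA_def .
qed

text \<open>A permutation of {1..N} regarded as a total partial injection, so that products in the
  group fall under \<open>link_relcomp\<close> as well.\<close>

definition graph_rel :: "nat \<Rightarrow> (nat \<Rightarrow> nat) \<Rightarrow> (nat \<times> nat) set" where
  "graph_rel N g = {(a, b). b \<in> {1..N} \<and> a = g b}"

lemma graph_rel_PI:
  assumes g: "g \<in> Sym N"
  shows "graph_rel N g \<in> PI N"
  unfolding PI_def
proof (intro CollectI conjI)
  show "graph_rel N g \<subseteq> {1..N} \<times> {1..N}"
  proof
    fix z assume "z \<in> graph_rel N g"
    then have "snd z \<in> {1..N}" "fst z = g (snd z)" by (simp_all add: graph_rel_def case_prod_unfold)
    then show "z \<in> {1..N} \<times> {1..N}" using Sym_in[OF g, of "snd z"] by (metis SigmaI prod.collapse)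
  qed
  have "g b = g b' \<Longrightarrow> b = b'" for b b' using Sym_bij[OF g] by (metis inv_left)
  then show "pinj (graph_rel N g)" by (intro pinjI) (simp_all add: graph_rel_def)
qed

lemma graph_rel_comp:
  assumes h: "h \<in> Sym N"
  shows "graph_rel N (g \<circ> h) = graph_rel N g O graph_rel N h"
proof -
  have "(a, b) \<in> graph_rel N (g \<circ> h) \<longleftrightarrow> (a, b) \<in> graph_rel N g O graph_rel N h" for a b
    using Sym_in[OF h, of b] unfolding graph_rel_def relcomp_unfold by (simp del: atLeastAtMost_iff) blast
  then show ?thesis by (intro Set.set_eqI) (simp only: split_paired_all)
qed

lemma covers_graph_rel:
  assumes R: "R \<in> PI N"
  shows "covers g R \<longleftrightarrow> R \<subseteq> graph_rel N g"
proof
  assume c: "covers g R"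
  show "R \<subseteq> graph_rel N g"
  proof (rule subrelI)
    fix a b assume ab: "(a, b) \<in> R"
    then show "(a, b) \<in> graph_rel N g"
      using PI_bounds[OF R ab] bspec[OF c[unfolded covers_def] ab] by (simp add: graph_rel_def)
  qed
next
  assume s: "R \<subseteq> graph_rel N g"
  show "covers g R" unfolding covers_def
  proof (clarify)
    fix a b assume "(a, b) \<in> R"
    then have "(a, b) \<in> graph_rel N g" using s by blast
    then show "g b = a" by (simp add: graph_rel_def)
  qed
qed

lemma hatG_mult:
  assumes x: "x \<in> alg_over (Sym N)" and y: "y \<in> alg_over (Sym N)"
    and w: "\<omega> \<in> Omega_fin l N" "\<omega>'' \<in> Omega_fin l N"
  shows "hatG (grp_mult x y) (link l \<omega> \<omega>'') =
    (\<Sum>\<omega>'\<in>Omega_fin l N. hatG x (link l \<omega> \<omega>') * hatG y (link l \<omega>' \<omega>''))"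
proof -
  have "of_bool (covers (g \<circ> h) (link l \<omega> \<omega>'')) =
    (\<Sum>\<omega>'\<in>Omega_fin l N. of_bool (covers g (link l \<omega> \<omega>')) * (of_bool (covers h (link l \<omega>' \<omega>'')) :: complex))"
    if "g \<in> keys x" "h \<in> keys y" for g h
  proof -
    have g: "g \<in> Sym N" "h \<in> Sym N" using that x y by (auto simp: alg_over_def)
    have "of_bool (covers (g \<circ> h) (link l \<omega> \<omega>'')) = (of_bool (link l \<omega> \<omega>'' \<subseteq> graph_rel N g O graph_rel N h) :: complex)"
      by (simp only: covers_graph_rel[OF link_PI[OF w]] graph_rel_comp[OF g(2)])
    also have "\<dots> = (\<Sum>\<omega>'\<in>Omega_fin l N. of_bool (link l \<omega> \<omega>' \<subseteq> graph_rel N g) * of_bool (link l \<omega>' \<omega>'' \<subseteq> graph_rel N h))"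
      by (rule link_relcomp[OF graph_rel_PI[OF g(1)] graph_rel_PI[OF g(2)] w])
    also have "\<dots> = (\<Sum>\<omega>'\<in>Omega_fin l N. of_bool (covers g (link l \<omega> \<omega>')) * of_bool (covers h (link l \<omega>' \<omega>'')))"
      by (rule sum.cong[OF refl]) (simp only: covers_graph_rel[OF link_PI[OF w(1)]] covers_graph_rel[OF link_PI[OF _ w(2)]])
    finally show ?thesis .
  qed
  then have "hatG (grp_mult x y) (link l \<omega> \<omega>'') = pairing (\<lambda>g. pairing (\<lambda>h.
     \<Sum>\<omega>'\<in>Omega_fin l N. of_bool (covers g (link l \<omega> \<omega>')) * of_bool (covers h (link l \<omega>' \<omega>''))) y) x"
    unfolding hatG_def pairing_convolve by (intro pairing_cong)
  then show ?thesis unfolding pairing_sum_product hatG_def .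
qed

text \<open>The intermediate words range over a set that grows with j. Those leaving {1..n}
  disappear in the limit: k vanishes there by balancedness, so the entries of \<beta> are uniformly
  small by \<open>column_null\<close>, while the row sums of \<alpha> stay bounded. On the remaining
  finite set the limit is taken termwise.\<close>

lemma hatG_mult_limit:
  assumes cB: "\<forall>\<^sub>F j in sequentially. \<alpha> j \<in> cB m j" "\<forall>\<^sub>F j in sequentially. \<beta> j \<in> cB m j"
    and h: "conv_hat \<alpha> h" and k: "conv_hat \<beta> k"
    and n: "m \<le> n" and w: "\<omega> \<in> Omega_fin l n" "\<omega>'' \<in> Omega_fin l n"
  shows "(\<lambda>j. hatG (grp_mult (\<alpha> j) (\<beta> j)) (link l \<omega> \<omega>''))
    \<longlonglongrightarrow> (\<Sum>\<omega>'\<in>Omega_fin l n. h (link l \<omega> \<omega>') * k (link l \<omega>' \<omega>''))"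
proof -
  let ?O = "Omega_fin l n"
  let ?p = "\<lambda>j \<omega>'. hatG (\<alpha> j) (link l \<omega> \<omega>') * hatG (\<beta> j) (link l \<omega>' \<omega>'')"
  have wi: "\<omega> \<in> Omega_inf l" "\<omega>'' \<in> Omega_inf l" using w by (simp_all add: Omega_fin_iff)
  have bal: "balanced m k" by (rule limit_balanced[OF cB(2) k])
  have main: "(\<lambda>j. \<Sum>\<omega>'\<in>?O. ?p j \<omega>') \<longlonglongrightarrow> (\<Sum>\<omega>'\<in>?O. h (link l \<omega> \<omega>') * k (link l \<omega>' \<omega>''))"
    using h k link_PI[OF w(1)] link_PI[OF _ w(2)] unfolding conv_hat_def
    by (intro tendsto_sum tendsto_mult) blast+
  obtain C where C: "\<forall>\<^sub>F j in sequentially. schur l (hatG (\<alpha> j)) C" using conv_hat_schur[OF cB(1) h] by blast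
  have rest: "(\<lambda>j. \<Sum>\<omega>'\<in>Omega_fin l j - ?O. ?p j \<omega>') \<longlonglongrightarrow> 0"
  proof (rule tendstoI)
    fix e :: real assume e: "e > 0"
    define d where "d = e / (\<bar>C\<bar> + 1)"
    have d: "d > 0" "\<bar>C\<bar> * d < e" "d\<^sup>2 > 0" using e by (simp_all add: d_def field_simps)
    show "\<forall>\<^sub>F j in sequentially. dist (\<Sum>\<omega>'\<in>Omega_fin l j - ?O. ?p j \<omega>') 0 < e"
      using C column_null[OF cB(2) k wi(2) d(3)]
    proof eventually_elim
      case (elim j)
      have fO: "finite (Omega_fin l j - ?O)" by simp
      have bd: "cmod (hatG (\<beta> j) (link l \<omega>' \<omega>'')) \<le> d" if o: "\<omega>' \<in> Omega_fin l j - ?O" for \<omega>'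
      proof -
        have wo: "\<omega>' \<in> Omega_inf l" using o by (simp add: Omega_fin_iff)
        obtain i where i: "i \<in> {1..l}" "n < pos \<omega>' i" using o wo by (auto simp: Omega_fin_iff not_le)
        have "pos \<omega>' i \<in> pos \<omega>' ` {1..l} - {1..m}" "pos \<omega>' i \<notin> pos \<omega>'' ` {1..l} - {1..m}"
          using i n w(2) by (auto simp: Omega_fin_iff not_le)
        then have "k (link l \<omega>' \<omega>'') = 0" using balanced_link[OF bal wo wi(2)] by blast
        moreover have "(\<Sum>v\<in>{\<omega>'}. (cmod (1 * hatG (\<beta> j) (link l v \<omega>'') + (- 1) * k (link l v \<omega>'')))\<^sup>2) \<le> d\<^sup>2"
          using elim(2) wo by blast
        ultimately have "(cmod (hatG (\<beta> j) (link l \<omega>' \<omega>'')))\<^sup>2 \<le> d\<^sup>2" by simp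
        then show ?thesis using d(1) by (simp add: abs_le_square_iff[symmetric])
      qed
      have "cmod (\<Sum>\<omega>'\<in>Omega_fin l j - ?O. ?p j \<omega>') \<le> (\<Sum>\<omega>'\<in>Omega_fin l j - ?O. cmod (hatG (\<alpha> j) (link l \<omega> \<omega>')) * d)"
        by (rule sum_norm_le) (simp add: norm_mult mult_left_mono bd)
      also have "\<dots> = (\<Sum>\<omega>'\<in>Omega_fin l j - ?O. cmod (hatG (\<alpha> j) (link l \<omega> \<omega>'))) * d" by (simp add: sum_distrib_right)
      also have "\<dots> \<le> C * d"
      proof (rule mult_right_mono)
        have "Omega_fin l j - ?O \<subseteq> Omega_inf l" by (auto simp: Omega_fin_iff)
        then show "(\<Sum>\<omega>'\<in>Omega_fin l j - ?O. cmod (hatG (\<alpha> j) (link l \<omega> \<omega>'))) \<le> C"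
          using elim(1) fO wi(1) unfolding schur_def by blast
      qed (use d in simp)
      also have "\<dots> \<le> \<bar>C\<bar> * d" using d(1) by (simp add: mult_right_mono)
      also have "\<dots> < e" by (rule d(2))
      finally show ?case by simp
    qed
  qed
  have "\<forall>\<^sub>F j in sequentially. (\<Sum>\<omega>'\<in>?O. ?p j \<omega>') + (\<Sum>\<omega>'\<in>Omega_fin l j - ?O. ?p j \<omega>')
      = hatG (grp_mult (\<alpha> j) (\<beta> j)) (link l \<omega> \<omega>'')"
    using cB eventually_ge_at_top[of n]
  proof eventually_elim
    case (elim j)
    have sub: "?O \<subseteq> Omega_fin l j" using elim(3) unfolding Omega_fin_def by auto
    have "hatG (grp_mult (\<alpha> j) (\<beta> j)) (link l \<omega> \<omega>'') = (\<Sum>\<omega>'\<in>Omega_fin l j. ?p j \<omega>')"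
      by (rule hatG_mult) (use elim sub w cB_alg_over in blast)+
    then show ?case using sum.subset_diff[OF sub, of "?p j"] by (simp add: add.commute)
  qed
  moreover have "(\<lambda>j. (\<Sum>\<omega>'\<in>?O. ?p j \<omega>') + (\<Sum>\<omega>'\<in>Omega_fin l j - ?O. ?p j \<omega>'))
      \<longlonglongrightarrow> (\<Sum>\<omega>'\<in>?O. h (link l \<omega> \<omega>') * k (link l \<omega>' \<omega>''))"
    using tendsto_add[OF main rest] by simp
  ultimately show ?thesis by (rule Lim_transform_eventually[rotated])
qed

section \<open>Matching the two kinds of sequences\<close>

definition seq_B :: "nat \<Rightarrow> (nat \<Rightarrow> grp_alg) set" where
  "seq_B m = {\<alpha> \<in> conv_seq. \<forall>\<^sub>F n in sequentially. \<alpha> n \<in> cB m n}"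

lemma cB_mono:
  assumes "m \<le> m'"
  shows "cB m n \<subseteq> cB m' n"
proof -
  have "Sym_stab m' n \<subseteq> Sym_stab m n" using assms by (auto simp: Sym_stab_def)
  then show ?thesis unfolding cB_def alg_centralizer_def by blast
qed

lemma seq_B_mono:
  assumes "m \<le> m'"
  shows "seq_B m \<subseteq> seq_B m'"
proof
  fix \<alpha> assume a: "\<alpha> \<in> seq_B m"
  then have "\<forall>\<^sub>F n in sequentially. \<alpha> n \<in> cB m n" by (simp add: seq_B_def)
  then have "\<forall>\<^sub>F n in sequentially. \<alpha> n \<in> cB m' n" by eventually_elim (use cB_mono[OF assms] in blast)
  then show "\<alpha> \<in> seq_B m'" using a by (simp add: seq_B_def)
qed

lemma conv_seq_Union: "conv_seq = (\<Union>m. seq_B m)"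
proof (intro Set.set_eqI iffI)
  fix \<alpha> assume a: "\<alpha> \<in> conv_seq"
  then have "\<exists>m. \<forall>\<^sub>F n in sequentially. \<alpha> n \<in> cB m n" by (simp add: conv_seq_def)
  then show "\<alpha> \<in> (\<Union>m. seq_B m)" using a by (simp add: seq_B_def)
qed (simp add: seq_B_def)

lemma seq_A_mono:
  assumes "m \<le> m'"
  shows "seq_A m \<subseteq> seq_A m'"
proof
  fix a assume a: "a \<in> seq_A m"
  have "Gam_sub m' n \<subseteq> Gam_sub m n" for n using assms by (auto simp: Gam_sub_def)
  then have "cA m n \<subseteq> cA m' n" for n unfolding cA_def alg_centralizer_def by blast
  moreover have "bdd_above ((\<lambda>n. max_deg (Gam_deg n) (a n)) ` {m'..})"
    by (rule bdd_above_mono[of "(\<lambda>n. max_deg (Gam_deg n) (a n)) ` {m..}"])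
      (use a assms in \<open>auto simp: seq_A_def\<close>)
  ultimately show "a \<in> seq_A m'" using a assms unfolding seq_A_def
    by (intro CollectI conjI allI impI) (simp_all add: subset_iff)
qed

text \<open>Set to 0 away from partial injections, here and in \<open>kernel_A\<close>, so that
  equality of kernels as functions means equality at the relations that matter.\<close>

definition kernel_B :: "(nat \<Rightarrow> grp_alg) \<Rightarrow> (nat \<times> nat) set \<Rightarrow> complex" where
  "kernel_B \<alpha> R = (if R \<in> (\<Union>k. PI k) then lim (\<lambda>n. hatG (\<alpha> n) R) else 0)"

definition kernel_A :: "(nat \<Rightarrow> sg_alg) \<Rightarrow> (nat \<times> nat) set \<Rightarrow> complex" where
  "kernel_A a R = (if R \<in> (\<Union>k. PI k) then kerA a R else 0)"

lemma kernel_B_eq: "conv_hat \<alpha> h \<Longrightarrow> R \<in> PI k \<Longrightarrow> kernel_B \<alpha> R = h R"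
  unfolding kernel_B_def conv_hat_def by (auto intro: limI)

lemma conv_hat_kernel_B: "conv_hat \<alpha> h \<Longrightarrow> conv_hat \<alpha> (kernel_B \<alpha>)"
  using kernel_B_eq[of \<alpha> h] by (simp add: conv_hat_def)

lemma kernel_A_eq: "a \<in> seq_A m \<Longrightarrow> m \<le> n \<Longrightarrow> R \<in> PI n \<Longrightarrow> kernel_A a R = hatA (a n) R"
  using kerA_eq[of a m n R] unfolding kernel_A_def by auto

lemma perm_deg_bounded_iff:
  "bdd_above (range (\<lambda>n. max_deg perm_deg (\<alpha> n))) \<longleftrightarrow> (\<exists>D. \<forall>n. \<forall>g\<in>keys (\<alpha> n). perm_deg g \<le> D)"
  unfolding bdd_above_def max_deg_le_iff[symmetric] by blast

lemma perm_deg_comp: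
  assumes "g \<in> Sym_inf" "h \<in> Sym_inf"
  shows "perm_deg (g \<circ> h) \<le> perm_deg g + perm_deg h"
proof -
  have fin: "finite {i. g i \<noteq> i}" if g: "g \<in> Sym_inf" for g
  proof -
    obtain n where "g \<in> Sym n" using g by (auto simp: Sym_inf_def)
    then have "{i. g i \<noteq> i} \<subseteq> {1..n}" using Sym_fix by blast
    then show ?thesis by (rule finite_subset) simp
  qed
  have "perm_deg (g \<circ> h) \<le> card ({i. g i \<noteq> i} \<union> {i. h i \<noteq> i})"
    unfolding perm_deg_def by (rule card_mono) (use fin assms in auto)
  also have "\<dots> \<le> perm_deg g + perm_deg h" unfolding perm_deg_def by (rule card_Un_le)
  finally show ?thesis .
qed

text \<open>A relation between representatives at one common level. The operations are checked on
  matched pairs and pass from there to the quotients.\<close>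

definition matched :: "nat \<Rightarrow> (nat \<Rightarrow> grp_alg) \<Rightarrow> (nat \<Rightarrow> sg_alg) \<Rightarrow> bool" where
  "matched m \<alpha> a \<longleftrightarrow> \<alpha> \<in> seq_B m \<and> a \<in> seq_A m \<and> kernel_B \<alpha> = kernel_A a"

text \<open>Everything is read off a single kernel h, attained as a limit on the group side and
  exactly at every level on the semigroup side. For each algebra operation it remains to exhibit
  h.\<close>

lemma matchedI:
  assumes al: "\<And>n. \<alpha> n \<in> alg_over Sym_inf" and cB: "\<forall>\<^sub>F n in sequentially. \<alpha> n \<in> cB m n"
    and deg: "\<And>n g. g \<in> keys (\<alpha> n) \<Longrightarrow> perm_deg g \<le> D" and h: "conv_hat \<alpha> h"
    and b: "\<And>n. m \<le> n \<Longrightarrow> b n \<in> alg_over (Gam n)" "\<And>n R. m \<le> n \<Longrightarrow> R \<in> PI n \<Longrightarrow> hatA (b n) R = h R"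
  shows "matched m \<alpha> b"
proof -
  have bdd: "bdd_above (range (\<lambda>n. max_deg perm_deg (\<alpha> n)))" unfolding perm_deg_bounded_iff using deg by (intro exI[of _ D]) simp
  have "\<alpha> \<in> seq_B m" using conv_seqI[OF al cB bdd h] cB by (simp add: seq_B_def)
  moreover have bA: "b \<in> seq_A m" by (rule seq_A_from_limit[OF al cB bdd h b])
  moreover have "kernel_B \<alpha> R = kernel_A b R" for R
  proof (cases "R \<in> (\<Union>k. PI k)")
    case True
    then obtain k where "R \<in> PI k" by blast
    then have R: "R \<in> PI (max m k)" using PI_mono[of k "max m k"] by auto
    then show ?thesis using kernel_B_eq[OF h R] kernel_A_eq[OF bA _ R] b(2)[OF _ R] by simp
  qed (simp add: kernel_B_def kernel_A_def)
  ultimately show ?thesis unfolding matched_def by blast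
qed

lemma matchedD:
  assumes "matched m \<alpha> a"
  shows "\<alpha> n \<in> alg_over Sym_inf" "\<forall>\<^sub>F n in sequentially. \<alpha> n \<in> cB m n"
    "\<exists>D. \<forall>n. \<forall>g\<in>keys (\<alpha> n). perm_deg g \<le> D" "conv_hat \<alpha> (kernel_A a)"
    "m \<le> n \<Longrightarrow> a n \<in> alg_over (Gam n)" "m \<le> n \<Longrightarrow> R \<in> PI n \<Longrightarrow> hatA (a n) R = kernel_A a R"
proof -
  have B: "\<alpha> \<in> conv_seq" and A: "a \<in> seq_A m" and e: "kernel_B \<alpha> = kernel_A a"
    and cB: "\<forall>\<^sub>F n in sequentially. \<alpha> n \<in> cB m n"
    using assms by (simp_all add: matched_def seq_B_def)
  show "\<alpha> n \<in> alg_over Sym_inf" "\<exists>D. \<forall>n. \<forall>g\<in>keys (\<alpha> n). perm_deg g \<le> D"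
    using B by (simp_all add: conv_seq_def perm_deg_bounded_iff)
  show "\<forall>\<^sub>F n in sequentially. \<alpha> n \<in> cB m n" by (rule cB)
  show "conv_hat \<alpha> (kernel_A a)" unfolding e[symmetric]
    by (rule conv_seq_conv_hat[OF B]) (rule conv_hat_kernel_B)
  show "m \<le> n \<Longrightarrow> a n \<in> alg_over (Gam n)" by (rule seq_A_alg[OF A])
  show "m \<le> n \<Longrightarrow> R \<in> PI n \<Longrightarrow> hatA (a n) R = kernel_A a R" using kernel_A_eq[OF A] by simp
qed

lemma cB_mult: "x \<in> cB m n \<Longrightarrow> y \<in> cB m n \<Longrightarrow> grp_mult x y \<in> cB m n"
  unfolding cB_def alg_centralizer_def
  by (intro CollectI conjI ballI grp_mult_alg) (simp_all, metis grp_mult_assoc)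

lemma cB_add: "x \<in> cB m n \<Longrightarrow> y \<in> cB m n \<Longrightarrow> x + y \<in> cB m n"
  unfolding cB_def alg_centralizer_def
  by (intro CollectI conjI ballI alg_over_add) (simp_all add: convolve_add_left convolve_add_right)

lemma cB_one: "single id 1 \<in> cB m n"
proof -
  have "id \<in> Sym n" by (simp add: Sym_permutes permutes_id)
  then show ?thesis unfolding cB_def alg_centralizer_def by (simp add: alg_over_single)
qed

lemma matched_add:
  assumes a: "matched m \<alpha> a" and b: "matched m \<beta> b"
  shows "matched m (\<lambda>n. \<alpha> n + \<beta> n) (\<lambda>n. a n + b n)"
proof -
  obtain D E where D: "\<And>n g. g \<in> keys (\<alpha> n) \<Longrightarrow> perm_deg g \<le> D" "\<And>n g. g \<in> keys (\<beta> n) \<Longrightarrow> perm_deg g \<le> E"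
    using matchedD(3)[OF a] matchedD(3)[OF b] by blast
  show ?thesis
  proof (rule matchedI[where D = "D + E" and h = "\<lambda>R. kernel_A a R + kernel_A b R"])
    show "\<alpha> n + \<beta> n \<in> alg_over Sym_inf" for n by (intro alg_over_add matchedD(1)[OF a] matchedD(1)[OF b])
    show "\<forall>\<^sub>F n in sequentially. \<alpha> n + \<beta> n \<in> cB m n"
      using matchedD(2)[OF a] matchedD(2)[OF b] by eventually_elim (rule cB_add)
    show "perm_deg g \<le> D + E" if "g \<in> keys (\<alpha> n + \<beta> n)" for n g
      using subsetD[OF Poly_Mapping.keys_add that] D[of g n] by (auto intro: trans_le_add1 trans_le_add2)
    show "conv_hat (\<lambda>n. \<alpha> n + \<beta> n) (\<lambda>R. kernel_A a R + kernel_A b R)"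
      using matchedD(4)[OF a] matchedD(4)[OF b] unfolding conv_hat_def hatG_add by (simp add: tendsto_add)
    show "m \<le> n \<Longrightarrow> a n + b n \<in> alg_over (Gam n)" for n
      by (intro alg_over_add matchedD(5)[OF a] matchedD(5)[OF b])
    show "m \<le> n \<Longrightarrow> R \<in> PI n \<Longrightarrow> hatA (a n + b n) R = kernel_A a R + kernel_A b R" for n R
      by (simp add: hatA_add matchedD(6)[OF a] matchedD(6)[OF b])
  qed
qed

lemma matched_scale:
  assumes a: "matched m \<alpha> a"
  shows "matched m (\<lambda>n. scale c (\<alpha> n)) (\<lambda>n. scale c (a n))"
proof -
  obtain D where D: "\<And>n g. g \<in> keys (\<alpha> n) \<Longrightarrow> perm_deg g \<le> D" using matchedD(3)[OF a] by blast
  show ?thesis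
  proof (rule matchedI[where D = D and h = "\<lambda>R. c * kernel_A a R"])
    show "scale c (\<alpha> n) \<in> alg_over Sym_inf" for n by (intro alg_over_scale matchedD(1)[OF a])
    show "\<forall>\<^sub>F n in sequentially. scale c (\<alpha> n) \<in> cB m n"
      using matchedD(2)[OF a] by eventually_elim (rule cB_scale)
    show "perm_deg g \<le> D" if "g \<in> keys (scale c (\<alpha> n))" for n g
      by (rule D[OF subsetD[OF keys_scale that]])
    show "conv_hat (\<lambda>n. scale c (\<alpha> n)) (\<lambda>R. c * kernel_A a R)"
      using matchedD(4)[OF a] unfolding conv_hat_def hatG_scale by (simp add: tendsto_mult_left)
    show "m \<le> n \<Longrightarrow> scale c (a n) \<in> alg_over (Gam n)" for n by (intro alg_over_scale matchedD(5)[OF a])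
    show "m \<le> n \<Longrightarrow> R \<in> PI n \<Longrightarrow> hatA (scale c (a n)) R = c * kernel_A a R" for n R
      by (simp add: hatA_scale matchedD(6)[OF a])
  qed
qed

lemma matched_one: "matched 0 (\<lambda>n. single id 1) (\<lambda>n. single (id_matr n) 1)"
proof (rule matchedI[where D = 0 and h = "\<lambda>R. of_bool (R \<subseteq> Id)"])
  show "single id 1 \<in> alg_over Sym_inf"
    by (rule alg_over_single) (simp add: Sym_inf_def Sym_permutes permutes_id)
  show "\<forall>\<^sub>F n in sequentially. single id 1 \<in> cB 0 n" by (simp add: cB_one)
  show "perm_deg g \<le> 0" if "g \<in> keys (single id 1 :: grp_alg)" for g
    using that by (simp add: perm_deg_def)
  have "covers id R \<longleftrightarrow> R \<subseteq> Id" for R unfolding covers_def by auto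
  then show "conv_hat (\<lambda>n. single id 1) (\<lambda>R. of_bool (R \<subseteq> Id))" by (simp add: conv_hat_def hatG_def)
  have r: "rel (id_matr n) = {(i, j). i = j \<and> i \<in> {1..n}}" for n
    by (auto simp: rel_def id_matr_def)
  show "single (id_matr n) 1 \<in> alg_over (Gam n)" for n
  proof (rule alg_over_single)
    show "id_matr n \<in> Gam n" unfolding Gam_def id_matr_def by (simp split: if_splits)
  qed
  show "hatA (single (id_matr n) 1) R = of_bool (R \<subseteq> Id)" if R: "R \<in> PI n" for n R
  proof -
    have "R \<subseteq> rel (id_matr n) \<longleftrightarrow> R \<subseteq> Id" using PI_bounds[OF R] unfolding r by blast
    then show ?thesis by (simp add: hatA_def)
  qed
qed

lemma matched_mult:
  assumes a: "matched m \<alpha> a" and b: "matched m \<beta> b"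
  shows "matched m (\<lambda>n. grp_mult (\<alpha> n) (\<beta> n)) (\<lambda>n. convolve mmult (a n) (b n))"
proof -
  obtain D E where D: "\<And>n g. g \<in> keys (\<alpha> n) \<Longrightarrow> perm_deg g \<le> D" "\<And>n g. g \<in> keys (\<beta> n) \<Longrightarrow> perm_deg g \<le> E"
    using matchedD(3)[OF a] matchedD(3)[OF b] by blast
  \<comment> \<open>The fact \<open>lim\<close> shows that this limit exists and is the incidence
    function of the product at every level from m on that contains R. In particular the products at
    different levels are compatible.\<close>
  define h where "h R = lim (\<lambda>n. hatG (grp_mult (\<alpha> n) (\<beta> n)) R)" for R
  have lim: "(\<lambda>j. hatG (grp_mult (\<alpha> j) (\<beta> j)) R) \<longlonglongrightarrow> hatA (convolve mmult (a n) (b n)) R"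
    if n: "m \<le> n" and R: "R \<in> PI n" for n R
  proof -
    obtain \<omega> \<omega>'' where w: "\<omega> \<in> Omega_fin (card R) n" "\<omega>'' \<in> Omega_fin (card R) n" and e: "link (card R) \<omega> \<omega>'' = R"
      by (rule PI_is_link[OF R])
    have "hatA (convolve mmult (a n) (b n)) R = (\<Sum>\<omega>'\<in>Omega_fin (card R) n.
        kernel_A a (link (card R) \<omega> \<omega>') * kernel_A b (link (card R) \<omega>' \<omega>''))"
      using hatA_mult[OF matchedD(5)[OF a n] matchedD(5)[OF b n] w]
      by (simp add: e matchedD(6)[OF a n] matchedD(6)[OF b n] link_PI w)
    then show ?thesis
      using hatG_mult_limit[OF matchedD(2)[OF a] matchedD(2)[OF b] matchedD(4)[OF a] matchedD(4)[OF b] n w]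
      by (simp only: e)
  qed
  show ?thesis
  proof (rule matchedI[where D = "D + E" and h = h])
    show "grp_mult (\<alpha> n) (\<beta> n) \<in> alg_over Sym_inf" for n
    proof (rule alg_over_convolve[OF matchedD(1)[OF a] matchedD(1)[OF b]])
      fix g h assume "g \<in> Sym_inf" "h \<in> Sym_inf"
      then obtain p q where "g \<in> Sym p" "h \<in> Sym q" by (auto simp: Sym_inf_def)
      then have "g \<in> Sym (max p q)" "h \<in> Sym (max p q)"
        using Sym_mono[of p "max p q"] Sym_mono[of q "max p q"] by auto
      then show "g \<circ> h \<in> Sym_inf" using comp_Sym unfolding Sym_inf_def by blast
    qed
    show "\<forall>\<^sub>F n in sequentially. grp_mult (\<alpha> n) (\<beta> n) \<in> cB m n"
      using matchedD(2)[OF a] matchedD(2)[OF b] by eventually_elim (rule cB_mult)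
    show "perm_deg k \<le> D + E" if "k \<in> keys (grp_mult (\<alpha> n) (\<beta> n))" for n k
    proof -
      from subsetD[OF keys_convolve that]
      obtain g h where k: "k = g \<circ> h" "g \<in> keys (\<alpha> n)" "h \<in> keys (\<beta> n)" by auto
      then have "g \<in> Sym_inf" "h \<in> Sym_inf"
        using matchedD(1)[OF a, of n] matchedD(1)[OF b, of n] by (auto simp: alg_over_def)
      then have "perm_deg k \<le> perm_deg g + perm_deg h" unfolding k(1) by (rule perm_deg_comp)
      then show ?thesis using D(1)[OF k(2)] D(2)[OF k(3)] by linarith
    qed
    show "conv_hat (\<lambda>n. grp_mult (\<alpha> n) (\<beta> n)) h"
      unfolding conv_hat_def
    proof (intro allI ballI)
      fix k R assume "R \<in> PI k"
      then have R: "R \<in> PI (max m k)" using PI_mono[of k "max m k"] by auto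
      show "(\<lambda>n. hatG (grp_mult (\<alpha> n) (\<beta> n)) R) \<longlonglongrightarrow> h R"
        using lim[OF _ R] limI[OF lim[OF _ R]] unfolding h_def by simp
    qed
    show "m \<le> n \<Longrightarrow> convolve mmult (a n) (b n) \<in> alg_over (Gam n)" for n
      by (rule alg_over_convolve[OF matchedD(5)[OF a] matchedD(5)[OF b]]) (auto intro: mmult_in_Gam)
    show "m \<le> n \<Longrightarrow> R \<in> PI n \<Longrightarrow> hatA (convolve mmult (a n) (b n)) R = h R" for n R
      unfolding h_def using limI[OF lim] by simp
  qed
qed

text \<open>The level m is the same on both sides, here and in \<open>ex_matched_B\<close>; this
  yields the equality of the images of \<open>sub_B m\<close> and \<open>sub_A m\<close>.\<close>

lemma ex_matched_A:
  assumes a: "\<alpha> \<in> seq_B m"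
  shows "\<exists>a. matched m \<alpha> a"
proof -
  have B: "\<alpha> \<in> conv_seq" and cB: "\<forall>\<^sub>F n in sequentially. \<alpha> n \<in> cB m n"
    using a by (simp_all add: seq_B_def)
  obtain h where h: "conv_hat \<alpha> h" using conv_seq_conv_hat[OF B] .
  obtain D where "\<forall>n. \<forall>g\<in>keys (\<alpha> n). perm_deg g \<le> D"
    using B unfolding conv_seq_def perm_deg_bounded_iff by blast
  then have "matched m \<alpha> (\<lambda>n. of_hat n h)"
    using B by (intro matchedI[OF _ cB _ h] of_hat_alg hatA_of_hat) (auto simp: conv_seq_def)
  then show ?thesis by blast
qed

lemma ex_matched_B:
  assumes a: "a \<in> seq_A m"
  shows "\<exists>\<alpha>. matched m \<alpha> a"
proof -
  obtain \<alpha> where al: "\<And>n. \<alpha> n \<in> alg_over Sym_inf" and cB: "\<forall>\<^sub>F n in sequentially. \<alpha> n \<in> cB m n"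
    and bdd: "bdd_above (range (\<lambda>n. max_deg perm_deg (\<alpha> n)))" and h: "conv_hat \<alpha> (kerA a)"
    using approximation[OF a] by (elim exE conjE) blast
  obtain D where D: "\<And>n g. g \<in> keys (\<alpha> n) \<Longrightarrow> perm_deg g \<le> D" using bdd unfolding perm_deg_bounded_iff by blast
  have "matched m \<alpha> a"
    by (rule matchedI[OF al cB D h seq_A_alg[OF a]]) (simp_all add: kerA_eq[OF a])
  then show ?thesis by blast
qed

lemma common_level:
  assumes "\<alpha> \<in> conv_seq" "a \<in> (\<Union>m. seq_A m)" "kernel_B \<alpha> = kernel_A a"
  shows "\<exists>m0. \<forall>m\<ge>m0. matched m \<alpha> a"
proof -
  obtain p q where "\<alpha> \<in> seq_B p" "a \<in> seq_A q" using assms by (auto simp: conv_seq_Union)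
  then show ?thesis using assms(3) seq_B_mono[of p] seq_A_mono[of q] unfolding matched_def
    by (intro exI[of _ "max p q"]) (auto dest: subsetD)
qed

section \<open>Quotients by the kernel of a map\<close>

text \<open>Both algebras are quotients by equality of the kernel. The bijection between them then
  follows abstractly from two maps with the same image.\<close>

definition kernel_rel :: "'s set \<Rightarrow> ('s \<Rightarrow> 'k) \<Rightarrow> ('s \<times> 's) set" where
  "kernel_rel S \<kappa> = {(x, y). x \<in> S \<and> y \<in> S \<and> \<kappa> x = \<kappa> y}"

definition transport :: "'t set \<Rightarrow> ('t \<Rightarrow> 'k) \<Rightarrow> ('s \<Rightarrow> 'k) \<Rightarrow> 's set \<Rightarrow> 't set" where
  "transport T \<kappa>' \<kappa> X = {t \<in> T. \<exists>x\<in>X. \<kappa>' t = \<kappa> x}"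

lemma kernel_rel_class: "s \<in> S \<Longrightarrow> kernel_rel S \<kappa> `` {s} = {x \<in> S. \<kappa> x = \<kappa> s}"
  by (auto simp: kernel_rel_def)

lemma kernel_rel_quotientE:
  assumes "X \<in> S // kernel_rel S \<kappa>"
  obtains s where "s \<in> S" "X = kernel_rel S \<kappa> `` {s}"
  using assms by (rule quotientE)

lemma transport_class:
  assumes "s \<in> S" "t \<in> T" "\<kappa> s = \<kappa>' t"
  shows "transport T \<kappa>' \<kappa> (kernel_rel S \<kappa> `` {s}) = kernel_rel T \<kappa>' `` {t}"
  unfolding kernel_rel_class[OF assms(1)] kernel_rel_class[OF assms(2)] transport_def
  using assms by auto

lemma transport_bij:
  assumes im: "\<kappa> ` S = \<kappa>' ` T"
  shows "bij_betw (transport T \<kappa>' \<kappa>) (S // kernel_rel S \<kappa>) (T // kernel_rel T \<kappa>')"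
  unfolding bij_betw_def
proof (intro conjI subset_antisym subsetI, rule inj_onI)
  fix X Y assume XY: "X \<in> S // kernel_rel S \<kappa>" "Y \<in> S // kernel_rel S \<kappa>"
    and eq: "transport T \<kappa>' \<kappa> X = transport T \<kappa>' \<kappa> Y"
  obtain s u where s: "s \<in> S" "X = kernel_rel S \<kappa> `` {s}" and u: "u \<in> S" "Y = kernel_rel S \<kappa> `` {u}"
    using XY by (elim kernel_rel_quotientE)
  obtain t where t: "t \<in> T" "\<kappa> s = \<kappa>' t" using im s(1) by blast
  have "t \<in> transport T \<kappa>' \<kappa> X" using s t by (auto simp: transport_def kernel_rel_class)
  then have "\<kappa>' t = \<kappa> u" unfolding eq using u by (auto simp: transport_def kernel_rel_class)
  then have "\<kappa> s = \<kappa> u" using t(2) by simp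
  then show "X = Y" using s u by (simp add: kernel_rel_class)
next
  fix Z assume "Z \<in> transport T \<kappa>' \<kappa> ` (S // kernel_rel S \<kappa>)"
  then obtain X where X: "X \<in> S // kernel_rel S \<kappa>" "Z = transport T \<kappa>' \<kappa> X" by blast
  obtain s where s: "s \<in> S" "X = kernel_rel S \<kappa> `` {s}" using X(1) by (elim kernel_rel_quotientE)
  obtain t where t: "t \<in> T" "\<kappa> s = \<kappa>' t" using im s(1) by blast
  show "Z \<in> T // kernel_rel T \<kappa>'" unfolding X(2) s(2) transport_class[where \<kappa> = \<kappa> and \<kappa>' = \<kappa>', OF s(1) t] by (rule quotientI[OF t(1)])
next
  fix Z assume "Z \<in> T // kernel_rel T \<kappa>'"
  then obtain t where t: "t \<in> T" "Z = kernel_rel T \<kappa>' `` {t}" by (elim kernel_rel_quotientE)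
  obtain s where s: "s \<in> S" "\<kappa> s = \<kappa>' t" using im t(1) by (metis imageE imageI)
  show "Z \<in> transport T \<kappa>' \<kappa> ` (S // kernel_rel S \<kappa>)"
    unfolding t(2) transport_class[where \<kappa> = \<kappa> and \<kappa>' = \<kappa>', OF s(1) t(1) s(2), symmetric] by (intro imageI quotientI s(1))
qed

lemma unop_class:
  assumes s: "s \<in> S" and f: "\<And>x. x \<in> S \<Longrightarrow> \<kappa> x = \<kappa> s \<Longrightarrow> f x \<in> S \<and> \<kappa> (f x) = \<kappa> (f s)"
  shows "(\<Union>x\<in>kernel_rel S \<kappa> `` {s}. kernel_rel S \<kappa> `` {f x}) = kernel_rel S \<kappa> `` {f s}"
proof -
  have "kernel_rel S \<kappa> `` {f x} = kernel_rel S \<kappa> `` {f s}" if "x \<in> kernel_rel S \<kappa> `` {s}" for x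
    using that f[of x] f[OF s refl] by (simp add: kernel_rel_class s)
  moreover have "s \<in> kernel_rel S \<kappa> `` {s}" by (simp add: kernel_rel_class s)
  ultimately show ?thesis by blast
qed

text \<open>Well-definedness on either side comes from f itself: two elements with the same kernel
  are compared through one matching element of the other side.\<close>

lemma transport_unop:
  assumes im: "\<kappa> ` S = \<kappa>' ` T"
    and f: "\<And>x a. x \<in> S \<Longrightarrow> a \<in> T \<Longrightarrow> \<kappa> x = \<kappa>' a \<Longrightarrow> f x \<in> S \<and> f' a \<in> T \<and> \<kappa> (f x) = \<kappa>' (f' a)"
    and X: "X \<in> S // kernel_rel S \<kappa>"
  shows "transport T \<kappa>' \<kappa> (\<Union>x\<in>X. kernel_rel S \<kappa> `` {f x})
     = (\<Union>a\<in>transport T \<kappa>' \<kappa> X. kernel_rel T \<kappa>' `` {f' a})"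
proof -
  obtain s where s: "s \<in> S" "X = kernel_rel S \<kappa> `` {s}" using X by (elim kernel_rel_quotientE)
  obtain t where t: "t \<in> T" "\<kappa> s = \<kappa>' t" using im s(1) by blast
  note st = f[OF s(1) t]
  have "(\<Union>x\<in>X. kernel_rel S \<kappa> `` {f x}) = kernel_rel S \<kappa> `` {f s}"
    unfolding s(2) by (rule unop_class[OF s(1)]) (use f[OF _ t(1)] st t(2) in simp)
  moreover have "(\<Union>a\<in>kernel_rel T \<kappa>' `` {t}. kernel_rel T \<kappa>' `` {f' a}) = kernel_rel T \<kappa>' `` {f' t}"
    by (rule unop_class[OF t(1)]) (use f[OF s(1)] st t(2) in simp)
  ultimately show ?thesis
    using transport_class[of "f s" S "f' t" T \<kappa> \<kappa>'] st by (simp add: s(2) transport_class[where \<kappa> = \<kappa> and \<kappa>' = \<kappa>', OF s(1) t])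
qed

lemma binop_class:
  assumes s: "s \<in> S" "u \<in> S"
    and f: "\<And>x y. x \<in> S \<Longrightarrow> y \<in> S \<Longrightarrow> \<kappa> x = \<kappa> s \<Longrightarrow> \<kappa> y = \<kappa> u \<Longrightarrow> f x y \<in> S \<and> \<kappa> (f x y) = \<kappa> (f s u)"
  shows "(\<Union>x\<in>kernel_rel S \<kappa> `` {s}. \<Union>y\<in>kernel_rel S \<kappa> `` {u}. kernel_rel S \<kappa> `` {f x y}) = kernel_rel S \<kappa> `` {f s u}"
proof -
  have "kernel_rel S \<kappa> `` {f x y} = kernel_rel S \<kappa> `` {f s u}"
    if "x \<in> kernel_rel S \<kappa> `` {s}" "y \<in> kernel_rel S \<kappa> `` {u}" for x y
    using that f[of x y] f[OF s refl refl] by (simp add: kernel_rel_class s)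
  moreover have "s \<in> kernel_rel S \<kappa> `` {s}" "u \<in> kernel_rel S \<kappa> `` {u}" by (simp_all add: kernel_rel_class s)
  ultimately show ?thesis by blast
qed

lemma transport_binop:
  assumes im: "\<kappa> ` S = \<kappa>' ` T"
    and f: "\<And>x y a b. x \<in> S \<Longrightarrow> y \<in> S \<Longrightarrow> a \<in> T \<Longrightarrow> b \<in> T \<Longrightarrow> \<kappa> x = \<kappa>' a \<Longrightarrow> \<kappa> y = \<kappa>' b \<Longrightarrow>
      f x y \<in> S \<and> f' a b \<in> T \<and> \<kappa> (f x y) = \<kappa>' (f' a b)"
    and X: "X \<in> S // kernel_rel S \<kappa>" and Y: "Y \<in> S // kernel_rel S \<kappa>"
  shows "transport T \<kappa>' \<kappa> (\<Union>x\<in>X. \<Union>y\<in>Y. kernel_rel S \<kappa> `` {f x y})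
     = (\<Union>a\<in>transport T \<kappa>' \<kappa> X. \<Union>b\<in>transport T \<kappa>' \<kappa> Y. kernel_rel T \<kappa>' `` {f' a b})"
proof -
  obtain s where s: "s \<in> S" "X = kernel_rel S \<kappa> `` {s}" using X by (elim kernel_rel_quotientE)
  obtain u where u: "u \<in> S" "Y = kernel_rel S \<kappa> `` {u}" using Y by (elim kernel_rel_quotientE)
  obtain t where t: "t \<in> T" "\<kappa> s = \<kappa>' t" using im s(1) by blast
  obtain v where v: "v \<in> T" "\<kappa> u = \<kappa>' v" using im u(1) by blast
  note st = f[OF s(1) u(1) t(1) v(1) t(2) v(2)]
  have "(\<Union>x\<in>X. \<Union>y\<in>Y. kernel_rel S \<kappa> `` {f x y}) = kernel_rel S \<kappa> `` {f s u}"
    unfolding s(2) u(2) by (rule binop_class[OF s(1) u(1)]) (use f[OF _ _ t(1) v(1)] st t(2) v(2) in simp)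
  moreover have "(\<Union>a\<in>kernel_rel T \<kappa>' `` {t}. \<Union>b\<in>kernel_rel T \<kappa>' `` {v}. kernel_rel T \<kappa>' `` {f' a b}) = kernel_rel T \<kappa>' `` {f' t v}"
    by (rule binop_class[OF t(1) v(1)]) (use f[OF s(1) u(1)] st t(2) v(2) in simp)
  ultimately show ?thesis
    using transport_class[of "f s u" S "f' t v" T \<kappa> \<kappa>'] st
    by (simp add: s(2) u(2) transport_class[where \<kappa> = \<kappa> and \<kappa>' = \<kappa>', OF s(1) t] transport_class[where \<kappa> = \<kappa> and \<kappa>' = \<kappa>', OF u(1) v])
qed

section \<open>The isomorphism\<close>

lemma T_lim_kernel: "\<alpha> \<in> conv_seq \<Longrightarrow> T_lim \<mu> \<alpha> = Op \<mu> (kernel_B \<alpha>)"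
  by (rule T_lim_Op, assumption) (rule conv_seq_conv_hat, assumption, rule conv_hat_kernel_B)

text \<open>Boundedness on the semigroup side is borrowed from the group side: a matched convergent
  sequence provides a Schur bound for the kernel.\<close>

lemma T_tilde_kernel:
  assumes a: "a \<in> seq_A m"
  shows "T_tilde \<mu> m a = Op \<mu> (kernel_A a)"
proof -
  obtain \<alpha> where al: "matched m \<alpha> a" using ex_matched_B[OF a] by blast
  obtain C where "schur (ysize \<mu>) (kernel_A a) C"
    using conv_hat_schur[OF matchedD(2)[OF al] matchedD(4)[OF al]] by blast
  then have "Op \<mu> (kernel_A a) \<in> End_T \<mu>" by (rule Op_End)
  then show ?thesis by (intro T_tilde_Op[OF a]) (auto simp: kernel_A_def)
qed

lemma conv_equiv_kernel: "conv_equiv = kernel_rel conv_seq kernel_B"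
proof -
  have "(\<forall>\<mu>\<in>Young. T_lim \<mu> \<alpha> = T_lim \<mu> \<beta>) \<longleftrightarrow> kernel_B \<alpha> = kernel_B \<beta>"
    if ab: "\<alpha> \<in> conv_seq" "\<beta> \<in> conv_seq" for \<alpha> \<beta>
  proof
    assume "\<forall>\<mu>\<in>Young. T_lim \<mu> \<alpha> = T_lim \<mu> \<beta>"
    then have O: "Op \<mu> (kernel_B \<alpha>) = Op \<mu> (kernel_B \<beta>)" if "\<mu> \<in> Young" for \<mu>
      using that by (simp add: T_lim_kernel ab)
    show "kernel_B \<alpha> = kernel_B \<beta>"
    proof
      fix R show "kernel_B \<alpha> R = kernel_B \<beta> R"
      proof (cases "R \<in> (\<Union>k. PI k)")
        case True
        then obtain k where "R \<in> PI k" by blast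
        then show ?thesis by (rule Op_inj[rotated]) (rule O)
      qed (simp add: kernel_B_def)
    qed
  qed (simp add: T_lim_kernel ab)
  then show ?thesis unfolding conv_equiv_def kernel_rel_def by (intro Collect_cong) (simp add: case_prod_unfold cong: conj_cong)
qed

lemma Op_kernel_A_inj:
  assumes "\<And>\<mu>. \<mu> \<in> Young \<Longrightarrow> Op \<mu> (kernel_A a) = Op \<mu> (kernel_A b)"
  shows "kernel_A a = kernel_A b"
proof
  fix R show "kernel_A a R = kernel_A b R"
  proof (cases "R \<in> (\<Union>k. PI k)")
    case True
    then obtain k where "R \<in> PI k" by blast
    then show ?thesis by (rule Op_inj[rotated]) (rule assms)
  qed (simp add: kernel_A_def)
qed

lemma A_equiv_kernel: "A_equiv = kernel_rel (\<Union>m. seq_A m) kernel_A"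
proof -
  have "(\<forall>\<^sub>F n in sequentially. a n = b n) \<longleftrightarrow> kernel_A a = kernel_A b"
    if ab: "a \<in> (\<Union>m. seq_A m)" "b \<in> (\<Union>m. seq_A m)" for a b
  proof
    assume "\<forall>\<^sub>F n in sequentially. a n = b n"
    then show "kernel_A a = kernel_A b" by (intro ext) (simp add: kernel_A_def kerA_cong)
  next
    assume e: "kernel_A a = kernel_A b"
    obtain p q where "a \<in> seq_A p" "b \<in> seq_A q" using ab by blast
    then have m: "a \<in> seq_A (max p q)" "b \<in> seq_A (max p q)"
      using seq_A_mono[of p "max p q"] seq_A_mono[of q "max p q"] by auto
    have k: "kerA a R = kerA b R" if R: "R \<in> PI k" for k R
    proof -
      have "R \<in> (\<Union>k. PI k)" using R by blast
      then show ?thesis using fun_cong[OF e, of R] by (simp add: kernel_A_def)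
    qed
    have "a n = b n" if "max p q \<le> n" for n by (rule kerA_inj[OF m k that])
    then show "\<forall>\<^sub>F n in sequentially. a n = b n" unfolding eventually_sequentially by blast
  qed
  then show ?thesis unfolding A_equiv_def kernel_rel_def by (intro Collect_cong) (simp add: case_prod_unfold cong: conj_cong)
qed

lemma kernels_eq: "kernel_B ` conv_seq = kernel_A ` (\<Union>m. seq_A m)"
proof (intro subset_antisym subsetI)
  fix h assume "h \<in> kernel_B ` conv_seq"
  then obtain m \<alpha> where "h = kernel_B \<alpha>" "\<alpha> \<in> seq_B m" by (auto simp: conv_seq_Union)
  then show "h \<in> kernel_A ` (\<Union>m. seq_A m)" using ex_matched_A[of \<alpha> m] unfolding matched_def by blast
next
  fix h assume "h \<in> kernel_A ` (\<Union>m. seq_A m)"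
  then obtain m a where a: "h = kernel_A a" "a \<in> seq_A m" by auto
  then obtain \<alpha> where "matched m \<alpha> a" using ex_matched_B by blast
  then show "h \<in> kernel_B ` conv_seq" using a(1) unfolding matched_def seq_B_def by (intro image_eqI[of _ _ \<alpha>]) auto
qed

lemma matched_Union:
  assumes "matched m \<alpha> a"
  shows "\<alpha> \<in> conv_seq \<and> a \<in> (\<Union>m. seq_A m) \<and> kernel_B \<alpha> = kernel_A a"
  using assms unfolding matched_def seq_B_def by blast

lemma common_level2:
  assumes "\<alpha> \<in> conv_seq" "\<beta> \<in> conv_seq" "a \<in> (\<Union>m. seq_A m)" "b \<in> (\<Union>m. seq_A m)"
    "kernel_B \<alpha> = kernel_A a" "kernel_B \<beta> = kernel_A b"
  shows "\<exists>m. matched m \<alpha> a \<and> matched m \<beta> b"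
proof -
  obtain p q where "\<forall>m\<ge>p. matched m \<alpha> a" "\<forall>m\<ge>q. matched m \<beta> b"
    using common_level[OF assms(1,3,5)] common_level[OF assms(2,4,6)] by blast
  then show ?thesis by (intro exI[of _ "max p q"]) simp
qed

lemma iota_B_class:
  assumes a: "\<alpha> \<in> conv_seq"
  shows "iota_B (conv_equiv `` {\<alpha>}) = (\<lambda>\<mu>\<in>Young. Op \<mu> (kernel_B \<alpha>))"
proof -
  have "(THE L. \<exists>\<beta>\<in>conv_equiv `` {\<alpha>}. L = T_lim \<mu> \<beta>) = Op \<mu> (kernel_B \<alpha>)" for \<mu>
  proof (rule the_equality)
    show "\<exists>\<beta>\<in>conv_equiv `` {\<alpha>}. Op \<mu> (kernel_B \<alpha>) = T_lim \<mu> \<beta>"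
      using a by (intro bexI[of _ \<alpha>]) (simp_all add: T_lim_kernel conv_equiv_kernel kernel_rel_class)
    show "L = Op \<mu> (kernel_B \<alpha>)" if "\<exists>\<beta>\<in>conv_equiv `` {\<alpha>}. L = T_lim \<mu> \<beta>" for L
    proof -
      obtain \<beta> where b: "\<beta> \<in> conv_equiv `` {\<alpha>}" "L = T_lim \<mu> \<beta>" using \<open>\<exists>\<beta>\<in>conv_equiv `` {\<alpha>}. L = T_lim \<mu> \<beta>\<close> by blast
      then have "\<beta> \<in> conv_seq \<and> kernel_B \<beta> = kernel_B \<alpha>" by (simp add: conv_equiv_kernel kernel_rel_class a)
      then show ?thesis using b(2) by (simp add: T_lim_kernel)
    qed
  qed
  then show ?thesis unfolding iota_B_def by (intro restrict_ext)
qed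

lemma iota_A_class:
  assumes a: "a \<in> (\<Union>m. seq_A m)"
  shows "iota_A (A_equiv `` {a}) = (\<lambda>\<mu>\<in>Young. Op \<mu> (kernel_A a))"
proof -
  have "(THE L. \<exists>m. \<exists>b\<in>A_equiv `` {a} \<inter> seq_A m. L = T_tilde \<mu> m b) = Op \<mu> (kernel_A a)" for \<mu>
  proof (rule the_equality)
    obtain m where "a \<in> seq_A m" using a by blast
    then show "\<exists>m. \<exists>b\<in>A_equiv `` {a} \<inter> seq_A m. Op \<mu> (kernel_A a) = T_tilde \<mu> m b"
      using a by (intro exI[of _ m] bexI[of _ a]) (simp_all only: T_tilde_kernel A_equiv_kernel kernel_rel_class, simp)
    fix L assume "\<exists>m. \<exists>b\<in>A_equiv `` {a} \<inter> seq_A m. L = T_tilde \<mu> m b"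
    then obtain m b where b: "b \<in> A_equiv `` {a}" "b \<in> seq_A m" "L = T_tilde \<mu> m b" by blast
    then have "kernel_A b = kernel_A a" by (simp only: A_equiv_kernel kernel_rel_class[OF a] mem_Collect_eq)
    then show "L = Op \<mu> (kernel_A a)" using b(2,3) by (simp add: T_tilde_kernel)
  qed
  then show ?thesis unfolding iota_A_def by (intro restrict_ext)
qed

theorem theorem6p5:
  shows "\<exists>F. F \<in> alg_iso alg_B alg_A \<and>
     (\<forall>X\<in>carrier alg_B. iota_A (F X) = iota_B X) \<and>
     (\<forall>G\<in>carrier alg_B \<rightarrow> carrier alg_A.
        (\<forall>X\<in>carrier alg_B. iota_A (G X) = iota_B X) \<longrightarrow> (\<forall>X\<in>carrier alg_B. G X = F X)) \<and>
     (\<forall>m::nat. F ` sub_B m = sub_A m)"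
proof -
  let ?A = "\<Union>m. seq_A m"
  define F where "F = transport ?A kernel_A kernel_B"
  have cB: "carrier alg_B = conv_seq // conv_equiv" and cA: "carrier alg_A = ?A // A_equiv"
    by (simp_all add: alg_B_def alg_A_def)
  have Fc: "F (conv_equiv `` {\<alpha>}) = A_equiv `` {a}" if "matched m \<alpha> a" for m \<alpha> a
    using matched_Union[OF that] transport_class[of \<alpha> conv_seq a ?A kernel_B kernel_A]
    unfolding F_def conv_equiv_kernel A_equiv_kernel by blast
  have clB: "\<exists>\<alpha> a m. matched m \<alpha> a \<and> X = conv_equiv `` {\<alpha>}" if X: "X \<in> carrier alg_B" for X
  proof -
    obtain \<alpha> where a: "\<alpha> \<in> conv_seq" "X = conv_equiv `` {\<alpha>}" using X unfolding cB by (rule quotientE)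
    obtain m where "\<alpha> \<in> seq_B m" using a(1) unfolding conv_seq_Union by blast
    then show ?thesis using ex_matched_A a(2) by blast
  qed
  have bij: "bij_betw F (carrier alg_B) (carrier alg_A)"
    unfolding F_def cA cB conv_equiv_kernel A_equiv_kernel by (rule transport_bij[OF kernels_eq])
  have add: "F (X \<oplus>\<^bsub>alg_B\<^esub> Y) = F X \<oplus>\<^bsub>alg_A\<^esub> F Y" if XY: "X \<in> carrier alg_B" "Y \<in> carrier alg_B" for X Y
  proof -
    have "F (\<Union>\<alpha>\<in>X. \<Union>\<beta>\<in>Y. conv_equiv `` {\<lambda>n. \<alpha> n + \<beta> n}) = (\<Union>a\<in>F X. \<Union>b\<in>F Y. A_equiv `` {\<lambda>n. a n + b n})"
      unfolding F_def conv_equiv_kernel A_equiv_kernel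
    proof (rule transport_binop[OF kernels_eq])
      fix \<alpha> \<beta> a b
      assume "\<alpha> \<in> conv_seq" "\<beta> \<in> conv_seq" "a \<in> ?A" "b \<in> ?A" "kernel_B \<alpha> = kernel_A a" "kernel_B \<beta> = kernel_A b"
      then obtain m where "matched m \<alpha> a" "matched m \<beta> b" using common_level2[of \<alpha> \<beta> a b] by blast
      from matched_Union[OF matched_add[OF this]]
      show "(\<lambda>n. \<alpha> n + \<beta> n) \<in> conv_seq \<and> (\<lambda>n. a n + b n) \<in> ?A \<and> kernel_B (\<lambda>n. \<alpha> n + \<beta> n) = kernel_A (\<lambda>n. a n + b n)" .
    qed (use XY in \<open>simp_all only: cB conv_equiv_kernel\<close>)
    then show ?thesis by (simp add: alg_B_def alg_A_def)
  qed
  have mult: "F (X \<otimes>\<^bsub>alg_B\<^esub> Y) = F X \<otimes>\<^bsub>alg_A\<^esub> F Y" if XY: "X \<in> carrier alg_B" "Y \<in> carrier alg_B" for X Y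
  proof -
    have "F (\<Union>\<alpha>\<in>X. \<Union>\<beta>\<in>Y. conv_equiv `` {\<lambda>n. grp_mult (\<alpha> n) (\<beta> n)})
      = (\<Union>a\<in>F X. \<Union>b\<in>F Y. A_equiv `` {\<lambda>n. convolve mmult (a n) (b n)})"
      unfolding F_def conv_equiv_kernel A_equiv_kernel
    proof (rule transport_binop[OF kernels_eq])
      fix \<alpha> \<beta> a b
      assume "\<alpha> \<in> conv_seq" "\<beta> \<in> conv_seq" "a \<in> ?A" "b \<in> ?A" "kernel_B \<alpha> = kernel_A a" "kernel_B \<beta> = kernel_A b"
      then obtain m where "matched m \<alpha> a" "matched m \<beta> b" using common_level2[of \<alpha> \<beta> a b] by blast
      from matched_Union[OF matched_mult[OF this]]
      show "(\<lambda>n. grp_mult (\<alpha> n) (\<beta> n)) \<in> conv_seq \<and> (\<lambda>n. convolve mmult (a n) (b n)) \<in> ?A \<and>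
        kernel_B (\<lambda>n. grp_mult (\<alpha> n) (\<beta> n)) = kernel_A (\<lambda>n. convolve mmult (a n) (b n))" .
    qed (use XY in \<open>simp_all only: cB conv_equiv_kernel\<close>)
    then show ?thesis by (simp add: alg_B_def alg_A_def)
  qed
  have smult: "F (c \<odot>\<^bsub>alg_B\<^esub> X) = c \<odot>\<^bsub>alg_A\<^esub> F X" if X: "X \<in> carrier alg_B" for c X
  proof -
    have "F (\<Union>\<alpha>\<in>X. conv_equiv `` {\<lambda>n. scale c (\<alpha> n)}) = (\<Union>a\<in>F X. A_equiv `` {\<lambda>n. scale c (a n)})"
      unfolding F_def conv_equiv_kernel A_equiv_kernel
    proof (rule transport_unop[OF kernels_eq])
      fix \<alpha> a assume "\<alpha> \<in> conv_seq" "a \<in> ?A" "kernel_B \<alpha> = kernel_A a"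
      then obtain m where "matched m \<alpha> a" using common_level[of \<alpha> a] by blast
      from matched_Union[OF matched_scale[OF this]]
      show "(\<lambda>n. scale c (\<alpha> n)) \<in> conv_seq \<and> (\<lambda>n. scale c (a n)) \<in> ?A \<and>
        kernel_B (\<lambda>n. scale c (\<alpha> n)) = kernel_A (\<lambda>n. scale c (a n))" .
    qed (use X in \<open>simp only: cB conv_equiv_kernel\<close>)
    then show ?thesis by (simp add: alg_B_def alg_A_def)
  qed
  have one: "F \<one>\<^bsub>alg_B\<^esub> = \<one>\<^bsub>alg_A\<^esub>" using Fc[OF matched_one] by (simp add: alg_B_def alg_A_def)
  have "F \<in> alg_iso alg_B alg_A"
    unfolding alg_iso_def ring_iso_def ring_hom_def
    using bij bij_betw_imp_funcset[OF bij] mult add smult one by simp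
  moreover have iota: "iota_A (F X) = iota_B X" if X: "X \<in> carrier alg_B" for X
  proof -
    obtain m \<alpha> a where m: "matched m \<alpha> a" "X = conv_equiv `` {\<alpha>}" using clB[OF X] by blast
    show ?thesis using matched_Union[OF m(1)]
      unfolding m(2) Fc[OF m(1)] by (simp only: iota_B_class iota_A_class)
  qed
  \<comment> \<open>Uniqueness is the injectivity of \<open>iota_A\<close>: the operators of all
    diagrams determine the kernel, and the kernel determines the class.\<close>
  moreover have "G X = F X" if G: "G \<in> carrier alg_B \<rightarrow> carrier alg_A"
    and GX: "\<forall>X\<in>carrier alg_B. iota_A (G X) = iota_B X" and X: "X \<in> carrier alg_B" for G X
  proof -
    have "G X \<in> ?A // A_equiv" "F X \<in> ?A // A_equiv"
      using funcset_mem[OF G X] funcset_mem[OF bij_betw_imp_funcset[OF bij] X] unfolding cA .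
    then obtain a b where a: "a \<in> ?A" "G X = A_equiv `` {a}" and b: "b \<in> ?A" "F X = A_equiv `` {b}"
      by (elim quotientE)
    have "iota_A (G X) = iota_A (F X)" using GX iota X by simp
    then have e: "(\<lambda>\<mu>\<in>Young. Op \<mu> (kernel_A a)) = (\<lambda>\<mu>\<in>Young. Op \<mu> (kernel_A b))"
      unfolding a(2) b(2) iota_A_class[OF a(1)] iota_A_class[OF b(1)] .
    have "kernel_A a = kernel_A b"
    proof (rule Op_kernel_A_inj)
      fix \<mu> assume "\<mu> \<in> Young"
      then show "Op \<mu> (kernel_A a) = Op \<mu> (kernel_A b)" using fun_cong[OF e, of \<mu>] by simp
    qed
    then show ?thesis unfolding a(2) b(2) A_equiv_kernel kernel_rel_class[OF a(1)] kernel_rel_class[OF b(1)] by simp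
  qed
  moreover have "F ` sub_B m = sub_A m" for m
  proof (intro subset_antisym subsetI)
    fix Z assume "Z \<in> F ` sub_B m"
    then obtain X \<alpha> where X: "Z = F X" "X \<in> carrier alg_B" "\<alpha> \<in> X" "\<forall>\<^sub>F n in sequentially. \<alpha> n \<in> cB m n"
      unfolding sub_B_def by blast
    \<comment> \<open>The representative supplied by the quotient need not lie in the centralizers
      of level m, so X is rewritten as the class of \<alpha> before a matching sequence is
      chosen.\<close>
    obtain \<beta> where b: "\<beta> \<in> conv_seq" "X = conv_equiv `` {\<beta>}" using X(2) unfolding cB by (rule quotientE)
    have al: "\<alpha> \<in> conv_seq" "kernel_B \<alpha> = kernel_B \<beta>"
      using X(3) b unfolding conv_equiv_kernel by (simp_all add: kernel_rel_class)
    have Xa: "X = conv_equiv `` {\<alpha>}"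
      unfolding b(2) conv_equiv_kernel kernel_rel_class[OF al(1)] kernel_rel_class[OF b(1)] al(2) ..
    have "\<alpha> \<in> seq_B m" using al(1) X(4) by (simp add: seq_B_def)
    then obtain a where a: "matched m \<alpha> a" using ex_matched_A by blast
    have "a \<in> ?A" "a \<in> seq_A m" using a unfolding matched_def by blast+
    moreover have "Z = A_equiv `` {a}" unfolding X(1) Xa by (rule Fc[OF a])
    moreover have "a \<in> A_equiv `` {a}" unfolding A_equiv_kernel kernel_rel_class[OF \<open>a \<in> ?A\<close>] using \<open>a \<in> ?A\<close> by simp
    ultimately show "Z \<in> sub_A m" unfolding sub_A_def cA by (intro CollectI conjI bexI[of _ a]) (auto intro: quotientI)
  next
    fix Z assume "Z \<in> sub_A m"
    then obtain a where Z: "Z \<in> ?A // A_equiv" "a \<in> Z" "a \<in> seq_A m" unfolding sub_A_def cA by blast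
    obtain b where b: "b \<in> ?A" "Z = A_equiv `` {b}" using Z(1) by (rule quotientE)
    have al: "a \<in> ?A" "kernel_A a = kernel_A b"
      using Z(2) unfolding b(2) A_equiv_kernel kernel_rel_class[OF b(1)] by simp_all
    have Za: "Z = A_equiv `` {a}"
      unfolding b(2) A_equiv_kernel kernel_rel_class[OF al(1)] kernel_rel_class[OF b(1)] al(2) ..
    obtain \<alpha> where m: "matched m \<alpha> a" using ex_matched_B[OF Z(3)] by blast
    then have c: "\<alpha> \<in> conv_seq" "\<forall>\<^sub>F n in sequentially. \<alpha> n \<in> cB m n" by (simp_all add: matched_def seq_B_def)
    have "\<alpha> \<in> conv_equiv `` {\<alpha>}" using c(1) unfolding conv_equiv_kernel by (simp add: kernel_rel_class)
    moreover have "conv_equiv `` {\<alpha>} \<in> carrier alg_B" unfolding cB by (rule quotientI[OF c(1)])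
    ultimately have "conv_equiv `` {\<alpha>} \<in> sub_B m" using c(2) unfolding sub_B_def by blast
    then show "Z \<in> F ` sub_B m" unfolding Za Fc[OF m, symmetric] by (rule imageI)
  qed
  ultimately show ?thesis by blast
qed

end
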